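(* Let $d\ge1$, $p>2$, $s\in(0,1)$ with $q_c:=-1+p(1-s)<1$. Let $\alpha_\varphi\in(0,1]$ and let $\varphi:Q_1\to\mathbb{R}$ satisfy $\varphi\in C^{0,1}_x(Q_1)\cap C^{0,\alpha_\varphi}_t(Q_1)$. Assume $u$ is a viscosity solution of $$\min\{u-\varphi,\ \partial_t u+(-\Delta_p)^s u\}=0\quad\text{in }Q_1$$ satisfying $$\|u\|_{L^\infty(Q_1)}+\sup_{t\in(-1,0]}\|u(\cdot,t)\|_{L^{p-1}_{sp}(\mathbb{R}^d)}\le 1 .$$ In addition, suppose that there is a constant $C_1$ such that $$|u(x,t)-u(y,t)|\le C_1|x-y|\quad\text{for all }x,y\in B_1,\ t\in(-1,0].$$ Then there exists a constant $C>0$ such that $$\sup_{x\in B_{1/2}}|u(x,t_1)-u(x,t_2)|\le C|t_1-t_2|^{\alpha}\quad\text{for every }t_1,t_2\in(-1/4,0],$$ where $$\alpha=\min\left\{\left(\frac{1}{1-q_c}\right)^-,\ \alpha_\varphi\right\}$$ and $\left(\frac{1}{1-q_c}\right)^-$ denotes an arbitrary fixed number strictly smaller than $\frac{1}{1-q_c}$. The constant $C$ depends only on $d$, $p$, $s$, $\alpha$, $[\varphi]_{C^{0,1}_x}$ and $[\varphi]_{C^{0,\alpha_\varphi}_t}$. In particular, $u$ is Lipschitz in time (i.e. the estimate holds with $\alpha=1$) when $q_c>0$ and $\alpha_\varphi=1$.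
   Context: Cylinders: $Q_r(x_0,t_0):=B_r(x_0)\times(t_0-r^2,t_0]$ and $Q_r:=Q_r(0,0)$; $B_r=B_r(0)$. Operator: for each fixed $t$, $(-\Delta_p)^s u(x,t):=\mathrm{P.V.}\int_{\mathbb{R}^d}\frac{|u(x,t)-u(y,t)|^{p-2}(u(x,t)-u(y,t))}{|x-y|^{d+sp}}\,dy$. Tail space: $L^{p-1}_{sp}(\mathbb{R}^d)$ is the set of $w\in L^{p-1}_{\mathrm{loc}}(\mathbb{R}^d)$ with $\|w\|_{L^{p-1}_{sp}(\mathbb{R}^d)}:=\left(\int_{\mathbb{R}^d}\frac{|w(x)|^{p-1}}{1+|x|^{d+sp}}\,dx\right)^{1/(p-1)}<\infty$. Obstacle regularity: $[\varphi]_{C^{0,1}_x}$ is the supremum of $|\varphi(x,t)-\varphi(y,t)|/|x-y|$ over $(x,t),(y,t)\in Q_1$, $x\ne y$, and $[\varphi]_{C^{0,\alpha_\varphi}_t}$ the supremum of $|\varphi(x,t)-\varphi(x,\tau)|/|t-\tau|^{\alpha_\varphi}$ over $(x,t),(x,\tau)\in Q_1$, $t\neq\tau$; membership in $C^{0,1}_x(Q_1)$, $C^{0,\alpha_\varphi}_t(Q_1)$ means these are finite. Viscosity solutions in $\Omega\times(t_1,t_2]$ (here $\Omega=B_1$, $(t_1,t_2]=(-1,0]$), with $\varphi$ continuous; functions $u$ are defined on $\mathbb{R}^d\times(t_1,t_2]$. $C^2(Q_r(x_0,t_0))$ denotes functions that are $C^2$ in space and $C^1$ in time. $u$ is a viscosity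 subsolution if $u\in \mathrm{USC}(\Omega\times(t_1,t_2])\cap C_{\mathrm{loc}}(t_1,t_2;L^{p-1}_{sp}(\mathbb{R}^d))$ and, whenever $\phi\in C^2(Q_r(x_0,t_0))$ with $Q_r(x_0,t_0)\subset\Omega\times(t_1,t_2]$ touches $u$ from above at $(x_0,t_0)$ in $Q_r(x_0,t_0)$ (i.e. $\phi\ge u$ in $Q_r(x_0,t_0)$ with equality at $(x_0,t_0)$), one has $$\min\{u(x_0,t_0)-\varphi(x_0,t_0),\ \partial_t\phi(x_0,t_0)+(-\Delta_p)^s\phi_r(x_0,t_0)\}\le 0,$$ where $\phi_r=\phi$ in $Q_r(x_0,t_0)$ and $\phi_r=u$ otherwise. A viscosity supersolution is defined similarly (LSC instead of USC, $\phi$ touching $u$ from below, and $\ge 0$ instead of $\le 0$). A viscosity solution is both a viscosity subsolution and a viscosity supersolution. *)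

theory Defs
  imports "HOL-Analysis.Analysis" "HOL-Probability.Essential_Supremum"
begin

text \<open>
  Space-time functions are total functions on \<open>(real ^ 'n) \<times> real\<close>, with \<open>d = CARD('n)\<close>; only their
  values at times in the half-open interval \<open>(t1, t2]\<close> are ever used (for the obstacle, only the
  values on \<open>\<Omega> \<times> (t1, t2]\<close>).
\<close>

definition par_cyl :: "real \<Rightarrow> real ^ 'n \<Rightarrow> real \<Rightarrow> ((real ^ 'n) \<times> real) set" where
  "par_cyl r x0 t0 = ball x0 r \<times> {t0 - r\<^sup>2 <.. t0}"

definition crit_exp :: "real \<Rightarrow> real \<Rightarrow> real" where
  "crit_exp p s = - 1 + p * (1 - s)"


subsection \<open>The fractional p-Laplacian\<close>

definition frac_kernel :: "real \<Rightarrow> real \<Rightarrow> (real ^ 'n \<Rightarrow> real) \<Rightarrow> real ^ 'n \<Rightarrow> real ^ 'n \<Rightarrow> real" where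
  "frac_kernel p s w x y =
     \<bar>w x - w y\<bar> powr (p - 2) * (w x - w y) / norm (x - y) powr (real CARD('n) + s * p)"

text \<open>
  Lebesgue integral with values in \<open>[-\<infinity>, \<infinity>]\<close>, meaningful if the positive or the negative part has
  finite integral.  The Bochner integral would return \<open>0\<close> for a non-integrable function.  This
  matters for test functions that blow up at the lateral boundary of their cylinder: there the
  operator takes the value \<open>-\<infinity>\<close> (touching from above) or \<open>\<infinity>\<close> (touching from below).
\<close>

definition ext_integral :: "(real ^ 'n) set \<Rightarrow> (real ^ 'n \<Rightarrow> real) \<Rightarrow> ereal" where
  "ext_integral S f =
     enn2ereal (\<integral>\<^sup>+ y \<in> S. ennreal (f y) \<partial>lebesgue) - enn2ereal (\<integral>\<^sup>+ y \<in> S. ennreal (- f y) \<partial>lebesgue)"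

definition frac_plap :: "real \<Rightarrow> real \<Rightarrow> (real ^ 'n \<Rightarrow> real) \<Rightarrow> real ^ 'n \<Rightarrow> ereal" where
  "frac_plap p s w x =
     Lim (at_right 0) (\<lambda>\<epsilon>. ext_integral {y. \<epsilon> < norm (x - y)} (frac_kernel p s w x))"


subsection \<open>The tail space\<close>

definition tail_integrand :: "real \<Rightarrow> real \<Rightarrow> (real ^ 'n \<Rightarrow> real) \<Rightarrow> real ^ 'n \<Rightarrow> real" where
  "tail_integrand p s w x =
     \<bar>w x\<bar> powr (p - 1) / (1 + norm x powr (real CARD('n) + s * p))"

definition tail_space :: "real \<Rightarrow> real \<Rightarrow> (real ^ 'n \<Rightarrow> real) set" where
  "tail_space p s = {w. w \<in> borel_measurable lebesgue
     \<and> (\<forall>K. compact K \<longrightarrow> set_integrable lebesgue K (\<lambda>x. \<bar>w x\<bar> powr (p - 1)))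
     \<and> integrable lebesgue (tail_integrand p s w)}"

definition tail_norm :: "real \<Rightarrow> real \<Rightarrow> (real ^ 'n \<Rightarrow> real) \<Rightarrow> real" where
  "tail_norm p s w = (integral\<^sup>L lebesgue (tail_integrand p s w)) powr (1 / (p - 1))"

text \<open>The time interval in \<open>C_loc(t1, t2; L)\<close> is the open one.\<close>

definition cont_loc_tail :: "real \<Rightarrow> real \<Rightarrow> real \<Rightarrow> real \<Rightarrow> ((real ^ 'n) \<times> real \<Rightarrow> real) \<Rightarrow> bool" where
  "cont_loc_tail p s t1 t2 u \<longleftrightarrow>
     (\<forall>t \<in> {t1 <..< t2}. (\<lambda>x. u (x, t)) \<in> tail_space p s
        \<and> ((\<lambda>\<tau>. tail_norm p s (\<lambda>x. u (x, \<tau>) - u (x, t))) \<longlongrightarrow> 0) (at t within {t1 <..< t2}))"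


subsection \<open>Obstacle seminorms\<close>

definition lip_x_seminorm :: "((real ^ 'n) \<times> real \<Rightarrow> real) \<Rightarrow> ereal" where
  "lip_x_seminorm \<psi> =
     Sup {ereal (\<bar>\<psi> (x, t) - \<psi> (y, t)\<bar> / norm (x - y)) | x y t.
            (x, t) \<in> par_cyl 1 0 0 \<and> (y, t) \<in> par_cyl 1 0 0 \<and> x \<noteq> y}"

definition holder_t_seminorm :: "real \<Rightarrow> ((real ^ 'n) \<times> real \<Rightarrow> real) \<Rightarrow> ereal" where
  "holder_t_seminorm a \<psi> =
     Sup {ereal (\<bar>\<psi> (x, t) - \<psi> (x, \<tau>)\<bar> / \<bar>t - \<tau>\<bar> powr a) | x t \<tau>.
            (x, t) \<in> par_cyl 1 0 0 \<and> (x, \<tau>) \<in> par_cyl 1 0 0 \<and> t \<noteq> \<tau>}"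


subsection \<open>Viscosity solutions of the obstacle problem\<close>

definition usc_on :: "('a :: topological_space) set \<Rightarrow> ('a \<Rightarrow> real) \<Rightarrow> bool" where
  "usc_on S f \<longleftrightarrow> (\<forall>z \<in> S. \<forall>a > f z. \<forall>\<^sub>F w in at z within S. f w < a)"

definition lsc_on :: "('a :: topological_space) set \<Rightarrow> ('a \<Rightarrow> real) \<Rightarrow> bool" where
  "lsc_on S f \<longleftrightarrow> (\<forall>z \<in> S. \<forall>a < f z. \<forall>\<^sub>F w in at z within S. a < f w)"

text \<open>
  \<open>C\<^sup>2\<close> in space and \<open>C\<^sup>1\<close> in time on a cylinder \<open>Q\<close>: the gradient \<open>g\<close>, the Hessian \<open>H\<close> and the
  time derivative \<open>T\<close> exist and are continuous on \<open>Q\<close>; at the top time the time derivative is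
  the one-sided derivative from the past.
\<close>

definition C21_on :: "((real ^ 'n) \<times> real) set \<Rightarrow> ((real ^ 'n) \<times> real \<Rightarrow> real) \<Rightarrow> bool" where
  "C21_on Q \<phi> \<longleftrightarrow>
     (\<exists>(g :: (real ^ 'n) \<times> real \<Rightarrow> real ^ 'n) (H :: (real ^ 'n) \<times> real \<Rightarrow> real ^ 'n ^ 'n) T.
        continuous_on Q \<phi> \<and> continuous_on Q g \<and> continuous_on Q H \<and> continuous_on Q T \<and>
        (\<forall>(x, t) \<in> Q.
           ((\<lambda>y. \<phi> (y, t)) has_derivative (\<lambda>h. g (x, t) \<bullet> h)) (at x) \<and>
           ((\<lambda>y. g (y, t)) has_derivative (\<lambda>h. H (x, t) *v h)) (at x) \<and>
           ((\<lambda>\<tau>. \<phi> (x, \<tau>)) has_real_derivative T (x, t)) (at t within {\<tau>. (x, \<tau>) \<in> Q})))"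

text \<open>
  Used only at the top centre of a cylinder, where the test function is controlled only for times
  up to \<open>t\<close>; hence the one-sided derivative.
\<close>

definition time_deriv :: "((real ^ 'n) \<times> real \<Rightarrow> real) \<Rightarrow> real ^ 'n \<Rightarrow> real \<Rightarrow> real" where
  "time_deriv \<phi> x t = vector_derivative (\<lambda>\<tau>. \<phi> (x, \<tau>)) (at t within {..t})"

definition glue ::
  "((real ^ 'n) \<times> real) set \<Rightarrow> ((real ^ 'n) \<times> real \<Rightarrow> real) \<Rightarrow> ((real ^ 'n) \<times> real \<Rightarrow> real) \<Rightarrow>
   (real ^ 'n) \<times> real \<Rightarrow> real" where
  "glue Q \<phi> u z = (if z \<in> Q then \<phi> z else u z)"

definition obstacle_op ::
  "real \<Rightarrow> real \<Rightarrow> ((real ^ 'n) \<times> real \<Rightarrow> real) \<Rightarrow> ((real ^ 'n) \<times> real \<Rightarrow> real) \<Rightarrow>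
   ((real ^ 'n) \<times> real \<Rightarrow> real) \<Rightarrow> real \<Rightarrow> real ^ 'n \<Rightarrow> real \<Rightarrow> ereal" where
  "obstacle_op p s \<psi> u \<phi> r x0 t0 =
     min (ereal (u (x0, t0) - \<psi> (x0, t0)))
         (ereal (time_deriv \<phi> x0 t0)
            + frac_plap p s (\<lambda>y. glue (par_cyl r x0 t0) \<phi> u (y, t0)) x0)"

definition visc_subsol ::
  "real \<Rightarrow> real \<Rightarrow> (real ^ 'n) set \<Rightarrow> real \<Rightarrow> real \<Rightarrow> ((real ^ 'n) \<times> real \<Rightarrow> real) \<Rightarrow>
   ((real ^ 'n) \<times> real \<Rightarrow> real) \<Rightarrow> bool" where
  "visc_subsol p s \<Omega> t1 t2 \<psi> u \<longleftrightarrow>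
     usc_on (\<Omega> \<times> {t1 <.. t2}) u \<and> cont_loc_tail p s t1 t2 u \<and>
     (\<forall>\<phi> r x0 t0. 0 < r \<longrightarrow> par_cyl r x0 t0 \<subseteq> \<Omega> \<times> {t1 <.. t2} \<longrightarrow> C21_on (par_cyl r x0 t0) \<phi> \<longrightarrow>
        (\<forall>z \<in> par_cyl r x0 t0. \<phi> z \<ge> u z) \<longrightarrow> \<phi> (x0, t0) = u (x0, t0) \<longrightarrow>
        obstacle_op p s \<psi> u \<phi> r x0 t0 \<le> 0)"

definition visc_supersol ::
  "real \<Rightarrow> real \<Rightarrow> (real ^ 'n) set \<Rightarrow> real \<Rightarrow> real \<Rightarrow> ((real ^ 'n) \<times> real \<Rightarrow> real) \<Rightarrow>
   ((real ^ 'n) \<times> real \<Rightarrow> real) \<Rightarrow> bool" where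
  "visc_supersol p s \<Omega> t1 t2 \<psi> u \<longleftrightarrow>
     lsc_on (\<Omega> \<times> {t1 <.. t2}) u \<and> cont_loc_tail p s t1 t2 u \<and>
     (\<forall>\<phi> r x0 t0. 0 < r \<longrightarrow> par_cyl r x0 t0 \<subseteq> \<Omega> \<times> {t1 <.. t2} \<longrightarrow> C21_on (par_cyl r x0 t0) \<phi> \<longrightarrow>
        (\<forall>z \<in> par_cyl r x0 t0. \<phi> z \<le> u z) \<longrightarrow> \<phi> (x0, t0) = u (x0, t0) \<longrightarrow>
        obstacle_op p s \<psi> u \<phi> r x0 t0 \<ge> 0)"

definition visc_sol ::
  "real \<Rightarrow> real \<Rightarrow> (real ^ 'n) set \<Rightarrow> real \<Rightarrow> real \<Rightarrow> ((real ^ 'n) \<times> real \<Rightarrow> real) \<Rightarrow>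
   ((real ^ 'n) \<times> real \<Rightarrow> real) \<Rightarrow> bool" where
  "visc_sol p s \<Omega> t1 t2 \<psi> u \<longleftrightarrow> visc_subsol p s \<Omega> t1 t2 \<psi> u \<and> visc_supersol p s \<Omega> t1 t2 \<psi> u"


subsection \<open>Normalization\<close>

definition Linf_norm :: "((real ^ 'n) \<times> real) set \<Rightarrow> ((real ^ 'n) \<times> real \<Rightarrow> real) \<Rightarrow> ereal" where
  "Linf_norm Q u = esssup (lebesgue_on Q) (\<lambda>z. ereal \<bar>u z\<bar>)"

text \<open>
  Membership in the tail space is required at every time: \<^const>\<open>tail_norm\<close> is the norm only on
  that space, and the top time is not covered by \<^const>\<open>cont_loc_tail\<close>.
\<close>

definition normalized :: "real \<Rightarrow> real \<Rightarrow> ((real ^ 'n) \<times> real \<Rightarrow> real) \<Rightarrow> bool" where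
  "normalized p s u \<longleftrightarrow>
     (\<forall>t \<in> {-1 <.. 0}. (\<lambda>x. u (x, t)) \<in> tail_space p s) \<and>
     Linf_norm (par_cyl 1 0 0) u + (SUP t \<in> {-1 <.. 0}. ereal (tail_norm p s (\<lambda>x. u (x, t)))) \<le> 1"

end

theory Submission
  imports Defs
begin

text \<open>
  Since the constant must not depend on the assumed Lipschitz constant, a universal spatial
  Hoelder estimate with exponent \<open>\<gamma>\<close> is proved first, for every \<open>\<gamma> < 1\<close>.  Consider the largest violation of
  \<open>u(x,t) - u(y,t) \<le> L w(x,t) |x - y|\<^sup>\<gamma>\<close>, where the weight \<open>w = ((1 - |x|\<^sup>2) (1 + t))\<^bsup>-k\<^esup>\<close> blows up at the
  parabolic boundary.  With \<open>a = x - y\<close> and \<open>W = L w\<close>, strict concavity of \<open>r\<^sup>\<gamma>\<close> makes the operators at \<open>x\<close> and \<open>y\<close>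
  differ by at least a multiple of \<open>W\<^bsup>p-1\<^esup> |a|\<^bsup>\<gamma>(p-1)-sp\<^esup>\<close>, while the time derivative of the weight, its variation in
  space and the tail contribute at most multiples of \<open>W |a|\<^sup>\<gamma>\<close> and small multiples of the gain.  Because
  \<open>s p > p - 2\<close>, the gain wins when \<open>L\<close> is large.  If the estimate holds with \<open>2 L\<close>, the increments of
  \<open>u\<close> around the maximum are controlled by \<open>W\<close>, so it holds with \<open>L\<close>; the Lipschitz assumption starts this descent.

  For the time estimate, \<open>u\<close> is compared on \<open>[t\<^sub>1, t\<^sub>2]\<close> with
  \<open>u(x\<^sub>0,t\<^sub>1) + K \<rho>\<^sup>\<gamma> + K \<rho>\<^bsup>\<gamma>-2\<^esup> |x - x\<^sub>0|\<^sup>2 + B |t\<^sub>2 - t\<^sub>1|\<^sup>\<alpha> + M (t - t\<^sub>1)\<close>.  At a contact point the Hoelder estimate bounds the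
  gradient of the paraboloid, hence the operator, by a power of \<open>\<rho>\<close>; then \<open>\<rho>\<close> is chosen as a
  multiple of \<open>|t\<^sub>2 - t\<^sub>1|\<^bsup>\<alpha>/\<gamma>\<^esup>\<close>.  Taking \<open>\<gamma>\<close> close to \<open>1\<close> reaches every \<open>\<alpha> \<le> 1\<close> below \<open>1 / (1 - q\<^sub>c)\<close>.
\<close>

subsection \<open>The signed power\<close>

text \<open>A solution is only continuous in time, so the spatial comparison doubles time as well:
  slices at \<open>t\<close> and \<open>\<tau>\<close> are coupled by
  \<open>n * (t - \<tau>)\<^sup>2\<close>, whose two time derivatives cancel. The price is a
  difference of tails at two times. Tails are continuous only on the open time interval, so the
  maximum is taken up to \<open>T < 0\<close>, and time 0 is reached by continuity of
  \<open>u\<close>. A subsolution gives information only off the contact set: in space a large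
  \<open>L\<close> beats the Lipschitz obstacle, in time the Hoelder seminorm of the obstacle enters
  the barrier as \<open>b\<close>. Far interactions cost \<open>R powr (- q - 1)\<close> with
  \<open>R\<close> comparable to \<open>(1 - |x|^2) (1 + t)\<close>; taking
  \<open>k (p - 2) \<ge> q + 1\<close> lets \<open>W powr (p - 2)\<close> outweigh this at the
  parabolic boundary. In the time estimate the local part of the operator is of order
  \<open>\<rho> powr (\<gamma> (p - 1) - s p)\<close>. Multiplied by \<open>t2 - t1\<close> it must
  stay below \<open>(t2 - t1) powr \<alpha>\<close>, where \<open>\<rho> powr \<gamma>\<close> is of
  that same order. This gives \<open>s p \<le> \<gamma> (p - 2 + 1 / \<alpha>)\<close>, at
  \<open>\<gamma> = 1\<close> the condition \<open>\<alpha> (1 - q_c) \<le> 1\<close>; a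
  \<open>\<gamma> < 1\<close> exists exactly under the strict inequality.\<close>

definition spow :: "real \<Rightarrow> real \<Rightarrow> real" where
  "spow p a = \<bar>a\<bar> powr (p - 2) * a"

lemma spow_minus [simp]: "spow p (- a) = - spow p a"
  by (simp add: spow_def)

lemma abs_spow: "\<bar>spow p a\<bar> = \<bar>a\<bar> powr (p - 1)"
proof (cases "a = 0")
  case False
  then have "\<bar>a\<bar> powr (p - 1) = \<bar>a\<bar> powr (p - 2) * \<bar>a\<bar> powr 1"
    by (subst powr_add[symmetric]) simp
  with False show ?thesis by (simp add: spow_def abs_mult)
qed (simp add: spow_def)

lemma spow_nonneg: "0 \<le> a \<Longrightarrow> spow p a = a powr (p - 1)"
  using abs_spow[of p a] by (simp add: spow_def abs_mult)

lemma spow_mono_nonneg: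
  assumes "p > 2" "0 \<le> b" "b \<le> a"
  shows "spow p b \<le> spow p a"
  using assms by (simp add: spow_nonneg powr_mono2)

lemma spow_mono:
  assumes "p > 2" "b \<le> a"
  shows "spow p b \<le> spow p a"
proof -
  consider "0 \<le> b" | "b < 0" "0 \<le> a" | "b < 0" "a < 0" by linarith
  then show ?thesis
  proof cases
    case 1 then show ?thesis using assms spow_mono_nonneg by blast
  next
    case 2
    have "spow p b \<le> 0" "0 \<le> spow p a" using 2 by (auto simp: spow_def mult_nonneg_nonpos)
    then show ?thesis by linarith
  next
    case 3
    then have "spow p (-a) \<le> spow p (-b)" using assms spow_mono_nonneg[of p "-a" "-b"] by simp
    then show ?thesis by simp
  qed
qed

lemma powr_diff_le:
  fixes a b e :: real
  assumes "e > 1" "0 \<le> b" "b \<le> a"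
  shows "a powr e - b powr e \<le> e * a powr (e - 1) * (a - b)"
proof -
  \<comment> \<open>The mean value theorem is used only on intervals of positive numbers, where
    \<open>powr\<close> is differentiable up to the left end.\<close>
  consider "b = a" | "b = 0" "b < a" | "0 < b" "b < a" using assms by linarith
  then show ?thesis
  proof cases
    case 2
    have "a powr e = a powr (e - 1) * a powr 1" by (subst powr_add[symmetric]) simp
    also have "\<dots> \<le> e * (a powr (e - 1) * a)"
      using 2 assms mult_right_mono[of 1 e "a powr (e - 1) * a"] by simp
    finally show ?thesis using 2 by (simp add: mult.assoc)
  next
    case 3
    have "\<exists>z>b. z < a \<and> (a powr e - b powr e) = (a - b) * (e * z powr (e - 1))"
      by (rule MVT2[OF \<open>b < a\<close>]) (use 3 in \<open>auto intro!: derivative_eq_intros\<close>)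
    then obtain z where z: "b < z" "z < a" "a powr e - b powr e = (a - b) * (e * z powr (e - 1))"
      by blast
    have "z powr (e - 1) \<le> a powr (e - 1)" using z 3 assms by (intro powr_mono2) auto
    then have "(a - b) * (e * z powr (e - 1)) \<le> (a - b) * (e * a powr (e - 1))"
      using 3 assms by (intro mult_left_mono) auto
    then show ?thesis using z by (simp add: mult_ac)
  qed simp
qed

lemma powr_diff_ge:
  fixes a b e :: real
  assumes "e > 1" "0 \<le> b" "b \<le> a"
  shows "e * b powr (e - 1) * (a - b) \<le> a powr e - b powr e"
proof -
  consider "b = a" | "b = 0" "b < a" | "0 < b" "b < a" using assms by linarith
  then show ?thesis
  proof cases
    case 3
    have "\<exists>z>b. z < a \<and> (a powr e - b powr e) = (a - b) * (e * z powr (e - 1))"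
      by (rule MVT2[OF \<open>b < a\<close>]) (use 3 in \<open>auto intro!: derivative_eq_intros\<close>)
    then obtain z where z: "b < z" "z < a" "a powr e - b powr e = (a - b) * (e * z powr (e - 1))"
      by blast
    have "b powr (e - 1) \<le> z powr (e - 1)" using z 3 assms by (intro powr_mono2) auto
    then have "(a - b) * (e * b powr (e - 1)) \<le> (a - b) * (e * z powr (e - 1))"
      using 3 assms by (intro mult_left_mono) auto
    then show ?thesis using z by (simp add: mult_ac)
  qed (use assms in auto)
qed

text \<open>On one side of 0 this is the mean value bound for the power \<open>p - 1\<close>.
  Oddness transfers it to the other side, and for opposite signs the two bounds are added through
  the value 0.\<close>

lemma spow_diff_le:
  assumes p: "p > 2" and a: "\<bar>a\<bar> \<le> M" and b: "\<bar>b\<bar> \<le> M" and ba: "b \<le> a"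
  shows "spow p a - spow p b \<le> (p - 1) * M powr (p - 2) * (a - b)"
proof -
  have nn: "spow p a - spow p b \<le> (p - 1) * M powr (p - 2) * (a - b)"
    if "0 \<le> b" "b \<le> a" "\<bar>a\<bar> \<le> M" for a b
  proof -
    have "spow p a - spow p b \<le> (p - 1) * a powr (p - 2) * (a - b)"
      using powr_diff_le[of "p - 1" b a] p that by (simp add: spow_nonneg)
    also have "\<dots> \<le> (p - 1) * M powr (p - 2) * (a - b)"
      using p that by (intro mult_right_mono mult_left_mono powr_mono2) auto
    finally show ?thesis .
  qed
  consider "0 \<le> b" | "b < 0" "0 \<le> a" | "b < 0" "a < 0" by linarith
  then show ?thesis
  proof cases
    case 1 then show ?thesis using nn[OF 1 ba a] by simp
  next
    case 2
    have "spow p a - spow p 0 \<le> (p - 1) * M powr (p - 2) * (a - 0)" using nn[of 0 a] 2 a by simp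
    moreover have "spow p (-b) - spow p 0 \<le> (p - 1) * M powr (p - 2) * (-b - 0)"
      using nn[of 0 "-b"] 2 b by simp
    moreover have "spow p 0 = 0" by (simp add: spow_def)
    ultimately show ?thesis by (simp add: algebra_simps)
  next
    case 3
    have "spow p (-b) - spow p (-a) \<le> (p - 1) * M powr (p - 2) * (-b - -a)"
      using nn[of "-a" "-b"] 3 ba b by simp
    then show ?thesis by simp
  qed
qed

lemma spow_diff_abs_le:
  assumes p: "p > 2" and a: "\<bar>a\<bar> \<le> M" and b: "\<bar>b\<bar> \<le> M"
  shows "\<bar>spow p a - spow p b\<bar> \<le> (p - 1) * M powr (p - 2) * \<bar>a - b\<bar>"
proof (cases "b \<le> a")
  case True
  then show ?thesis using spow_diff_le[OF p a b True] spow_mono[OF p True] by simp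
next
  case False
  then show ?thesis using spow_diff_le[OF p b a] spow_mono[OF p, of a b] by simp
qed

text \<open>The derivative degenerates at 0, but not on a whole interval. If the midpoint
  \<open>m\<close> is nonnegative, the top quarter \<open>[m + h/2, m + h]\<close> lies above
  \<open>h/2 = (a - b)/4\<close>, and the derivative there is at least
  \<open>(h/2) powr (p - 2)\<close>. A negative midpoint is reflected.\<close>

lemma spow_diff_ge:
  assumes p: "p > 2" and ba: "b \<le> a"
  shows "((a - b) / 4) powr (p - 1) \<le> spow p a - spow p b"
proof -
  define h where "h = (a - b) / 2"
  have key: "(h / 2) powr (p - 1) \<le> spow p (m + h) - spow p (m - h)" if m: "0 \<le> m" and h: "0 < h" for m h
  proof -
    have "(p - 1) * (m + h/2) powr (p - 2) * (h/2) \<le> spow p (m + h) - spow p (m + h/2)"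
      using powr_diff_ge[of "p - 1" "m + h/2" "m + h"] p m h by (simp add: spow_nonneg)
    moreover have "(h/2) powr (p - 1) \<le> (p - 1) * (m + h/2) powr (p - 2) * (h/2)"
    proof -
      have "(h/2) powr (p - 1) = (h/2) powr (p - 2) * (h/2) powr 1" by (subst powr_add[symmetric]) simp
      also have "\<dots> \<le> (m + h/2) powr (p - 2) * (h/2)" using p m h by (auto intro!: mult_right_mono powr_mono2)
      also have "\<dots> \<le> (p - 1) * ((m + h/2) powr (p - 2) * (h/2))"
        using p m h mult_right_mono[of 1 "p - 1" "(m + h/2) powr (p - 2) * (h/2)"] by simp
      finally show ?thesis by (simp add: mult.assoc)
    qed
    moreover have "spow p (m - h) \<le> spow p (m + h/2)" using p h by (intro spow_mono) auto
    ultimately show ?thesis by linarith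
  qed
  show ?thesis
  proof (cases "a = b")
    case False
    then have h: "0 < h" using ba by (simp add: h_def)
    show ?thesis
    proof (cases "0 \<le> (a + b) / 2")
      case True
      from key[OF True h] show ?thesis by (simp add: h_def field_simps)
    next
      case False
      then have "0 \<le> - ((a + b) / 2)" by simp
      from key[OF this h] have "(h / 2) powr (p - 1) \<le> spow p (-b) - spow p (-a)"
        by (simp add: h_def field_simps)
      then show ?thesis by (simp add: h_def field_simps)
    qed
  qed simp
qed

text \<open>Tangent line of the concave function \<open>B powr (g/2)\<close> of the squared norm. In
  this variable the tangent is an exact quadratic polynomial in \<open>z\<close>, valid for every
  \<open>z\<close>, so the modulus is touched from above by a paraboloid without a smallness
  condition.\<close>

lemma norm_add_powr_le:
  fixes a z :: "'a :: real_inner"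
  assumes g: "0 < g" "g \<le> 1" and a: "a \<noteq> 0"
  shows "norm (a + z) powr g \<le> norm a powr g + g / 2 * norm a powr (g - 2) * (2 * (a \<bullet> z) + (norm z)\<^sup>2)"
proof -
  define A where "A = (norm a)\<^sup>2"
  define B where "B = (norm (a + z))\<^sup>2"
  have A: "A > 0" using a by (simp add: A_def)
  have B: "B \<ge> 0" by (simp add: B_def)
  have tangent: "B powr (g/2) \<le> A powr (g/2) + g / 2 * A powr (g/2 - 1) * (B - A)"
  proof -
    define t where "t = B / A"
    have t: "t \<ge> 0" using A B by (simp add: t_def)
    have "t powr (g/2) \<le> 1 + (g/2) * (t - 1)"
    proof (cases "t = 0")
      case False
      \<comment> \<open>Young's inequality with weights \<open>g/2\<close> and
        \<open>1 - g/2\<close> is the tangent inequality at 1.\<close>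
      then have "t powr (g/2) * 1 powr (1 - g/2) \<le> (g/2) * t + (1 - g/2) * 1"
        using t g False by (intro Youngs_inequality_0) auto
      then show ?thesis by (simp add: field_simps)
    qed (use g in auto)
    then have "A powr (g/2) * t powr (g/2) \<le> A powr (g/2) * (1 + (g/2) * (t - 1))"
      by (intro mult_left_mono) auto
    moreover have "A powr (g/2) * t powr (g/2) = B powr (g/2)"
      using A B by (simp add: t_def powr_divide)
    moreover have "A powr (g/2) * (t - 1) = A powr (g/2 - 1) * (B - A)"
    proof -
      have "A powr (g/2 - 1) = A powr (g/2) / A" using A by (simp add: powr_diff)
      then show ?thesis using A by (simp only: t_def) (simp add: field_simps)
    qed
    moreover have "A powr (g/2) * (1 + (g/2) * (t - 1)) = A powr (g/2) + g/2 * (A powr (g/2) * (t - 1))"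
      by (simp only: distrib_left mult_1_right mult.left_commute)
    ultimately show ?thesis by (simp only: mult.assoc)
  qed
  have pw: "(x\<^sup>2) powr r = x powr (2 * r)" if "x \<ge> 0" for x r :: real
    using that by (simp flip: powr_numeral add: powr_powr)
  have "B - A = 2 * (a \<bullet> z) + (norm z)\<^sup>2"
    by (simp add: A_def B_def power2_norm_eq_inner inner_add inner_commute)
  moreover have "B powr (g/2) = norm (a + z) powr g" "A powr (g/2) = norm a powr g"
    "A powr (g/2 - 1) = norm a powr (g - 2)"
    by (simp_all add: A_def B_def pw right_diff_distrib)
  ultimately show ?thesis using tangent by simp
qed

subsection \<open>Radial integrals and affine changes of variables\<close>

text \<open>Domination by a countable sum of multiples of indicators of balls. It turns integrals of
  radial powers into geometric series and avoids polar coordinates.\<close>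

lemma dyadic_integral:
  fixes f :: "'a :: euclidean_space \<Rightarrow> real" and c R :: "nat \<Rightarrow> real"
  assumes f [measurable]: "f \<in> borel_measurable borel"
    and nn: "\<And>z. 0 \<le> f z" "\<And>j. 0 \<le> c j" "\<And>j. 0 \<le> R j"
    and cov: "\<And>z. f z \<noteq> 0 \<Longrightarrow> \<exists>j. norm z < R j \<and> f z \<le> c j"
    and S: "(\<lambda>j. c j * R j ^ DIM('a)) sums S"
  shows "integrable lebesgue f"
    and "integral\<^sup>L lebesgue f \<le> unit_ball_vol (real DIM('a)) * S"
proof -
  let ?v = "unit_ball_vol (real DIM('a))"
  have v: "?v \<ge> 0" by simp
  have S0: "S \<ge> 0" using S nn by (intro sums_le[OF _ sums_zero S]) auto
  have "(\<integral>\<^sup>+z. ennreal (f z) \<partial>lborel) \<le> (\<integral>\<^sup>+z. (\<Sum>j. ennreal (c j) * indicator (ball (0::'a) (R j)) z) \<partial>lborel)"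
  proof (rule nn_integral_mono)
    fix z :: 'a
    show "ennreal (f z) \<le> (\<Sum>j. ennreal (c j) * indicator (ball 0 (R j)) z)"
    proof (cases "f z = 0")
      case False
      then obtain j where j: "norm z < R j" "f z \<le> c j" using cov by blast
      have "ennreal (f z) \<le> ennreal (c j) * indicator (ball 0 (R j)) z"
        using j by (simp add: ennreal_leI)
      also have "\<dots> \<le> (\<Sum>i. ennreal (c i) * indicator (ball 0 (R i)) z)"
        using sum_le_suminf[of "\<lambda>i. ennreal (c i) * indicator (ball 0 (R i)) z" "{j}"]
        by (simp del: sum_mult_indicator)
      finally show ?thesis .
    qed simp
  qed
  also have "\<dots> = (\<Sum>j. \<integral>\<^sup>+z. ennreal (c j) * indicator (ball (0::'a) (R j)) z \<partial>lborel)"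
    by (rule nn_integral_suminf, intro borel_measurable_times_ennreal borel_measurable_const borel_measurable_indicator) auto
  also have "\<dots> = (\<Sum>j. ennreal (c j) * emeasure lborel (ball (0::'a) (R j)))"
    by (intro suminf_cong nn_integral_cmult_indicator) auto
  also have "\<dots> = (\<Sum>j. ennreal (?v * (c j * R j ^ DIM('a))))"
    using nn by (intro suminf_cong) (simp add: emeasure_ball ennreal_mult'[symmetric] mult_ac)
  also have "\<dots> = ennreal (?v * S)"
    using sums_mult[OF S, of ?v] nn v by (intro suminf_ennreal_eq) auto
  finally have le: "(\<integral>\<^sup>+z. ennreal (f z) \<partial>lborel) \<le> ennreal (?v * S)" .
  have int: "integrable lborel f"
    using le nn by (intro integrableI_nonneg) (auto simp: top_unique less_top[symmetric])
  then show "integrable lebesgue f" by (simp add: integrable_completion)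
  have "integral\<^sup>L lborel f \<le> ?v * S"
  proof -
    have "ennreal (integral\<^sup>L lborel f) \<le> ennreal (?v * S)"
      using le nn_integral_eq_integral[OF int] nn by simp
    then show ?thesis using v S0 by (subst (asm) ennreal_le_iff) auto
  qed
  then show "integral\<^sup>L lebesgue f \<le> ?v * S" by (simp add: integral_completion)
qed

lemma powr_minus_dyadic: "((2::real) ^ j) powr e = (2 powr e) ^ j"
  by (simp add: powr_powr powr_realpow[symmetric] mult.commute)

text \<open>On the ring between \<open>2 ^ j * \<rho>\<close> and
  \<open>2 ^ (j + 1) * \<rho>\<close> the mass is at most a multiple of
  \<open>\<rho> powr (- e) * (2 powr (- e)) ^ j\<close>. By scaling, \<open>C\<close> does not
  depend on \<open>\<rho>\<close>.\<close>

lemma radial_outer: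
  fixes e :: real
  assumes e: "e > 0"
  shows "\<exists>C>0. \<forall>\<rho>>0. integrable lebesgue (\<lambda>z::'a::euclidean_space. indicator {z. \<rho> \<le> norm z} z * norm z powr (- (real DIM('a) + e)))
    \<and> integral\<^sup>L lebesgue (\<lambda>z::'a. indicator {z. \<rho> \<le> norm z} z * norm z powr (- (real DIM('a) + e))) \<le> C * \<rho> powr (- e)"
proof -
  let ?d = "DIM('a)"
  let ?v = "unit_ball_vol (real DIM('a))"
  define x where "x = (2::real) powr (- e)"
  have x: "0 < x" "x < 1" using e by (auto simp: x_def powr_less_one)
  define C where "C = ?v * (2 ^ ?d / (1 - x)) + 1"
  have C: "C > 0" using x by (auto simp: C_def intro!: add_nonneg_pos mult_nonneg_nonneg)
  show ?thesis
  proof (intro exI[of _ C] conjI allI impI C)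
    fix \<rho> :: real assume \<rho>: "\<rho> > 0"
    define f where "f = (\<lambda>z::'a. indicator {z. \<rho> \<le> norm z} z * norm z powr (- (real ?d + e)))"
    define c where "c = (\<lambda>j::nat. (2 ^ j * \<rho>) powr (- (real ?d + e)))"
    define R where "R = (\<lambda>j::nat. 2 ^ Suc j * \<rho>)"
    have meas: "f \<in> borel_measurable borel" unfolding f_def by measurable
    have cov: "\<exists>j. norm z < R j \<and> f z \<le> c j" if "f z \<noteq> 0" for z
    proof -
      from that have z: "\<rho> \<le> norm z" by (auto simp: f_def split: split_indicator_asm)
      define j where "j = (LEAST j. norm z < R j)"
      obtain m where "norm z / \<rho> < 2 ^ m" using real_arch_pow[of 2 "norm z / \<rho>"] by auto
      then have "norm z < 2 ^ m * \<rho>" using \<rho> by (simp add: field_simps)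
      also have "\<dots> \<le> R m" using \<rho> by (simp add: R_def)
      finally have "norm z < R m" .
      then have j: "norm z < R j" unfolding j_def by (rule LeastI)
      have "2 ^ j * \<rho> \<le> norm z"
      proof (cases j)
        case (Suc i)
        then have "\<not> norm z < R i" using not_less_Least[of i "\<lambda>j. norm z < R j"] by (simp add: j_def)
        then show ?thesis by (simp add: R_def Suc)
      qed (use z in simp)
      then have "f z \<le> c j"
        using \<rho> z e by (auto simp: f_def c_def intro!: powr_mono2')
      with j show ?thesis by blast
    qed
    have "c j * R j ^ ?d = 2 ^ ?d * \<rho> powr (- e) * x ^ j" for j
    proof -
      have "R j ^ ?d = 2 ^ ?d * (2 ^ j * \<rho>) powr (real ?d)"
        using \<rho> by (simp add: R_def powr_realpow power_mult_distrib)
      then have "c j * R j ^ ?d = 2 ^ ?d * ((2 ^ j * \<rho>) powr (- (real ?d + e)) * (2 ^ j * \<rho>) powr (real ?d))"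
        by (simp add: c_def)
      also have "\<dots> = 2 ^ ?d * (2 ^ j * \<rho>) powr (- e)" by (simp add: powr_add[symmetric])
      also have "\<dots> = 2 ^ ?d * \<rho> powr (- e) * x ^ j"
        using \<rho> by (simp add: powr_mult powr_minus_dyadic x_def)
      finally show ?thesis .
    qed
    moreover have "(\<lambda>j. 2 ^ ?d * \<rho> powr (- e) * x ^ j) sums (2 ^ ?d * \<rho> powr (- e) * (1 / (1 - x)))"
      using x by (intro sums_mult geometric_sums) auto
    ultimately have S: "(\<lambda>j. c j * R j ^ ?d) sums (2 ^ ?d * \<rho> powr (- e) * (1 / (1 - x)))" by simp
    have nn: "\<And>z. 0 \<le> f z" "\<And>j. 0 \<le> c j" "\<And>j. 0 \<le> R j" using \<rho> by (auto simp: f_def c_def R_def)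
    note D = dyadic_integral[OF meas nn cov S]
    show "integrable lebesgue (\<lambda>z::'a. indicator {z. \<rho> \<le> norm z} z * norm z powr (- (real ?d + e)))"
      using D(1) by (simp add: f_def)
    have "integral\<^sup>L lebesgue f \<le> ?v * (2 ^ ?d * \<rho> powr (- e) * (1 / (1 - x)))" by (rule D(2))
    also have "\<dots> = (C - 1) * \<rho> powr (- e)" by (simp add: C_def mult_ac)
    also have "\<dots> \<le> C * \<rho> powr (- e)" by (intro mult_right_mono) auto
    finally show "integral\<^sup>L lebesgue (\<lambda>z::'a. indicator {z. \<rho> \<le> norm z} z * norm z powr (- (real ?d + e))) \<le> C * \<rho> powr (- e)"
      by (simp add: f_def)
  qed
qed

lemma radial_inner:
  fixes e :: real
  assumes e: "e > 0"
  shows "\<exists>C>0. \<forall>\<rho>>0. integrable lebesgue (\<lambda>z::'a::euclidean_space. indicator {z. norm z < \<rho>} z * norm z powr (e - real DIM('a)))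
    \<and> integral\<^sup>L lebesgue (\<lambda>z::'a. indicator {z. norm z < \<rho>} z * norm z powr (e - real DIM('a))) \<le> C * \<rho> powr e"
proof -
  let ?d = "DIM('a)"
  let ?v = "unit_ball_vol (real DIM('a))"
  define x where "x = (2::real) powr (- e)"
  have x: "0 < x" "x < 1" using e by (auto simp: x_def powr_less_one)
  define C where "C = ?v * (2 ^ ?d / (1 - x)) + 1"
  have C: "C > 0" using x by (auto simp: C_def intro!: add_nonneg_pos mult_nonneg_nonneg)
  show ?thesis
  proof (intro exI[of _ C] conjI allI impI C)
    fix \<rho> :: real assume \<rho>: "\<rho> > 0"
    define f where "f = (\<lambda>z::'a. indicator {z. norm z < \<rho>} z * norm z powr (e - real ?d))"
    define R where "R = (\<lambda>j::nat. (1/2) ^ j * \<rho>)"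
    \<comment> \<open>The exponent \<open>e - DIM('a)\<close> has no fixed sign, so its two factors
      are bounded separately, one at the outer and one at the inner radius of the ring.\<close>
    define c where "c = (\<lambda>j::nat. R j powr e * (R j / 2) powr (- real ?d))"
    have R: "R j > 0" for j using \<rho> by (simp add: R_def)
    have meas: "f \<in> borel_measurable borel" unfolding f_def by measurable
    have cov: "\<exists>j. norm z < R j \<and> f z \<le> c j" if "f z \<noteq> 0" for z
    proof -
      \<comment> \<open>The convention \<open>0 powr r = 0\<close> makes \<open>f\<close> vanish at
        the origin, which lies in no ring.\<close>
      from that have z: "norm z < \<rho>" "z \<noteq> 0" by (auto simp: f_def split: split_indicator_asm)
      define j where "j = (LEAST j. R j / 2 \<le> norm z)"
      obtain m where "(1/2) ^ m < norm z / \<rho>" using real_arch_pow_inv[of "norm z / \<rho>" "1/2"] z \<rho> by auto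
      then have "(1/2) ^ m * \<rho> < norm z" using \<rho> by (simp add: field_simps)
      then have "R m / 2 \<le> norm z" using R[of m] by (simp add: R_def)
      then have j: "R j / 2 \<le> norm z" unfolding j_def by (rule LeastI)
      have jl: "norm z < R j"
      proof (cases j)
        case (Suc i)
        then have "\<not> R i / 2 \<le> norm z" using not_less_Least[of i "\<lambda>j. R j / 2 \<le> norm z"] by (simp add: j_def)
        then show ?thesis by (simp add: R_def Suc)
      qed (use z in \<open>simp add: R_def\<close>)
      have "f z = norm z powr e * norm z powr (- real ?d)"
        using z by (simp add: f_def powr_diff powr_minus field_simps)
      also have "\<dots> \<le> c j"
        unfolding c_def using j jl e R[of j] z by (intro mult_mono powr_mono2 powr_mono2') auto
      finally show ?thesis using jl by blast
    qed
    have "c j * R j ^ ?d = 2 ^ ?d * \<rho> powr e * x ^ j" for j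
    proof -
      have "c j * R j ^ ?d = R j powr e * ((R j / 2) powr (- real ?d) * R j powr (real ?d))"
        using R[of j] by (simp add: c_def powr_realpow)
      also have "(R j / 2) powr (- real ?d) * R j powr (real ?d) = 2 ^ ?d"
        using R[of j] by (simp add: powr_minus powr_divide powr_realpow)
      also have "R j powr e = \<rho> powr e * x ^ j"
      proof -
        have "((1/2::real) ^ j) powr e = x ^ j"
          by (simp add: x_def powr_minus power_one_over powr_divide powr_minus_dyadic power_inverse field_simps)
        then show ?thesis using \<rho> by (simp add: R_def powr_mult)
      qed
      finally show ?thesis by simp
    qed
    moreover have "(\<lambda>j. 2 ^ ?d * \<rho> powr e * x ^ j) sums (2 ^ ?d * \<rho> powr e * (1 / (1 - x)))"
      using x by (intro sums_mult geometric_sums) auto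
    ultimately have S: "(\<lambda>j. c j * R j ^ ?d) sums (2 ^ ?d * \<rho> powr e * (1 / (1 - x)))" by simp
    have nn: "\<And>z. 0 \<le> f z" "\<And>j. 0 \<le> c j" "\<And>j. 0 \<le> R j" using R by (auto simp: f_def c_def less_imp_le)
    note D = dyadic_integral[OF meas nn cov S]
    show "integrable lebesgue (\<lambda>z::'a. indicator {z. norm z < \<rho>} z * norm z powr (e - real ?d))"
      using D(1) by (simp add: f_def)
    have "integral\<^sup>L lebesgue f \<le> ?v * (2 ^ ?d * \<rho> powr e * (1 / (1 - x)))" by (rule D(2))
    also have "\<dots> = (C - 1) * \<rho> powr e" by (simp add: C_def mult_ac)
    also have "\<dots> \<le> C * \<rho> powr e" by (intro mult_right_mono) auto
    finally show "integral\<^sup>L lebesgue (\<lambda>z::'a. indicator {z. norm z < \<rho>} z * norm z powr (e - real ?d)) \<le> C * \<rho> powr e"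
      by (simp add: f_def)
  qed
qed

text \<open>Translations recentre the kernel at a contact point, and the reflection
  (\<open>\<sigma> = -1\<close>) gives the cancellation behind the principal value.\<close>

lemma distr_lebesgue_affine:
  fixes x :: "'a::euclidean_space"
  assumes \<sigma>: "\<sigma> = 1 \<or> \<sigma> = (-1::real)"
  shows "distr lebesgue lebesgue (\<lambda>z. x + \<sigma> *\<^sub>R z) = lebesgue"
    and "(\<lambda>z. x + \<sigma> *\<^sub>R z) \<in> lebesgue \<rightarrow>\<^sub>M lebesgue"
proof -
  have T: "(\<lambda>z. x + (\<Sum>j\<in>Basis. (\<sigma> * (z \<bullet> j)) *\<^sub>R j)) = (\<lambda>z. x + \<sigma> *\<^sub>R z)"
    by (simp add: scaleR_scaleR[symmetric] scaleR_sum_right[symmetric] euclidean_representation del: scaleR_scaleR)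
  have "(\<Prod>j\<in>(Basis::'a set). \<bar>\<sigma>\<bar>) = 1" using \<sigma> by auto
  then show "distr lebesgue lebesgue (\<lambda>z. x + \<sigma> *\<^sub>R z) = lebesgue"
    using lebesgue_affine_euclidean[of "\<lambda>_. \<sigma>" x] \<sigma> unfolding T by (auto simp: density_1)
  show "(\<lambda>z. x + \<sigma> *\<^sub>R z) \<in> lebesgue \<rightarrow>\<^sub>M lebesgue"
    using lebesgue_affine_measurable[of "\<lambda>_. \<sigma>" x] \<sigma> unfolding T by auto
qed

lemma
  fixes f :: "'a::euclidean_space \<Rightarrow> real"
  assumes \<sigma>: "\<sigma> = 1 \<or> \<sigma> = (-1::real)" and f: "f \<in> borel_measurable lebesgue"
  shows integrable_lebesgue_affine_comp: "integrable lebesgue (\<lambda>z. f (x + \<sigma> *\<^sub>R z)) \<longleftrightarrow> integrable lebesgue f"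
    and integral_lebesgue_affine_comp: "integral\<^sup>L lebesgue (\<lambda>z. f (x + \<sigma> *\<^sub>R z)) = integral\<^sup>L lebesgue f"
proof -
  note D = distr_lebesgue_affine[OF \<sigma>, of x]
  show "integrable lebesgue (\<lambda>z. f (x + \<sigma> *\<^sub>R z)) \<longleftrightarrow> integrable lebesgue f"
    using integrable_distr_eq[OF D(2) f] D(1) by simp
  show "integral\<^sup>L lebesgue (\<lambda>z. f (x + \<sigma> *\<^sub>R z)) = integral\<^sup>L lebesgue f"
    using integral_distr[OF D(2) f] D(1) by simp
qed

text \<open>Away from \<open>x\<close> the distance dominates both constants and
  \<open>norm y\<close>: \<open>1 \<le> norm (x - y) / \<epsilon>\<close> and
  \<open>norm y \<le> (1 + norm x / \<epsilon>) * norm (x - y)\<close>. Adding the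
  \<open>q\<close>-th powers compares the kernel with the tail weight.\<close>

lemma powr_kernel_compare:
  fixes x y :: "'a::real_normed_vector"
  assumes q: "q > 0" and \<epsilon>: "\<epsilon> > 0" "\<epsilon> \<le> norm (x - y)"
  shows "norm (x - y) powr (- q) \<le> (\<epsilon> powr (- q) + (1 + norm x / \<epsilon>) powr q) / (1 + norm y powr q)"
proof -
  let ?r = "norm (x - y)"
  have r: "?r > 0" using \<epsilon> by linarith
  have "norm x \<le> norm x / \<epsilon> * ?r"
    using mult_left_mono[OF \<epsilon>(2), of "norm x / \<epsilon>"] \<epsilon>(1) by (simp add: field_simps)
  moreover have "norm y \<le> norm x + ?r" using norm_triangle_ineq4[of x "x - y"] by simp
  ultimately have "norm y \<le> (1 + norm x / \<epsilon>) * ?r" by (simp add: algebra_simps)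
  then have "norm y powr q \<le> ((1 + norm x / \<epsilon>) * ?r) powr q" using q by (intro powr_mono2) auto
  also have "\<dots> = (1 + norm x / \<epsilon>) powr q * ?r powr q" using \<epsilon> by (simp add: powr_mult)
  finally have 1: "norm y powr q \<le> (1 + norm x / \<epsilon>) powr q * ?r powr q" .
  have "1 = \<epsilon> powr (- q) * \<epsilon> powr q" using \<epsilon> by (simp add: powr_add[symmetric])
  also have "\<dots> \<le> \<epsilon> powr (- q) * ?r powr q" using \<epsilon> q by (intro mult_left_mono powr_mono2) auto
  finally have "1 + norm y powr q \<le> (\<epsilon> powr (- q) + (1 + norm x / \<epsilon>) powr q) * ?r powr q"
    using 1 by (simp add: algebra_simps)
  then have "(1 + norm y powr q) * ?r powr (- q) \<le> (\<epsilon> powr (- q) + (1 + norm x / \<epsilon>) powr q) * ?r powr q * ?r powr (- q)"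
    by (intro mult_right_mono) auto
  also have "\<dots> = \<epsilon> powr (- q) + (1 + norm x / \<epsilon>) powr q"
    using r by (simp add: mult.assoc powr_add[symmetric])
  moreover have "1 + norm y powr q > 0" by (intro add_pos_nonneg) auto
  ultimately show ?thesis by (simp add: field_simps)
qed

lemma integrable_tail_weight:
  fixes q :: real
  assumes q: "q > DIM('a)"
  shows "integrable lebesgue (\<lambda>y::'a::euclidean_space. 1 / (1 + norm y powr q))"
proof -
  define e where "e = q - DIM('a)"
  have e: "e > 0" using q by (simp add: e_def)
  obtain C where "\<forall>\<rho>>0. integrable lebesgue (\<lambda>z::'a. indicator {z. \<rho> \<le> norm z} z * norm z powr (- (real DIM('a) + e)))"
    using radial_outer[OF e, where 'a='a] by blast
  then have 1: "integrable lebesgue (\<lambda>z::'a. indicator {z. 1 \<le> norm z} z * norm z powr (- q))"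
    by (auto simp: e_def)
  have 2: "integrable lebesgue (\<lambda>z::'a. indicator (cball 0 1) z :: real)"
    by (intro integrable_real_indicator) (auto simp: emeasure_cball)
  show ?thesis
  proof (rule Bochner_Integration.integrable_bound[OF Bochner_Integration.integrable_add[OF 1 2]])
    show "(\<lambda>y::'a. 1 / (1 + norm y powr q)) \<in> borel_measurable lebesgue"
      by (rule measurable_completion) measurable
    show "AE y::'a in lebesgue. norm (1 / (1 + norm y powr q))
        \<le> norm (indicator {z. 1 \<le> norm z} y * norm y powr (- q) + indicator (cball 0 1) y)"
    proof (rule AE_I2)
      fix y :: 'a
      have pos: "1 + norm y powr q > 0" by (intro add_pos_nonneg) auto
      show "norm (1 / (1 + norm y powr q))
          \<le> norm (indicator {z. 1 \<le> norm z} y * norm y powr (- q) + indicator (cball 0 1) y)"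
      proof (cases "norm y \<le> 1")
        case True
        then show ?thesis using pos by (auto split: split_indicator simp: field_simps)
      next
        case False
        then have "norm y powr q > 0" by auto
        then have "1 / (1 + norm y powr q) \<le> norm y powr (- q)"
          by (simp add: powr_minus inverse_eq_divide frac_le)
        then show ?thesis using False pos by auto
      qed
    qed
  qed
qed

subsection \<open>Kernel and tail\<close>

text \<open>The bridge from the extended integral that defines the operator to ordinary Bochner
  integrals, in which all estimates are made.\<close>

lemma ext_integral_eq:
  assumes "set_integrable lebesgue S f"
  shows "ext_integral S f = ereal (LINT y:S|lebesgue. f y)"
proof -
  let ?g = "\<lambda>y. indicator S y * f y"
  have i: "integrable lebesgue ?g" using assms by (simp add: set_integrable_def)
  have 1: "(\<integral>\<^sup>+ y \<in> S. ennreal (f y) \<partial>lebesgue) = (\<integral>\<^sup>+ y. ennreal (?g y) \<partial>lebesgue)"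
    by (intro nn_integral_cong) (auto split: split_indicator)
  have 2: "(\<integral>\<^sup>+ y \<in> S. ennreal (- f y) \<partial>lebesgue) = (\<integral>\<^sup>+ y. ennreal (- ?g y) \<partial>lebesgue)"
    by (intro nn_integral_cong) (auto split: split_indicator)
  obtain a where a: "0 \<le> a" "(\<integral>\<^sup>+ y. ennreal (?g y) \<partial>lebesgue) = ennreal a"
    using i by (auto simp: real_integrable_def elim: ennreal_cases)
  obtain b where b: "0 \<le> b" "(\<integral>\<^sup>+ y. ennreal (- ?g y) \<partial>lebesgue) = ennreal b"
    using i by (auto simp: real_integrable_def elim: ennreal_cases)
  have "integral\<^sup>L lebesgue ?g = a - b"
    using real_lebesgue_integral_def[OF i] a b by simp
  then show ?thesis
    using a b by (simp add: ext_integral_def 1 2 set_lebesgue_integral_def)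
qed

text \<open>The reflection of \<open>y\<close> at \<open>x\<close> preserves Lebesgue measure and
  changes the sign of the integrand.\<close>

lemma set_integral_odd:
  fixes f :: "'a::euclidean_space \<Rightarrow> real"
  assumes f: "(\<lambda>y. indicator S y * f y) \<in> borel_measurable lebesgue"
    and S: "\<And>z. x + z \<in> S \<longleftrightarrow> x - z \<in> S" and odd: "\<And>z. f (x + z) = - f (x - z)"
  shows "(LINT y:S|lebesgue. f y) = 0"
proof -
  let ?g = "\<lambda>y. indicator S y * f y"
  have "integral\<^sup>L lebesgue ?g = integral\<^sup>L lebesgue (\<lambda>z. ?g (2 *\<^sub>R x + (- 1) *\<^sub>R z))"
    using integral_lebesgue_affine_comp[OF _ f, of "-1" "2 *\<^sub>R x"] by simp
  also have "(\<lambda>z. ?g (2 *\<^sub>R x + (- 1) *\<^sub>R z)) = (\<lambda>z. - ?g z)"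
  proof
    fix z
    define w where "w = 2 *\<^sub>R x + (- 1) *\<^sub>R z"
    have w: "x + (x - z) = w" "x - (x - z) = z" by (auto simp: w_def scaleR_2)
    have "w \<in> S \<longleftrightarrow> z \<in> S" "f w = - f z"
      using S[of "x - z"] odd[of "x - z"] unfolding w by auto
    then show "?g (2 *\<^sub>R x + (- 1) *\<^sub>R z) = - ?g z"
      unfolding w_def[symmetric] by (simp add: indicator_def)
  qed
  finally have "integral\<^sup>L lebesgue ?g = - integral\<^sup>L lebesgue ?g" by simp
  then show ?thesis by (simp add: set_lebesgue_integral_def)
qed

lemma abs_add_powr_le:
  fixes a b e :: real
  assumes "e > 0"
  shows "\<bar>a + b\<bar> powr e \<le> 2 powr e * (\<bar>a\<bar> powr e + \<bar>b\<bar> powr e)"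
proof -
  have "\<bar>a + b\<bar> powr e \<le> (2 * max \<bar>a\<bar> \<bar>b\<bar>) powr e" using assms by (intro powr_mono2) auto
  also have "\<dots> = 2 powr e * max \<bar>a\<bar> \<bar>b\<bar> powr e" by (simp add: powr_mult)
  also have "\<dots> \<le> 2 powr e * (\<bar>a\<bar> powr e + \<bar>b\<bar> powr e)" by (intro mult_left_mono) (auto simp: max_def)
  finally show ?thesis .
qed

text \<open>\<open>q\<close> is the exponent of the kernel. The argument \<open>dim\<close> makes
  the dimension a parameter of the locale, so that \<open>q\<close> can refer to it.\<close>

locale frac_params =
  fixes p s q :: real and dim :: "'n::finite itself"
  assumes p: "p > 2" and s: "0 < s" "s < 1" and q: "q = real CARD('n) + s * p"
begin

lemma sp: "s * p > 0" "s * p < p" using p s by auto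

lemma q_pos: "q > 0" "q > real CARD('n)" "q > 1"
proof -
  have "real CARD('n) \<ge> 1" by (simp add: Suc_le_eq)
  then show "q > 0" "q > real CARD('n)" "q > 1" using sp q by linarith+
qed

definition tailw :: "real ^ 'n \<Rightarrow> real" where "tailw y = 1 / (1 + norm y powr q)"

lemma tailw_pos: "tailw y > 0"
  unfolding tailw_def by (intro divide_pos_pos add_pos_nonneg) auto

lemma integrable_tailw: "integrable lebesgue tailw"
  using integrable_tail_weight[where 'a = "real ^ 'n", of q] q_pos by (simp add: tailw_def[abs_def])

definition tail_ok :: "(real ^ 'n \<Rightarrow> real) \<Rightarrow> bool" where
  "tail_ok U \<longleftrightarrow> U \<in> borel_measurable lebesgue \<and> integrable lebesgue (\<lambda>y. \<bar>U y\<bar> powr (p - 1) * tailw y)"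

lemma tail_integrand_eq: "tail_integrand p s U = (\<lambda>y::real^'n. \<bar>U y\<bar> powr (p - 1) * tailw y)"
  by (simp add: tail_integrand_def tailw_def q[symmetric] fun_eq_iff)

lemma tail_ok_measurable: "tail_ok U \<Longrightarrow> U \<in> borel_measurable lebesgue"
  by (simp add: tail_ok_def)

lemma frac_kernel_eq: "frac_kernel p s U (x::real^'n) y = spow p (U x - U y) * norm (x - y) powr (- q)"
  by (simp add: frac_kernel_def spow_def q[symmetric] powr_minus divide_inverse)

lemma tail_ok_minus: "tail_ok U \<Longrightarrow> tail_ok (\<lambda>y. - U y)"
  by (simp add: tail_ok_def)

lemma borel_measurable_norm_powr:
  "(\<lambda>y::real^'n. norm (x - y) powr e) \<in> borel_measurable lebesgue"
  by (rule measurable_completion) measurable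

lemma borel_measurable_spow [measurable]: "spow p \<in> borel_measurable borel"
  unfolding spow_def[abs_def] by measurable

lemma frac_kernel_measurable:
  assumes "U \<in> borel_measurable lebesgue"
  shows "frac_kernel p s U (x::real^'n) \<in> borel_measurable lebesgue"
proof -
  have "(\<lambda>y. spow p (U x - U y)) \<in> borel_measurable lebesgue"
    using assms by (intro measurable_compose[OF _ borel_measurable_spow]) auto
  then show ?thesis
    unfolding frac_kernel_eq[abs_def] by (intro borel_measurable_times borel_measurable_norm_powr)
qed

lemma lebesgue_norm_sets:
  "{y::real^'n. \<rho> \<le> norm (x - y)} \<in> sets lebesgue" "{y::real^'n. norm (x - y) < \<rho>} \<in> sets lebesgue"
  "{y::real^'n. \<rho> < norm (x - y)} \<in> sets lebesgue" "{y::real^'n. norm (x - y) \<le> \<rho>} \<in> sets lebesgue"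
  by (auto intro!: sets_completionI_sets)

lemma tail_kernel_integrable:
  assumes U: "tail_ok U" and \<epsilon>: "\<epsilon> > 0"
  shows "set_integrable lebesgue {y. \<epsilon> \<le> norm (x - y)} (\<lambda>y. (c + \<bar>U y\<bar> powr (p - 1)) * norm (x - y) powr (- q))"
proof -
  define K where "K = \<epsilon> powr (- q) + (1 + norm x / \<epsilon>) powr q"
  have i: "integrable lebesgue (\<lambda>y. K * (\<bar>c\<bar> * tailw y + \<bar>U y\<bar> powr (p - 1) * tailw y))"
    using U integrable_tailw by (simp add: tail_ok_def)
  show ?thesis unfolding set_integrable_def
  proof (rule Bochner_Integration.integrable_bound[OF i])
    have "(\<lambda>y. \<bar>U y\<bar> powr (p - 1)) \<in> borel_measurable lebesgue"
      using tail_ok_measurable[OF U] by measurable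
    then show "(\<lambda>y. indicator {y. \<epsilon> \<le> norm (x - y)} y *\<^sub>R ((c + \<bar>U y\<bar> powr (p - 1)) * norm (x - y) powr (- q))) \<in> borel_measurable lebesgue"
      by (intro borel_measurable_scaleR borel_measurable_indicator lebesgue_norm_sets borel_measurable_times
          borel_measurable_add borel_measurable_norm_powr borel_measurable_const)
    show "AE y in lebesgue. norm (indicator {y. \<epsilon> \<le> norm (x - y)} y *\<^sub>R ((c + \<bar>U y\<bar> powr (p - 1)) * norm (x - y) powr (- q)))
      \<le> norm (K * (\<bar>c\<bar> * tailw y + \<bar>U y\<bar> powr (p - 1) * tailw y))"
    proof (rule AE_I2)
      fix y
      have K: "K \<ge> 0" by (simp add: K_def)
      show "norm (indicator {y. \<epsilon> \<le> norm (x - y)} y *\<^sub>R ((c + \<bar>U y\<bar> powr (p - 1)) * norm (x - y) powr (- q)))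
        \<le> norm (K * (\<bar>c\<bar> * tailw y + \<bar>U y\<bar> powr (p - 1) * tailw y))"
      proof (cases "\<epsilon> \<le> norm (x - y)")
        case True
        have "norm (x - y) powr (- q) \<le> K * tailw y"
          using powr_kernel_compare[OF q_pos(1) \<epsilon> True] by (simp add: K_def tailw_def)
        then have "\<bar>c + \<bar>U y\<bar> powr (p - 1)\<bar> * norm (x - y) powr (- q) \<le> (\<bar>c\<bar> + \<bar>U y\<bar> powr (p - 1)) * (K * tailw y)"
          by (intro mult_mono) (auto intro: abs_triangle_ineq[THEN order_trans])
        moreover have "(\<bar>c\<bar> + \<bar>U y\<bar> powr (p - 1)) * (K * tailw y) = K * (\<bar>c\<bar> * tailw y + \<bar>U y\<bar> powr (p - 1) * tailw y)"
          by (simp only: distrib_right distrib_left mult_ac)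
        moreover have "K * (\<bar>c\<bar> * tailw y + \<bar>U y\<bar> powr (p - 1) * tailw y) \<ge> 0"
          using K tailw_pos[of y] by simp
        ultimately show ?thesis using True
          by (simp only: real_norm_def abs_of_nonneg) (simp add: abs_mult)
      qed auto
    qed
  qed
qed

lemma frac_kernel_integrable:
  assumes U: "tail_ok U" and \<epsilon>: "\<epsilon> > 0"
  shows "set_integrable lebesgue {y. \<epsilon> \<le> norm (x - y)} (frac_kernel p s U x)"
proof -
  let ?S = "{y. \<epsilon> \<le> norm (x - y)}"
  have i: "integrable lebesgue (\<lambda>y. 2 powr (p - 1) * (indicator ?S y *\<^sub>R ((\<bar>U x\<bar> powr (p - 1) + \<bar>U y\<bar> powr (p - 1)) * norm (x - y) powr (- q))))"
    using tail_kernel_integrable[OF U \<epsilon>, of x "\<bar>U x\<bar> powr (p - 1)"]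
    unfolding set_integrable_def by (intro integrable_mult_right)
  show ?thesis unfolding set_integrable_def
  proof (rule Bochner_Integration.integrable_bound[OF i])
    show "(\<lambda>y. indicator ?S y *\<^sub>R frac_kernel p s U x y) \<in> borel_measurable lebesgue"
      using frac_kernel_measurable[OF tail_ok_measurable[OF U]]
      by (intro borel_measurable_scaleR borel_measurable_indicator lebesgue_norm_sets)
    show "AE y in lebesgue. norm (indicator ?S y *\<^sub>R frac_kernel p s U x y)
      \<le> norm (2 powr (p - 1) * (indicator ?S y *\<^sub>R ((\<bar>U x\<bar> powr (p - 1) + \<bar>U y\<bar> powr (p - 1)) * norm (x - y) powr (- q))))"
    proof (rule AE_I2)
      fix y
      have "\<bar>spow p (U x - U y)\<bar> \<le> 2 powr (p - 1) * (\<bar>U x\<bar> powr (p - 1) + \<bar>U y\<bar> powr (p - 1))"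
        using abs_add_powr_le[of "p - 1" "U x" "- U y"] p by (simp add: abs_spow)
      then have "\<bar>spow p (U x - U y)\<bar> * norm (x - y) powr (- q) \<le> 2 powr (p - 1) * (\<bar>U x\<bar> powr (p - 1) + \<bar>U y\<bar> powr (p - 1)) * norm (x - y) powr (- q)"
        by (rule mult_right_mono) simp
      then show "norm (indicator ?S y *\<^sub>R frac_kernel p s U x y)
      \<le> norm (2 powr (p - 1) * (indicator ?S y *\<^sub>R ((\<bar>U x\<bar> powr (p - 1) + \<bar>U y\<bar> powr (p - 1)) * norm (x - y) powr (- q))))"
        by (simp add: frac_kernel_eq abs_mult mult.assoc split: split_indicator)
    qed
  qed
qed

lemma radial_outer_at:
  assumes e: "e > 0"
  shows "\<exists>C>0. \<forall>(x::real^'n) \<rho>. \<rho> > 0 \<longrightarrow>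
    set_integrable lebesgue {y. \<rho> \<le> norm (x - y)} (\<lambda>y. norm (x - y) powr (- (real CARD('n) + e)))
    \<and> (LINT y:{y. \<rho> \<le> norm (x - y)}|lebesgue. norm (x - y) powr (- (real CARD('n) + e))) \<le> C * \<rho> powr (- e)"
proof -
  obtain C where C: "C > 0" "\<And>\<rho>. \<rho> > 0 \<Longrightarrow> integrable lebesgue (\<lambda>z::real^'n. indicator {z. \<rho> \<le> norm z} z * norm z powr (- (real CARD('n) + e)))
    \<and> integral\<^sup>L lebesgue (\<lambda>z::real^'n. indicator {z. \<rho> \<le> norm z} z * norm z powr (- (real CARD('n) + e))) \<le> C * \<rho> powr (- e)"
    using radial_outer[OF e, where 'a = "real^'n"] by auto
  show ?thesis
  proof (intro exI[of _ C] conjI allI impI C(1))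
    fix x :: "real^'n" and \<rho> :: real assume \<rho>: "\<rho> > 0"
    define f where "f = (\<lambda>z::real^'n. indicator {z. \<rho> \<le> norm z} z * norm z powr (- (real CARD('n) + e)))"
    have m: "f \<in> borel_measurable lebesgue" unfolding f_def by (rule measurable_completion) measurable
    have eq: "(\<lambda>y. f (x + (-1) *\<^sub>R y)) = (\<lambda>y. indicator {y. \<rho> \<le> norm (x - y)} y *\<^sub>R norm (x - y) powr (- (real CARD('n) + e)))"
      by (auto simp: f_def indicator_def fun_eq_iff)
    show "set_integrable lebesgue {y. \<rho> \<le> norm (x - y)} (\<lambda>y. norm (x - y) powr (- (real CARD('n) + e)))"
      using integrable_lebesgue_affine_comp[OF _ m, of "-1" x] C(2)[OF \<rho>]
      unfolding eq set_integrable_def by (simp add: f_def)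
    show "(LINT y:{y. \<rho> \<le> norm (x - y)}|lebesgue. norm (x - y) powr (- (real CARD('n) + e))) \<le> C * \<rho> powr (- e)"
      using integral_lebesgue_affine_comp[OF _ m, of "-1" x] C(2)[OF \<rho>]
      unfolding eq set_lebesgue_integral_def by (simp add: f_def)
  qed
qed

lemma radial_inner_at:
  assumes e: "e > 0"
  shows "\<exists>C>0. \<forall>(x::real^'n) \<rho>. \<rho> > 0 \<longrightarrow>
    set_integrable lebesgue {y. norm (x - y) < \<rho>} (\<lambda>y. norm (x - y) powr (e - real CARD('n)))
    \<and> (LINT y:{y. norm (x - y) < \<rho>}|lebesgue. norm (x - y) powr (e - real CARD('n))) \<le> C * \<rho> powr e"
proof -
  obtain C where C: "C > 0" "\<And>\<rho>. \<rho> > 0 \<Longrightarrow> integrable lebesgue (\<lambda>z::real^'n. indicator {z. norm z < \<rho>} z * norm z powr (e - real CARD('n)))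
    \<and> integral\<^sup>L lebesgue (\<lambda>z::real^'n. indicator {z. norm z < \<rho>} z * norm z powr (e - real CARD('n))) \<le> C * \<rho> powr e"
    using radial_inner[OF e, where 'a = "real^'n"] by auto
  show ?thesis
  proof (intro exI[of _ C] conjI allI impI C(1))
    fix x :: "real^'n" and \<rho> :: real assume \<rho>: "\<rho> > 0"
    define f where "f = (\<lambda>z::real^'n. indicator {z. norm z < \<rho>} z * norm z powr (e - real CARD('n)))"
    have m: "f \<in> borel_measurable lebesgue" unfolding f_def by (rule measurable_completion) measurable
    have eq: "(\<lambda>y. f (x + (-1) *\<^sub>R y)) = (\<lambda>y. indicator {y. norm (x - y) < \<rho>} y *\<^sub>R norm (x - y) powr (e - real CARD('n)))"
      by (auto simp: f_def indicator_def fun_eq_iff)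
    show "set_integrable lebesgue {y. norm (x - y) < \<rho>} (\<lambda>y. norm (x - y) powr (e - real CARD('n)))"
      using integrable_lebesgue_affine_comp[OF _ m, of "-1" x] C(2)[OF \<rho>]
      unfolding eq set_integrable_def by (simp add: f_def)
    show "(LINT y:{y. norm (x - y) < \<rho>}|lebesgue. norm (x - y) powr (e - real CARD('n))) \<le> C * \<rho> powr e"
      using integral_lebesgue_affine_comp[OF _ m, of "-1" x] C(2)[OF \<rho>]
      unfolding eq set_lebesgue_integral_def by (simp add: f_def)
  qed
qed

end

subsection \<open>The operator on functions that are paraboloids near a point\<close>

lemma LINT_mono_set:
  fixes f g :: "'a \<Rightarrow> real"
  assumes "set_integrable M S f" "set_integrable M S g" "\<And>y. y \<in> S \<Longrightarrow> f y \<le> g y"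
  shows "(LINT y:S|M. f y) \<le> (LINT y:S|M. g y)"
  using assms unfolding set_integrable_def set_lebesgue_integral_def
  by (intro integral_mono) (auto split: split_indicator)

lemma set_integrable_bounded_by:
  fixes f g :: "'a \<Rightarrow> real"
  assumes g: "set_integrable M T g" and f: "f \<in> borel_measurable M" and S: "S \<in> sets M" "S \<subseteq> T"
    and le: "\<And>y. y \<in> S \<Longrightarrow> \<bar>f y\<bar> \<le> g y"
  shows "set_integrable M S f" "\<bar>LINT y:S|M. f y\<bar> \<le> (LINT y:S|M. g y)"
proof -
  have gS: "set_integrable M S g" using set_integrable_subset[OF g S] .
  show f1: "set_integrable M S f"
    unfolding set_integrable_def
  proof (rule Bochner_Integration.integrable_bound[OF gS[unfolded set_integrable_def]])
    show "(\<lambda>y. indicator S y *\<^sub>R f y) \<in> borel_measurable M"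
      using f S by (intro borel_measurable_scaleR borel_measurable_indicator)
    show "AE y in M. norm (indicator S y *\<^sub>R f y) \<le> norm (indicator S y *\<^sub>R g y)"
      using le by (intro AE_I2) (auto split: split_indicator intro: order_trans[OF _ abs_ge_self])
  qed
  have "(LINT y:S|M. f y) \<le> (LINT y:S|M. g y)"
    using LINT_mono_set[OF f1 gS] le by fastforce
  moreover have "(LINT y:S|M. - f y) \<le> (LINT y:S|M. g y)"
    using LINT_mono_set[of M S "\<lambda>y. - f y" g] gS f1 le
    unfolding set_integrable_def by fastforce
  moreover have "(LINT y:S|M. - f y) = - (LINT y:S|M. f y)"
    by (simp add: set_lebesgue_integral_def)
  ultimately show "\<bar>LINT y:S|M. f y\<bar> \<le> (LINT y:S|M. g y)" by linarith
qed

lemma LINT_nonneg_mono_sets: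
  fixes g :: "'a \<Rightarrow> real"
  assumes g: "set_integrable M T g" and S: "S \<in> sets M" "S \<subseteq> T" and nn: "\<And>y. y \<in> T \<Longrightarrow> 0 \<le> g y"
  shows "(LINT y:S|M. g y) \<le> (LINT y:T|M. g y)"
  using g set_integrable_subset[OF g S] S nn
  unfolding set_integrable_def set_lebesgue_integral_def
  by (intro integral_mono) (auto split: split_indicator)

context frac_params
begin

text \<open>After subtraction of the odd linear part, the integrand at distance \<open>r\<close> is
  at most \<open>(p - 1) ((|P| + Q \<rho>) r) powr (p - 2) * Q r^2 * r powr (- q)\<close>, a power
  \<open>p - s p - d\<close> of \<open>r\<close>, which is integrable at 0 because
  \<open>s < 1\<close>. The radius \<open>R\<close> is kept apart from \<open>\<rho>\<close>:
  letting it tend to 0 proves that the principal value exists.\<close>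

lemma paraboloid_kernel_bounds:
  obtains C where "C > 0" and "\<And>(x::real^'n) P Q \<rho> S R. 0 < \<rho> \<Longrightarrow> 0 \<le> Q \<Longrightarrow> S \<in> sets lebesgue \<Longrightarrow>
     0 < R \<Longrightarrow> R \<le> \<rho> \<Longrightarrow> S \<subseteq> {y. norm (x - y) < R} \<Longrightarrow>
       set_integrable lebesgue S (\<lambda>y. (spow p (- (P \<bullet> (y - x)) - Q * (norm (x - y))\<^sup>2) - spow p (- (P \<bullet> (y - x)))) * norm (x - y) powr (- q))
       \<and> \<bar>LINT y:S|lebesgue. (spow p (- (P \<bullet> (y - x)) - Q * (norm (x - y))\<^sup>2) - spow p (- (P \<bullet> (y - x)))) * norm (x - y) powr (- q)\<bar>
         \<le> C * (norm P + Q * \<rho>) powr (p - 2) * Q * R powr (p - s * p)"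
proof -
  define e where "e = p - s * p"
  have e: "e > 0" using sp by (simp add: e_def)
  obtain C where C: "C > 0" "\<And>(x::real^'n) \<rho>. \<rho> > 0 \<Longrightarrow>
    set_integrable lebesgue {y. norm (x - y) < \<rho>} (\<lambda>y. norm (x - y) powr (e - real CARD('n)))
    \<and> (LINT y:{y. norm (x - y) < \<rho>}|lebesgue. norm (x - y) powr (e - real CARD('n))) \<le> C * \<rho> powr e"
    using radial_inner_at[OF e] by blast
  show ?thesis
  proof (rule that[of "(p - 1) * C"], goal_cases)
    case 1
    show "(p - 1) * C > 0" using p C by simp
  next
    case (2 x P Q \<rho> S R)
    note \<rho> = 2(1) and Q = 2(2) and S = 2(3) and R = 2(4,5) and SR = 2(6)
    define M where "M = (p - 1) * (norm P + Q * \<rho>) powr (p - 2) * Q"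
    have M: "M \<ge> 0" using p Q by (simp add: M_def)
    let ?g = "\<lambda>y. (spow p (- (P \<bullet> (y - x)) - Q * (norm (x - y))\<^sup>2) - spow p (- (P \<bullet> (y - x)))) * norm (x - y) powr (- q)"
    have meas: "?g \<in> borel_measurable lebesgue"
      by (rule measurable_completion) measurable
    have bd: "\<bar>?g y\<bar> \<le> M * norm (x - y) powr (e - real CARD('n))" if "y \<in> S" for y
    proof (cases "x = y")
      case False
      define r where "r = norm (x - y)"
      have r: "0 < r" "r < \<rho>" using False that SR R by (auto simp: r_def)
      define t where "t = P \<bullet> (y - x)"
      have P: "\<bar>t\<bar> \<le> norm P * r"
        unfolding t_def using Cauchy_Schwarz_ineq2[of P "y - x"] by (simp add: r_def norm_minus_commute)
      have "Q * r\<^sup>2 \<le> Q * \<rho> * r" using Q r by (simp add: power2_eq_square mult_mono mult.assoc mult_left_mono)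
      then have 1: "\<bar>- t - Q * r\<^sup>2\<bar> \<le> (norm P + Q * \<rho>) * r"
      proof -
        have "0 \<le> Q * r\<^sup>2" "(norm P + Q * \<rho>) * r = norm P * r + Q * \<rho> * r"
          using Q by (auto simp: distrib_right)
        with \<open>Q * r\<^sup>2 \<le> Q * \<rho> * r\<close> P show ?thesis by linarith
      qed
      have "0 \<le> Q * \<rho> * r" using Q r \<rho> by simp
      then have 2: "\<bar>- t\<bar> \<le> (norm P + Q * \<rho>) * r"
        using P by (simp add: algebra_simps)
      have "\<bar>?g y\<bar> \<le> ((p - 1) * ((norm P + Q * \<rho>) * r) powr (p - 2) * \<bar>- Q * r\<^sup>2\<bar>) * r powr (- q)"
        using spow_diff_abs_le[OF p 1 2] by (simp add: abs_mult r_def t_def mult_right_mono)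
      also have "\<dots> = M * (r powr (p - 2) * r powr 2 * r powr (- q))"
        using Q r \<rho> by (simp add: M_def powr_mult mult_ac)
      also have "r powr (p - 2) * r powr 2 * r powr (- q) = r powr (e - real CARD('n))"
        by (simp add: powr_add[symmetric] e_def q algebra_simps)
      finally show ?thesis by (simp add: r_def)
    qed (use M in simp)
    have gi: "set_integrable lebesgue {y. norm (x - y) < R} (\<lambda>y. M * norm (x - y) powr (e - real CARD('n)))"
      using C(2)[OF R(1), of x] by (intro set_integrable_mult_right) auto
    note B = set_integrable_bounded_by[OF gi meas S SR bd]
    have "\<bar>LINT y:S|lebesgue. ?g y\<bar> \<le> (LINT y:S|lebesgue. M * norm (x - y) powr (e - real CARD('n)))" using B(2) .
    also have "\<dots> \<le> (LINT y:{y. norm (x - y) < R}|lebesgue. M * norm (x - y) powr (e - real CARD('n)))"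
      using LINT_nonneg_mono_sets[OF gi S SR] M by simp
    also have "\<dots> \<le> M * (C * R powr e)"
      using C(2)[OF R(1), of x] M by (simp add: mult_left_mono)
    finally have "\<bar>LINT y:S|lebesgue. ?g y\<bar> \<le> (p - 1) * C * (norm P + Q * \<rho>) powr (p - 2) * Q * R powr (p - s * p)"
      by (simp add: M_def e_def mult_ac)
    with B(1) show ?case by blast
  qed
qed

text \<open>This part is too singular for absolute convergence at \<open>x\<close> when
  \<open>s\<close> is large. It is integrated only away from \<open>x\<close>, over symmetric sets,
  where it cancels.\<close>

lemma paraboloid_linear_part:
  fixes x P :: "real^'n"
  assumes S: "S \<in> sets lebesgue" "S \<subseteq> {y. \<epsilon> \<le> norm (x - y) \<and> norm (x - y) < \<rho>}" and \<epsilon>: "\<epsilon> > 0"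
    and sym: "\<And>z. x + z \<in> S \<longleftrightarrow> x - z \<in> S"
  shows "set_integrable lebesgue S (\<lambda>y. spow p (- (P \<bullet> (y - x))) * norm (x - y) powr (- q))"
    and "(LINT y:S|lebesgue. spow p (- (P \<bullet> (y - x))) * norm (x - y) powr (- q)) = 0"
proof -
  let ?o = "\<lambda>y. spow p (- (P \<bullet> (y - x))) * norm (x - y) powr (- q)"
  have meas: "?o \<in> borel_measurable lebesgue"
    by (rule measurable_completion) measurable
  have "set_integrable lebesgue {y. \<epsilon> \<le> norm (x - y)} (\<lambda>y. norm (x - y) powr (- (real CARD('n) + s * p)))"
    using radial_outer_at[OF sp(1)] \<epsilon> by blast
  then have gi: "set_integrable lebesgue {y. \<epsilon> \<le> norm (x - y)} (\<lambda>y. (norm P * \<rho>) powr (p - 1) * norm (x - y) powr (- q))"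
    by (intro set_integrable_mult_right) (simp add: q)
  show "set_integrable lebesgue S ?o"
  proof (rule set_integrable_bounded_by(1)[OF gi meas S(1)])
    show "S \<subseteq> {y. \<epsilon> \<le> norm (x - y)}" using S by auto
    fix y assume "y \<in> S"
    then have "norm (x - y) \<le> \<rho>" using S by auto
    then have "\<bar>P \<bullet> (y - x)\<bar> \<le> norm P * \<rho>"
      using Cauchy_Schwarz_ineq2[of P "y - x"] mult_left_mono[of "norm (x - y)" \<rho> "norm P"]
      by (simp add: norm_minus_commute)
    then have "\<bar>P \<bullet> (y - x)\<bar> powr (p - 1) \<le> (norm P * \<rho>) powr (p - 1)" using p by (intro powr_mono2) auto
    then show "\<bar>?o y\<bar> \<le> (norm P * \<rho>) powr (p - 1) * norm (x - y) powr (- q)"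
      by (simp add: abs_mult abs_spow mult_right_mono)
  qed
  show "(LINT y:S|lebesgue. ?o y) = 0"
  proof (rule set_integral_odd[where x = x])
    show "(\<lambda>y. indicator S y * ?o y) \<in> borel_measurable lebesgue"
      by (rule borel_measurable_times[OF borel_measurable_indicator[OF S(1)] meas])
    show "?o (x + z) = - ?o (x - z)" for z
    proof -
      have 1: "x + z - x = z" "x - z - x = - z" "x - (x + z) = - z" "x - (x - z) = z" by auto
      show ?thesis unfolding 1 by (simp only: inner_minus_right spow_minus minus_minus norm_minus_cancel mult_minus_left)
    qed
  qed (rule sym)
qed

text \<open>Two radii occur because the viscosity definition replaces \<open>u\<close> only inside a
  small cylinder (radius \<open>r\<close>), while the estimate needs the scale
  \<open>\<rho>\<close>. Between them \<open>w\<close> lies below the paraboloid, so monotonicity of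
  \<open>spow\<close> allows the replacement there too; the error no longer sees
  \<open>r\<close>.\<close>

lemma frac_plap_paraboloid:
  "\<exists>C>0. \<forall>(x::real^'n) w P Q r \<rho>. 0 < r \<longrightarrow> r \<le> \<rho> \<longrightarrow> 0 \<le> Q \<longrightarrow> tail_ok w \<longrightarrow>
     (\<forall>y. norm (x - y) < r \<longrightarrow> w y = w x + P \<bullet> (y - x) + Q * (norm (x - y))\<^sup>2) \<longrightarrow>
     (\<forall>y. norm (x - y) < \<rho> \<longrightarrow> w y \<le> w x + P \<bullet> (y - x) + Q * (norm (x - y))\<^sup>2) \<longrightarrow>
     (\<exists>v. ((\<lambda>\<epsilon>. ext_integral {y. \<epsilon> < norm (x - y)} (frac_kernel p s w x)) \<longlongrightarrow> ereal v) (at_right 0) \<and>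
        (LINT y:{y. \<rho> \<le> norm (x - y)}|lebesgue. frac_kernel p s w x y)
          - C * (norm P + Q * \<rho>) powr (p - 2) * Q * \<rho> powr (p - s * p) \<le> v)"
proof -
  show ?thesis
  proof (rule paraboloid_kernel_bounds, goal_cases)
    case (1 C)
    note C = 1(1) and Cb = 1(2)
    show ?case
      proof (rule exI[of _ C], intro conjI allI impI C)
        fix x P :: "real^'n" and w Q r \<rho>
        assume r: "0 < r" "r \<le> \<rho>" and Q: "0 \<le> (Q::real)" and w: "tail_ok w"
          and eq: "\<forall>y. norm (x - y) < r \<longrightarrow> w y = w x + P \<bullet> (y - x) + Q * (norm (x - y))\<^sup>2"
          and le: "\<forall>y. norm (x - y) < \<rho> \<longrightarrow> w y \<le> w x + P \<bullet> (y - x) + Q * (norm (x - y))\<^sup>2"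
        have \<rho>: "\<rho> > 0" using r by simp
        define f where "f = frac_kernel p s w x"
        define g where "g = (\<lambda>y. (spow p (- (P \<bullet> (y - x)) - Q * (norm (x - y))\<^sup>2) - spow p (- (P \<bullet> (y - x)))) * norm (x - y) powr (- q))"
        define o' where "o' = (\<lambda>y. spow p (- (P \<bullet> (y - x))) * norm (x - y) powr (- q))"
        define K where "K = C * (norm P + Q * \<rho>) powr (p - 2) * Q"
        have K: "K \<ge> 0" using C Q by (simp add: K_def)
        have gb: "set_integrable lebesgue S g" "\<bar>LINT y:S|lebesgue. g y\<bar> \<le> K * R powr (p - s * p)"
          if "S \<in> sets lebesgue" "0 < R" "R \<le> \<rho>" "S \<subseteq> {y. norm (x - y) < R}" for S R
          using Cb[OF \<rho> Q that(1-4), of P] by (auto simp: g_def K_def)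
        have go: "set_integrable lebesgue S (\<lambda>y. g y + o' y)" "(LINT y:S|lebesgue. g y + o' y) = (LINT y:S|lebesgue. g y)"
          if S: "S \<in> sets lebesgue" "S \<subseteq> {y. \<epsilon> \<le> norm (x - y) \<and> norm (x - y) < \<rho>}" and \<epsilon>: "\<epsilon> > 0"
            and sym: "\<And>z. x + z \<in> S \<longleftrightarrow> x - z \<in> S" for S \<epsilon>
        proof -
          have 1: "set_integrable lebesgue S g" using S \<rho> by (intro gb(1)[of _ \<rho>]) auto
          note 2 = paraboloid_linear_part[OF S \<epsilon> sym, of P, folded o'_def]
          show "set_integrable lebesgue S (\<lambda>y. g y + o' y)" using 1 2(1) by (rule set_integral_add(1))
          show "(LINT y:S|lebesgue. g y + o' y) = (LINT y:S|lebesgue. g y)"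
            using set_integral_add(2)[OF 1 2(1)] 2(2) by simp
        qed
        have gosum: "g y + o' y = spow p (- (P \<bullet> (y - x)) - Q * (norm (x - y))\<^sup>2) * norm (x - y) powr (- q)" for y
          by (simp add: g_def o'_def algebra_simps)
        have fi: "set_integrable lebesgue {y. \<epsilon> \<le> norm (x - y)} f" if "\<epsilon> > 0" for \<epsilon>
          using frac_kernel_integrable[OF w that] by (simp add: f_def)
        \<comment> \<open>The principal value: inside radius \<open>r\<close> only the absolutely
          convergent second-order part \<open>g\<close> survives, since the linear part cancels over
          every ring.\<close>
        define v where "v = (LINT y:{y. r \<le> norm (x - y)}|lebesgue. f y) + (LINT y:{y. norm (x - y) < r}|lebesgue. g y)"
        have ev: "ext_integral {y. \<epsilon> < norm (x - y)} f = ereal (v - (LINT y:{y. norm (x - y) \<le> \<epsilon>}|lebesgue. g y))"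
          if \<epsilon>: "0 < \<epsilon>" "\<epsilon> < r" for \<epsilon>
        proof -
          let ?A = "{y. \<epsilon> < norm (x - y)} \<inter> {y. norm (x - y) < r}"
          have A: "?A \<in> sets lebesgue" by (intro sets.Int lebesgue_norm_sets)
          have i1: "set_integrable lebesgue {y. \<epsilon> < norm (x - y)} f"
            by (rule set_integrable_subset[OF fi[OF \<epsilon>(1)]]) (auto intro: lebesgue_norm_sets)
          have iA: "set_integrable lebesgue ?A f"
            by (rule set_integrable_subset[OF i1 A]) auto
          have U: "{y. r \<le> norm (x - y)} \<union> ?A = {y. \<epsilon> < norm (x - y)}" and d: "{y. r \<le> norm (x - y)} \<inter> ?A = {}"
            using \<epsilon> by auto
          have "(LINT y:{y. \<epsilon> < norm (x - y)}|lebesgue. f y)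
              = (LINT y:{y. r \<le> norm (x - y)}|lebesgue. f y) + (LINT y:?A|lebesgue. f y)"
            using set_integral_Un[OF d fi[OF r(1)] iA] unfolding U .
          also have "(LINT y:?A|lebesgue. f y) = (LINT y:?A|lebesgue. g y + o' y)"
          proof (rule set_lebesgue_integral_cong[OF A], intro allI impI)
            fix y assume "y \<in> ?A"
            then have "w x - w y = - (P \<bullet> (y - x)) - Q * (norm (x - y))\<^sup>2" using eq by auto
            then show "f y = g y + o' y" by (simp only: f_def frac_kernel_eq gosum)
          qed
          also have "\<dots> = (LINT y:?A|lebesgue. g y)"
            by (rule go(2)[OF A _ \<epsilon>(1)]) (use \<epsilon> r in auto)
          also have "\<dots> = (LINT y:{y. norm (x - y) < r}|lebesgue. g y) - (LINT y:{y. norm (x - y) \<le> \<epsilon>}|lebesgue. g y)"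
          proof -
            have "?A \<union> {y. norm (x - y) \<le> \<epsilon>} = {y. norm (x - y) < r}" "?A \<inter> {y. norm (x - y) \<le> \<epsilon>} = {}" using \<epsilon> by auto
            moreover have "set_integrable lebesgue ?A g" using A r \<rho> by (intro gb(1)[of _ \<rho>]) auto
            moreover have "set_integrable lebesgue {y. norm (x - y) \<le> \<epsilon>} g"
              using r \<rho> \<epsilon> by (intro gb(1)[of _ \<rho>]) (auto intro: lebesgue_norm_sets)
            ultimately have "(LINT y:{y. norm (x - y) < r}|lebesgue. g y) = (LINT y:?A|lebesgue. g y) + (LINT y:{y. norm (x - y) \<le> \<epsilon>}|lebesgue. g y)"
              using set_integral_Un[of ?A "{y. norm (x - y) \<le> \<epsilon>}" lebesgue g] by simp
            then show ?thesis by simp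
          qed
          finally show ?thesis using ext_integral_eq[OF i1] by (simp add: v_def)
        qed
        \<comment> \<open>The bound holds for open balls, so the closed ball of radius
          \<open>\<epsilon>\<close> is placed in the open one of radius
          \<open>2 * \<epsilon>\<close>.\<close>
        have lim0: "((\<lambda>\<epsilon>. LINT y:{y. norm (x - y) \<le> \<epsilon>}|lebesgue. g y) \<longlongrightarrow> 0) (at_right 0)"
        proof (rule Lim_null_comparison)
          show "\<forall>\<^sub>F \<epsilon> in at_right 0. norm (LINT y:{y. norm (x - y) \<le> \<epsilon>}|lebesgue. g y) \<le> K * (2 * \<epsilon>) powr (p - s * p)"
            unfolding eventually_at_right_field
          proof (intro exI[of _ "\<rho> / 2"] conjI allI impI)
            fix \<epsilon> :: real assume "\<epsilon> > 0" "\<epsilon> < \<rho> / 2"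
            then show "norm (LINT y:{y. norm (x - y) \<le> \<epsilon>}|lebesgue. g y) \<le> K * (2 * \<epsilon>) powr (p - s * p)"
              unfolding real_norm_def by (intro gb(2)) (auto intro: lebesgue_norm_sets)
          qed (use \<rho> in simp)
          have "((\<lambda>\<epsilon>. K * (2 * \<epsilon>) powr (p - s * p)) \<longlongrightarrow> K * (2 * 0) powr (p - s * p)) (at_right 0)"
            using sp by (intro tendsto_intros tendsto_powr') (auto simp: eventually_at_right_field intro!: exI[of _ 1])
          then show "((\<lambda>\<epsilon>. K * (2 * \<epsilon>) powr (p - s * p)) \<longlongrightarrow> 0) (at_right 0)" using sp by simp
        qed
        have "((\<lambda>\<epsilon>. ereal (v - (LINT y:{y. norm (x - y) \<le> \<epsilon>}|lebesgue. g y))) \<longlongrightarrow> ereal (v - 0)) (at_right 0)"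
          by (intro tendsto_intros lim0)
        moreover have "\<forall>\<^sub>F \<epsilon> in at_right 0. ereal (v - (LINT y:{y. norm (x - y) \<le> \<epsilon>}|lebesgue. g y)) = ext_integral {y. \<epsilon> < norm (x - y)} f"
          unfolding eventually_at_right_field using ev r by (intro exI[of _ r]) auto
        ultimately have lim: "((\<lambda>\<epsilon>. ext_integral {y. \<epsilon> < norm (x - y)} f) \<longlongrightarrow> ereal v) (at_right 0)"
          using Lim_transform_eventually by fastforce
        have "(LINT y:{y. \<rho> \<le> norm (x - y)}|lebesgue. f y) - K * \<rho> powr (p - s * p) \<le> v"
        proof -
          let ?A = "{y. r \<le> norm (x - y)} \<inter> {y. norm (x - y) < \<rho>}"
          have A: "?A \<in> sets lebesgue" by (intro sets.Int lebesgue_norm_sets)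
          have iA: "set_integrable lebesgue ?A f"
            by (rule set_integrable_subset[OF fi[OF r(1)] A]) auto
          have U: "{y. \<rho> \<le> norm (x - y)} \<union> ?A = {y. r \<le> norm (x - y)}" and d: "{y. \<rho> \<le> norm (x - y)} \<inter> ?A = {}"
            using r by auto
          have "(LINT y:{y. r \<le> norm (x - y)}|lebesgue. f y)
              = (LINT y:{y. \<rho> \<le> norm (x - y)}|lebesgue. f y) + (LINT y:?A|lebesgue. f y)"
            using set_integral_Un[OF d fi[OF \<rho>] iA] unfolding U .
          \<comment> \<open>The one inequality of the proof: lowering \<open>w\<close> raises
            \<open>w x - w y\<close>, hence the kernel.\<close>
          moreover have "(LINT y:?A|lebesgue. g y + o' y) \<le> (LINT y:?A|lebesgue. f y)"
          proof (rule LINT_mono_set[OF _ iA])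
            show "set_integrable lebesgue ?A (\<lambda>y. g y + o' y)" by (rule go(1)[OF A _ r(1)]) auto
            fix y assume "y \<in> ?A"
            then have "- (P \<bullet> (y - x)) - Q * (norm (x - y))\<^sup>2 \<le> w x - w y" using le by auto
            then show "g y + o' y \<le> f y" unfolding f_def frac_kernel_eq gosum
              by (intro mult_right_mono spow_mono[OF p]) auto
          qed
          moreover have "(LINT y:?A|lebesgue. g y + o' y) = (LINT y:?A|lebesgue. g y)"
            by (rule go(2)[OF A _ r(1)]) auto
          moreover have "(LINT y:{y. norm (x - y) < \<rho>}|lebesgue. g y) = (LINT y:?A|lebesgue. g y) + (LINT y:{y. norm (x - y) < r}|lebesgue. g y)"
          proof -
            have "?A \<union> {y. norm (x - y) < r} = {y. norm (x - y) < \<rho>}" "?A \<inter> {y. norm (x - y) < r} = {}" using r by auto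
            moreover have "set_integrable lebesgue ?A g" using A r \<rho> by (intro gb(1)[of _ \<rho>]) auto
            moreover have "set_integrable lebesgue {y. norm (x - y) < r} g"
              using r \<rho> by (intro gb(1)[of _ \<rho>]) (auto intro: lebesgue_norm_sets)
            ultimately show ?thesis
              using set_integral_Un[of ?A "{y. norm (x - y) < r}" lebesgue g] by simp
          qed
          moreover have "\<bar>LINT y:{y. norm (x - y) < \<rho>}|lebesgue. g y\<bar> \<le> K * \<rho> powr (p - s * p)"
            using \<rho> by (intro gb(2)) (auto intro: lebesgue_norm_sets)
          ultimately show ?thesis by (simp add: v_def)
        qed
        with lim show "\<exists>v. ((\<lambda>\<epsilon>. ext_integral {y. \<epsilon> < norm (x - y)} (frac_kernel p s w x)) \<longlongrightarrow> ereal v) (at_right 0) \<and>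
            (LINT y:{y. \<rho> \<le> norm (x - y)}|lebesgue. frac_kernel p s w x y)
              - C * (norm P + Q * \<rho>) powr (p - 2) * Q * \<rho> powr (p - s * p) \<le> v"
          by (auto simp: f_def K_def)
      qed
  qed
qed

end

subsection \<open>Viscosity inequalities for paraboloids\<close>

text \<open>The factor \<open>\<beta>\<close> is needed because the time-dependent weight multiplies
  the whole spatial modulus. \<open>Q\<close> may have either sign, so touching from above and from
  below are both covered.\<close>

lemma C21_on_paraboloid:
  fixes P x0 :: "real ^ 'n"
  assumes d: "\<And>t. t \<in> I \<Longrightarrow> (\<alpha> has_real_derivative \<alpha>' t) (at t)" "\<And>t. t \<in> I \<Longrightarrow> (\<beta> has_real_derivative \<beta>' t) (at t)"
    and c: "continuous_on I \<alpha>'" "continuous_on I \<beta>'" and sub: "S \<subseteq> UNIV \<times> I"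
  shows "C21_on S (\<lambda>z. \<alpha> (snd z) + \<beta> (snd z) * (P \<bullet> (fst z - x0) + Q * (norm (x0 - fst z))\<^sup>2))"
  unfolding C21_on_def
proof (intro exI conjI)
  let ?\<phi> = "\<lambda>z. \<alpha> (snd z) + \<beta> (snd z) * (P \<bullet> (fst z - x0) + Q * (norm (x0 - fst z))\<^sup>2)"
  let ?g = "\<lambda>z. \<beta> (snd z) *\<^sub>R (P + (2 * Q) *\<^sub>R (fst z - x0))"
  let ?H = "\<lambda>z. (\<beta> (snd z) * (2 * Q)) *\<^sub>R (mat 1 :: real ^ 'n ^ 'n)"
  let ?T = "\<lambda>z. \<alpha>' (snd z) + \<beta>' (snd z) * (P \<bullet> (fst z - x0) + Q * (norm (x0 - fst z))\<^sup>2)"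
  have cI: "continuous_on S (\<lambda>z. f (snd z))" if "continuous_on I f" for f :: "real \<Rightarrow> real"
    by (rule continuous_on_compose2[OF that continuous_on_snd[OF continuous_on_id]]) (use sub in auto)
  have c\<alpha>: "continuous_on I \<alpha>" "continuous_on I \<beta>"
    using d by (auto intro!: continuous_at_imp_continuous_on DERIV_isCont)
  note cc = cI[OF c\<alpha>(1)] cI[OF c\<alpha>(2)] cI[OF c(1)] cI[OF c(2)]
  show "continuous_on S ?\<phi>" "continuous_on S ?g" "continuous_on S ?H" "continuous_on S ?T"
    by (intro continuous_intros cc)+
  show "\<forall>(x, t)\<in>S. ((\<lambda>y. ?\<phi> (y, t)) has_derivative (\<lambda>h. ?g (x, t) \<bullet> h)) (at x) \<and>
           ((\<lambda>y. ?g (y, t)) has_derivative (\<lambda>h. ?H (x, t) *v h)) (at x) \<and>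
           ((\<lambda>\<tau>. ?\<phi> (x, \<tau>)) has_real_derivative ?T (x, t)) (at t within {\<tau>. (x, \<tau>) \<in> S})"
  proof (clarify, intro conjI)
    fix x t assume xt: "(x, t) \<in> S"
    then have t: "t \<in> I" using sub by auto
    show "((\<lambda>y. ?\<phi> (y, t)) has_derivative (\<lambda>h. ?g (x, t) \<bullet> h)) (at x)"
      unfolding power2_norm_eq_inner
      by (rule derivative_eq_intros refl | simp add: fun_eq_iff inner_add inner_diff inner_commute algebra_simps)+
    show "((\<lambda>y. ?g (y, t)) has_derivative (\<lambda>h. ?H (x, t) *v h)) (at x)"
      by (rule derivative_eq_intros refl | simp add: fun_eq_iff scaleR_matrix_vector_assoc[symmetric])+
    show "((\<lambda>\<tau>. ?\<phi> (x, \<tau>)) has_real_derivative ?T (x, t)) (at t within {\<tau>. (x, \<tau>) \<in> S})"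
      using DERIV_add[OF d(1)[OF t] DERIV_cmult_right[OF d(2)[OF t], of "P \<bullet> (x - x0) + Q * (norm (x0 - x))\<^sup>2"]]
      by (auto intro: has_field_derivative_at_within)
  qed
qed

context frac_params
begin

text \<open>
  Used with \<open>v = u\<close>, \<open>E\<close> the set where \<open>u\<close> is above the obstacle, and with \<open>v = - u\<close>, \<open>E\<close> everything.
  The cylinder on which the test function touches may be much smaller than the ball of radius \<open>\<rho>\<close>
  on which it touches at the time \<open>t0\<close>; the error depends on \<open>\<rho>\<close> only.
\<close>

definition visc_ineq :: "real \<Rightarrow> ((real ^ 'n) \<times> real \<Rightarrow> bool) \<Rightarrow> ((real ^ 'n) \<times> real \<Rightarrow> real) \<Rightarrow> bool" where
  "visc_ineq C E v \<longleftrightarrow> (\<forall>x0 t0 r \<rho> P Q \<alpha> \<alpha>' \<beta> \<beta>'. 0 < r \<longrightarrow> r \<le> \<rho> \<longrightarrow> 0 \<le> Q \<longrightarrow>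
     par_cyl r x0 t0 \<subseteq> par_cyl 1 0 0 \<longrightarrow> E (x0, t0) \<longrightarrow>
     (\<forall>t\<in>{t0 - r\<^sup>2<..t0}. (\<alpha> has_real_derivative \<alpha>' t) (at t) \<and> (\<beta> has_real_derivative \<beta>' t) (at t)) \<longrightarrow>
     continuous_on {t0 - r\<^sup>2<..t0} \<alpha>' \<longrightarrow> continuous_on {t0 - r\<^sup>2<..t0} \<beta>' \<longrightarrow>
     \<alpha> t0 = v (x0, t0) \<longrightarrow> \<beta> t0 = 1 \<longrightarrow>
     (\<forall>x t. (x, t) \<in> par_cyl r x0 t0 \<longrightarrow> v (x, t) \<le> \<alpha> t + \<beta> t * (P \<bullet> (x - x0) + Q * (norm (x0 - x))\<^sup>2)) \<longrightarrow>
     (\<forall>x. norm (x0 - x) < \<rho> \<longrightarrow> v (x, t0) \<le> v (x0, t0) + P \<bullet> (x - x0) + Q * (norm (x0 - x))\<^sup>2) \<longrightarrow>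
     \<alpha>' t0 + (LINT y:{y. \<rho> \<le> norm (x0 - y)}|lebesgue. frac_kernel p s (\<lambda>y. v (y, t0)) x0 y)
       \<le> C * (norm P + Q * \<rho>) powr (p - 2) * Q * \<rho> powr (p - s * p))"

lemma tail_ok_patch:
  assumes U: "tail_ok U"
  shows "tail_ok (\<lambda>y. if norm (x - y) < r then c + (P \<bullet> (y - x) + Q * (norm (x - y))\<^sup>2) else U y)"
proof -
  let ?w = "\<lambda>y. if norm (x - y) < r then c + (P \<bullet> (y - x) + Q * (norm (x - y))\<^sup>2) else U y"
  define B where "B = \<bar>c\<bar> + (norm P * \<bar>r\<bar> + \<bar>Q\<bar> * r\<^sup>2)"
  have m1: "(\<lambda>y. c + (P \<bullet> (y - x) + Q * (norm (x - y))\<^sup>2)) \<in> borel_measurable lebesgue"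
    by (rule measurable_completion) measurable
  have m: "?w \<in> borel_measurable lebesgue"
    by (rule measurable_If[OF m1 tail_ok_measurable[OF U]]) (use lebesgue_norm_sets(2)[of x r] in simp)
  have i: "integrable lebesgue (\<lambda>y. B powr (p - 1) * tailw y + \<bar>U y\<bar> powr (p - 1) * tailw y)"
    using U integrable_tailw by (simp add: tail_ok_def)
  have "integrable lebesgue (\<lambda>y. \<bar>?w y\<bar> powr (p - 1) * tailw y)"
  proof (rule Bochner_Integration.integrable_bound[OF i])
    have "tailw \<in> borel_measurable lebesgue" using integrable_tailw by auto
    then show "(\<lambda>y. \<bar>?w y\<bar> powr (p - 1) * tailw y) \<in> borel_measurable lebesgue"
      using m by measurable
    show "AE y in lebesgue. norm (\<bar>?w y\<bar> powr (p - 1) * tailw y)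
        \<le> norm (B powr (p - 1) * tailw y + \<bar>U y\<bar> powr (p - 1) * tailw y)"
    proof (rule AE_I2)
      fix y
      have "\<bar>?w y\<bar> powr (p - 1) \<le> B powr (p - 1) + \<bar>U y\<bar> powr (p - 1)"
      proof (cases "norm (x - y) < r")
        case True
        have "\<bar>P \<bullet> (y - x)\<bar> \<le> norm P * \<bar>r\<bar>"
        proof -
          have "norm (x - y) \<le> \<bar>r\<bar>" using True by linarith
          then show ?thesis
            using Cauchy_Schwarz_ineq2[of P "y - x"] mult_left_mono[of "norm (x - y)" "\<bar>r\<bar>" "norm P"]
            by (simp add: norm_minus_commute)
        qed
        moreover have "\<bar>Q * (norm (x - y))\<^sup>2\<bar> \<le> \<bar>Q\<bar> * r\<^sup>2"
          using True by (auto simp: abs_mult intro!: mult_left_mono power_mono)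
        ultimately have "\<bar>c + (P \<bullet> (y - x) + Q * (norm (x - y))\<^sup>2)\<bar> \<le> B" unfolding B_def by linarith
        then have "\<bar>c + (P \<bullet> (y - x) + Q * (norm (x - y))\<^sup>2)\<bar> powr (p - 1) \<le> B powr (p - 1)"
          using p by (intro powr_mono2) auto
        moreover have "0 \<le> \<bar>U y\<bar> powr (p - 1)" by simp
        ultimately show ?thesis unfolding if_P[OF True] by linarith
      qed simp
      then have "\<bar>?w y\<bar> powr (p - 1) * tailw y \<le> (B powr (p - 1) + \<bar>U y\<bar> powr (p - 1)) * tailw y"
        using tailw_pos[of y] by (intro mult_right_mono) auto
      moreover have "0 \<le> \<bar>?w y\<bar> powr (p - 1) * tailw y" using tailw_pos[of y] by simp
      ultimately show "norm (\<bar>?w y\<bar> powr (p - 1) * tailw y)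
        \<le> norm (B powr (p - 1) * tailw y + \<bar>U y\<bar> powr (p - 1) * tailw y)"
        unfolding real_norm_def by (simp only: distrib_right)
    qed
  qed
  with m show ?thesis by (simp add: tail_ok_def)
qed

lemma time_deriv_eq:
  assumes "((\<lambda>\<tau>. \<phi> (x, \<tau>)) has_real_derivative D) (at t)"
  shows "time_deriv \<phi> x t = D"
  unfolding time_deriv_def
proof (rule vector_derivative_within)
  \<comment> \<open>A one-sided derivative is unique only because its filter is nontrivial; it
    contains the left neighbourhoods of \<open>t\<close>.\<close>
  have "at_left t \<le> at t within {..t}" by (rule at_le) auto
  then show "at t within {..t} \<noteq> bot" using trivial_limit_at_left_real[of t] bot.extremum_uniqueI by fastforce
  show "((\<lambda>\<tau>. \<phi> (x, \<tau>)) has_vector_derivative D) (at t within {..t})"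
    using has_field_derivative_at_within[OF assms] by (simp add: has_real_derivative_iff_has_vector_derivative)
qed

lemma frac_kernel_minus: "frac_kernel p s (\<lambda>y. - w y) x y = - frac_kernel p s w (x::real^'n) y"
proof -
  have "- w x - - w y = - (w x - w y)" by simp
  then show ?thesis by (simp only: frac_kernel_eq spow_minus mult_minus_left)
qed

lemma ext_integral_kernel_minus:
  assumes "tail_ok w" "\<epsilon> > 0"
  shows "ext_integral {y. \<epsilon> < norm (x - y)} (frac_kernel p s (\<lambda>y. - w y) x) = - ext_integral {y. \<epsilon> < norm (x - y)} (frac_kernel p s w x)"
proof -
  have i: "set_integrable lebesgue {y. \<epsilon> < norm (x - y)} (frac_kernel p s w x)"
    by (rule set_integrable_subset[OF frac_kernel_integrable[OF assms]]) (auto intro: lebesgue_norm_sets)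
  then have "set_integrable lebesgue {y. \<epsilon> < norm (x - y)} (\<lambda>y. - frac_kernel p s w x y)"
    by (simp add: set_integrable_def)
  then show ?thesis using i by (simp add: frac_kernel_minus[abs_def] ext_integral_eq set_lebesgue_integral_def)
qed

text \<open>A nonpositive minimum gives the equation only where its first entry is positive, that is
  where \<open>u\<close> is above the obstacle. A nonnegative minimum gives both entries, so the
  supersolution side holds everywhere. With \<open>- u\<close> in the second case both inequalities
  have one form and one constant, independent of \<open>u\<close> and of the obstacle.\<close>

lemma visc_ineq_exists:
  "\<exists>C>0. \<forall>\<psi> u. (\<forall>t\<in>{-1<..0}. tail_ok (\<lambda>x. u (x, t))) \<longrightarrow>
     (visc_subsol p s (ball 0 1) (-1) 0 \<psi> u \<longrightarrow> visc_ineq C (\<lambda>z. \<psi> z < u z) u) \<and>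
     (visc_supersol p s (ball 0 1) (-1) 0 \<psi> u \<longrightarrow> visc_ineq C (\<lambda>z. True) (\<lambda>z. - u z))"
proof -
  have cyl1: "par_cyl 1 0 0 = ball (0::real^'n) 1 \<times> {-1<..0}" by (simp add: par_cyl_def)
  show ?thesis
    using frac_plap_paraboloid
  proof (elim exE conjE, goal_cases)
    case (1 C)
    note C = 1(1) and PV = 1(2)[rule_format]
    show ?case
    proof (rule exI[of _ C], intro conjI allI impI C)
      fix \<psi> u :: "(real ^ 'n) \<times> real \<Rightarrow> real"
      assume T: "\<forall>t\<in>{-1<..0}. tail_ok (\<lambda>x. u (x, t))" and sub: "visc_subsol p s (ball 0 1) (-1) 0 \<psi> u"
      show "visc_ineq C (\<lambda>z. \<psi> z < u z) u"
        unfolding visc_ineq_def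
      proof (intro allI impI)
        fix x0 P :: "real^'n" and t0 r \<rho> Q \<alpha> \<alpha>' \<beta> \<beta>'
        assume r: "0 < r" "r \<le> \<rho>" and Q: "0 \<le> (Q::real)" and cyl: "par_cyl r x0 t0 \<subseteq> par_cyl 1 0 0"
          and E: "\<psi> (x0, t0) < u (x0, t0)"
          and d: "\<forall>t\<in>{t0 - r\<^sup>2<..t0}. (\<alpha> has_real_derivative \<alpha>' t) (at t) \<and> (\<beta> has_real_derivative \<beta>' t) (at t)"
          and c: "continuous_on {t0 - r\<^sup>2<..t0} \<alpha>'" "continuous_on {t0 - r\<^sup>2<..t0} \<beta>'"
          and a0: "\<alpha> t0 = u (x0, t0)" and b0: "\<beta> t0 = 1"
          and le: "\<forall>x t. (x, t) \<in> par_cyl r x0 t0 \<longrightarrow> u (x, t) \<le> \<alpha> t + \<beta> t * (P \<bullet> (x - x0) + Q * (norm (x0 - x))\<^sup>2)"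
          and le0: "\<forall>x. norm (x0 - x) < \<rho> \<longrightarrow> u (x, t0) \<le> u (x0, t0) + P \<bullet> (x - x0) + Q * (norm (x0 - x))\<^sup>2"
        define \<phi> where "\<phi> = (\<lambda>z. \<alpha> (snd z) + \<beta> (snd z) * (P \<bullet> (fst z - x0) + Q * (norm (x0 - fst z))\<^sup>2))"
        define w where "w = (\<lambda>y. glue (par_cyl r x0 t0) \<phi> u (y, t0))"
        have in0: "(x0, t0) \<in> par_cyl r x0 t0" using r by (simp add: par_cyl_def)
        then have t0: "t0 \<in> {-1<..0}" using cyl cyl1 by auto
        have w: "w = (\<lambda>y. if norm (x0 - y) < r then u (x0, t0) + (P \<bullet> (y - x0) + Q * (norm (x0 - y))\<^sup>2) else u (y, t0))"
          using r by (auto simp: w_def glue_def par_cyl_def dist_norm \<phi>_def a0 b0 fun_eq_iff)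
        have wx: "w x0 = u (x0, t0)" using r by (simp add: w)
        have tw: "tail_ok w" unfolding w using tail_ok_patch[OF T[rule_format, OF t0], of x0 r "u (x0, t0)" P Q] by simp
        have weq: "w y = w x0 + P \<bullet> (y - x0) + Q * (norm (x0 - y))\<^sup>2" if "norm (x0 - y) < r" for y
          using wx that by (simp add: w)
        have wle: "w y \<le> w x0 + P \<bullet> (y - x0) + Q * (norm (x0 - y))\<^sup>2" if "norm (x0 - y) < \<rho>" for y
          using wx le0 that by (simp add: w)
        obtain v where v: "((\<lambda>\<epsilon>. ext_integral {y. \<epsilon> < norm (x0 - y)} (frac_kernel p s w x0)) \<longlongrightarrow> ereal v) (at_right 0)"
          "(LINT y:{y. \<rho> \<le> norm (x0 - y)}|lebesgue. frac_kernel p s w x0 y)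
            - C * (norm P + Q * \<rho>) powr (p - 2) * Q * \<rho> powr (p - s * p) \<le> v"
          using PV[OF r Q tw weq wle] by blast
        have fp: "frac_plap p s w x0 = ereal v"
          unfolding frac_plap_def by (rule tendsto_Lim[OF _ v(1)]) simp
        have "C21_on (par_cyl r x0 t0) \<phi>"
          unfolding \<phi>_def by (rule C21_on_paraboloid[where I = "{t0 - r\<^sup>2<..t0}" and \<alpha>' = \<alpha>' and \<beta>' = \<beta>']) (use d c in \<open>auto simp: par_cyl_def\<close>)
        moreover have "\<forall>z\<in>par_cyl r x0 t0. u z \<le> \<phi> z" using le by (auto simp: \<phi>_def)
        moreover have "\<phi> (x0, t0) = u (x0, t0)" by (simp add: \<phi>_def a0)
        ultimately have "obstacle_op p s \<psi> u \<phi> r x0 t0 \<le> 0"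
          using sub r(1) cyl unfolding visc_subsol_def cyl1 by blast
        moreover have "time_deriv \<phi> x0 t0 = \<alpha>' t0"
          by (rule time_deriv_eq) (use d r in \<open>simp add: \<phi>_def\<close>)
        \<comment> \<open>\<open>E\<close> rules out that the minimum is attained by the obstacle
          entry.\<close>
        ultimately have "\<alpha>' t0 + v \<le> 0"
          using E by (auto simp: obstacle_op_def w_def[symmetric] fp min_le_iff_disj zero_ereal_def)
        moreover have "(LINT y:{y. \<rho> \<le> norm (x0 - y)}|lebesgue. frac_kernel p s w x0 y)
           = (LINT y:{y. \<rho> \<le> norm (x0 - y)}|lebesgue. frac_kernel p s (\<lambda>y. u (y, t0)) x0 y)"
        proof (rule set_lebesgue_integral_cong[OF lebesgue_norm_sets(1)], intro allI impI)
          fix y assume "y \<in> {y. \<rho> \<le> norm (x0 - y)}"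
          then show "frac_kernel p s w x0 y = frac_kernel p s (\<lambda>y. u (y, t0)) x0 y"
            using r by (simp add: frac_kernel_def wx) (simp add: w)
        qed
        ultimately show "\<alpha>' t0 + (LINT y:{y. \<rho> \<le> norm (x0 - y)}|lebesgue. frac_kernel p s (\<lambda>y. u (y, t0)) x0 y)
         \<le> C * (norm P + Q * \<rho>) powr (p - 2) * Q * \<rho> powr (p - s * p)" using v(2) by linarith
      qed
    next
      fix \<psi> u :: "(real ^ 'n) \<times> real \<Rightarrow> real"
      assume T: "\<forall>t\<in>{-1<..0}. tail_ok (\<lambda>x. u (x, t))" and super: "visc_supersol p s (ball 0 1) (-1) 0 \<psi> u"
      show "visc_ineq C (\<lambda>z. True) (\<lambda>z. - u z)"
        unfolding visc_ineq_def
      proof (intro allI impI)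
        fix x0 P :: "real^'n" and t0 r \<rho> Q \<alpha> \<alpha>' \<beta> \<beta>'
        assume r: "0 < r" "r \<le> \<rho>" and Q: "0 \<le> (Q::real)" and cyl: "par_cyl r x0 t0 \<subseteq> par_cyl 1 0 0"
          and d: "\<forall>t\<in>{t0 - r\<^sup>2<..t0}. (\<alpha> has_real_derivative \<alpha>' t) (at t) \<and> (\<beta> has_real_derivative \<beta>' t) (at t)"
          and c: "continuous_on {t0 - r\<^sup>2<..t0} \<alpha>'" "continuous_on {t0 - r\<^sup>2<..t0} \<beta>'"
          and a0: "\<alpha> t0 = - u (x0, t0)" and b0: "\<beta> t0 = 1"
          and le: "\<forall>x t. (x, t) \<in> par_cyl r x0 t0 \<longrightarrow> - u (x, t) \<le> \<alpha> t + \<beta> t * (P \<bullet> (x - x0) + Q * (norm (x0 - x))\<^sup>2)"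
          and le0: "\<forall>x. norm (x0 - x) < \<rho> \<longrightarrow> - u (x, t0) \<le> - u (x0, t0) + P \<bullet> (x - x0) + Q * (norm (x0 - x))\<^sup>2"
        define \<phi> where "\<phi> = (\<lambda>z. - \<alpha> (snd z) + - \<beta> (snd z) * (P \<bullet> (fst z - x0) + Q * (norm (x0 - fst z))\<^sup>2))"
        define w2 where "w2 = (\<lambda>y. glue (par_cyl r x0 t0) \<phi> u (y, t0))"
        \<comment> \<open>The operator is odd. After negation the test function touches from above,
          and the estimate for upper paraboloids applies to \<open>w\<close>.\<close>
        define w where "w = (\<lambda>y. - w2 y)"
        have in0: "(x0, t0) \<in> par_cyl r x0 t0" using r by (simp add: par_cyl_def)
        then have t0: "t0 \<in> {-1<..0}" using cyl cyl1 by auto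
        have w: "w = (\<lambda>y. if norm (x0 - y) < r then - u (x0, t0) + (P \<bullet> (y - x0) + Q * (norm (x0 - y))\<^sup>2) else - u (y, t0))"
          using r by (auto simp: w_def w2_def glue_def par_cyl_def dist_norm \<phi>_def a0 b0 fun_eq_iff)
        have wx: "w x0 = - u (x0, t0)" using r by (simp add: w)
        have tw: "tail_ok w" unfolding w
          using tail_ok_patch[OF tail_ok_minus[OF T[rule_format, OF t0]], of x0 r "- u (x0, t0)" P Q] by simp
        have weq: "w y = w x0 + P \<bullet> (y - x0) + Q * (norm (x0 - y))\<^sup>2" if "norm (x0 - y) < r" for y
          using wx that by (simp add: w)
        have wle: "w y \<le> w x0 + P \<bullet> (y - x0) + Q * (norm (x0 - y))\<^sup>2" if "norm (x0 - y) < \<rho>" for y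
          using wx le0 that by (simp add: w)
        obtain v where v: "((\<lambda>\<epsilon>. ext_integral {y. \<epsilon> < norm (x0 - y)} (frac_kernel p s w x0)) \<longlongrightarrow> ereal v) (at_right 0)"
          "(LINT y:{y. \<rho> \<le> norm (x0 - y)}|lebesgue. frac_kernel p s w x0 y)
            - C * (norm P + Q * \<rho>) powr (p - 2) * Q * \<rho> powr (p - s * p) \<le> v"
          using PV[OF r Q tw weq wle] by blast
        have w2: "w2 = (\<lambda>y. - w y)" by (simp add: w_def)
        have "((\<lambda>\<epsilon>. - ext_integral {y. \<epsilon> < norm (x0 - y)} (frac_kernel p s w x0)) \<longlongrightarrow> - ereal v) (at_right 0)"
          using v(1) by (rule tendsto_uminus_ereal)
        moreover have "\<forall>\<^sub>F \<epsilon> in at_right 0. - ext_integral {y. \<epsilon> < norm (x0 - y)} (frac_kernel p s w x0) = ext_integral {y. \<epsilon> < norm (x0 - y)} (frac_kernel p s w2 x0)"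
          unfolding w2 eventually_at_right_field using ext_integral_kernel_minus[OF tw] by (intro exI[of _ 1]) simp
        ultimately have "((\<lambda>\<epsilon>. ext_integral {y. \<epsilon> < norm (x0 - y)} (frac_kernel p s w2 x0)) \<longlongrightarrow> - ereal v) (at_right 0)"
          by (rule Lim_transform_eventually)
        then have fp: "frac_plap p s w2 x0 = - ereal v"
          unfolding frac_plap_def by (intro tendsto_Lim) simp
        have "C21_on (par_cyl r x0 t0) \<phi>"
          unfolding \<phi>_def by (rule C21_on_paraboloid[where I = "{t0 - r\<^sup>2<..t0}" and \<alpha>' = "\<lambda>t. - \<alpha>' t" and \<beta>' = "\<lambda>t. - \<beta>' t"])
            (use d c in \<open>auto simp: par_cyl_def intro!: DERIV_minus continuous_on_minus\<close>)
        moreover have "\<forall>z\<in>par_cyl r x0 t0. \<phi> z \<le> u z" using le by (fastforce simp: \<phi>_def)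
        moreover have "\<phi> (x0, t0) = u (x0, t0)" by (simp add: \<phi>_def a0)
        ultimately have "obstacle_op p s \<psi> u \<phi> r x0 t0 \<ge> 0"
          using super r(1) cyl unfolding visc_supersol_def cyl1 by blast
        moreover have "time_deriv \<phi> x0 t0 = - \<alpha>' t0"
          by (rule time_deriv_eq) (use d r in \<open>auto simp: \<phi>_def intro!: DERIV_minus\<close>)
        ultimately have "\<alpha>' t0 + v \<le> 0"
          by (auto simp: obstacle_op_def w2_def[symmetric] fp zero_ereal_def)
        moreover have "(LINT y:{y. \<rho> \<le> norm (x0 - y)}|lebesgue. frac_kernel p s w x0 y)
           = (LINT y:{y. \<rho> \<le> norm (x0 - y)}|lebesgue. frac_kernel p s (\<lambda>y. - u (y, t0)) x0 y)"
        proof (rule set_lebesgue_integral_cong[OF lebesgue_norm_sets(1)], intro allI impI)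
          fix y assume "y \<in> {y. \<rho> \<le> norm (x0 - y)}"
          then show "frac_kernel p s w x0 y = frac_kernel p s (\<lambda>y. - u (y, t0)) x0 y"
            using r by (simp add: frac_kernel_def wx) (simp add: w)
        qed
        ultimately show "\<alpha>' t0 + (LINT y:{y. \<rho> \<le> norm (x0 - y)}|lebesgue. frac_kernel p s (\<lambda>y. - u (y, t0)) x0 y)
         \<le> C * (norm P + Q * \<rho>) powr (p - 2) * Q * \<rho> powr (p - s * p)" using v(2) by linarith
      qed
    qed
  qed
qed

lemma visc_ineqD:
  assumes "visc_ineq C E v" "0 < r" "r \<le> \<rho>" "0 \<le> Q" "par_cyl r x0 t0 \<subseteq> par_cyl 1 0 0" "E (x0, t0)"
    "\<And>t. t \<in> {t0 - r\<^sup>2<..t0} \<Longrightarrow> (\<alpha> has_real_derivative \<alpha>' t) (at t)"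
    "\<And>t. t \<in> {t0 - r\<^sup>2<..t0} \<Longrightarrow> (\<beta> has_real_derivative \<beta>' t) (at t)"
    "continuous_on {t0 - r\<^sup>2<..t0} \<alpha>'" "continuous_on {t0 - r\<^sup>2<..t0} \<beta>'"
    "\<alpha> t0 = v (x0, t0)" "\<beta> t0 = 1"
    "\<And>x t. (x, t) \<in> par_cyl r x0 t0 \<Longrightarrow> v (x, t) \<le> \<alpha> t + \<beta> t * (P \<bullet> (x - x0) + Q * (norm (x0 - x))\<^sup>2)"
    "\<And>x. norm (x0 - x) < \<rho> \<Longrightarrow> v (x, t0) \<le> v (x0, t0) + P \<bullet> (x - x0) + Q * (norm (x0 - x))\<^sup>2"
  shows "\<alpha>' t0 + (LINT y:{y. \<rho> \<le> norm (x0 - y)}|lebesgue. frac_kernel p s (\<lambda>y. v (y, t0)) x0 y)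
       \<le> C * (norm P + Q * \<rho>) powr (p - 2) * Q * \<rho> powr (p - s * p)"
  using assms(1)[unfolded visc_ineq_def, rule_format, OF assms(2-6) _ assms(9-)] assms(7,8) by blast

subsection \<open>Comparing the operator at two points\<close>

text \<open>
  Truncating the kernel at \<open>R\<close>, instead of splitting the integral there, makes the far part Lipschitz
  in the base point.
\<close>

definition farw :: "real \<Rightarrow> real ^ 'n \<Rightarrow> real ^ 'n \<Rightarrow> real" where
  "farw R x y = max (norm (x - y)) R powr (- q)"

lemma farw_nonneg: "0 \<le> farw R x y"
  by (simp add: farw_def)

lemma farw_measurable: "farw R x \<in> borel_measurable lebesgue"
  unfolding farw_def[abs_def] by (rule measurable_completion) measurable

text \<open>Outside radius \<open>R\<close> this is the comparison of the kernel with the tail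
  weight; inside, \<open>norm y \<le> 2\<close>, so the tail weight is bounded below.\<close>

lemma farw_le:
  assumes x: "norm x \<le> 1" and R: "0 < R" "R \<le> 1"
  shows "farw R x y \<le> (1 + 2 powr q) * R powr (- q) * tailw y"
proof (cases "R \<le> norm (x - y)")
  case True
  have "norm x / R \<le> 1 / R" "1 \<le> 1 / R" using x R by (auto intro: divide_right_mono)
  then have "1 + norm x / R \<le> 2 / R" by simp
  then have "(1 + norm x / R) powr q \<le> (2 / R) powr q"
    using x R q_pos by (intro powr_mono2) auto
  also have "\<dots> = 2 powr q * R powr (- q)" using R by (simp add: powr_divide powr_minus_divide)
  finally have "R powr (- q) + (1 + norm x / R) powr q \<le> (1 + 2 powr q) * R powr (- q)" by (simp add: algebra_simps)
  then have "(R powr (- q) + (1 + norm x / R) powr q) * tailw y \<le> (1 + 2 powr q) * R powr (- q) * tailw y"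
    using tailw_pos[of y] by (intro mult_right_mono) auto
  with powr_kernel_compare[OF q_pos(1) R(1) True] True show ?thesis
    by (simp add: farw_def tailw_def max_def)
next
  case False
  have "norm y \<le> norm x + norm (x - y)" using norm_triangle_ineq4[of x "x - y"] by simp
  then have "norm y powr q \<le> 2 powr q" using False x R q_pos by (intro powr_mono2) auto
  moreover have "0 < 1 + norm y powr q" by (intro add_pos_nonneg) auto
  ultimately have "1 \<le> (1 + 2 powr q) * tailw y"
    by (simp add: tailw_def)
  then have "R powr (- q) * 1 \<le> R powr (- q) * ((1 + 2 powr q) * tailw y)" by (intro mult_left_mono) auto
  then show ?thesis using False by (simp add: farw_def mult_ac)
qed

lemma powr_neg_diff_le:
  fixes a b e :: real
  assumes "e > 0" "0 < a" "a \<le> b"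
  shows "a powr (- e) - b powr (- e) \<le> e * a powr (- e - 1) * (b - a)"
proof (cases "a = b")
  case False
  then have "a < b" using assms by simp
  have "\<exists>z>a. z < b \<and> (b powr (- e) - a powr (- e)) = (b - a) * (- e * z powr (- e - 1))"
    by (rule MVT2[OF \<open>a < b\<close>]) (use assms in \<open>auto intro!: derivative_eq_intros\<close>)
  then obtain z where z: "a < z" "z < b" "b powr (- e) - a powr (- e) = (b - a) * (- e * z powr (- e - 1))" by blast
  have "z powr (- e - 1) \<le> a powr (- e - 1)" using z assms by (intro powr_mono2') auto
  then have "(b - a) * (e * z powr (- e - 1)) \<le> (b - a) * (e * a powr (- e - 1))"
    using z assms by (intro mult_left_mono) auto
  then show ?thesis using z(3) by (simp add: mult_ac)
qed simp

text \<open>The truncated kernel is Lipschitz in the distance, with slope \<open>q\<close> times the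
  power \<open>- q - 1\<close> of the smaller truncated distance, hence one more factor
  \<open>1 / R\<close> than in \<open>farw_le\<close>. The base point nearer to \<open>w\<close>
  supplies the smaller distance, whence the case distinction.\<close>

lemma farw_diff_le:
  assumes x: "norm x \<le> 1" and y: "norm y \<le> 1" and R: "0 < R" "R \<le> 1"
  shows "\<bar>farw R x w - farw R y w\<bar> \<le> 2 * q * (1 + 2 powr q) * R powr (- q - 1) * norm (x - y) * tailw w"
proof -
  have main: "farw R x w - farw R y w \<le> 2 * q * (1 + 2 powr q) * R powr (- q - 1) * norm (x - y) * tailw w"
    if x: "norm x \<le> 1" and le: "norm (x - w) \<le> norm (y - w)" for x y
  proof -
    define a where "a = max (norm (x - w)) R"
    define b where "b = max (norm (y - w)) R"
    have ab: "0 < a" "a \<le> b" "R \<le> a" using R le by (auto simp: a_def b_def)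
    have "norm (y - w) \<le> norm (x - w) + norm (x - y)"
      using norm_triangle_ineq4[of "x - w" "x - y"] by simp
    then have ba: "b - a \<le> norm (x - y)"
      using norm_ge_zero[of "x - y"] unfolding a_def b_def max_def by (simp split: if_splits; linarith)
    have "a powr (- q) = farw R x w" by (simp add: farw_def a_def)
    then have "a powr (- q) * a powr (- 1) \<le> ((1 + 2 powr q) * R powr (- q) * tailw w) * R powr (- 1)"
      using farw_le[OF x R, of w] ab R tailw_pos[of w] by (intro mult_mono powr_mono2') auto
    then have pw: "a powr (- q - 1) \<le> (1 + 2 powr q) * R powr (- q) * tailw w * R powr (- 1)"
      unfolding powr_add[symmetric] by simp
    have "farw R x w - farw R y w \<le> q * a powr (- q - 1) * (b - a)"
      using powr_neg_diff_le[OF q_pos(1) ab(1,2)] by (simp add: farw_def a_def b_def)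
    also have "\<dots> \<le> q * a powr (- q - 1) * norm (x - y)"
      using ba q_pos by (intro mult_left_mono) auto
    also have "\<dots> \<le> q * ((1 + 2 powr q) * R powr (- q) * tailw w * R powr (- 1)) * norm (x - y)"
      using pw q_pos by (intro mult_right_mono mult_left_mono) auto
    also have "\<dots> = (q * (1 + 2 powr q) * (R powr (- q) * R powr (- 1)) * norm (x - y) * tailw w)"
      by (simp add: mult_ac)
    also have "R powr (- q) * R powr (- 1) = R powr (- q - 1)" unfolding powr_add[symmetric] by simp
    also have "q * (1 + 2 powr q) * R powr (- q - 1) * norm (x - y) * tailw w
      \<le> 2 * (q * (1 + 2 powr q) * R powr (- q - 1) * norm (x - y) * tailw w)"
      using q_pos tailw_pos[of w] by (simp add: mult_nonneg_nonneg)
    finally show ?thesis by (simp add: mult.assoc)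
  qed
  have mono: "farw R y w \<le> farw R x w" if "norm (x - w) \<le> norm (y - w)" for x y
    unfolding farw_def using that R q_pos by (intro powr_mono2') auto
  show ?thesis
  proof (cases "norm (x - w) \<le> norm (y - w)")
    case True
    then show ?thesis using main[OF x True] mono[OF True] by simp
  next
    case False
    then have "norm (y - w) \<le> norm (x - w)" by simp
    then show ?thesis using main[OF y, of x] mono[of y x] by (simp add: norm_minus_commute)
  qed
qed

text \<open>The power \<open>p - 1\<close> of the tail norm, which is linear under integration of
  pointwise bounds.\<close>

definition tail_mass :: "(real ^ 'n \<Rightarrow> real) \<Rightarrow> real" where
  "tail_mass U = integral\<^sup>L lebesgue (\<lambda>y. \<bar>U y\<bar> powr (p - 1) * tailw y)"

lemma tail_ok_diff:
  assumes "tail_ok U" "tail_ok V"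
  shows "tail_ok (\<lambda>y. U y - V y)"
proof -
  have m: "(\<lambda>y. U y - V y) \<in> borel_measurable lebesgue" using assms by (auto simp: tail_ok_def)
  have i: "integrable lebesgue (\<lambda>y. 2 powr (p - 1) * (\<bar>U y\<bar> powr (p - 1) * tailw y + \<bar>V y\<bar> powr (p - 1) * tailw y))"
    using assms by (simp add: tail_ok_def)
  have "integrable lebesgue (\<lambda>y. \<bar>U y - V y\<bar> powr (p - 1) * tailw y)"
  proof (rule Bochner_Integration.integrable_bound[OF i])
    have "tailw \<in> borel_measurable lebesgue" using integrable_tailw by auto
    then show "(\<lambda>y. \<bar>U y - V y\<bar> powr (p - 1) * tailw y) \<in> borel_measurable lebesgue" using m by measurable
    show "AE y in lebesgue. norm (\<bar>U y - V y\<bar> powr (p - 1) * tailw y)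
      \<le> norm (2 powr (p - 1) * (\<bar>U y\<bar> powr (p - 1) * tailw y + \<bar>V y\<bar> powr (p - 1) * tailw y))"
    proof (rule AE_I2)
      fix y
      have "\<bar>U y - V y\<bar> powr (p - 1) * tailw y \<le> 2 powr (p - 1) * (\<bar>U y\<bar> powr (p - 1) + \<bar>V y\<bar> powr (p - 1)) * tailw y"
        using abs_add_powr_le[of "p - 1" "U y" "- V y"] p tailw_pos[of y] by (intro mult_right_mono) auto
      then show "norm (\<bar>U y - V y\<bar> powr (p - 1) * tailw y)
      \<le> norm (2 powr (p - 1) * (\<bar>U y\<bar> powr (p - 1) * tailw y + \<bar>V y\<bar> powr (p - 1) * tailw y))"
        using tailw_pos[of y] unfolding real_norm_def distrib_left distrib_right
        by (intro order_trans[OF _ abs_ge_self]) (simp add: mult.assoc)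
    qed
  qed
  with m show ?thesis by (simp add: tail_ok_def)
qed

text \<open>Origin: \<open>(2 + a + b) powr (p - 1) \<le> 3 powr (p - 1) * (2 powr (p - 1) + a powr
  (p - 1) + b powr (p - 1))\<close>, integrated against the tail weight. The summand 2 stands for
  two tail masses of at most 1.\<close>

definition tail_const :: real where
  "tail_const = 3 powr (p - 1) * (2 powr (p - 1) * integral\<^sup>L lebesgue tailw + 2)"

lemma tail_const_pos: "tail_const > 0"
  unfolding tail_const_def
  using tailw_pos by (intro mult_pos_pos add_nonneg_pos mult_nonneg_nonneg Bochner_Integration.integral_nonneg) (auto intro: less_imp_le)

lemma tail_sum_integral:
  assumes U: "tail_ok U" "tail_mass U \<le> 1" and V: "tail_ok V" "tail_mass V \<le> 1"
  shows "integrable lebesgue (\<lambda>y. (2 + \<bar>U y\<bar> + \<bar>V y\<bar>) powr (p - 1) * tailw y)"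
    and "integral\<^sup>L lebesgue (\<lambda>y. (2 + \<bar>U y\<bar> + \<bar>V y\<bar>) powr (p - 1) * tailw y) \<le> tail_const"
proof -
  let ?b = "\<lambda>y. (2 + \<bar>U y\<bar> + \<bar>V y\<bar>) powr (p - 1) * tailw y"
  let ?h = "\<lambda>y. 3 powr (p - 1) * (2 powr (p - 1) * tailw y + (\<bar>U y\<bar> powr (p - 1) * tailw y + \<bar>V y\<bar> powr (p - 1) * tailw y))"
  have i: "integrable lebesgue ?h"
    using U V integrable_tailw by (simp add: tail_ok_def)
  have le: "?b y \<le> ?h y" for y
  proof -
    define m where "m = max 2 (max \<bar>U y\<bar> \<bar>V y\<bar>)"
    have "(2 + \<bar>U y\<bar> + \<bar>V y\<bar>) powr (p - 1) \<le> (3 * m) powr (p - 1)"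
      using p by (intro powr_mono2) (auto simp: m_def)
    also have "\<dots> = 3 powr (p - 1) * m powr (p - 1)" by (simp add: powr_mult m_def)
    also have "m powr (p - 1) \<le> 2 powr (p - 1) + (\<bar>U y\<bar> powr (p - 1) + \<bar>V y\<bar> powr (p - 1))"
      by (auto simp: m_def max_def)
    finally have "(2 + \<bar>U y\<bar> + \<bar>V y\<bar>) powr (p - 1) \<le> 3 powr (p - 1) * (2 powr (p - 1) + (\<bar>U y\<bar> powr (p - 1) + \<bar>V y\<bar> powr (p - 1)))"
      by simp
    then have "?b y \<le> 3 powr (p - 1) * (2 powr (p - 1) + (\<bar>U y\<bar> powr (p - 1) + \<bar>V y\<bar> powr (p - 1))) * tailw y"
      using tailw_pos[of y] by (intro mult_right_mono) auto
    then show ?thesis by (simp add: algebra_simps)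
  qed
  have nn: "0 \<le> ?b y" for y using tailw_pos[of y] by simp
  show ib: "integrable lebesgue ?b"
  proof (rule Bochner_Integration.integrable_bound[OF i])
    have "tailw \<in> borel_measurable lebesgue" using integrable_tailw by auto
    then show "?b \<in> borel_measurable lebesgue"
      using tail_ok_measurable[OF U(1)] tail_ok_measurable[OF V(1)] by measurable
    show "AE y in lebesgue. norm (?b y) \<le> norm (?h y)"
      unfolding real_norm_def
      by (intro AE_I2 order_trans[OF _ abs_ge_self], subst abs_of_nonneg[OF nn], rule le)
  qed
  have "integral\<^sup>L lebesgue ?b \<le> integral\<^sup>L lebesgue ?h" using ib i le by (intro integral_mono)
  also have "\<dots> = 3 powr (p - 1) * (2 powr (p - 1) * integral\<^sup>L lebesgue tailw + (tail_mass U + tail_mass V))"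
    using U V integrable_tailw by (simp add: tail_ok_def tail_mass_def)
  also have "\<dots> \<le> tail_const" unfolding tail_const_def using U V by (intro mult_left_mono add_left_mono) auto
  finally show "integral\<^sup>L lebesgue ?b \<le> tail_const" .
qed

lemma far_integrable:
  assumes U: "tail_ok U" "tail_mass U \<le> 1" and x: "norm x \<le> 1" "\<bar>U x\<bar> \<le> 1" and R: "0 < R" "R \<le> 1"
  shows "integrable lebesgue (\<lambda>y. spow p (U x - U y) * farw R x y)"
proof (rule Bochner_Integration.integrable_bound[OF integrable_mult_right[OF tail_sum_integral(1)[OF U U], of "(1 + 2 powr q) * R powr (- q)"]])
  have "(\<lambda>y. spow p (U x - U y)) \<in> borel_measurable lebesgue"
    using tail_ok_measurable[OF U(1)] by (intro measurable_compose[OF _ borel_measurable_spow]) auto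
  then show "(\<lambda>y. spow p (U x - U y) * farw R x y) \<in> borel_measurable lebesgue"
    by (intro borel_measurable_times farw_measurable)
  show "AE y in lebesgue. norm (spow p (U x - U y) * farw R x y)
    \<le> norm ((1 + 2 powr q) * R powr (- q) * ((2 + \<bar>U y\<bar> + \<bar>U y\<bar>) powr (p - 1) * tailw y))"
  proof (rule AE_I2)
    fix y
    have "\<bar>U x - U y\<bar> powr (p - 1) \<le> (2 + \<bar>U y\<bar> + \<bar>U y\<bar>) powr (p - 1)"
      using x p by (intro powr_mono2) auto
    then have "\<bar>U x - U y\<bar> powr (p - 1) * farw R x y \<le> (2 + \<bar>U y\<bar> + \<bar>U y\<bar>) powr (p - 1) * ((1 + 2 powr q) * R powr (- q) * tailw y)"
      using farw_le[OF x(1) R] farw_nonneg by (intro mult_mono) auto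
    then show "norm (spow p (U x - U y) * farw R x y)
    \<le> norm ((1 + 2 powr q) * R powr (- q) * ((2 + \<bar>U y\<bar> + \<bar>U y\<bar>) powr (p - 1) * tailw y))"
      using tailw_pos[of y] farw_nonneg[of R x y] by (simp add: abs_mult abs_spow mult_ac abs_of_pos)
  qed
qed

text \<open>The change of the product splits into the change of the increments and the change of the
  kernel. Both increments are dominated by \<open>2 + |U| + |V|\<close>, whose weighted power is
  integrable with a universal bound. The difference \<open>U - V\<close> occurs to the first power
  only and is isolated by Young's inequality, so that closeness of the slices in the tail norm
  suffices.\<close>

lemma far_difference:
  assumes U: "tail_ok U" "tail_mass U \<le> 1" and V: "tail_ok V" "tail_mass V \<le> 1"
    and x: "norm x \<le> 1" "\<bar>U x\<bar> \<le> 1" and y: "norm y \<le> 1" "\<bar>V y\<bar> \<le> 1" and R: "0 < R" "R \<le> 1"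
    and \<zeta>: "0 < \<zeta>" "\<zeta> \<le> 1"
  shows "\<bar>integral\<^sup>L lebesgue (\<lambda>w. spow p (U x - U w) * farw R x w) - integral\<^sup>L lebesgue (\<lambda>w. spow p (V y - V w) * farw R y w)\<bar>
    \<le> (p - 1 + 2 * q) * (1 + 2 powr q) * R powr (- q - 1) *
        ((\<bar>U x - V y\<bar> + norm (x - y) + \<zeta>) * tail_const + \<zeta> powr (2 - p) * tail_mass (\<lambda>w. U w - V w))"
proof -
  let ?f = "\<lambda>w. spow p (U x - U w) * farw R x w" and ?g = "\<lambda>w. spow p (V y - V w) * farw R y w"
  let ?b = "\<lambda>w. 2 + \<bar>U w\<bar> + \<bar>V w\<bar>"
  define K where "K = (p - 1 + 2 * q) * (1 + 2 powr q) * R powr (- q - 1)"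
  define \<eta> where "\<eta> = \<bar>U x - V y\<bar>"
  let ?h = "\<lambda>w. K * ((\<eta> + norm (x - y) + \<zeta>) * (?b w powr (p - 1) * tailw w) + \<zeta> powr (2 - p) * (\<bar>U w - V w\<bar> powr (p - 1) * tailw w))"
  have K: "K \<ge> 0" using p q_pos by (simp add: K_def)
  have iUV: "integrable lebesgue (\<lambda>w. \<bar>U w - V w\<bar> powr (p - 1) * tailw w)"
    using tail_ok_diff[OF U(1) V(1)] by (simp add: tail_ok_def)
  have ih: "integrable lebesgue ?h"
    using tail_sum_integral(1)[OF U V] iUV by simp
  have if': "integrable lebesgue ?f" "integrable lebesgue ?g"
    using far_integrable U V x y R by auto
  have pt: "\<bar>?f w - ?g w\<bar> \<le> ?h w" for w
  proof -
    define b where "b = ?b w"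
    define e where "e = \<bar>U w - V w\<bar>"
    have b: "b \<ge> 1" "\<bar>U x - U w\<bar> \<le> b" "\<bar>V y - V w\<bar> \<le> b" using x y by (auto simp: b_def)
    have bp: "b powr (p - 2) \<le> b powr (p - 1)" using b by (intro powr_mono) auto
    \<comment> \<open>Either \<open>e \<le> \<zeta> * b\<close>, and the first term dominates, or
      \<open>b < e / \<zeta>\<close>, and replacing \<open>b\<close> by this gives the second
      term.\<close>
    have young: "b powr (p - 2) * e \<le> \<zeta> * b powr (p - 1) + \<zeta> powr (2 - p) * e powr (p - 1)"
    proof (cases "e \<le> \<zeta> * b")
      case True
      have "b powr (p - 2) * e \<le> b powr (p - 2) * (\<zeta> * b)" using True by (intro mult_left_mono) auto
      also have "\<dots> = \<zeta> * (b powr (p - 2) * b powr 1)" using b by simp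
      also have "\<dots> = \<zeta> * b powr (p - 1)" unfolding powr_add[symmetric] by simp
      finally show ?thesis by (smt (verit) mult_nonneg_nonneg powr_ge_zero)
    next
      case False
      then have e: "e > 0" using b \<zeta> by (smt (verit) mult_nonneg_nonneg)
      have "b powr (p - 2) \<le> (e / \<zeta>) powr (p - 2)"
        using False b \<zeta> p by (intro powr_mono2) (auto simp: field_simps)
      also have "\<dots> = \<zeta> powr (2 - p) * e powr (p - 2)"
        using \<zeta> e powr_minus_divide[of \<zeta> "p - 2"] by (simp add: powr_divide)
      finally have "b powr (p - 2) * e \<le> \<zeta> powr (2 - p) * e powr (p - 2) * e powr 1"
        using e by (simp add: mult_right_mono)
      also have "\<dots> = \<zeta> powr (2 - p) * e powr (p - 1)" unfolding mult.assoc powr_add[symmetric] by simp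
      finally show ?thesis using \<zeta> by (smt (verit) mult_nonneg_nonneg powr_ge_zero)
    qed
    have "\<bar>spow p (U x - U w) - spow p (V y - V w)\<bar> \<le> (p - 1) * b powr (p - 2) * \<bar>(U x - U w) - (V y - V w)\<bar>"
      by (rule spow_diff_abs_le[OF p b(2,3)])
    also have "\<dots> \<le> (p - 1) * b powr (p - 2) * (\<eta> + e)"
      using p by (intro mult_left_mono) (auto simp: \<eta>_def e_def)
    also have "\<dots> = (p - 1) * (b powr (p - 2) * \<eta> + b powr (p - 2) * e)" by (simp add: algebra_simps)
    also have "\<dots> \<le> (p - 1) * (b powr (p - 1) * \<eta> + (\<zeta> * b powr (p - 1) + \<zeta> powr (2 - p) * e powr (p - 1)))"
      using p bp young by (intro mult_left_mono add_mono mult_right_mono) (auto simp: \<eta>_def)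
    finally have s1: "\<bar>spow p (U x - U w) - spow p (V y - V w)\<bar> \<le> (p - 1) * ((\<eta> + \<zeta>) * b powr (p - 1) + \<zeta> powr (2 - p) * e powr (p - 1))"
      by (simp add: algebra_simps)
    have s2: "\<bar>spow p (V y - V w)\<bar> \<le> b powr (p - 1)" unfolding abs_spow using b p by (intro powr_mono2) auto
    define T where "T = (1 + 2 powr q) * R powr (- q - 1) * tailw w"
    have T: "T \<ge> 0" using tailw_pos[of w] by (simp add: T_def)
    have "R powr (- q) \<le> R powr (- q - 1)" using R by (intro powr_mono') auto
    then have "(1 + 2 powr q) * R powr (- q) * tailw w \<le> T"
      unfolding T_def using tailw_pos[of w] by (intro mult_right_mono mult_left_mono) auto
    then have t1: "farw R x w \<le> T" using farw_le[OF x(1) R, of w] by simp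
    have t2: "\<bar>farw R x w - farw R y w\<bar> \<le> 2 * q * norm (x - y) * T"
      using farw_diff_le[OF x(1) y(1) R, of w] unfolding T_def by (simp only: mult_ac)
    have "?f w - ?g w = (spow p (U x - U w) - spow p (V y - V w)) * farw R x w + spow p (V y - V w) * (farw R x w - farw R y w)"
      by (simp add: algebra_simps)
    then have "\<bar>?f w - ?g w\<bar> \<le> \<bar>spow p (U x - U w) - spow p (V y - V w)\<bar> * farw R x w + \<bar>spow p (V y - V w)\<bar> * \<bar>farw R x w - farw R y w\<bar>"
      using farw_nonneg[of R x w] by (metis abs_mult abs_of_nonneg abs_triangle_ineq)
    also have "\<dots> \<le> (p - 1) * ((\<eta> + \<zeta>) * b powr (p - 1) + \<zeta> powr (2 - p) * e powr (p - 1)) * T + b powr (p - 1) * (2 * q * norm (x - y) * T)"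
      using s1 s2 t1 t2 farw_nonneg[of R x w] by (intro add_mono mult_mono) (auto intro: order_trans[OF abs_ge_zero])
    also have "\<dots> = T * ((p - 1) * ((\<eta> + \<zeta>) * b powr (p - 1) + \<zeta> powr (2 - p) * e powr (p - 1)) + 2 * q * (norm (x - y) * b powr (p - 1)))"
      by (simp only: distrib_left mult_ac)
    also have "\<dots> \<le> T * ((p - 1 + 2 * q) * ((\<eta> + norm (x - y) + \<zeta>) * b powr (p - 1) + \<zeta> powr (2 - p) * e powr (p - 1)))"
    proof (rule mult_left_mono[OF _ T])
      have n: "0 \<le> (\<eta> + \<zeta>) * b powr (p - 1) + \<zeta> powr (2 - p) * e powr (p - 1)" "0 \<le> norm (x - y) * b powr (p - 1)"
        using \<zeta> by (auto simp: \<eta>_def)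
      have "(p - 1) * A + 2 * q * B \<le> (p - 1 + 2 * q) * (A + B)" if "0 \<le> A" "0 \<le> B" for A B :: real
      proof -
        have "0 \<le> (p - 1) * B" "0 \<le> 2 * q * A" using that p q_pos by auto
        then show ?thesis by (simp add: algebra_simps)
      qed
      from this[OF n] show "(p - 1) * ((\<eta> + \<zeta>) * b powr (p - 1) + \<zeta> powr (2 - p) * e powr (p - 1)) + 2 * q * (norm (x - y) * b powr (p - 1))
        \<le> (p - 1 + 2 * q) * ((\<eta> + norm (x - y) + \<zeta>) * b powr (p - 1) + \<zeta> powr (2 - p) * e powr (p - 1))"
        by (simp add: algebra_simps)
    qed
    also have "\<dots> = ?h w" unfolding T_def K_def b_def[symmetric] e_def[symmetric] by (simp only: distrib_left mult_ac)
    finally show ?thesis .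
  qed
  have "\<bar>integral\<^sup>L lebesgue ?f - integral\<^sup>L lebesgue ?g\<bar> = \<bar>integral\<^sup>L lebesgue (\<lambda>w. ?f w - ?g w)\<bar>"
    using if' by simp
  also have "\<dots> \<le> integral\<^sup>L lebesgue (\<lambda>w. \<bar>?f w - ?g w\<bar>)" by (rule integral_abs_bound)
  also have "\<dots> \<le> integral\<^sup>L lebesgue ?h" using pt if' ih by (intro integral_mono) auto
  also have "\<dots> = K * ((\<eta> + norm (x - y) + \<zeta>) * integral\<^sup>L lebesgue (\<lambda>w. ?b w powr (p - 1) * tailw w) + \<zeta> powr (2 - p) * tail_mass (\<lambda>w. U w - V w))"
    using tail_sum_integral(1)[OF U V] iUV by (simp add: tail_mass_def)
  also have "\<dots> \<le> K * ((\<eta> + norm (x - y) + \<zeta>) * tail_const + \<zeta> powr (2 - p) * tail_mass (\<lambda>w. U w - V w))"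
    using tail_sum_integral(2)[OF U V] K \<zeta> by (intro mult_left_mono add_right_mono) (auto simp: \<eta>_def)
  finally show ?thesis by (simp add: K_def \<eta>_def)
qed

text \<open>Within distance \<open>R\<close> the kernel is
  \<open>(norm z powr (- q) - R powr (- q))\<close> plus the truncated kernel, beyond
  \<open>R\<close> it is the truncated kernel alone. The truncated kernel is integrated over the
  whole space so that its dependence on \<open>x\<close> is smooth; its part over the small ball is
  subtracted again.\<close>

lemma kernel_split:
  assumes U: "tail_ok U" "tail_mass U \<le> 1" and x: "norm x \<le> 1" "\<bar>U x\<bar> \<le> 1" and R: "0 < R" "R \<le> 1"
    and \<rho>: "0 < \<rho>" "\<rho> \<le> R"
  shows "set_integrable lebesgue {z. \<rho> \<le> norm z \<and> norm z < R} (\<lambda>z. spow p (U x - U (x + z)) * (norm z powr (- q) - R powr (- q)))"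
    and "(LINT y:{y. \<rho> \<le> norm (x - y)}|lebesgue. frac_kernel p s U x y)
      = (LINT z:{z. \<rho> \<le> norm z \<and> norm z < R}|lebesgue. spow p (U x - U (x + z)) * (norm z powr (- q) - R powr (- q)))
        + integral\<^sup>L lebesgue (\<lambda>y. spow p (U x - U y) * farw R x y)
        - (LINT y:{y. norm (x - y) < \<rho>}|lebesgue. spow p (U x - U y) * farw R x y)"
proof -
  let ?Z = "{z::real^'n. \<rho> \<le> norm z \<and> norm z < R}"
  let ?S = "{y. \<rho> \<le> norm (x - y)}" and ?T = "{y. norm (x - y) < \<rho>}"
  let ?g = "\<lambda>z. spow p (U x - U (x + z)) * (norm z powr (- q) - R powr (- q))"
  define h where "h = (\<lambda>y. spow p (U x - U y) * farw R x y)"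
  define f where "f = (\<lambda>y. indicator ?S y *\<^sub>R (frac_kernel p s U x y - h y))"
  have ih: "integrable lebesgue h" unfolding h_def by (rule far_integrable[OF U x R])
  have ihU: "set_integrable lebesgue UNIV h" using ih by (simp add: set_integrable_def)
  have iS: "set_integrable lebesgue ?S h" by (rule set_integrable_subset[OF ihU]) (auto intro: lebesgue_norm_sets)
  have iT: "set_integrable lebesgue ?T h" by (rule set_integrable_subset[OF ihU]) (auto intro: lebesgue_norm_sets)
  have ST: "?S \<union> ?T = UNIV" "?S \<inter> ?T = {}" by auto
  have sum: "integral\<^sup>L lebesgue h = (LINT y:?S|lebesgue. h y) + (LINT y:?T|lebesgue. h y)"
    using set_integral_Un[OF ST(2) iS iT] unfolding ST(1) by (simp add: set_lebesgue_integral_def)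
  have ik: "set_integrable lebesgue ?S (frac_kernel p s U x)" by (rule frac_kernel_integrable[OF U(1) \<rho>(1)])
  have if': "integrable lebesgue f"
    using set_integral_diff(1)[OF ik iS] unfolding f_def set_integrable_def .
  have fI: "integral\<^sup>L lebesgue f = (LINT y:?S|lebesgue. frac_kernel p s U x y) - (LINT y:?S|lebesgue. h y)"
    using set_integral_diff(2)[OF ik iS] unfolding f_def set_lebesgue_integral_def .
  have shift: "(\<lambda>z. f (x + 1 *\<^sub>R z)) = (\<lambda>z. indicator ?Z z *\<^sub>R ?g z)"
  proof
    fix z
    have "norm (x - (x + 1 *\<^sub>R z)) = norm z" by simp
    then show "f (x + 1 *\<^sub>R z) = indicator ?Z z *\<^sub>R ?g z"
      using \<rho> by (auto simp: f_def h_def indicator_def frac_kernel_eq farw_def max_def algebra_simps)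
  qed
  have mf: "f \<in> borel_measurable lebesgue" using if' by auto
  show "set_integrable lebesgue ?Z ?g"
    using integrable_lebesgue_affine_comp[OF _ mf, of 1 x] if' unfolding shift set_integrable_def by simp
  have "(LINT z:?Z|lebesgue. ?g z) = integral\<^sup>L lebesgue f"
    using integral_lebesgue_affine_comp[OF _ mf, of 1 x] unfolding shift set_lebesgue_integral_def by simp
  then show "(LINT y:?S|lebesgue. frac_kernel p s U x y) = (LINT z:?Z|lebesgue. ?g z)
        + integral\<^sup>L lebesgue (\<lambda>y. spow p (U x - U y) * farw R x y)
        - (LINT y:?T|lebesgue. spow p (U x - U y) * farw R x y)"
    using fI sum unfolding h_def by linarith
qed

lemma near_small_part:
  assumes U: "tail_ok U" "tail_mass U \<le> 1" and x: "norm x \<le> 1" "\<bar>U x\<bar> \<le> 1" and R: "0 < R" "R \<le> 1"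
    and \<rho>: "0 < \<rho>" "\<rho> \<le> R" and H: "\<And>z. norm z < \<rho> \<Longrightarrow> \<bar>U x - U (x + z)\<bar> \<le> M"
  shows "\<bar>LINT y:{y. norm (x - y) < \<rho>}|lebesgue. spow p (U x - U y) * farw R x y\<bar>
    \<le> M powr (p - 1) * (1 + 2 powr q) * R powr (- q) * integral\<^sup>L lebesgue tailw"
proof -
  define K where "K = M powr (p - 1) * (1 + 2 powr q) * R powr (- q)"
  have K: "K \<ge> 0" by (simp add: K_def)
  have i: "integrable lebesgue (\<lambda>y. K * tailw y)" using integrable_tailw by simp
  have gi: "set_integrable lebesgue UNIV (\<lambda>y. K * tailw y)" using i by (simp add: set_integrable_def)
  have m: "(\<lambda>y. spow p (U x - U y) * farw R x y) \<in> borel_measurable lebesgue"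
    using far_integrable[OF U x R] by auto
  have bd: "\<bar>spow p (U x - U y) * farw R x y\<bar> \<le> K * tailw y" if "y \<in> {y. norm (x - y) < \<rho>}" for y
  proof -
    have "\<bar>U x - U y\<bar> \<le> M" using H[of "y - x"] that by (simp add: norm_minus_commute)
    then have "\<bar>U x - U y\<bar> powr (p - 1) \<le> M powr (p - 1)" using p by (intro powr_mono2) auto
    then have "\<bar>U x - U y\<bar> powr (p - 1) * farw R x y \<le> M powr (p - 1) * ((1 + 2 powr q) * R powr (- q) * tailw y)"
      using farw_le[OF x(1) R] farw_nonneg by (intro mult_mono) auto
    then show ?thesis using farw_nonneg[of R x y] by (simp add: abs_mult abs_spow K_def mult.assoc)
  qed
  note B = set_integrable_bounded_by(2)[OF gi m lebesgue_norm_sets(2)[of x \<rho>] _ bd]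
  have "(LINT y:{y. norm (x - y) < \<rho>}|lebesgue. K * tailw y) \<le> (LINT y:UNIV|lebesgue. K * tailw y)"
    by (rule LINT_nonneg_mono_sets[OF gi lebesgue_norm_sets(2)]) (auto intro!: mult_nonneg_nonneg[OF K less_imp_le[OF tailw_pos]])
  also have "\<dots> = K * integral\<^sup>L lebesgue tailw" by (simp add: set_lebesgue_integral_def)
  finally show ?thesis using B by (simp add: K_def)
qed

text \<open>
  Only the ball \<open>ball (x - y) (\<eta> * norm (x - y))\<close> of shifts contributes a gain: moving \<open>x\<close> away from \<open>y\<close> by
  about \<open>x - y\<close> and \<open>y\<close> onto \<open>x\<close> tests the strict concavity \<open>2 powr \<gamma> < 2\<close>.  For the other shifts, moving both
  points by the same \<open>z\<close> leaves \<open>norm (x - y)\<close> unchanged and costs only the variation of the weight.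
\<close>

lemma near_difference:
  assumes \<gamma>: "0 < \<gamma>" "\<gamma> < 1" and \<nu>: "0 < \<nu>" "\<nu> \<le> 1" "\<gamma> * (p - 2) + \<nu> < s * p"
    and \<eta>: "0 < \<eta>" "\<eta> < 1" "\<kappa> > 0" "(1 + 2 * \<eta>) * (2 + \<eta>) powr \<gamma> + \<eta> powr \<gamma> \<le> 2 - \<kappa>"
  obtains c C where "c > 0" "C > 0"
    "\<And>(x::real^'n) y U V W R \<delta>. x \<noteq> y \<Longrightarrow> 0 < \<delta> \<Longrightarrow> \<delta> \<le> 1 - \<eta> \<Longrightarrow> 0 < R \<Longrightarrow> norm (x - y) \<le> \<eta> * R \<Longrightarrow> norm (x - y) \<le> R / 4 \<Longrightarrow> 1 \<le> W \<Longrightarrow>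
     set_integrable lebesgue {z. \<delta> * norm (x - y) \<le> norm z \<and> norm z < R} (\<lambda>z. spow p (U x - U (x + z)) * (norm z powr (- q) - R powr (- q))) \<Longrightarrow>
     set_integrable lebesgue {z. \<delta> * norm (x - y) \<le> norm z \<and> norm z < R} (\<lambda>z. spow p (V y - V (y + z)) * (norm z powr (- q) - R powr (- q))) \<Longrightarrow>
     (\<And>z. norm z \<le> R \<Longrightarrow> - (W * norm (x - y) powr \<gamma> * norm z / R) \<le> (U x - U (x + z)) - (V y - V (y + z))) \<Longrightarrow>
     (\<And>z. norm z \<le> R \<Longrightarrow> 2 * W * norm (x - y) powr \<gamma> - W * (1 + norm z / R) * norm (x - y + z) powr \<gamma> - W * norm (x - y - z) powr \<gamma>
         \<le> (U x - U (x + z)) - (V y - V (y + z))) \<Longrightarrow>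
     (\<And>z. norm z \<le> R \<Longrightarrow> \<bar>U x - U (x + z)\<bar> \<le> 8 * W * norm z powr \<gamma>) \<Longrightarrow>
     (\<And>z. norm z \<le> R \<Longrightarrow> \<bar>V y - V (y + z)\<bar> \<le> 8 * W * norm z powr \<gamma>) \<Longrightarrow>
     (c - C * \<delta> powr (- (s * p - \<gamma> * (p - 2) - \<nu>)) * (norm (x - y) / R) powr \<nu>) * (W powr (p - 1) * norm (x - y) powr (\<gamma> * (p - 1) - s * p))
     \<le> (LINT z:{z. \<delta> * norm (x - y) \<le> norm z \<and> norm z < R}|lebesgue. spow p (U x - U (x + z)) * (norm z powr (- q) - R powr (- q)))
        - (LINT z:{z. \<delta> * norm (x - y) \<le> norm z \<and> norm z < R}|lebesgue. spow p (V y - V (y + z)) * (norm z powr (- q) - R powr (- q)))"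
proof -
  \<comment> \<open>The error at distance \<open>r\<close> will be a multiple of
    \<open>r powr (- (d + e))\<close>; \<open>e > 0\<close> makes its integral over distances at
    least \<open>\<delta> |x - y|\<close> a negative power of that distance.\<close>
  define e where "e = s * p - \<gamma> * (p - 2) - \<nu>"
  have e: "e > 0" using \<nu> by (simp add: e_def)
  let ?n = "real CARD('n)"
  let ?v = "unit_ball_vol ?n"
  obtain C0 where C0: "C0 > 0" "\<forall>(x::real^'n) \<rho>. \<rho> > 0 \<longrightarrow>
    set_integrable lebesgue {y. \<rho> \<le> norm (x - y)} (\<lambda>y. norm (x - y) powr (- (?n + e)))
    \<and> (LINT y:{y. \<rho> \<le> norm (x - y)}|lebesgue. norm (x - y) powr (- (?n + e))) \<le> C0 * \<rho> powr (- e)"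
    using radial_outer_at[OF e] by blast
  have out: "set_integrable lebesgue {z::real^'n. \<rho> \<le> norm z} (\<lambda>z. norm z powr (- (?n + e)))"
     "(LINT z:{z::real^'n. \<rho> \<le> norm z}|lebesgue. norm z powr (- (?n + e))) \<le> C0 * \<rho> powr (- e)" if "\<rho> > 0" for \<rho>
    using C0(2)[rule_format, OF that, of 0] by auto
  \<comment> \<open>Product of the monotonicity of \<open>spow\<close> at a gap
    \<open>\<kappa> W |a| powr \<gamma>\<close>, the lower bound of the reduced kernel, and the
    volume of the ball of radius \<open>\<eta> |a|\<close>.\<close>
  define c where "c = (\<kappa> / 4) powr (p - 1) * (1/2) * 2 powr (- q) * ?v * \<eta> powr ?n"
  define C where "C = (p - 1) * 8 powr (p - 2) * C0"
  have c: "c > 0" using \<eta> by (simp add: c_def)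
  have C: "C > 0" using p C0 by (simp add: C_def)
  show ?thesis
  proof (rule that[OF c C], goal_cases)
    case (1 x y U V W R \<delta>)
    note ne = 1(1) and \<delta> = 1(2,3) and R = 1(4) and aR = 1(5,6) and W = 1(7) and iU = 1(8) and iV = 1(9)
      and H1 = 1(10) and H2 = 1(11) and H3 = 1(12,13)
    define a where "a = x - y"
    define A where "A = norm a"
    have A: "A > 0" using ne by (simp add: A_def a_def)
    have AR: "A \<le> \<eta> * R" "A \<le> R / 4" using aR by (auto simp: A_def a_def)
    define Z where "Z = {z::real^'n. \<delta> * A \<le> norm z \<and> norm z < R}"
    define k where "k = (\<lambda>z::real^'n. norm z powr (- q) - R powr (- q))"
    define H where "H = (\<lambda>z. spow p (U x - U (x + z)) - spow p (V y - V (y + z)))"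
    define G where "G = (\<kappa> * (W * A powr \<gamma>) / 4) powr (p - 1)"
    define K where "K = (p - 1) * 8 powr (p - 2) * W powr (p - 1) * A powr \<gamma> * R powr (- \<nu>)"
    define g where "g = G * (1/2 * (2 * A) powr (- q))"
    let ?B = "ball a (\<eta> * A)"
    have K: "K \<ge> 0" using p by (simp add: K_def)
    have G: "G \<ge> 0" by (simp add: G_def)
    have Zs: "Z \<in> sets lebesgue"
    proof -
      have "Z = {z. \<delta> * A \<le> norm (0 - z)} \<inter> {z. norm (0 - z) < R}" by (auto simp: Z_def)
      then show ?thesis by (simp only: sets.Int lebesgue_norm_sets)
    qed
    have nz: "z \<noteq> 0" "norm z > 0" if "z \<in> Z" for z
    proof -
      have "0 < \<delta> * A" using \<delta> A by simp
      moreover have "\<delta> * A \<le> norm z" using that by (simp add: Z_def)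
      ultimately show "norm z > 0" by linarith
      then show "z \<noteq> 0" by auto
    qed
    have k: "0 \<le> k z" "k z \<le> norm z powr (- q)" if "z \<in> Z" for z
    proof -
      have "R powr (- q) \<le> norm z powr (- q)" using nz[OF that] that q_pos by (intro powr_mono2') (auto simp: Z_def)
      then show "0 \<le> k z" by (simp add: k_def)
      show "k z \<le> norm z powr (- q)" by (simp add: k_def)
    qed
    have err: "- (K * norm z powr (- (?n + e))) \<le> H z * k z" if z: "z \<in> Z" for z
    proof (cases "V y - V (y + z) \<le> U x - U (x + z)")
      case True
      then have "0 \<le> H z" using spow_mono[OF p] by (simp add: H_def)
      then have "0 \<le> H z * k z" using k(1)[OF z] by simp
      moreover have "0 \<le> K * norm z powr (- (?n + e))" using K by simp
      ultimately show ?thesis by linarith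
    next
      case False
      let ?r = "norm z"
      have r: "?r > 0" "?r \<le> R" using nz[OF z] z by (auto simp: Z_def)
      have "- H z \<le> (p - 1) * (8 * W * ?r powr \<gamma>) powr (p - 2) * ((V y - V (y + z)) - (U x - U (x + z)))"
        using spow_diff_le[OF p H3(2)[OF r(2)] H3(1)[OF r(2)]] False by (simp add: H_def)
      also have "\<dots> \<le> (p - 1) * (8 * W * ?r powr \<gamma>) powr (p - 2) * (W * A powr \<gamma> * (?r / R))"
        using H1[OF r(2)] p by (intro mult_left_mono) (auto simp: A_def a_def)
      \<comment> \<open>As \<open>?r \<le> R\<close>, the linear variation of the weight may be
        weakened to the power \<open>\<nu>\<close>. With the full power 1 the error need not be
        governed by the small scale; with \<open>\<nu>\<close> it is, and the factor
        \<open>(|a| / R) powr \<nu>\<close> remains as smallness.\<close>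
      also have "\<dots> \<le> (p - 1) * (8 * W * ?r powr \<gamma>) powr (p - 2) * (W * A powr \<gamma> * (?r / R) powr \<nu>)"
      proof -
        have "(?r / R) powr 1 \<le> (?r / R) powr \<nu>" using r R \<nu> by (intro powr_mono') auto
        then show ?thesis using r R p W by (intro mult_left_mono) auto
      qed
      finally have "- H z * k z \<le> (p - 1) * (8 * W * ?r powr \<gamma>) powr (p - 2) * (W * A powr \<gamma> * (?r / R) powr \<nu>) * ?r powr (- q)"
        using k[OF z] p W by (intro mult_mono) auto
      also have "(8 * W * ?r powr \<gamma>) powr (p - 2) = 8 powr (p - 2) * W powr (p - 2) * ?r powr (\<gamma> * (p - 2))"
        using W by (simp add: powr_mult powr_powr)
      also have "(?r / R) powr \<nu> = ?r powr \<nu> * R powr (- \<nu>)" using r R by (simp add: powr_divide powr_minus_divide)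
      also have "(p - 1) * (8 powr (p - 2) * W powr (p - 2) * ?r powr (\<gamma> * (p - 2))) * (W * A powr \<gamma> * (?r powr \<nu> * R powr (- \<nu>))) * ?r powr (- q)
        = (p - 1) * 8 powr (p - 2) * (W powr (p - 2) * W powr 1) * A powr \<gamma> * R powr (- \<nu>) * (?r powr (\<gamma> * (p - 2)) * ?r powr \<nu> * ?r powr (- q))"
        using W by (simp add: mult_ac)
      also have "W powr (p - 2) * W powr 1 = W powr (p - 1)" unfolding powr_add[symmetric] by simp
      also have "?r powr (\<gamma> * (p - 2)) * ?r powr \<nu> * ?r powr (- q) = ?r powr (- (?n + e))"
        unfolding powr_add[symmetric] by (simp add: e_def q algebra_simps)
      finally show ?thesis by (simp add: K_def)
    qed
    have ballZ: "z \<in> Z" "norm z \<le> 2 * A" if "z \<in> ?B" for z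
    proof -
      have d: "norm (a - z) < \<eta> * A" using that by (simp add: dist_norm)
      have "norm z \<le> A + norm (a - z)" unfolding A_def using norm_triangle_ineq4[of a "a - z"] by simp
      moreover have "\<eta> * A \<le> 1 * A" using \<eta> A by (intro mult_right_mono) auto
      ultimately show 2: "norm z \<le> 2 * A" using d by linarith
      have "A \<le> norm z + norm (a - z)" unfolding A_def using norm_triangle_ineq[of z "a - z"] by simp
      moreover have "\<delta> * A \<le> (1 - \<eta>) * A" using \<delta> A by (intro mult_right_mono) auto
      ultimately have "\<delta> * A \<le> norm z" using d by (simp add: algebra_simps)
      then show "z \<in> Z" using 2 AR R by (simp add: Z_def)
    qed
    \<comment> \<open>For \<open>z\<close> near \<open>a\<close> the moved points are at distances
      about \<open>2 |a|\<close> and about 0, so the lower bound is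
      \<open>2 - 2 powr \<gamma>\<close> in units of \<open>W |a| powr \<gamma>\<close>, up to the
      errors collected in the hypothesis on \<open>\<eta>\<close>.\<close>
    have gain: "g \<le> H z * k z" if z: "z \<in> ?B" for z
    proof -
      let ?r = "norm z"
      have r: "?r > 0" "?r \<le> 2 * A" "?r \<le> R / 2" using ballZ[OF z] nz AR by auto
      have rR: "?r \<le> R" using r R by simp
      have d: "norm (a - z) \<le> \<eta> * A" using z by (simp add: dist_norm)
      have d2: "norm (a + z) \<le> (2 + \<eta>) * A"
      proof -
        have "norm (a + z) = norm (2 *\<^sub>R a - (a - z))" by (simp add: scaleR_2)
        also have "\<dots> \<le> norm (2 *\<^sub>R a) + norm (a - z)" by (rule norm_triangle_ineq4)
        also have "\<dots> \<le> (2 + \<eta>) * A" using d by (simp add: A_def algebra_simps)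
        finally show ?thesis .
      qed
      have p1: "norm (a - z) powr \<gamma> \<le> \<eta> powr \<gamma> * A powr \<gamma>"
        using powr_mono2[OF _ _ d, of \<gamma>] \<gamma> \<eta> A by (simp add: powr_mult)
      have p2: "norm (a + z) powr \<gamma> \<le> (2 + \<eta>) powr \<gamma> * A powr \<gamma>"
        using powr_mono2[OF _ _ d2, of \<gamma>] \<gamma> \<eta> A by (simp add: powr_mult)
      have "?r / R \<le> 2 * \<eta>" using r AR R by (simp add: field_simps)
      then have "W * (1 + ?r / R) * norm (a + z) powr \<gamma> \<le> W * (1 + 2 * \<eta>) * ((2 + \<eta>) powr \<gamma> * A powr \<gamma>)"
        using p2 W \<eta> R by (intro mult_mono) (auto intro!: add_nonneg_nonneg)
      moreover have "W * norm (a - z) powr \<gamma> \<le> W * (\<eta> powr \<gamma> * A powr \<gamma>)" using p1 W by (intro mult_left_mono) auto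
      moreover have "W * (1 + 2 * \<eta>) * ((2 + \<eta>) powr \<gamma> * A powr \<gamma>) + W * (\<eta> powr \<gamma> * A powr \<gamma>)
         = (W * A powr \<gamma>) * ((1 + 2 * \<eta>) * (2 + \<eta>) powr \<gamma> + \<eta> powr \<gamma>)" by (simp add: algebra_simps)
      moreover have "\<dots> \<le> (W * A powr \<gamma>) * (2 - \<kappa>)" using \<eta>(4) W by (intro mult_left_mono) auto
      moreover have "(W * A powr \<gamma>) * (2 - \<kappa>) = 2 * W * A powr \<gamma> - \<kappa> * (W * A powr \<gamma>)" by (simp add: algebra_simps)
      ultimately have diff: "\<kappa> * (W * A powr \<gamma>) \<le> (U x - U (x + z)) - (V y - V (y + z))"
        using H2[OF rR] unfolding a_def[symmetric] A_def[symmetric] by linarith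
      moreover have "0 \<le> \<kappa> * (W * A powr \<gamma>)" using \<eta> W by simp
      ultimately have "V y - V (y + z) \<le> U x - U (x + z)" by linarith
      from spow_diff_ge[OF p this] have "(((U x - U (x + z)) - (V y - V (y + z))) / 4) powr (p - 1) \<le> H z" by (simp add: H_def)
      moreover have "G \<le> (((U x - U (x + z)) - (V y - V (y + z))) / 4) powr (p - 1)"
        unfolding G_def using diff \<eta> W p by (intro powr_mono2) auto
      ultimately have GH: "G \<le> H z" by linarith
      \<comment> \<open>Since \<open>?r \<le> R / 2\<close> and \<open>q > 1\<close>, subtracting
        \<open>R powr (- q)\<close> removes at most half of the kernel.\<close>
      have "1/2 * (2 * A) powr (- q) \<le> k z"
      proof -
        have "R powr (- q) \<le> (2 * ?r) powr (- q)" using r q_pos by (intro powr_mono2') auto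
        also have "\<dots> = 2 powr (- q) * ?r powr (- q)" by (simp add: powr_mult)
        also have "2 powr (- q) \<le> (2::real) powr (- 1)" using q_pos by (intro powr_mono) auto
        finally have "R powr (- q) \<le> 1/2 * ?r powr (- q)" by (simp add: mult_right_mono)
        moreover have "(2 * A) powr (- q) \<le> ?r powr (- q)" using r q_pos by (intro powr_mono2') auto
        ultimately show ?thesis by (simp add: k_def)
      qed
      then show ?thesis unfolding g_def using GH G k(1)[OF ballZ(1)[OF z]] by (intro mult_mono) auto
    qed
    have iH: "set_integrable lebesgue Z (\<lambda>z. H z * k z)"
      using set_integral_diff(1)[OF iU iV] unfolding H_def k_def Z_def A_def a_def by (simp add: left_diff_distrib)
    have LH: "(LINT z:Z|lebesgue. H z * k z) = (LINT z:Z|lebesgue. spow p (U x - U (x + z)) * k z) - (LINT z:Z|lebesgue. spow p (V y - V (y + z)) * k z)"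
      using set_integral_diff(2)[OF iU iV] unfolding H_def k_def Z_def A_def a_def by (simp add: left_diff_distrib)
    have \<rho>: "\<delta> * A > 0" using \<delta> A by simp
    have io: "set_integrable lebesgue Z (\<lambda>z. K * norm z powr (- (?n + e)))"
      using set_integrable_subset[OF out(1)[OF \<rho>] Zs] by (intro set_integrable_mult_right) (auto simp: Z_def)
    have ib: "set_integrable lebesgue Z (\<lambda>z. g * indicator ?B z)"
      unfolding set_integrable_def
    proof -
      have "integrable lebesgue (\<lambda>z. g * indicator ?B z)"
        by (intro integrable_mult_right integrable_real_indicator) (auto simp: emeasure_ball A \<eta> less_imp_le)
      moreover have "(\<lambda>z. indicator Z z *\<^sub>R (g * indicator ?B z)) = (\<lambda>z. g * indicator ?B z)"
        using ballZ(1) by (auto simp: indicator_def fun_eq_iff)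
      ultimately show "integrable lebesgue (\<lambda>z. indicator Z z *\<^sub>R (g * indicator ?B z))" by simp
    qed
    have "(LINT z:Z|lebesgue. g * indicator ?B z - K * norm z powr (- (?n + e))) \<le> (LINT z:Z|lebesgue. H z * k z) + (LINT z:Z|lebesgue. 0)"
    proof -
      have "(LINT z:Z|lebesgue. g * indicator ?B z - K * norm z powr (- (?n + e))) \<le> (LINT z:Z|lebesgue. H z * k z)"
      proof (rule LINT_mono_set[OF set_integral_diff(1)[OF ib io] iH])
        fix z assume z: "z \<in> Z"
        have "0 \<le> K * norm z powr (- (?n + e))" using K by simp
        then show "g * indicator ?B z - K * norm z powr (- (?n + e)) \<le> H z * k z"
          using err[OF z] gain[of z] by (auto simp: indicator_def)
      qed
      then show ?thesis by (simp add: set_lebesgue_integral_def)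
    qed
    also have "(LINT z:Z|lebesgue. g * indicator ?B z - K * norm z powr (- (?n + e)))
        = (LINT z:Z|lebesgue. g * indicator ?B z) - K * (LINT z:Z|lebesgue. norm z powr (- (?n + e)))"
      using set_integral_diff(2)[OF ib io] by simp
    also have "(LINT z:Z|lebesgue. g * indicator ?B z) = g * (?v * (\<eta> * A) powr ?n)"
    proof -
      have "(\<lambda>z. indicator Z z *\<^sub>R (g * indicator ?B z)) = (\<lambda>z. g * indicator ?B z)"
        using ballZ(1) by (auto simp: indicator_def fun_eq_iff)
      then have "(LINT z:Z|lebesgue. g * indicator ?B z) = integral\<^sup>L lebesgue (\<lambda>z. g * indicator ?B z)"
        unfolding set_lebesgue_integral_def by (simp only:)
      also have "\<dots> = g * measure lebesgue ?B" by simp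
      also have "measure lebesgue ?B = ?v * (\<eta> * A) powr ?n"
        using content_ball[of "\<eta> * A" a] \<eta> A by (simp add: powr_realpow measure_completion)
      finally show ?thesis .
    qed
    finally have main: "g * (?v * (\<eta> * A) powr ?n) - K * (LINT z:Z|lebesgue. norm z powr (- (?n + e))) \<le> (LINT z:Z|lebesgue. H z * k z)"
      by (simp add: set_lebesgue_integral_def)
    have "(LINT z:Z|lebesgue. norm z powr (- (?n + e))) \<le> C0 * (\<delta> * A) powr (- e)"
      using LINT_nonneg_mono_sets[OF out(1)[OF \<rho>] Zs] out(2)[OF \<rho>] by (force simp: Z_def)
    then have o2: "K * (LINT z:Z|lebesgue. norm z powr (- (?n + e))) \<le> K * (C0 * (\<delta> * A) powr (- e))"
      using K by (rule mult_left_mono)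
    have X1: "g * (?v * (\<eta> * A) powr ?n) = c * (W powr (p - 1) * A powr (\<gamma> * (p - 1) - s * p))"
    proof -
      have "G = (\<kappa> / 4) powr (p - 1) * W powr (p - 1) * A powr (\<gamma> * (p - 1))"
        unfolding G_def using W \<eta> by (simp add: powr_mult powr_powr powr_divide)
      moreover have "A powr (\<gamma> * (p - 1)) * A powr (- q) * A powr ?n = A powr (\<gamma> * (p - 1) - s * p)"
        unfolding powr_add[symmetric] by (simp add: q)
      ultimately show ?thesis
        unfolding g_def c_def using \<eta> A by (simp add: powr_mult mult_ac)
    qed
    have X2: "K * (C0 * (\<delta> * A) powr (- e)) = C * \<delta> powr (- e) * (A / R) powr \<nu> * (W powr (p - 1) * A powr (\<gamma> * (p - 1) - s * p))"
    proof -
      have "(A / R) powr \<nu> = A powr \<nu> * R powr (- \<nu>)" using A R by (simp add: powr_divide powr_minus_divide)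
      moreover have "A powr \<gamma> * A powr (- e) = A powr \<nu> * A powr (\<gamma> * (p - 1) - s * p)"
        unfolding powr_add[symmetric] by (simp add: e_def algebra_simps)
      ultimately show ?thesis unfolding K_def C_def using \<delta> A by (simp add: powr_mult mult_ac)
    qed
    have "(c - C * \<delta> powr (- e) * (A / R) powr \<nu>) * (W powr (p - 1) * A powr (\<gamma> * (p - 1) - s * p)) \<le> (LINT z:Z|lebesgue. H z * k z)"
      using main o2 X1 X2 by (simp add: left_diff_distrib)
    then have "(c - C * \<delta> powr (- e) * (A / R) powr \<nu>) * (W powr (p - 1) * A powr (\<gamma> * (p - 1) - s * p))
      \<le> (LINT z:Z|lebesgue. spow p (U x - U (x + z)) * k z) - (LINT z:Z|lebesgue. spow p (V y - V (y + z)) * k z)"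
      by (simp only: LH)
    then show ?case unfolding k_def Z_def A_def a_def e_def .
  qed
qed

end

text \<open>At \<open>\<eta> = 0\<close> the left side equals \<open>2 powr \<gamma> < 2\<close>;
  \<open>\<kappa>\<close> is half of this gap, and continuity leaves room for a positive
  \<open>\<eta>\<close>.\<close>

lemma powr_concavity_gap:
  fixes \<gamma> :: real
  assumes "0 < \<gamma>" "\<gamma> < 1"
  obtains \<eta> \<kappa> where "0 < \<eta>" "\<eta> < 1" "\<kappa> > 0" "(1 + 2 * \<eta>) * (2 + \<eta>) powr \<gamma> + \<eta> powr \<gamma> \<le> 2 - \<kappa>"
proof -
  define \<kappa> where "\<kappa> = (2 - 2 powr \<gamma>) / 2"
  have "2 powr \<gamma> < (2::real) powr 1" using assms by (intro powr_less_mono) auto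
  then have \<kappa>: "\<kappa> > 0" and lt: "2 powr \<gamma> < 2 - \<kappa>" by (auto simp: \<kappa>_def field_simps)
  have "((\<lambda>\<eta>. (1 + 2 * \<eta>) * (2 + \<eta>) powr \<gamma> + \<eta> powr \<gamma>) \<longlongrightarrow> (1 + 2 * 0) * (2 + 0) powr \<gamma> + 0 powr \<gamma>) (at_right (0::real))"
    using assms by (intro tendsto_intros tendsto_powr') (auto simp: eventually_at_right_field intro!: exI[of _ 1])
  then have "\<forall>\<^sub>F \<eta> in at_right 0. (1 + 2 * \<eta>) * (2 + \<eta>) powr \<gamma> + \<eta> powr \<gamma> < 2 - \<kappa>"
    using lt assms by (intro order_tendstoD(2)) auto
  then obtain b where b: "b > 0" "\<And>\<eta>. 0 < \<eta> \<Longrightarrow> \<eta> < b \<Longrightarrow> (1 + 2 * \<eta>) * (2 + \<eta>) powr \<gamma> + \<eta> powr \<gamma> < 2 - \<kappa>"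
    unfolding eventually_at_right_field by auto
  show ?thesis
    by (rule that[of "min (b / 2) (1 / 2)" \<kappa>]) (use b(1) \<kappa> b(2)[of "min (b / 2) (1 / 2)"] in \<open>auto simp: less_imp_le\<close>)
qed

lemma small_powr_exists:
  fixes K e b m :: real
  assumes "K \<ge> 0" "e > 0" "b > 0" "m > 0"
  obtains d where "0 < d" "d \<le> m" "K * d powr e \<le> b"
proof (rule that[of "min m ((b / (K + 1)) powr (1 / e))"])
  let ?t = "(b / (K + 1)) powr (1 / e)"
  have "min m ?t powr e \<le> ?t powr e" using assms by (intro powr_mono2) auto
  also have "\<dots> = b / (K + 1)" using assms by (simp add: powr_powr)
  finally have "K * min m ?t powr e \<le> K * (b / (K + 1))" using assms by (intro mult_left_mono) auto
  also have "\<dots> \<le> b" using assms by (simp add: field_simps)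
  finally show "K * min m ?t powr e \<le> b" .
qed (use assms in auto)

context frac_params
begin

text \<open>
  \<open>U\<close> and \<open>V\<close> are two time slices of the solution, \<open>W * norm (x - y) powr \<gamma>\<close> is the weighted modulus at
  the maximum point, \<open>R\<close> the scale on which the weight varies, and \<open>\<Theta>\<close> the sum of the time
  derivatives of the two test functions.  The free parameter \<open>\<zeta>\<close> separates the tail of \<open>U - V\<close> by Young's inequality.
\<close>

lemma elliptic_core:
  assumes \<gamma>: "0 < \<gamma>" "\<gamma> < 1" "\<gamma> * (p - 2) < s * p" and CE: "CE \<ge> 0" and ct: "ct \<ge> 0"
  obtains \<delta> \<epsilon> C where "0 < \<delta>" "\<delta> < 1" "0 < \<epsilon>" "\<epsilon> \<le> 1 / 4" "C > 0"
    "\<And>(x::real^'n) y U V W R \<Theta> \<zeta>. x \<noteq> y \<Longrightarrow> 0 < R \<Longrightarrow> R \<le> 1 \<Longrightarrow> norm (x - y) \<le> \<epsilon> * R \<Longrightarrow> 1 \<le> W \<Longrightarrow>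
     W * norm (x - y) powr \<gamma> \<le> 2 \<Longrightarrow> norm x \<le> 1 \<Longrightarrow> norm y \<le> 1 \<Longrightarrow> \<bar>U x\<bar> \<le> 1 \<Longrightarrow> \<bar>V y\<bar> \<le> 1 \<Longrightarrow>
     tail_ok U \<Longrightarrow> tail_mass U \<le> 1 \<Longrightarrow> tail_ok V \<Longrightarrow> tail_mass V \<le> 1 \<Longrightarrow>
     (\<And>z. norm z \<le> R \<Longrightarrow> - (W * norm (x - y) powr \<gamma> * norm z / R) \<le> (U x - U (x + z)) - (V y - V (y + z))) \<Longrightarrow>
     (\<And>z. norm z \<le> R \<Longrightarrow> 2 * W * norm (x - y) powr \<gamma> - W * (1 + norm z / R) * norm (x - y + z) powr \<gamma> - W * norm (x - y - z) powr \<gamma>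
         \<le> (U x - U (x + z)) - (V y - V (y + z))) \<Longrightarrow>
     (\<And>z. norm z \<le> R \<Longrightarrow> \<bar>U x - U (x + z)\<bar> \<le> 8 * W * norm z powr \<gamma>) \<Longrightarrow>
     (\<And>z. norm z \<le> R \<Longrightarrow> \<bar>V y - V (y + z)\<bar> \<le> 8 * W * norm z powr \<gamma>) \<Longrightarrow>
     0 < \<zeta> \<Longrightarrow> \<zeta> \<le> 1 \<Longrightarrow>
     \<Theta> + (LINT w:{w. \<delta> * norm (x - y) \<le> norm (x - w)}|lebesgue. frac_kernel p s U x w)
       - (LINT w:{w. \<delta> * norm (x - y) \<le> norm (y - w)}|lebesgue. frac_kernel p s V y w)
       \<le> CE * \<delta> powr (p - s * p) * (W powr (p - 1) * norm (x - y) powr (\<gamma> * (p - 1) - s * p)) \<Longrightarrow>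
     - (ct * W * norm (x - y) powr \<gamma> / R) \<le> \<Theta> \<Longrightarrow>
     W powr (p - 1) * norm (x - y) powr (\<gamma> * (p - 1) - s * p)
       \<le> C * R powr (- q - 1) * (W * norm (x - y) powr \<gamma> + \<bar>U x - V y\<bar> + \<zeta> + \<zeta> powr (2 - p) * tail_mass (\<lambda>w. U w - V w))"
proof -
  \<comment> \<open>Half of the available gap keeps \<open>\<gamma> * (p - 2) + \<nu>\<close>
    strictly below \<open>s * p\<close>.\<close>
  define \<nu> where "\<nu> = min 1 ((s * p - \<gamma> * (p - 2)) / 2)"
  have \<nu>: "0 < \<nu>" "\<nu> \<le> 1" "\<gamma> * (p - 2) + \<nu> < s * p"
  proof -
    define g where "g = s * p - \<gamma> * (p - 2)"
    have "g > 0" using \<gamma> by (simp add: g_def)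
    moreover have "\<nu> = min 1 (g / 2)" by (simp add: \<nu>_def g_def)
    ultimately show "0 < \<nu>" "\<nu> \<le> 1" by auto
    have "\<nu> \<le> g / 2" unfolding \<nu>_def g_def by (rule min.cobounded2)
    then show "\<gamma> * (p - 2) + \<nu> < s * p" proof -
      assume "\<nu> \<le> g / 2"
      then have "\<nu> < g" using \<open>g > 0\<close> by simp
      then show ?thesis by (simp add: g_def algebra_simps)
    qed
  qed
  obtain \<eta> \<kappa> where \<eta>: "0 < \<eta>" "\<eta> < 1" "\<kappa> > 0" "(1 + 2 * \<eta>) * (2 + \<eta>) powr \<gamma> + \<eta> powr \<gamma> \<le> 2 - \<kappa>"
    by (rule powr_concavity_gap[OF \<gamma>(1,2)])
  show ?thesis
  proof (rule near_difference[OF \<gamma>(1,2) \<nu> \<eta>], goal_cases)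
    case (1 c1 C1)
    note c1 = 1(1) and C1 = 1(2) and near = 1(3)
    \<comment> \<open>The gain constant \<open>c1\<close> does not depend on
      \<open>\<delta>\<close>, so \<open>\<delta>\<close> can be chosen to make the error of the two
      test functions at most a quarter of the gain.\<close>
    obtain \<delta> where \<delta>: "0 < \<delta>" "\<delta> \<le> 1 - \<eta>" "CE * \<delta> powr (p - s * p) \<le> c1 / 4"
      using small_powr_exists[of CE "p - s * p" "c1 / 4" "1 - \<eta>"] CE sp c1 \<eta> by auto
    define D where "D = C1 * \<delta> powr (- (s * p - \<gamma> * (p - 2) - \<nu>))"
    \<comment> \<open>Chosen after \<open>\<delta>\<close>, since \<open>D\<close> grows as
      \<open>\<delta>\<close> shrinks; the variation of the weight then costs another quarter of the
      gain.\<close>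
    obtain \<epsilon> where \<epsilon>: "0 < \<epsilon>" "\<epsilon> \<le> min \<eta> (1/4)" "D * \<epsilon> powr \<nu> \<le> c1 / 4"
      using small_powr_exists[of D \<nu> "c1 / 4" "min \<eta> (1/4)"] C1 \<nu> c1 \<eta> by (auto simp: D_def)
    define TW where "TW = integral\<^sup>L lebesgue tailw"
    have TW: "TW \<ge> 0" unfolding TW_def using tailw_pos by (intro Bochner_Integration.integral_nonneg) (auto intro: less_imp_le)
    define K1 where "K1 = (p - 1 + 2 * q) * (1 + 2 powr q)"
    have K1: "K1 \<ge> 0" using p q_pos by (simp add: K1_def)
    define K2 where "K2 = 8 powr (p - 1) * 2 powr (p - 2) * (1 + 2 powr q) * TW"
    have K2: "K2 \<ge> 0" using TW by (simp add: K2_def)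
    define K where "K = ct + K1 * (tail_const + 1) + 2 * K2"
    have K: "K \<ge> 0" using K1 K2 ct tail_const_pos by (simp add: K_def)
    show ?case
    proof (rule that[of \<delta> \<epsilon> "2 * (K + 1) / c1"], goal_cases)
      case (6 x y U V W R \<Theta> \<zeta>)
      note ne = 6(1) and R = 6(2,3) and aR = 6(4) and W = 6(5) and wa2 = 6(6) and x = 6(7) and y = 6(8)
        and Ux = 6(9) and Vy = 6(10) and U = 6(11,12) and V = 6(13,14) and H1 = 6(15) and H2 = 6(16) and H3 = 6(17,18)
        and \<zeta> = 6(19,20) and ineq = 6(21) and \<Theta> = 6(22)
      define A where "A = norm (x - y)"
      define X where "X = W powr (p - 1) * A powr (\<gamma> * (p - 1) - s * p)"
      define wa where "wa = W * A powr \<gamma>"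
      define M where "M = tail_mass (\<lambda>w. U w - V w)"
      have A: "A > 0" using ne by (simp add: A_def)
      have X: "X \<ge> 0" by (simp add: X_def)
      have wa: "0 \<le> wa" "wa \<le> 2" using W wa2 by (auto simp: wa_def A_def)
      have M: "M \<ge> 0" unfolding M_def tail_mass_def
        by (intro Bochner_Integration.integral_nonneg mult_nonneg_nonneg less_imp_le[OF tailw_pos]) auto
      have \<epsilon>1: "\<epsilon> \<le> 1/4" "\<epsilon> \<le> \<eta>" using \<epsilon> by auto
      have A1: "A \<le> \<eta> * R" "A \<le> R / 4"
      proof -
        have "\<epsilon> * R \<le> \<eta> * R" "\<epsilon> * R \<le> 1/4 * R" using \<epsilon>1 R by (auto intro: mult_right_mono)
        then show "A \<le> \<eta> * R" "A \<le> R / 4" using aR by (auto simp: A_def)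
      qed
      have A_le1: "A \<le> 1" using A1 R by simp
      \<comment> \<open>This absorbs the term \<open>norm (x - y)\<close> of the far difference into
        \<open>wa\<close>.\<close>
      have Awa: "A \<le> wa"
      proof -
        have "A powr 1 \<le> A powr \<gamma>" using A A_le1 \<gamma> by (intro powr_mono') auto
        also have "\<dots> \<le> W * A powr \<gamma>" using W mult_right_mono[of 1 W "A powr \<gamma>"] by simp
        finally show ?thesis using A by (simp add: wa_def)
      qed
      define \<rho> where "\<rho> = \<delta> * A"
      have \<rho>: "0 < \<rho>" "\<rho> \<le> R" "\<rho> \<le> A"
      proof -
        show "0 < \<rho>" using \<delta> A by (simp add: \<rho>_def)
        have "\<delta> * A \<le> 1 * A" using \<delta> \<eta> A by (intro mult_right_mono) auto
        then show "\<rho> \<le> A" by (simp add: \<rho>_def)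
        then show "\<rho> \<le> R" using A1 R by simp
      qed
      note kU = kernel_split[OF U x Ux R \<rho>(1,2)]
      note kV = kernel_split[OF V y Vy R \<rho>(1,2)]
      define NU where "NU = (LINT z:{z. \<rho> \<le> norm z \<and> norm z < R}|lebesgue. spow p (U x - U (x + z)) * (norm z powr (- q) - R powr (- q)))"
      define NV where "NV = (LINT z:{z. \<rho> \<le> norm z \<and> norm z < R}|lebesgue. spow p (V y - V (y + z)) * (norm z powr (- q) - R powr (- q)))"
      define FU where "FU = integral\<^sup>L lebesgue (\<lambda>w. spow p (U x - U w) * farw R x w)"
      define FV where "FV = integral\<^sup>L lebesgue (\<lambda>w. spow p (V y - V w) * farw R y w)"
      define SU where "SU = (LINT w:{w. norm (x - w) < \<rho>}|lebesgue. spow p (U x - U w) * farw R x w)"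
      define SV where "SV = (LINT w:{w. norm (y - w) < \<rho>}|lebesgue. spow p (V y - V w) * farw R y w)"
      have nearXY: "(c1 - D * (A / R) powr \<nu>) * X \<le> NU - NV"
        using near[OF ne \<delta>(1,2) R(1) A1[unfolded A_def] W kU(1)[unfolded \<rho>_def A_def] kV(1)[unfolded \<rho>_def A_def] H1 H2 H3]
        unfolding D_def X_def NU_def NV_def \<rho>_def A_def by blast
      have "(A / R) powr \<nu> \<le> \<epsilon> powr \<nu>" using aR A R \<nu> by (intro powr_mono2) (auto simp: A_def field_simps)
      moreover have "D \<ge> 0" using C1 by (simp add: D_def)
      ultimately have "D * (A / R) powr \<nu> \<le> D * \<epsilon> powr \<nu>" by (rule mult_left_mono)
      then have "D * (A / R) powr \<nu> \<le> c1 / 4" using \<epsilon>(3) by linarith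
      then have "(c1 - c1 / 4) * X \<le> (c1 - D * (A / R) powr \<nu>) * X" using X by (intro mult_right_mono) auto
      with nearXY have n1: "3 / 4 * c1 * X \<le> NU - NV" by simp
      have ineq': "\<Theta> + (NU + FU - SU) - (NV + FV - SV) \<le> c1 / 4 * X"
      proof -
        have "CE * \<delta> powr (p - s * p) * X \<le> c1 / 4 * X" using \<delta>(3) X by (rule mult_right_mono)
        then show ?thesis using ineq kU(2) kV(2)
          unfolding NU_def NV_def FU_def FV_def SU_def SV_def X_def \<rho>_def A_def by linarith
      qed
      have RR: "1 / R \<le> R powr (- q - 1)" "R powr (- q) \<le> R powr (- q - 1)"
      proof -
        have "R powr (-1) \<le> R powr (- q - 1)" using R q_pos by (intro powr_mono') auto
        then show "1 / R \<le> R powr (- q - 1)" using R by (simp add: powr_minus_divide)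
        show "R powr (- q) \<le> R powr (- q - 1)" using R by (intro powr_mono') auto
      qed
      define r where "r = R powr (- q - 1)"
      have r: "r \<ge> 0" by (simp add: r_def)
      \<comment> \<open>The power \<open>p - 1\<close> of \<open>wa\<close> is reduced to the first
        power by \<open>wa \<le> 2\<close>, so that all lower-order terms are linear in
        \<open>wa\<close>.\<close>
      have small: "\<bar>S\<bar> \<le> K2 * r * wa"
        if "\<bar>S\<bar> \<le> (8 * W * \<rho> powr \<gamma>) powr (p - 1) * (1 + 2 powr q) * R powr (- q) * TW" for S
      proof -
        have "(8 * W * \<rho> powr \<gamma>) powr (p - 1) \<le> (8 * wa) powr (p - 1)"
          unfolding wa_def using W \<rho> \<gamma> p powr_mono2[OF _ _ \<rho>(3), of \<gamma>] by (intro powr_mono2) (auto simp: mult.assoc)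
        also have "\<dots> = 8 powr (p - 1) * (wa powr (p - 2) * wa powr 1)"
          using wa unfolding powr_add[symmetric] by (simp add: powr_mult)
        also have "\<dots> \<le> 8 powr (p - 1) * (2 powr (p - 2) * wa)"
          using wa p by (intro mult_left_mono mult_mono powr_mono2) auto
        finally have "(8 * W * \<rho> powr \<gamma>) powr (p - 1) * (1 + 2 powr q) * R powr (- q) * TW \<le> 8 powr (p - 1) * (2 powr (p - 2) * wa) * (1 + 2 powr q) * r * TW"
          using TW RR(2) wa by (intro mult_mono) (auto simp: r_def)
        also have "\<dots> = K2 * r * wa" by (simp add: K2_def mult_ac)
        finally show ?thesis using that by linarith
      qed
      have H3': "\<bar>U x - U (x + z)\<bar> \<le> 8 * W * \<rho> powr \<gamma>" "\<bar>V y - V (y + z)\<bar> \<le> 8 * W * \<rho> powr \<gamma>" if "norm z < \<rho>" for z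
      proof -
        have "norm z \<le> R" using that \<rho> by simp
        moreover have "8 * W * norm z powr \<gamma> \<le> 8 * W * \<rho> powr \<gamma>"
          using that W \<gamma> by (intro mult_left_mono powr_mono2) auto
        ultimately show "\<bar>U x - U (x + z)\<bar> \<le> 8 * W * \<rho> powr \<gamma>" "\<bar>V y - V (y + z)\<bar> \<le> 8 * W * \<rho> powr \<gamma>"
          using H3[of z] by auto
      qed
      have SU: "\<bar>SU\<bar> \<le> K2 * r * wa"
        using near_small_part[OF U x Ux R \<rho>(1,2) H3'(1)] by (intro small) (simp add: SU_def TW_def)
      have SV: "\<bar>SV\<bar> \<le> K2 * r * wa"
        using near_small_part[OF V y Vy R \<rho>(1,2) H3'(2)] by (intro small) (simp add: SV_def TW_def)
      have F: "\<bar>FU - FV\<bar> \<le> K1 * r * ((\<bar>U x - V y\<bar> + A + \<zeta>) * tail_const + \<zeta> powr (2 - p) * M)"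
        using far_difference[OF U V x Ux y Vy R \<zeta>] by (simp add: FU_def FV_def K1_def r_def A_def M_def)
      have T: "- \<Theta> \<le> ct * r * wa"
      proof -
        have "ct * wa * (1 / R) \<le> ct * wa * r" using RR(1) ct wa by (intro mult_left_mono) (auto simp: r_def)
        then show ?thesis using \<Theta> by (simp add: wa_def A_def mult_ac)
      qed
      define Y where "Y = wa + \<bar>U x - V y\<bar> + \<zeta> + \<zeta> powr (2 - p) * M"
      have zM: "0 \<le> \<zeta> powr (2 - p) * M" using M by simp
      have Y: "Y \<ge> 0" "wa \<le> Y" "(\<bar>U x - V y\<bar> + A + \<zeta>) * tail_const + \<zeta> powr (2 - p) * M \<le> (tail_const + 1) * Y"
      proof -
        show "Y \<ge> 0" "wa \<le> Y" using wa \<zeta> zM by (auto simp: Y_def)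
        have "(\<bar>U x - V y\<bar> + A + \<zeta>) * tail_const \<le> Y * tail_const"
          using Awa zM tail_const_pos by (intro mult_right_mono) (auto simp: Y_def)
        moreover have "\<zeta> powr (2 - p) * M \<le> Y" using wa \<zeta> by (simp add: Y_def)
        ultimately show "(\<bar>U x - V y\<bar> + A + \<zeta>) * tail_const + \<zeta> powr (2 - p) * M \<le> (tail_const + 1) * Y"
          by (simp add: algebra_simps)
      qed
      have F': "\<bar>FU - FV\<bar> \<le> K1 * (tail_const + 1) * (r * Y)"
      proof -
        have "K1 * r * ((\<bar>U x - V y\<bar> + A + \<zeta>) * tail_const + \<zeta> powr (2 - p) * M) \<le> K1 * r * ((tail_const + 1) * Y)"
          using Y(3) K1 r by (intro mult_left_mono) auto
        then show ?thesis using F by (simp add: mult_ac)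
      qed
      have rY: "r * wa \<le> r * Y" "0 \<le> r * Y" using Y r by (auto intro: mult_left_mono)
      have "ct * r * wa \<le> ct * (r * Y)" "K2 * r * wa \<le> K2 * (r * Y)"
        using mult_left_mono[OF rY(1) ct] mult_left_mono[OF rY(1) K2] by (auto simp: mult.assoc)
      \<comment> \<open>With both quarters spent, half of the gain remains against the lower-order
        terms.\<close>
      then have "3 / 4 * c1 * X \<le> c1 / 4 * X + ct * (r * Y) + K1 * (tail_const + 1) * (r * Y) + 2 * (K2 * (r * Y))"
        using n1 ineq' T SU SV F' by linarith
      then have "c1 / 2 * X \<le> ct * (r * Y) + K1 * (tail_const + 1) * (r * Y) + 2 * (K2 * (r * Y))" by linarith
      also have "\<dots> = K * (r * Y)" by (simp only: K_def distrib_right mult.assoc)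
      also have "\<dots> \<le> (K + 1) * (r * Y)" using rY by (intro mult_right_mono) auto
      finally have "X \<le> 2 * (K + 1) / c1 * (r * Y)" using c1 by (simp add: field_simps)
      then show ?case by (simp add: X_def r_def Y_def wa_def A_def M_def mult.assoc)
    qed (use \<delta> \<epsilon> \<eta> K c1 in auto)
  qed
qed

end

subsection \<open>Spatial weights\<close>

definition sweight :: "nat \<Rightarrow> 'a::real_normed_vector \<Rightarrow> real" where
  "sweight k x = (1 / (1 - (norm x)\<^sup>2)) ^ k"

lemma sweight_pos: "norm x < 1 \<Longrightarrow> sweight k x > 0"
  by (simp add: sweight_def power_less_one_iff abs_square_less_1)

text \<open>With \<open>m = 1 - |x|^2\<close>, a shift changes \<open>m\<close> by the relative
  amount \<open>r = \<sigma> / m\<close>. On the scale \<open>R\<close> even \<open>y = k r\<close>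
  is at most \<open>3/8\<close>, so Bernoulli's inequality and
  \<open>1 / (1 - y) \<le> 1 + y + 2 y^2\<close> give a quadratic upper bound uniformly up to the
  boundary. The linear coefficient is the logarithmic gradient of the weight.\<close>

lemma sweight_quadratic:
  fixes x z :: "'a::real_inner"
  assumes x: "norm x < 1" and k: "1 \<le> k" and R: "0 < R" "R \<le> (1 - (norm x)\<^sup>2) / (16 * real k)"
    and z: "norm z \<le> 2 * R"
  shows "(1 - (norm x)\<^sup>2) / 2 \<le> 1 - (norm (x + z))\<^sup>2"
    and "sweight k (x + z) \<le> sweight k x * (1 + ((2 * real k / (1 - (norm x)\<^sup>2)) *\<^sub>R x) \<bullet> z + (norm z)\<^sup>2 / (8 * R\<^sup>2))"
proof -
  define m where "m = 1 - (norm x)\<^sup>2"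
  define \<sigma> where "\<sigma> = 2 * (x \<bullet> z) + (norm z)\<^sup>2"
  define K where "K = real k"
  have K: "K \<ge> 1" using k by (simp add: K_def)
  have m: "0 < m" "m \<le> 1" using x by (auto simp: m_def power_less_one_iff abs_square_less_1)
  have Rm: "R * (16 * K) \<le> m" using R(2) K by (simp add: m_def K_def field_simps)
  have R1: "R * 16 \<le> R * (16 * K)" using R(1) K by simp
  have z1: "norm z \<le> 1" using z R1 Rm m by linarith
  have sq: "(norm (x + z))\<^sup>2 = (norm x)\<^sup>2 + \<sigma>"
    by (simp add: \<sigma>_def power2_norm_eq_inner inner_add inner_commute)
  have "\<bar>x \<bullet> z\<bar> \<le> norm x * norm z" by (rule Cauchy_Schwarz_ineq2)
  also have "\<dots> \<le> 1 * norm z" using x by (intro mult_right_mono) auto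
  finally have xz: "\<bar>x \<bullet> z\<bar> \<le> norm z" by simp
  have zz: "(norm z)\<^sup>2 \<le> norm z" using z1 by (simp add: power2_eq_square mult_left_le)
  have \<sigma>: "\<bar>\<sigma>\<bar> \<le> 3 * norm z" using xz zz zero_le_power2[of "norm z"] unfolding \<sigma>_def by linarith
  have K\<sigma>: "K * \<bar>\<sigma>\<bar> \<le> 3 / 8 * m"
  proof -
    have "K * \<bar>\<sigma>\<bar> \<le> K * (6 * R)" using \<sigma> z K by (intro mult_left_mono) auto
    then show ?thesis using Rm by (simp add: mult_ac)
  qed
  have "\<bar>\<sigma>\<bar> \<le> K * \<bar>\<sigma>\<bar>" using K mult_right_mono[of 1 K "\<bar>\<sigma>\<bar>"] by simp
  then have \<sigma>m: "\<bar>\<sigma>\<bar> \<le> 3 / 8 * m" using K\<sigma> by linarith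
  then show "(1 - (norm x)\<^sup>2) / 2 \<le> 1 - (norm (x + z))\<^sup>2"
    unfolding sq using m by (simp add: m_def abs_le_iff)
  define r where "r = \<sigma> / m"
  define y where "y = K * r"
  have y: "\<bar>y\<bar> \<le> 3 / 8" using K\<sigma> m K by (simp add: y_def r_def abs_mult field_simps)
  have r: "\<bar>r\<bar> \<le> 3 / 8" using \<sigma>m m by (simp add: r_def field_simps)
  have bern: "1 - y \<le> (1 - r) ^ k"
    using Bernoulli_inequality[of "- r" k] r by (simp add: y_def K_def)
  have "1 / (1 - r) ^ k \<le> 1 / (1 - y)" using bern y by (intro divide_left_mono mult_pos_pos) auto
  also have "\<dots> \<le> 1 + y + 2 * y\<^sup>2"
  proof -
    have "(1 + y + 2 * y\<^sup>2) * (1 - y) = 1 + y\<^sup>2 * (1 - 2 * y)" by (simp add: power2_eq_square algebra_simps)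
    moreover have "0 \<le> y\<^sup>2 * (1 - 2 * y)" using y by (intro mult_nonneg_nonneg) auto
    moreover have "0 < 1 - y" using y by linarith
    ultimately show ?thesis by (subst pos_divide_le_eq) linarith+
  qed
  finally have b1: "1 / (1 - r) ^ k \<le> 1 + y + 2 * y\<^sup>2" .
  have "sweight k (x + z) = sweight k x * (1 / (1 - r) ^ k)"
  proof -
    have "1 - (norm (x + z))\<^sup>2 = m * (1 - r)" unfolding sq using m by (simp add: r_def m_def field_simps)
    then show ?thesis by (simp add: sweight_def m_def power_mult_distrib power_divide)
  qed
  also have "\<dots> \<le> sweight k x * (1 + y + 2 * y\<^sup>2)"
    using b1 sweight_pos[OF x, of k] by (intro mult_left_mono) auto
  also have "\<dots> \<le> sweight k x * (1 + ((2 * real k / (1 - (norm x)\<^sup>2)) *\<^sub>R x) \<bullet> z + (norm z)\<^sup>2 / (8 * R\<^sup>2))"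
  proof (intro mult_left_mono less_imp_le[OF sweight_pos[OF x]])
    define j where "j = K / m"
    have j: "1 \<le> j" "j * R \<le> 1 / 16" using K m Rm by (auto simp: j_def field_simps)
    have "y = 2 * j * (x \<bullet> z) + j * (norm z)\<^sup>2" using m by (simp add: y_def r_def \<sigma>_def j_def field_simps)
    moreover have "j * (norm z)\<^sup>2 \<le> j\<^sup>2 * (norm z)\<^sup>2" using j by (intro mult_right_mono) (auto simp: power2_eq_square)
    \<comment> \<open>The 18 is \<open>2 * 3^2\<close> from \<open>|\<sigma>| \<le> 3 |z|\<close>;
      one more unit comes from the quadratic part of \<open>y\<close>, and
      \<open>19 * 8 \<le> 16^2\<close> closes the estimate.\<close>
    moreover have "2 * y\<^sup>2 \<le> 18 * (j\<^sup>2 * (norm z)\<^sup>2)"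
    proof -
      have "\<bar>y\<bar> = j * \<bar>\<sigma>\<bar>" using j m K by (simp add: y_def r_def j_def abs_mult)
      also have "\<dots> \<le> j * (3 * norm z)" using \<sigma> j by (intro mult_left_mono) auto
      finally have "\<bar>y\<bar>\<^sup>2 \<le> (j * (3 * norm z))\<^sup>2" by (intro power_mono) auto
      then show ?thesis by (simp add: power_mult_distrib)
    qed
    moreover have "19 * (j\<^sup>2 * (norm z)\<^sup>2) \<le> (norm z)\<^sup>2 / (8 * R\<^sup>2)"
    proof -
      have "(j * R)\<^sup>2 \<le> (1 / 16)\<^sup>2" using j R by (intro power_mono) auto
      then have "19 * 8 * (j * R)\<^sup>2 \<le> 1" by (simp add: power2_eq_square)
      then have "19 * 8 * (j * R)\<^sup>2 * (norm z)\<^sup>2 \<le> 1 * (norm z)\<^sup>2" by (rule mult_right_mono) simp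
      then show ?thesis using R by (simp add: field_simps power_mult_distrib)
    qed
    moreover have "((2 * real k / (1 - (norm x)\<^sup>2)) *\<^sub>R x) \<bullet> z = 2 * j * (x \<bullet> z)"
      by (simp add: m_def[symmetric] K_def[symmetric] j_def)
    ultimately show "1 + y + 2 * y\<^sup>2 \<le> 1 + ((2 * real k / (1 - (norm x)\<^sup>2)) *\<^sub>R x) \<bullet> z + (norm z)\<^sup>2 / (8 * R\<^sup>2)"
      by linarith
  qed
  finally show "sweight k (x + z) \<le> sweight k x * (1 + ((2 * real k / (1 - (norm x)\<^sup>2)) *\<^sub>R x) \<bullet> z + (norm z)\<^sup>2 / (8 * R\<^sup>2))" .
qed

lemma sweight_gradient_le:
  fixes x :: "'a::real_inner"
  assumes x: "norm x < 1" and k: "1 \<le> k" and R: "0 < R" "R \<le> (1 - (norm x)\<^sup>2) / (16 * real k)"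
  shows "norm ((2 * real k / (1 - (norm x)\<^sup>2)) *\<^sub>R x) \<le> 1 / (8 * R)"
proof -
  have m: "0 < 1 - (norm x)\<^sup>2" using x by (auto simp: power_less_one_iff abs_square_less_1)
  have "norm ((2 * real k / (1 - (norm x)\<^sup>2)) *\<^sub>R x) = 2 * real k / (1 - (norm x)\<^sup>2) * norm x"
    using m by simp
  also have "\<dots> \<le> 2 * real k / (1 - (norm x)\<^sup>2) * 1"
    using x m by (intro mult_left_mono) auto
  also have "\<dots> \<le> 1 / (8 * R)" using R m k by (simp add: field_simps)
  finally show ?thesis .
qed

text \<open>The second form reaches \<open>2 * R\<close> because neighbourhoods of \<open>y\<close>
  are seen from \<open>x\<close>: a shift \<open>z\<close> of \<open>y\<close> is the shift
  \<open>z - (x - y)\<close> of \<open>x\<close>.\<close>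

lemma sweight_linear:
  fixes x z :: "'a::real_inner"
  assumes x: "norm x < 1" and k: "1 \<le> k" and R: "0 < R" "R \<le> (1 - (norm x)\<^sup>2) / (16 * real k)"
  shows "norm z \<le> R \<Longrightarrow> sweight k (x + z) \<le> sweight k x * (1 + norm z / R)"
    and "norm z \<le> 2 * R \<Longrightarrow> sweight k (x + z) \<le> sweight k x * 2"
proof -
  let ?b = "(2 * real k / (1 - (norm x)\<^sup>2)) *\<^sub>R x"
  have "?b \<bullet> z \<le> 1 / (8 * R) * norm z"
    using norm_cauchy_schwarz[of ?b z] mult_right_mono[OF sweight_gradient_le[OF assms] norm_ge_zero[of z]] by linarith
  also have "\<dots> = norm z / R / 8" by simp
  finally have b0: "?b \<bullet> z \<le> norm z / R / 8" .
  define B where "B = ?b \<bullet> z"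
  define G where "G = (norm z)\<^sup>2 / (8 * R\<^sup>2)"
  define t where "t = norm z / R"
  have b: "B \<le> t / 8" "0 \<le> t" using b0 R by (auto simp: B_def t_def)
  note SQ = sweight_quadratic(2)[OF assms, of z, folded B_def G_def]
  {
    assume z: "norm z \<le> R"
    have "(norm z)\<^sup>2 \<le> R * norm z" using z by (simp add: power2_eq_square mult_right_mono)
    then have "G \<le> t / 8" using R by (simp add: G_def t_def field_simps power2_eq_square)
    then have le: "1 + B + G \<le> 1 + norm z / R" using b unfolding t_def[symmetric] by linarith
    have "norm z \<le> 2 * R" using z R by simp
    then show "sweight k (x + z) \<le> sweight k x * (1 + norm z / R)"
      using SQ mult_left_mono[OF le less_imp_le[OF sweight_pos[OF x, of k]]] by linarith
  }
  {
    assume z: "norm z \<le> 2 * R"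
    have "(norm z)\<^sup>2 \<le> (2 * R)\<^sup>2" using z by (intro power_mono) auto
    then have "G \<le> 1 / 2" using R by (simp add: G_def field_simps power2_eq_square)
    moreover have "t \<le> 2" using z R by (simp add: t_def field_simps)
    ultimately have le: "1 + B + G \<le> 2" using b by linarith
    show "sweight k (x + z) \<le> sweight k x * 2"
      using SQ[OF z] mult_left_mono[OF le less_imp_le[OF sweight_pos[OF x, of k]]] by linarith
  }
qed

text \<open>Both factors have quadratic upper bounds; in their product the second-order
  contributions add up exactly: 1/8 from the weight, 1/2 from the modulus and 3/8 from the cross
  term, in units of \<open>|a| powr (\<gamma> - 2) |z|^2\<close>. The conditions
  \<open>|z| \<le> |a| \<le> R\<close> are what makes the cross term quadratic.\<close>

lemma product_paraboloid:
  fixes a b z :: "'a::real_inner"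
  assumes \<gamma>: "0 < \<gamma>" "\<gamma> \<le> 1" and a: "a \<noteq> 0" "norm a \<le> R" and z: "norm z \<le> norm a" and b: "norm b \<le> 1 / (8 * R)"
  shows "(1 + b \<bullet> z + (norm z)\<^sup>2 / (8 * R\<^sup>2)) * norm (a + z) powr \<gamma>
    \<le> norm a powr \<gamma> + (norm a powr \<gamma> *\<^sub>R b + (\<gamma> * norm a powr (\<gamma> - 2)) *\<^sub>R a) \<bullet> z + norm a powr (\<gamma> - 2) * (norm z)\<^sup>2"
proof -
  define A where "A = norm a"
  define r where "r = norm z"
  define g where "g = A powr (\<gamma> - 2)"
  have A: "A > 0" "A \<le> R" using a by (auto simp: A_def)
  then have R: "R > 0" by simp
  have r: "0 \<le> r" "r \<le> A" using z by (auto simp: r_def A_def)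
  have g: "g > 0" using A by (simp add: g_def)
  have gA: "A powr \<gamma> = g * A\<^sup>2"
  proof -
    have "g * A\<^sup>2 = A powr (\<gamma> - 2) * A powr 2" using A by (simp add: g_def)
    also have "\<dots> = A powr \<gamma>" unfolding powr_add[symmetric] by simp
    finally show ?thesis by simp
  qed
  define X where "X = b \<bullet> z + r\<^sup>2 / (8 * R\<^sup>2)"
  define Y where "Y = \<gamma> / 2 * g * (2 * (a \<bullet> z) + r\<^sup>2)"
  have bz: "\<bar>b \<bullet> z\<bar> \<le> r / (8 * R)"
    using Cauchy_Schwarz_ineq2[of b z] mult_right_mono[OF b, of r] by (simp add: r_def)
  have q: "r\<^sup>2 / (8 * R\<^sup>2) \<le> r / (8 * R)"
  proof -
    have "r * r \<le> R * r" using r A by (intro mult_right_mono) auto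
    then show ?thesis using R by (simp add: field_simps power2_eq_square)
  qed
  have q0: "0 \<le> r\<^sup>2 / (8 * R\<^sup>2)" by simp
  have X: "\<bar>X\<bar> \<le> r / (4 * R)"
  proof -
    have "r / (4 * R) = r / (8 * R) + r / (8 * R)" by simp
    then show ?thesis unfolding X_def using bz q q0 by linarith
  qed
  have "r / (4 * R) \<le> 1 / 4" using r A R by (simp add: field_simps)
  then have X1: "0 \<le> 1 + X" using X by linarith
  have az: "\<bar>a \<bullet> z\<bar> \<le> A * r" using Cauchy_Schwarz_ineq2[of a z] by (simp add: A_def r_def)
  have rr: "r\<^sup>2 \<le> A * r" using r by (simp add: power2_eq_square mult_right_mono)
  have Y: "\<bar>Y\<bar> \<le> 3 / 2 * g * (A * r)"
  proof -
    have "\<bar>2 * (a \<bullet> z) + r\<^sup>2\<bar> \<le> 3 * (A * r)" using az rr zero_le_power2[of r] by linarith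
    then have "\<gamma> / 2 * g * \<bar>2 * (a \<bullet> z) + r\<^sup>2\<bar> \<le> 1 / 2 * g * (3 * (A * r))"
      using \<gamma> g by (intro mult_mono) auto
    then show ?thesis using \<gamma> g by (simp add: Y_def abs_mult)
  qed
  have XY: "X * Y \<le> 3 / 8 * g * r\<^sup>2"
  proof -
    have "X * Y \<le> \<bar>X\<bar> * \<bar>Y\<bar>" by (metis abs_ge_self abs_mult)
    also have "\<dots> \<le> r / (4 * R) * (3 / 2 * g * (A * r))" using X Y by (intro mult_mono) auto
    also have "\<dots> = (A / R) * (3 / 8 * g * r\<^sup>2)" using R by (simp add: field_simps power2_eq_square)
    also have "\<dots> \<le> 1 * (3 / 8 * g * r\<^sup>2)" using A R g by (intro mult_right_mono) auto
    finally show ?thesis by simp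
  qed
  have AX: "A powr \<gamma> * (r\<^sup>2 / (8 * R\<^sup>2)) \<le> g * r\<^sup>2 / 8"
  proof -
    have "A\<^sup>2 / R\<^sup>2 \<le> 1" using A R by (simp add: power_mono)
    then have "A\<^sup>2 / R\<^sup>2 * (g * r\<^sup>2 / 8) \<le> 1 * (g * r\<^sup>2 / 8)" using g by (intro mult_right_mono) auto
    moreover have "A powr \<gamma> * (r\<^sup>2 / (8 * R\<^sup>2)) = A\<^sup>2 / R\<^sup>2 * (g * r\<^sup>2 / 8)" by (simp add: gA mult_ac)
    ultimately show ?thesis by simp
  qed
  have Yq: "\<gamma> / 2 * g * r\<^sup>2 \<le> 1 / 2 * (g * r\<^sup>2)"
  proof -
    have "\<gamma> / 2 * (g * r\<^sup>2) \<le> 1 / 2 * (g * r\<^sup>2)" using \<gamma> g by (intro mult_right_mono) auto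
    then show ?thesis by (simp add: mult.assoc)
  qed
  have "norm (a + z) powr \<gamma> \<le> A powr \<gamma> + Y"
    using norm_add_powr_le[OF \<gamma> a(1), of z] by (simp add: A_def r_def g_def Y_def)
  then have "(1 + X) * norm (a + z) powr \<gamma> \<le> (1 + X) * (A powr \<gamma> + Y)" using X1 by (rule mult_left_mono)
  also have "\<dots> = A powr \<gamma> + A powr \<gamma> * (b \<bullet> z) + A powr \<gamma> * (r\<^sup>2 / (8 * R\<^sup>2)) + \<gamma> * g * (a \<bullet> z) + \<gamma> / 2 * g * r\<^sup>2 + X * Y"
    by (simp add: X_def Y_def algebra_simps)
  also have "\<dots> \<le> A powr \<gamma> + A powr \<gamma> * (b \<bullet> z) + \<gamma> * g * (a \<bullet> z) + g * r\<^sup>2"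
    using AX Yq XY by linarith
  also have "\<dots> = A powr \<gamma> + (A powr \<gamma> *\<^sub>R b + (\<gamma> * g) *\<^sub>R a) \<bullet> z + g * r\<^sup>2" by (simp add: inner_add_left)
  finally show ?thesis by (simp add: X_def A_def r_def g_def add.assoc)
qed

context frac_params
begin

subsection \<open>Doubling of the time variable\<close>

lemma tail_mass_nonneg: "0 \<le> tail_mass U"
  unfolding tail_mass_def
  by (intro Bochner_Integration.integral_nonneg mult_nonneg_nonneg less_imp_le[OF tailw_pos]) auto

lemma tail_mass_diff_le:
  assumes "tail_ok U" "tail_ok V" "tail_ok Z"
  shows "tail_mass (\<lambda>y. U y - V y) \<le> 2 powr (p - 1) * (tail_mass (\<lambda>y. U y - Z y) + tail_mass (\<lambda>y. V y - Z y))"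
proof -
  let ?I = "\<lambda>f y. \<bar>f y\<bar> powr (p - 1) * tailw y"
  have i: "integrable lebesgue (?I (\<lambda>y. U y - V y))" "integrable lebesgue (?I (\<lambda>y. U y - Z y))" "integrable lebesgue (?I (\<lambda>y. V y - Z y))"
    using tail_ok_diff assms unfolding tail_ok_def[of "\<lambda>y. _ y - _ y"] by blast+
  have "integral\<^sup>L lebesgue (?I (\<lambda>y. U y - V y))
     \<le> integral\<^sup>L lebesgue (\<lambda>y. 2 powr (p - 1) * (?I (\<lambda>y. U y - Z y) y + ?I (\<lambda>y. V y - Z y) y))"
  proof (rule integral_mono)
    fix y
    have "\<bar>(U y - Z y) + - (V y - Z y)\<bar> powr (p - 1) \<le> 2 powr (p - 1) * (\<bar>U y - Z y\<bar> powr (p - 1) + \<bar>- (V y - Z y)\<bar> powr (p - 1))"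
      using p by (intro abs_add_powr_le) auto
    then have "\<bar>U y - V y\<bar> powr (p - 1) * tailw y \<le> 2 powr (p - 1) * (\<bar>U y - Z y\<bar> powr (p - 1) + \<bar>V y - Z y\<bar> powr (p - 1)) * tailw y"
      using tailw_pos[of y] by (intro mult_right_mono) (auto simp: abs_minus_commute)
    then show "?I (\<lambda>y. U y - V y) y \<le> 2 powr (p - 1) * (?I (\<lambda>y. U y - Z y) y + ?I (\<lambda>y. V y - Z y) y)"
      by (simp only: distrib_left distrib_right mult.assoc)
  next
    show "integrable lebesgue (?I (\<lambda>y. U y - V y))" by (rule i(1))
    show "integrable lebesgue (\<lambda>y. 2 powr (p - 1) * (?I (\<lambda>y. U y - Z y) y + ?I (\<lambda>y. V y - Z y) y))"
      by (intro integrable_mult_right Bochner_Integration.integrable_add i(2,3))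
  qed
  also have "\<dots> = 2 powr (p - 1) * (tail_mass (\<lambda>y. U y - Z y) + tail_mass (\<lambda>y. V y - Z y))"
    unfolding tail_mass_def using i by (subst integral_mult_right_zero, subst Bochner_Integration.integral_add) auto
  finally show ?thesis by (simp add: tail_mass_def)
qed

lemma tail_mass_eq_norm: "tail_mass U = tail_norm p s U powr (p - 1)"
proof -
  have "tail_norm p s U = tail_mass U powr (1 / (p - 1))" by (simp add: tail_norm_def tail_mass_def tail_integrand_eq)
  then show ?thesis using p tail_mass_nonneg[of U] by (simp add: powr_powr)
qed

text \<open>Continuity into the tail space holds at each time of an open interval. A Lebesgue number
  of a cover of the compact \<open>[a, b]\<close> makes it uniform, two nearby times being compared
  through the centre of a common ball.\<close>

lemma tail_uniform:
  assumes c: "cont_loc_tail p s (-1) 0 (u :: (real^'n) \<times> real \<Rightarrow> real)" and ab: "-1 < a" "b < 0" and \<iota>: "\<iota> > 0"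
    and ok: "\<And>t. -1 < t \<Longrightarrow> t \<le> 0 \<Longrightarrow> tail_ok (\<lambda>x. u (x, t))"
  obtains \<omega> where "\<omega> > 0" "\<And>t \<tau>. t \<in> {a..b} \<Longrightarrow> \<tau> \<in> {a..b} \<Longrightarrow> \<bar>t - \<tau>\<bar> < \<omega> \<Longrightarrow> tail_mass (\<lambda>x. u (x, t) - u (x, \<tau>)) < \<iota>"
proof -
  \<comment> \<open>The passage through the centre uses a triangle inequality with constant
    \<open>2 powr (p - 1)\<close> and two terms.\<close>
  define \<iota>' where "\<iota>' = \<iota> / (2 * 2 powr (p - 1))"
  have \<iota>': "\<iota>' > 0" using \<iota> by (simp add: \<iota>'_def)
  have loc: "\<exists>d>0. \<forall>\<tau>\<in>{-1<..<0}. \<bar>\<tau> - t\<bar> < d \<longrightarrow> tail_mass (\<lambda>x. u (x, \<tau>) - u (x, t)) < \<iota>'" if t: "t \<in> {-1<..<0}" for t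
  proof -
    have "((\<lambda>\<tau>. tail_norm p s (\<lambda>x. u (x, \<tau>) - u (x, t))) \<longlongrightarrow> 0) (at t within {-1<..<0})"
      using c t unfolding cont_loc_tail_def by blast
    then have "((\<lambda>\<tau>. tail_mass (\<lambda>x. u (x, \<tau>) - u (x, t))) \<longlongrightarrow> 0 powr (p - 1)) (at t within {-1<..<0})"
      unfolding tail_mass_eq_norm using p by (intro tendsto_powr') (auto simp: tail_norm_def)
    then have "\<forall>\<^sub>F \<tau> in at t within {-1<..<0}. tail_mass (\<lambda>x. u (x, \<tau>) - u (x, t)) < \<iota>'"
      using \<iota>' p by (intro order_tendstoD(2)) auto
    then obtain d where d: "d > 0" "\<forall>\<tau>\<in>{-1<..<0}. \<tau> \<noteq> t \<and> dist \<tau> t < d \<longrightarrow> tail_mass (\<lambda>x. u (x, \<tau>) - u (x, t)) < \<iota>'"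
      unfolding eventually_at by blast
    show ?thesis
    proof (intro exI[of _ d] conjI ballI impI d(1))
      fix \<tau> assume "\<tau> \<in> {-1<..<0}" "\<bar>\<tau> - t\<bar> < d"
      then show "tail_mass (\<lambda>x. u (x, \<tau>) - u (x, t)) < \<iota>'"
        using d(2) \<iota>' p by (cases "\<tau> = t") (auto simp: dist_real_def tail_mass_def)
    qed
  qed
  have "\<exists>d. \<forall>t\<in>{-1<..<0}. d t > 0 \<and> (\<forall>\<tau>\<in>{-1<..<0}. \<bar>\<tau> - t\<bar> < d t \<longrightarrow> tail_mass (\<lambda>x. u (x, \<tau>) - u (x, t)) < \<iota>')"
    by (rule bchoice) (intro ballI loc)
  then obtain d where d0: "\<forall>t\<in>{-1<..<0}. d t > 0 \<and> (\<forall>\<tau>\<in>{-1<..<0}. \<bar>\<tau> - t\<bar> < d t \<longrightarrow> tail_mass (\<lambda>x. u (x, \<tau>) - u (x, t)) < \<iota>')" ..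
  have d: "\<And>t. t \<in> {-1<..<0} \<Longrightarrow> d t > 0"
    "\<And>t \<tau>. t \<in> {-1<..<0} \<Longrightarrow> \<tau> \<in> {-1<..<0} \<Longrightarrow> \<bar>\<tau> - t\<bar> < d t \<Longrightarrow> tail_mass (\<lambda>x. u (x, \<tau>) - u (x, t)) < \<iota>'"
    using d0 by auto
  have cov: "{a..b} \<subseteq> \<Union> ((\<lambda>t. ball t (d t)) ` {-1<..<0})" 
  proof
    fix t assume "t \<in> {a..b}"
    then have t: "t \<in> {-1<..<0}" using ab by auto
    then show "t \<in> \<Union> ((\<lambda>t. ball t (d t)) ` {-1<..<0})" using d(1)[OF t] by (auto intro!: bexI[of _ t])
  qed
  obtain e where e: "e > 0" "\<And>t. t \<in> {a..b} \<Longrightarrow> \<exists>G \<in> (\<lambda>t. ball t (d t)) ` {-1<..<0}. ball t e \<subseteq> G"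
    by (rule Heine_Borel_lemma[OF compact_Icc cov]) auto
  show ?thesis
  proof (rule that[OF e(1)])
    fix t \<tau> assume t: "t \<in> {a..b}" and \<tau>: "\<tau> \<in> {a..b}" and lt: "\<bar>t - \<tau>\<bar> < e"
    obtain t0 where t0: "t0 \<in> {-1<..<0}" "ball t e \<subseteq> ball t0 (d t0)" using e(2)[OF t] by auto
    have "t \<in> ball t0 (d t0)" "\<tau> \<in> ball t0 (d t0)" using t0(2) lt e(1) by (auto simp: dist_real_def subset_eq)
    then have "tail_mass (\<lambda>x. u (x, t) - u (x, t0)) < \<iota>'" "tail_mass (\<lambda>x. u (x, \<tau>) - u (x, t0)) < \<iota>'"
      using d(2)[OF t0(1)] t \<tau> ab by (auto simp: dist_real_def abs_minus_commute)
    then have "2 powr (p - 1) * (tail_mass (\<lambda>x. u (x, t) - u (x, t0)) + tail_mass (\<lambda>x. u (x, \<tau>) - u (x, t0))) < 2 powr (p - 1) * (\<iota>' + \<iota>')"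
      by (intro mult_strict_left_mono add_strict_mono) auto
    also have "\<dots> = \<iota>" by (simp add: \<iota>'_def field_simps)
    finally show "tail_mass (\<lambda>x. u (x, t) - u (x, \<tau>)) < \<iota>"
      using tail_mass_diff_le[of "\<lambda>x. u (x, t)" "\<lambda>x. u (x, \<tau>)" "\<lambda>x. u (x, t0)"] ok t \<tau> ab t0(1) by auto
  qed
qed

text \<open>The value at the maximum is at least \<open>M > 0\<close> and the oscillation of
  \<open>u\<close> at most 2, so the penalty is at most 2 there. A large \<open>n\<close> therefore
  brings the two times together, and uniform continuity of \<open>u\<close> and of the tails does
  the rest. The weight depends on the first time only, which keeps the second test function
  simple.\<close>

lemma doubling:
  fixes u :: "(real^'n) \<times> real \<Rightarrow> real" and \<Phi> :: "real^'n \<Rightarrow> real^'n \<Rightarrow> real \<Rightarrow> real"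
  assumes \<sigma>: "0 < \<sigma>" "T < 0"
    and K: "K = cball 0 (sqrt (1 - \<sigma>))" "I = {-1 + \<sigma>..T}"
    and u: "continuous_on (ball 0 1 \<times> {-1<..0}) u" "\<And>x t. x \<in> ball 0 1 \<Longrightarrow> -1 < t \<Longrightarrow> t \<le> 0 \<Longrightarrow> \<bar>u (x, t)\<bar> \<le> 1"
    and \<Phi>: "continuous_on (K \<times> K \<times> I) (\<lambda>(x, y, t). \<Phi> x y t)" "\<And>x y t. x \<in> K \<Longrightarrow> y \<in> K \<Longrightarrow> t \<in> I \<Longrightarrow> 0 \<le> \<Phi> x y t"
    and c: "cont_loc_tail p s (-1) 0 u" and ok: "\<And>t. -1 < t \<Longrightarrow> t \<le> 0 \<Longrightarrow> tail_ok (\<lambda>x. u (x, t))"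
    and pos: "x0 \<in> K" "y0 \<in> K" "t0 \<in> I" "0 < M" "M \<le> u (x0, t0) - u (y0, t0) - \<Phi> x0 y0 t0"
    and \<iota>: "\<iota> > 0"
  obtains n x y t \<tau> where "n > 0" "x \<in> K" "y \<in> K" "t \<in> I" "\<tau> \<in> I"
    "M \<le> u (x, t) - u (y, \<tau>) - \<Phi> x y t - n * (t - \<tau>)\<^sup>2"
    "\<And>x' y' t' \<tau>'. x' \<in> K \<Longrightarrow> y' \<in> K \<Longrightarrow> t' \<in> I \<Longrightarrow> \<tau>' \<in> I \<Longrightarrow>
       u (x', t') - u (y', \<tau>') - \<Phi> x' y' t' - n * (t' - \<tau>')\<^sup>2 \<le> u (x, t) - u (y, \<tau>) - \<Phi> x y t - n * (t - \<tau>)\<^sup>2"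
    "\<bar>t - \<tau>\<bar> < \<iota>" "\<bar>u (y, t) - u (y, \<tau>)\<bar> < \<iota>" "tail_mass (\<lambda>w. u (w, t) - u (w, \<tau>)) < \<iota>"
proof -
  have KI: "compact (K \<times> I)" unfolding K by (intro compact_Times) auto
  have s1: "sqrt (1 - \<sigma>) < 1" using \<sigma> by (simp add: real_sqrt_lt_1_iff)
  then have sub: "K \<times> I \<subseteq> ball 0 1 \<times> {-1<..0}" using \<sigma> unfolding K by (auto intro: order_le_less_trans[OF _ s1])
  have uc: "continuous_on (K \<times> I) u" using continuous_on_subset[OF u(1) sub] .
  obtain \<omega>1 where \<omega>1: "\<omega>1 > 0" "\<And>z z'. z \<in> K \<times> I \<Longrightarrow> z' \<in> K \<times> I \<Longrightarrow> dist z' z < \<omega>1 \<Longrightarrow> dist (u z') (u z) < \<iota>"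
    using compact_uniformly_continuous[OF uc KI] \<iota> unfolding uniformly_continuous_on_def by metis
  obtain \<omega>2 where \<omega>2: "\<omega>2 > 0" "\<And>t \<tau>. t \<in> I \<Longrightarrow> \<tau> \<in> I \<Longrightarrow> \<bar>t - \<tau>\<bar> < \<omega>2 \<Longrightarrow> tail_mass (\<lambda>x. u (x, t) - u (x, \<tau>)) < \<iota>"
    by (rule tail_uniform[OF c _ \<sigma>(2) \<iota> ok, of "-1 + \<sigma>"]) (use \<sigma> K in auto)
  define \<omega> where "\<omega> = min \<iota> (min \<omega>1 \<omega>2)"
  have \<omega>: "\<omega> > 0" using \<iota> \<omega>1 \<omega>2 by (simp add: \<omega>_def)
  \<comment> \<open>Any numerator above the bound 2 of the penalty forces
    \<open>|t - \<tau>| < \<omega>\<close>.\<close>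
  define n where "n = 3 / \<omega>\<^sup>2"
  have n: "n > 0" using \<omega> by (simp add: n_def)
  define F where "F = (\<lambda>(x, y, t, \<tau>). u (x, t) - u (y, \<tau>) - \<Phi> x y t - n * (t - \<tau>)\<^sup>2)"
  let ?S = "K \<times> K \<times> I \<times> I"
  have cS: "compact ?S" unfolding K by (intro compact_Times) auto
  have neS: "?S \<noteq> {}" using pos by auto
  have cF: "continuous_on ?S F"
    unfolding F_def case_prod_unfold
    by (intro continuous_intros continuous_on_compose2[OF uc] continuous_on_compose2[OF \<Phi>(1)[unfolded case_prod_unfold], where f = "\<lambda>z. (fst z, fst (snd z), fst (snd (snd z)))", simplified]) auto
  obtain z where z: "z \<in> ?S" "\<forall>z'\<in>?S. F z' \<le> F z"
    using continuous_attains_sup[OF cS neS cF] by blast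
  obtain x y t \<tau> where z': "z = (x, y, t, \<tau>)" by (cases z) auto
  have mem: "x \<in> K" "y \<in> K" "t \<in> I" "\<tau> \<in> I" using z(1) z' by auto
  have "F (x0, y0, t0, t0) \<le> F z" using z(2) pos by auto
  then have FM: "M \<le> u (x, t) - u (y, \<tau>) - \<Phi> x y t - n * (t - \<tau>)\<^sup>2" using pos by (simp add: F_def z')
  have b1: "u (x, t) \<le> 1" "- 1 \<le> u (y, \<tau>)" using u(2)[of x t] u(2)[of y \<tau>] sub mem by (auto simp: abs_le_iff)
  have "n * (t - \<tau>)\<^sup>2 \<le> 2" using FM pos(4) \<Phi>(2)[OF mem(1-3)] b1 by linarith
  then have "3 * (t - \<tau>)\<^sup>2 \<le> 2 * \<omega>\<^sup>2" using \<omega> by (simp add: n_def field_simps)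
  moreover have "\<omega>\<^sup>2 > 0" using \<omega> by simp
  ultimately have "(t - \<tau>)\<^sup>2 < \<omega>\<^sup>2" by linarith
  then have lt: "\<bar>t - \<tau>\<bar> < \<omega>" using power2_less_imp_less[of "\<bar>t - \<tau>\<bar>" \<omega>] \<omega> by simp
  show ?thesis
  proof (rule that[OF n mem FM])
    show "u (x', t') - u (y', \<tau>') - \<Phi> x' y' t' - n * (t' - \<tau>')\<^sup>2 \<le> u (x, t) - u (y, \<tau>) - \<Phi> x y t - n * (t - \<tau>)\<^sup>2"
      if "x' \<in> K" "y' \<in> K" "t' \<in> I" "\<tau>' \<in> I" for x' y' t' \<tau>'
      using z(2) that by (force simp: F_def z')
    show "\<bar>t - \<tau>\<bar> < \<iota>" using lt by (simp add: \<omega>_def)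
    show "tail_mass (\<lambda>w. u (w, t) - u (w, \<tau>)) < \<iota>" using \<omega>2(2)[OF mem(3,4)] lt by (simp add: \<omega>_def)
    show "\<bar>u (y, t) - u (y, \<tau>)\<bar> < \<iota>"
      using \<omega>1(2)[of "(y, \<tau>)" "(y, t)"] mem lt by (simp add: \<omega>_def dist_Pair_Pair dist_real_def)
  qed
qed

subsection \<open>Spatial Hoelder estimate\<close>

text \<open>Constants on which the estimates may depend are parameters: \<open>C0\<close> and the
  spatial Lipschitz constant \<open>A\<close> of the obstacle. The time modulus of the obstacle and
  the Lipschitz constant of \<open>u\<close> are hidden under existential quantifiers, so no
  constant chosen before \<open>u\<close> can depend on them.\<close>

definition sol_data :: "real \<Rightarrow> real \<Rightarrow> ((real^'n) \<times> real \<Rightarrow> real) \<Rightarrow> ((real^'n) \<times> real \<Rightarrow> real) \<Rightarrow> bool" where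
  "sol_data C0 A \<psi> u \<longleftrightarrow>
     visc_ineq C0 (\<lambda>z. \<psi> z < u z) u \<and> visc_ineq C0 (\<lambda>z. True) (\<lambda>z. - u z) \<and>
     (\<forall>t. -1 < t \<longrightarrow> t \<le> 0 \<longrightarrow> tail_ok (\<lambda>x. u (x, t)) \<and> tail_mass (\<lambda>x. u (x, t)) \<le> 1) \<and>
     continuous_on (ball 0 1 \<times> {-1<..0}) u \<and>
     (\<forall>x t. norm x < 1 \<longrightarrow> -1 < t \<longrightarrow> t \<le> 0 \<longrightarrow> \<bar>u (x, t)\<bar> \<le> 1) \<and>
     cont_loc_tail p s (-1) 0 u \<and>
     (\<forall>x t. norm x < 1 \<longrightarrow> -1 < t \<longrightarrow> t \<le> 0 \<longrightarrow> \<psi> (x, t) \<le> u (x, t)) \<and>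
     (\<forall>x y t. norm x < 1 \<longrightarrow> norm y < 1 \<longrightarrow> -1 < t \<longrightarrow> t \<le> 0 \<longrightarrow> \<bar>\<psi> (x, t) - \<psi> (y, t)\<bar> \<le> A * norm (x - y)) \<and>
     (\<exists>B a. 0 < a \<and> (\<forall>x t \<tau>. norm x < 1 \<longrightarrow> -1 < t \<longrightarrow> t \<le> 0 \<longrightarrow> -1 < \<tau> \<longrightarrow> \<tau> \<le> 0 \<longrightarrow>
        \<bar>\<psi> (x, t) - \<psi> (x, \<tau>)\<bar> \<le> B * \<bar>t - \<tau>\<bar> powr a)) \<and>
     (\<exists>C1. \<forall>x y t. norm x < 1 \<longrightarrow> norm y < 1 \<longrightarrow> -1 < t \<longrightarrow> t \<le> 0 \<longrightarrow> \<bar>u (x, t) - u (y, t)\<bar> \<le> C1 * norm (x - y))"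

text \<open>The weight sits at \<open>x\<close> alone, so only one of the two test functions carries
  it; the absolute value is recovered by exchanging the points.\<close>

definition space_bound :: "nat \<Rightarrow> real \<Rightarrow> real \<Rightarrow> real \<Rightarrow> ((real^'n) \<times> real \<Rightarrow> real) \<Rightarrow> bool" where
  "space_bound k \<gamma> T L u \<longleftrightarrow> (\<forall>x y t. norm x < 1 \<longrightarrow> norm y < 1 \<longrightarrow> -1 < t \<longrightarrow> t \<le> T \<longrightarrow>
     u (x, t) - u (y, t) \<le> L * sweight k x * (1 + t) powr (- real k) * norm (x - y) powr \<gamma>)"

text \<open>\<open>W * A powr (\<gamma> - 2)\<close> is the curvature of the weighted modulus at
  distance \<open>A\<close> and \<open>2 * W * A powr (\<gamma> - 1)\<close> bounds its slope. On
  the scale \<open>\<delta> * A\<close> the error then has the homogeneity of the gain, with the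
  small factor \<open>\<delta> powr (p - s * p)\<close>.\<close>

lemma test_error_bound:
  assumes \<gamma>: "0 < \<gamma>" "\<gamma> < 1" and C0: "C0 \<ge> 0" and A: "A > 0" and W: "W \<ge> 1" and \<delta>: "0 < \<delta>" "\<delta> \<le> 1"
    and P: "norm P \<le> 2 * W * A powr (\<gamma> - 1)"
  shows "C0 * (norm P + W * A powr (\<gamma> - 2) * (\<delta> * A)) powr (p - 2) * (W * A powr (\<gamma> - 2)) * (\<delta> * A) powr (p - s * p)
    \<le> C0 * 3 powr (p - 2) * \<delta> powr (p - s * p) * (W powr (p - 1) * A powr (\<gamma> * (p - 1) - s * p))"
proof -
  have "A powr (\<gamma> - 2) * A powr 1 = A powr (\<gamma> - 1)" unfolding powr_add[symmetric] by simp
  then have "W * A powr (\<gamma> - 2) * (\<delta> * A) = \<delta> * (W * A powr (\<gamma> - 1))" using A by (simp add: mult_ac)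
  also have "\<dots> \<le> 1 * (W * A powr (\<gamma> - 1))" using \<delta> W by (intro mult_right_mono) auto
  finally have "norm P + W * A powr (\<gamma> - 2) * (\<delta> * A) \<le> 3 * (W * A powr (\<gamma> - 1))" using P by simp
  moreover have "0 \<le> W * A powr (\<gamma> - 2) * (\<delta> * A)" using W \<delta> A by simp
  ultimately have "(norm P + W * A powr (\<gamma> - 2) * (\<delta> * A)) powr (p - 2) \<le> (3 * (W * A powr (\<gamma> - 1))) powr (p - 2)"
    using p by (intro powr_mono2) auto
  also have "\<dots> = 3 powr (p - 2) * W powr (p - 2) * A powr ((\<gamma> - 1) * (p - 2))"
    using W by (simp add: powr_mult powr_powr)
  finally have "C0 * (norm P + W * A powr (\<gamma> - 2) * (\<delta> * A)) powr (p - 2) * (W * A powr (\<gamma> - 2)) * (\<delta> * A) powr (p - s * p)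
    \<le> C0 * (3 powr (p - 2) * W powr (p - 2) * A powr ((\<gamma> - 1) * (p - 2))) * (W * A powr (\<gamma> - 2)) * (\<delta> * A) powr (p - s * p)"
    using C0 W by (intro mult_right_mono mult_left_mono) auto
  also have "\<dots> = C0 * 3 powr (p - 2) * \<delta> powr (p - s * p) * ((W powr (p - 2) * W powr 1) * (A powr ((\<gamma> - 1) * (p - 2)) * A powr (\<gamma> - 2) * A powr (p - s * p)))"
    using W A \<delta> by (simp add: powr_mult mult_ac)
  also have "W powr (p - 2) * W powr 1 = W powr (p - 1)" unfolding powr_add[symmetric] by simp
  also have "A powr ((\<gamma> - 1) * (p - 2)) * A powr (\<gamma> - 2) * A powr (p - s * p) = A powr (\<gamma> * (p - 1) - s * p)"
    unfolding powr_add[symmetric] by (simp add: algebra_simps)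
  finally show ?thesis .
qed

text \<open>
  The Lipschitz constant of \<open>u\<close> keeps the points where the weighted
  modulus is violated away from the parabolic boundary.
\<close>

lemma space_bound_halving:
  assumes \<gamma>: "0 < \<gamma>" "\<gamma> < 1" "\<gamma> * (p - 2) < s * p" and C0: "C0 > 0" and A\<psi>: "A\<psi> \<ge> 0"
  obtains k L0 where "1 \<le> k" "1 \<le> L0"
    "\<And>u \<psi> T L. sol_data C0 A\<psi> \<psi> u \<Longrightarrow> -1 < T \<Longrightarrow> T < 0 \<Longrightarrow> L0 \<le> L \<Longrightarrow> space_bound k \<gamma> T (2 * L) u \<Longrightarrow> space_bound k \<gamma> T L u"
proof -
  show ?thesis
  \<comment> \<open>The first constant is twice that of \<open>test_error_bound\<close>, one for
    each contact point; the 1 bounds the loss from the time derivative of the weight in units of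
    \<open>W |a| powr \<gamma> / R\<close>.\<close>
  proof (rule elliptic_core[OF \<gamma>, of "2 * C0 * 3 powr (p - 2)" 1], goal_cases)
    case (3 \<delta> \<epsilon> C)
    note \<delta> = 3(1,2) and \<epsilon> = 3(3,4) and C = 3(5) and core = 3(6)
    \<comment> \<open>The final comparison is between
      \<open>L powr (p - 2) * D powr (- k (p - 2))\<close> and a multiple of
      \<open>D powr (- q - 1)\<close>, where \<open>D\<close> may be arbitrarily small.\<close>
    obtain k0 :: nat where k0: "(q + 1) / (p - 2) \<le> real k0" using real_arch_simple by blast
    define k where "k = max 1 k0"
    have k: "1 \<le> k" "q + 1 \<le> real k * (p - 2)"
    proof -
      show "1 \<le> k" by (simp add: k_def)
      have "(q + 1) / (p - 2) \<le> real k" using k0 by (simp add: k_def)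
      then show "q + 1 \<le> real k * (p - 2)" using p by (simp add: field_simps)
    qed
    define N where "N = 16 * real k"
    have N: "N \<ge> 16" using k by (simp add: N_def)
    define H where "H = 5 * C * N powr (q + 1)"
    have H: "H \<ge> 0" using C by (simp add: H_def)
    \<comment> \<open>The summands serve, in this order: \<open>W \<ge> 1\<close>, exclusion of the
      contact set, closeness \<open>|x - y| \<le> \<epsilon> R\<close>, and the final
      contradiction.\<close>
    define L0 where "L0 = 1 + A\<psi> + 2 * N / \<epsilon> + (H + 1) powr (1 / (p - 2))"
    have eN: "0 \<le> 2 * N / \<epsilon>" using N \<epsilon> by simp
    have hh: "0 \<le> (H + 1) powr (1 / (p - 2))" by simp
    show ?case
    proof (rule that[of k L0])
      show "1 \<le> k" by (rule k)
      show "1 \<le> L0" using A\<psi> eN hh by (simp add: L0_def)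
    next
      fix u \<psi> T L
      assume sol: "sol_data C0 A\<psi> \<psi> u" and T: "-1 < T" "T < 0" and L: "L0 \<le> L" and sb2: "space_bound k \<gamma> T (2 * L) u"
      have L1: "1 \<le> L" "A\<psi> \<le> L" "2 * N / \<epsilon> \<le> L" "(H + 1) powr (1 / (p - 2)) \<le> L"
        using L A\<psi> eN hh unfolding L0_def by linarith+
      have vsub: "visc_ineq C0 (\<lambda>z. \<psi> z < u z) u" and vsup: "visc_ineq C0 (\<lambda>z. True) (\<lambda>z. - u z)"
        and ok: "\<And>t. -1 < t \<Longrightarrow> t \<le> 0 \<Longrightarrow> tail_ok (\<lambda>x. u (x, t))" and mass: "\<And>t. -1 < t \<Longrightarrow> t \<le> 0 \<Longrightarrow> tail_mass (\<lambda>x. u (x, t)) \<le> 1"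
        and cont: "continuous_on (ball 0 1 \<times> {-1<..0}) u"
        and bd: "\<And>x t. norm x < 1 \<Longrightarrow> -1 < t \<Longrightarrow> t \<le> 0 \<Longrightarrow> \<bar>u (x, t)\<bar> \<le> 1"
        and clt: "cont_loc_tail p s (-1) 0 u"
        and obs: "\<And>x t. norm x < 1 \<Longrightarrow> -1 < t \<Longrightarrow> t \<le> 0 \<Longrightarrow> \<psi> (x, t) \<le> u (x, t)"
        and \<psi>x: "\<And>x y t. norm x < 1 \<Longrightarrow> norm y < 1 \<Longrightarrow> -1 < t \<Longrightarrow> t \<le> 0 \<Longrightarrow> \<bar>\<psi> (x, t) - \<psi> (y, t)\<bar> \<le> A\<psi> * norm (x - y)"
        using sol unfolding sol_data_def by auto
      obtain B a where \<psi>t: "0 < a" "\<And>x t \<tau>. norm x < 1 \<Longrightarrow> -1 < t \<Longrightarrow> t \<le> 0 \<Longrightarrow> -1 < \<tau> \<Longrightarrow> \<tau> \<le> 0 \<Longrightarrow>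
          \<bar>\<psi> (x, t) - \<psi> (x, \<tau>)\<bar> \<le> B * \<bar>t - \<tau>\<bar> powr a"
        using sol unfolding sol_data_def by blast
      obtain C1 where C1: "\<And>x y t. norm x < 1 \<Longrightarrow> norm y < 1 \<Longrightarrow> -1 < t \<Longrightarrow> t \<le> 0 \<Longrightarrow> \<bar>u (x, t) - u (y, t)\<bar> \<le> C1 * norm (x - y)"
        using sol unfolding sol_data_def by blast
      define E where "E = max C1 1"
      have E: "1 \<le> E" "\<And>x y t. norm x < 1 \<Longrightarrow> norm y < 1 \<Longrightarrow> -1 < t \<Longrightarrow> t \<le> 0 \<Longrightarrow> u (x, t) - u (y, t) \<le> E * norm (x - y)"
      proof -
        show "1 \<le> E" by (simp add: E_def)
        fix x y :: "real^'n" and t :: real assume "norm x < 1" "norm y < 1" "-1 < t" "t \<le> 0"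
        then have "u (x, t) - u (y, t) \<le> C1 * norm (x - y)" using C1[of x y t] by linarith
        also have "\<dots> \<le> E * norm (x - y)" by (intro mult_right_mono) (auto simp: E_def)
        finally show "u (x, t) - u (y, t) \<le> E * norm (x - y)" .
      qed
      define \<theta> where "\<theta> = (\<lambda>t::real. (1 + t) powr (- real k))"
      define \<Phi> where "\<Phi> = (\<lambda>(x::real^'n) y t. L * sweight k x * \<theta> t * norm (x - y) powr \<gamma>)"
      \<comment> \<open>Violations will satisfy \<open>D > 1 / (2 * E) = 8 * \<sigma>\<close>; the
        factor 8 leaves room for shifts, test cylinders and the second time. \<open>\<sigma>\<close>
        depends on the solution but provides only compactness and never enters \<open>k\<close> or
        \<open>L0\<close>.\<close>
      define \<sigma> where "\<sigma> = 1 / (16 * E)"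
      have \<sigma>: "0 < \<sigma>" "\<sigma> < 1" using E(1) by (auto simp: \<sigma>_def field_simps)
      show "space_bound k \<gamma> T L u"
      proof (rule ccontr)
        assume "\<not> space_bound k \<gamma> T L u"
        then obtain x0 y0 t0 where pt0: "norm x0 < 1" "norm y0 < 1" "-1 < t0" "t0 \<le> T" "\<Phi> x0 y0 t0 < u (x0, t0) - u (y0, t0)"
          unfolding space_bound_def \<Phi>_def \<theta>_def by (auto simp: not_le)
        define M where "M = u (x0, t0) - u (y0, t0) - \<Phi> x0 y0 t0"
        have M: "M > 0" using pt0 by (simp add: M_def)

        \<comment> \<open>Points of violation: distance to the parabolic boundary and to each
          other\<close>
        have weight: "sweight k x * \<theta> t = (1 / ((1 - (norm x)\<^sup>2) * (1 + t))) ^ k" if "norm x < 1" "-1 < t" for x :: "real^'n" and t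
          using that by (simp add: sweight_def \<theta>_def powr_minus powr_realpow power_one_over power_mult_distrib divide_simps)
        have dist_D: "8 * \<sigma> \<le> (1 - (norm x)\<^sup>2) * (1 + t)"
          and dist_a: "norm (x - y) \<le> \<epsilon> * ((1 - (norm x)\<^sup>2) * (1 + t) / N)" and ne: "x \<noteq> y"
          and D1: "(1 - (norm x)\<^sup>2) * (1 + t) \<le> 1 + t" "(1 - (norm x)\<^sup>2) * (1 + t) \<le> 1 - (norm x)\<^sup>2"
          if xy: "norm x < 1" "norm y < 1" "-1 < t" "t \<le> T" "\<Phi> x y t < u (x, t) - u (y, t)" for x y t
        proof -
          define m where "m = 1 - (norm x)\<^sup>2"
          define D where "D = m * (1 + t)"
          have m: "0 < m" "m \<le> 1" using xy(1) by (auto simp: m_def power_less_one_iff abs_square_less_1)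
          have tt: "0 < 1 + t" "1 + t \<le> 1" using xy T by auto
          have D: "0 < D" using m tt by (simp add: D_def)
          show "(1 - (norm x)\<^sup>2) * (1 + t) \<le> 1 + t" "(1 - (norm x)\<^sup>2) * (1 + t) \<le> 1 - (norm x)\<^sup>2"
            using m tt unfolding m_def[symmetric] by (auto simp: mult_left_le mult_left_le_one_le)
          then have Dle: "D \<le> 1" using m by (simp add: D_def m_def)
          have w: "sweight k x * \<theta> t = (1 / D) ^ k" using weight xy by (simp add: D_def m_def)
          define a where "a = norm (x - y)"
          show ne: "x \<noteq> y" using xy(5) \<gamma> by (auto simp: \<Phi>_def)
          then have a: "0 < a" by (simp add: a_def)
          have "1 / D \<le> (1 / D) ^ k" using self_le_power[of "1 / D" k] D Dle k by simp
          have Phi: "\<Phi> x y t = L * (1 / D) ^ k * a powr \<gamma>" by (simp add: \<Phi>_def w[symmetric] a_def mult.assoc)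
          have a2: "a \<le> 2" unfolding a_def using norm_triangle_ineq4[of x y] xy by linarith
          have "a powr (1 - \<gamma>) \<le> 2 powr (1 - \<gamma>)" using a a2 \<gamma> by (intro powr_mono2) auto
          also have "\<dots> \<le> 2 powr 1" using \<gamma> by (intro powr_mono) auto
          finally have a3: "a powr (1 - \<gamma>) \<le> 2" by simp
          have aa: "a = a powr \<gamma> * a powr (1 - \<gamma>)" using a by (simp add: powr_add[symmetric])
          \<comment> \<open>The Lipschitz bound of \<open>u\<close> against the violation: as
            \<open>a \<le> 2\<close>, \<open>E * a\<close> is at most
            \<open>2 * E * a powr \<gamma>\<close>, which cancels the modulus.\<close>
          have "L * (1 / D) ^ k * a powr \<gamma> < E * a" using xy(5) E(2)[of x y t] xy T unfolding Phi a_def by linarith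
          also have "E * a = E * a powr (1 - \<gamma>) * a powr \<gamma>" using aa by (metis mult.assoc mult.commute)
          also have "\<dots> \<le> E * 2 * a powr \<gamma>" using a3 E(1) by (intro mult_right_mono mult_left_mono) auto
          finally have "L * (1 / D) ^ k < E * 2" using a by simp
          moreover have "1 * (1 / D) \<le> L * (1 / D) ^ k" using \<open>1 / D \<le> (1 / D) ^ k\<close> L1 D by (intro mult_mono) auto
          ultimately have "1 / D < 2 * E" by simp
          then show "8 * \<sigma> \<le> (1 - (norm x)\<^sup>2) * (1 + t)"
            using D E(1) unfolding D_def[unfolded m_def, symmetric] \<sigma>_def by (simp add: field_simps)
          \<comment> \<open>Here only \<open>|u| \<le> 1\<close> is used, so the resulting closeness
            of \<open>x\<close> and \<open>y\<close> relative to the scale of the weight is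
            universal.\<close>
          have "L * (1 / D) ^ k * a powr \<gamma> \<le> 2"
            using xy(5) bd[of x t] bd[of y t] xy T unfolding Phi by (auto simp: abs_le_iff)
          moreover have "L * (1 / D) * a powr \<gamma> \<le> L * (1 / D) ^ k * a powr \<gamma>"
            using \<open>1 / D \<le> (1 / D) ^ k\<close> L1 by (intro mult_right_mono mult_left_mono) auto
          ultimately have "L * (1 / D) * a powr \<gamma> \<le> 2" by linarith
          then have ag: "a powr \<gamma> \<le> 2 / L * D" using D L1 by (simp add: field_simps)
          have "2 / L \<le> \<epsilon> / N" using L1(1,3) \<epsilon> N by (simp add: field_simps)
          moreover have "\<epsilon> / N \<le> 1" using \<epsilon> N by (simp add: field_simps)
          ultimately have "2 / L * D \<le> \<epsilon> / N * D" "2 / L * D \<le> 1 * D"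
            using D by (auto intro!: mult_right_mono simp del: times_divide_eq_left)
          then have "2 / L * D \<le> 1" using Dle by linarith
          have "a \<le> 1"
          proof (rule ccontr)
            assume "\<not> a \<le> 1"
            then have "1 powr \<gamma> < a powr \<gamma>" using \<gamma> by (intro powr_less_mono2) auto
            then show False using ag \<open>2 / L * D \<le> 1\<close> by simp
          qed
          then have "a powr 1 \<le> a powr \<gamma>" using a \<gamma> by (intro powr_mono') auto
          then have "a \<le> \<epsilon> / N * D" using ag \<open>2 / L * D \<le> \<epsilon> / N * D\<close> a by simp
          then show "norm (x - y) \<le> \<epsilon> * ((1 - (norm x)\<^sup>2) * (1 + t) / N)" by (simp add: a_def D_def m_def)
        qed

        \<comment> \<open>Compact sets that contain the violations with room to spare\<close>
        define K where "K = cball (0::real^'n) (sqrt (1 - \<sigma>))"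
        define I where "I = {-1 + \<sigma>..T}"
        have inK: "x \<in> K" if "\<sigma> \<le> 1 - (norm x)\<^sup>2" for x
          using that real_le_rsqrt[of "norm x" "1 - \<sigma>"] by (simp add: K_def)
        have K1: "norm x < 1" "\<sigma> \<le> 1 - (norm x)\<^sup>2" if "x \<in> K" for x
        proof -
          have "norm x \<le> sqrt (1 - \<sigma>)" using that by (simp add: K_def)
          then have "(norm x)\<^sup>2 \<le> (sqrt (1 - \<sigma>))\<^sup>2" by (intro power_mono) auto
          then show "\<sigma> \<le> 1 - (norm x)\<^sup>2" using \<sigma> by simp
          then have "(norm x)\<^sup>2 < 1" using \<sigma> by linarith
          then show "norm x < 1" using abs_square_less_1[of "norm x"] by simp
        qed
        have near_K: "x + z \<in> K" if "norm x < 1" "8 * \<sigma> \<le> (1 - (norm x)\<^sup>2) * (1 + t)" "(1 - (norm x)\<^sup>2) * (1 + t) \<le> 1 - (norm x)\<^sup>2"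
          "norm z \<le> 2 * ((1 - (norm x)\<^sup>2) * (1 + t) / N)" for x z :: "real^'n" and t
        proof -
          have R: "0 < (1 - (norm x)\<^sup>2) * (1 + t) / N" "(1 - (norm x)\<^sup>2) * (1 + t) / N \<le> (1 - (norm x)\<^sup>2) / (16 * real k)"
            using that(2,3) \<sigma> N unfolding N_def by (auto intro: divide_right_mono)
          have "(1 - (norm x)\<^sup>2) / 2 \<le> 1 - (norm (x + z))\<^sup>2"
            by (rule sweight_quadratic(1)[OF that(1) k(1) R that(4)])
          then have "1 - (norm x)\<^sup>2 \<le> 2 * (1 - (norm (x + z))\<^sup>2)" by simp
          then show ?thesis using order_trans[OF that(2,3)] \<sigma>(1) by (intro inK) auto
        qed
        have mem0: "x0 \<in> K" "y0 \<in> K" "t0 \<in> I"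
        proof -
          note d = dist_D[OF pt0] dist_a[OF pt0] ne[OF pt0] D1[OF pt0]
          show "x0 \<in> K" using order_trans[OF d(1) d(5)] \<sigma> by (intro inK) linarith
          show "t0 \<in> I" using order_trans[OF d(1) d(4)] \<sigma> pt0 by (simp add: I_def)
          have pos: "0 \<le> (1 - (norm x0)\<^sup>2) * (1 + t0) / N" using order_trans[OF _ d(1), of 0] \<sigma> N by (intro divide_nonneg_nonneg) auto
          have "norm (y0 - x0) \<le> 2 * ((1 - (norm x0)\<^sup>2) * (1 + t0) / N)"
            using d(2) mult_right_mono[of \<epsilon> 2, OF _ pos] \<epsilon> by (simp add: norm_minus_commute)
          from near_K[OF pt0(1) d(1) d(5) this] show "y0 \<in> K" by simp
        qed
        have cs: "continuous_on K (sweight k)"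
          unfolding sweight_def[abs_def] using K1(2) \<sigma> by (intro continuous_intros) force
        have c\<theta>: "continuous_on I \<theta>"
          unfolding \<theta>_def using \<sigma> by (intro continuous_intros) (auto simp: I_def)
        have c\<Phi>: "continuous_on (K \<times> K \<times> I) (\<lambda>(x, y, t). \<Phi> x y t)"
          unfolding \<Phi>_def case_prod_unfold
          by (intro continuous_intros continuous_on_compose2[OF cs] continuous_on_compose2[OF c\<theta>] continuous_on_powr')
            (use \<gamma> in auto)
        have \<Phi>0: "0 \<le> \<Phi> x y t" if "x \<in> K" for x y t
          unfolding \<Phi>_def \<theta>_def using L1 less_imp_le[OF sweight_pos[OF K1(1)[OF that], of k]] by simp
        define \<zeta> where "\<zeta> = min 1 (M / 8)"
        have \<zeta>: "0 < \<zeta>" "\<zeta> \<le> 1" "\<zeta> \<le> M / 8" using M by (auto simp: \<zeta>_def)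
        obtain \<iota>1 where \<iota>1: "0 < \<iota>1" "\<iota>1 \<le> min (M / 8) (\<sigma> / real k)" "\<bar>B\<bar> * \<iota>1 powr a \<le> M / 2"
          using small_powr_exists[of "\<bar>B\<bar>" a "M / 2" "min (M / 8) (\<sigma> / real k)"] \<psi>t(1) M \<sigma> k by auto
        \<comment> \<open>\<open>\<zeta>\<close> is fixed first; then the two times are brought so
          close that even \<open>\<zeta> powr (2 - p)\<close> times the mass of the tail difference
          is at most \<open>M / 8\<close>.\<close>
        define \<iota> where "\<iota> = min \<iota>1 (\<zeta> powr (p - 2) * (M / 8))"
        have \<iota>: "0 < \<iota>" "\<iota> \<le> M / 8" "\<iota> \<le> \<sigma> / real k" "\<bar>B\<bar> * \<iota> powr a \<le> M / 2" "\<zeta> powr (2 - p) * \<iota> \<le> M / 8"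
        proof -
          show "0 < \<iota>" using \<iota>1 \<zeta> M by (simp add: \<iota>_def)
          show "\<iota> \<le> M / 8" "\<iota> \<le> \<sigma> / real k" using \<iota>1 by (auto simp: \<iota>_def)
          have "\<iota> powr a \<le> \<iota>1 powr a" using \<open>0 < \<iota>\<close> \<psi>t(1) by (intro powr_mono2) (auto simp: \<iota>_def)
          then have "\<bar>B\<bar> * \<iota> powr a \<le> \<bar>B\<bar> * \<iota>1 powr a" by (intro mult_left_mono) auto
          then show "\<bar>B\<bar> * \<iota> powr a \<le> M / 2" using \<iota>1(3) by linarith
          have "\<zeta> powr (2 - p) * \<iota> \<le> \<zeta> powr (2 - p) * (\<zeta> powr (p - 2) * (M / 8))" by (intro mult_left_mono) (auto simp: \<iota>_def)
          also have "\<dots> = (\<zeta> powr (2 - p) * \<zeta> powr (p - 2)) * (M / 8)" by simp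
          also have "\<zeta> powr (2 - p) * \<zeta> powr (p - 2) = 1" unfolding powr_add[symmetric] using \<zeta> by simp
          finally show "\<zeta> powr (2 - p) * \<iota> \<le> M / 8" by simp
        qed
        have bd': "\<bar>u (x, t)\<bar> \<le> 1" if "x \<in> ball 0 1" "- 1 < t" "t \<le> 0" for x t using bd that by simp
        have M': "M \<le> u (x0, t0) - u (y0, t0) - \<Phi> x0 y0 t0" by (simp add: M_def)
        show False
        proof (rule doubling[OF \<sigma>(1) T(2) K_def I_def cont _ c\<Phi> _ clt _ mem0 M _ \<iota>(1)], goal_cases)

          \<comment> \<open>Increments of the solution around the doubled maximum point\<close>
          case (5 n x y t \<tau>)
          note n = 5(1) and mem = 5(2-5) and FM = 5(6) and mx = 5(7) and small = 5(8-10)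
          have x1: "norm x < 1" and y1: "norm y < 1" using K1 mem by auto
          have t1: "-1 < t" "t \<le> T" "t \<le> 0" and \<tau>1: "-1 < \<tau>" "\<tau> \<le> T" "\<tau> \<le> 0"
            using mem(3,4) \<sigma> T by (auto simp: I_def)
          have n0: "0 \<le> n * (t - \<tau>)\<^sup>2" using n by simp
          have gap: "M + \<Phi> x y t \<le> u (x, t) - u (y, \<tau>)" using FM n0 by linarith
          have lt: "\<Phi> x y t < u (x, t) - u (y, t)" using gap small(2) \<iota>(2) M by linarith
          note dd = dist_D[OF x1 y1 t1(1,2) lt] dist_a[OF x1 y1 t1(1,2) lt] ne[OF x1 y1 t1(1,2) lt] D1[OF x1 y1 t1(1,2) lt]
          define D where "D = (1 - (norm x)\<^sup>2) * (1 + t)"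
          define R where "R = D / N"
          define A where "A = norm (x - y)"
          define W where "W = L * sweight k x * \<theta> t"
          define wa where "wa = W * A powr \<gamma>"
          have D8: "8 * \<sigma> \<le> D" and Dt: "D \<le> 1 + t" and Dm: "D \<le> 1 - (norm x)\<^sup>2" using dd by (auto simp: D_def)
          have D0: "0 < D" using D8 \<sigma> by linarith
          have Dle: "D \<le> 1" using Dm by (smt (verit) zero_le_power2)
          have R0: "0 < R" using D0 N by (simp add: R_def)
          have Rk: "R \<le> (1 - (norm x)\<^sup>2) / (16 * real k)" unfolding R_def N_def using Dm k by (intro divide_right_mono) auto
          have R1: "R \<le> 1" using Dle N by (simp add: R_def field_simps)
          have AR: "A \<le> \<epsilon> * R" using dd by (simp add: A_def R_def D_def)
          have "\<epsilon> * R \<le> 1 * R" using \<epsilon> R0 by (intro mult_right_mono) auto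
          then have AR1: "A \<le> R" using AR by simp
          have A0: "0 < A" using dd by (simp add: A_def)
          have \<theta>0: "0 < \<theta> t" using t1 by (simp add: \<theta>_def)
          have WD: "W = L * (1 / D) ^ k" using weight[OF x1 t1(1)] by (simp add: W_def D_def mult.assoc)
          have "1 \<le> (1 / D) ^ k" using D0 Dle by (intro one_le_power) simp
          then have W1: "1 \<le> W" unfolding WD using L1(1) mult_mono[of 1 L 1 "(1 / D) ^ k"] by simp
          have Phi: "\<Phi> x y t = wa" by (simp add: \<Phi>_def wa_def W_def A_def)
          have ubd: "\<bar>u (x, t)\<bar> \<le> 1" "\<bar>u (y, \<tau>)\<bar> \<le> 1" using bd x1 y1 t1 \<tau>1 by auto
          have wa2: "wa \<le> 2" using gap ubd M unfolding Phi by (auto simp: abs_le_iff)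
          have wa0: "0 \<le> wa" using W1 by (simp add: wa_def)
          have xK: "x + z \<in> K" if "norm z \<le> 2 * R" for z
            using near_K[OF x1 dd(1) dd(5)] that by (simp add: R_def D_def)
          have yx: "y + z = x + (z - (x - y))" for z by simp
          have zy: "norm (z - (x - y)) \<le> 2 * R" if "norm z \<le> R" for z
            using norm_triangle_ineq4[of z "x - y"] that AR1 by (simp add: A_def)
          have yK: "y + z \<in> K" if "norm z \<le> R" for z
            unfolding yx using xK[OF zy[OF that]] .
          have mxS: "u (x', t) - u (y', \<tau>) - \<Phi> x' y' t \<le> u (x, t) - u (y, \<tau>) - wa" if "x' \<in> K" "y' \<in> K" for x' y'
            using mx[OF that mem(3,4)] by (simp add: Phi)
          have Phi_x: "\<Phi> (x + z) y' t \<le> W * (1 + norm z / R) * norm (x + z - y') powr \<gamma>" if "norm z \<le> R" for z y'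
          proof -
            have "L * sweight k (x + z) * \<theta> t \<le> L * (sweight k x * (1 + norm z / R)) * \<theta> t"
              using sweight_linear(1)[OF x1 k(1) R0 Rk that] L1 \<theta>0 by (intro mult_right_mono mult_left_mono) auto
            then have "L * sweight k (x + z) * \<theta> t \<le> W * (1 + norm z / R)" by (simp add: W_def mult_ac)
            then show ?thesis unfolding \<Phi>_def by (rule mult_right_mono) simp
          qed
          \<comment> \<open>Both points are moved by the same \<open>z\<close>: the distance is
            unchanged and only the weight varies.\<close>
          have H1: "- (W * norm (x - y) powr \<gamma> * norm z / R) \<le> (u (x, t) - u (x + z, t)) - (u (y, \<tau>) - u (y + z, \<tau>))"
            if z: "norm z \<le> R" for z
          proof -
            have "x + z \<in> K" "y + z \<in> K" using xK[of z] yK[of z] z R0 by auto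
            note m = mxS[OF this]
            have "\<Phi> (x + z) (y + z) t \<le> W * (1 + norm z / R) * A powr \<gamma>" using Phi_x[OF z, of "y + z"] by (simp add: A_def)
            also have "\<dots> = wa + W * A powr \<gamma> * norm z / R" by (simp add: wa_def algebra_simps)
            finally show ?thesis using m unfolding A_def[symmetric] by linarith
          qed
          \<comment> \<open>The points are moved one at a time, and the two maximality inequalities
            are added.\<close>
          have H2: "2 * W * norm (x - y) powr \<gamma> - W * (1 + norm z / R) * norm (x - y + z) powr \<gamma> - W * norm (x - y - z) powr \<gamma>
              \<le> (u (x, t) - u (x + z, t)) - (u (y, \<tau>) - u (y + z, \<tau>))" if z: "norm z \<le> R" for z
          proof -
            have "x + z \<in> K" using xK[of z] z R0 by auto
            from mxS[OF this mem(2)] Phi_x[OF z, of y]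
            have "u (x + z, t) \<le> u (x, t) - wa + W * (1 + norm z / R) * norm (x - y + z) powr \<gamma>"
              by (simp add: algebra_simps)
            moreover have "u (y, \<tau>) - u (y + z, \<tau>) \<le> W * norm (x - y - z) powr \<gamma> - wa"
              using mxS[OF mem(1) yK[OF z]] by (simp add: \<Phi>_def W_def algebra_simps)
            ultimately show ?thesis unfolding A_def[symmetric] wa_def by linarith
          qed
          \<comment> \<open>The weight is evaluated at \<open>t\<close>, but the increments at
            \<open>y\<close> belong to the time \<open>\<tau>\<close>. As
            \<open>|t - \<tau>| \<le> (1 + t) / (8 k)\<close>, Bernoulli's inequality bounds the
            ratio of the weights by 2.\<close>
          have \<theta>\<tau>: "\<theta> \<tau> \<le> 2 * \<theta> t"
          proof -
            have k1: "1 \<le> real k" using k by simp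
            have "\<bar>t - \<tau>\<bar> \<le> \<sigma> / real k" using small(1) \<iota>(3) by linarith
            also have "\<dots> \<le> ((1 + t) / 8) / real k" using D8 Dt k1 by (intro divide_right_mono) auto
            finally have "(1 + t) * (1 - 1 / (8 * real k)) \<le> 1 + \<tau>" using k1 by (simp add: field_simps abs_le_iff)
            moreover have "0 < (1 + t) * (1 - 1 / (8 * real k))" using t1 k1 by (intro mult_pos_pos) (auto simp: field_simps)
            ultimately have "\<theta> \<tau> \<le> ((1 + t) * (1 - 1 / (8 * real k))) powr (- real k)"
              unfolding \<theta>_def by (intro powr_mono2') auto
            also have "\<dots> = \<theta> t * (1 - 1 / (8 * real k)) powr (- real k)" by (simp add: \<theta>_def powr_mult)
            also have "\<dots> \<le> \<theta> t * 2"
            proof (rule mult_left_mono)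
              have "1 + real k * (- (1 / (8 * real k))) \<le> (1 + - (1 / (8 * real k))) ^ k"
                using k1 by (intro Bernoulli_inequality) (simp add: field_simps)
              then have "1 / 2 \<le> (1 - 1 / (8 * real k)) ^ k" using k1 by simp
              moreover have "(1 - 1 / (8 * real k)) powr (- real k) = 1 / (1 - 1 / (8 * real k)) ^ k"
                using k1 by (subst powr_minus_divide, subst powr_realpow) (auto simp: field_simps)
              moreover have "1 / B \<le> 2" if "1 / 2 \<le> B" for B :: real using that by (simp add: field_simps)
              ultimately show "(1 - 1 / (8 * real k)) powr (- real k) \<le> 2" by simp
            qed (use \<theta>0 in simp)
            finally show ?thesis by simp
          qed
          \<comment> \<open>The factor 8 is \<open>2 * 2 * 2\<close>: the weaker hypothesis with
            \<open>2 * L\<close>, the spatial weight within \<open>2 * R\<close>, and the time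
            weight.\<close>
          have sb: "u (x', t') - u (y', t') \<le> 8 * W * norm (x' - y') powr \<gamma>"
            if "x' \<in> K" "y' \<in> K" "-1 < t'" "t' \<le> T" "\<theta> t' \<le> 2 * \<theta> t" "sweight k x' \<le> sweight k x * 2" for x' y' t'
          proof -
            have s0: "0 \<le> sweight k x" using sweight_pos[OF x1, of k] by simp
            have "u (x', t') - u (y', t') \<le> 2 * L * sweight k x' * \<theta> t' * norm (x' - y') powr \<gamma>"
              using sb2 K1 that unfolding space_bound_def \<theta>_def by blast
            also have "\<dots> \<le> 2 * L * (sweight k x * 2) * (2 * \<theta> t) * norm (x' - y') powr \<gamma>"
              using that L1 s0 \<theta>0 sweight_pos[OF K1(1)[OF that(1)], of k]
              by (intro mult_right_mono mult_mono) (auto simp: \<theta>_def intro!: mult_nonneg_nonneg)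
            also have "\<dots> = 8 * W * norm (x' - y') powr \<gamma>" by (simp add: W_def)
            finally show ?thesis .
          qed
          have \<theta>2: "\<theta> t \<le> 2 * \<theta> t" using \<theta>0 by simp
          have s2: "sweight k (x + z) \<le> sweight k x * 2" if "norm z \<le> 2 * R" for z
            by (rule sweight_linear(2)[OF x1 k(1) R0 Rk that])
          have s2': "sweight k (y + z) \<le> sweight k x * 2" if "norm z \<le> R" for z
            unfolding yx using s2[OF zy[OF that]] .
          have H3x: "\<bar>u (x, t) - u (x + z, t)\<bar> \<le> 8 * W * norm z powr \<gamma>" if z: "norm z \<le> R" for z
          proof -
            have z2: "norm z \<le> 2 * R" using z R0 by simp
            show ?thesis
              using sb[OF mem(1) xK[OF z2] t1(1,2) \<theta>2] sb[OF xK[OF z2] mem(1) t1(1,2) \<theta>2 s2[OF z2]] s2[of 0] R0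
              by (simp add: abs_le_iff)
          qed
          have H3y: "\<bar>u (y, \<tau>) - u (y + z, \<tau>)\<bar> \<le> 8 * W * norm z powr \<gamma>" if z: "norm z \<le> R" for z
            using sb[OF mem(2) yK[OF z] \<tau>1(1,2) \<theta>\<tau>] sb[OF yK[OF z] mem(2) \<tau>1(1,2) \<theta>\<tau> s2'[OF z]] s2'[of 0] R0
            by (simp add: abs_le_iff)
          have A1: "A \<le> 1" using AR1 R1 by simp
          have Awa: "A \<le> A powr \<gamma>" using powr_mono'[of \<gamma> 1 A] \<gamma> A0 A1 by simp
          \<comment> \<open>On the contact set the excess of \<open>u\<close> would be an excess of
            the obstacle, as \<open>u\<close> is above it at \<open>y\<close>. The Lipschitz bound
            with \<open>A\<psi> \<le> W\<close> and closeness of the times leave at most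
            \<open>wa + M / 2\<close>.\<close>
          have obst: "\<psi> (x, t) < u (x, t)"
          proof (rule ccontr)
            assume "\<not> \<psi> (x, t) < u (x, t)"
            then have "u (x, t) - u (y, \<tau>) \<le> (\<psi> (x, t) - \<psi> (y, t)) + (\<psi> (y, t) - \<psi> (y, \<tau>))"
              using obs[OF y1 \<tau>1(1,3)] by linarith
            also have "\<dots> \<le> A\<psi> * A + B * \<bar>t - \<tau>\<bar> powr a"
              using \<psi>x[OF x1 y1 t1(1,3)] \<psi>t(2)[OF y1 t1(1,3) \<tau>1(1,3)] by (simp add: A_def abs_le_iff)
            also have "A\<psi> * A \<le> wa"
            proof -
              have "A\<psi> * A \<le> W * A powr \<gamma>"
              proof (intro mult_mono)
                have "L * 1 \<le> L * (1 / D) ^ k" using L1 \<open>1 \<le> (1 / D) ^ k\<close> by (intro mult_left_mono) auto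
                then show "A\<psi> \<le> W" using L1(2) by (simp add: WD)
              qed (use Awa W1 A0 in auto)
              then show ?thesis by (simp add: wa_def)
            qed
            also have "B * \<bar>t - \<tau>\<bar> powr a \<le> \<bar>B\<bar> * \<iota> powr a"
              using small(1) \<psi>t(1) by (intro mult_mono powr_mono2) auto
            finally show False using gap \<iota>(4) M unfolding Phi by linarith
          qed

          \<comment> \<open>Test paraboloids at the two contact points\<close>
          define b where "b = (2 * real k / (1 - (norm x)\<^sup>2)) *\<^sub>R x"
          have nb: "norm b \<le> 1 / (8 * R)" unfolding b_def by (rule sweight_gradient_le[OF x1 k(1) R0 Rk])
          \<comment> \<open>Gradient at \<open>x\<close> of weight times modulus, divided by the
            weight: the first term from the weight, the second from the modulus.\<close>
          define P0 where "P0 = A powr \<gamma> *\<^sub>R b + (\<gamma> * A powr (\<gamma> - 2)) *\<^sub>R (x - y)"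
          define Q where "Q = W * A powr (\<gamma> - 2)"
          define \<rho> where "\<rho> = \<delta> * A"
          have Q0: "0 \<le> Q" using W1 by (simp add: Q_def)
          have \<rho>: "0 < \<rho>" "\<rho> \<le> A"
            using \<delta> A0 mult_right_mono[of \<delta> 1 A] by (auto simp: \<rho>_def)
          have pow1: "A powr (\<gamma> - 2) * A = A powr (\<gamma> - 1)" "A powr \<gamma> / A = A powr (\<gamma> - 1)"
          proof -
            show "A powr (\<gamma> - 2) * A = A powr (\<gamma> - 1)" using A0 powr_add[of A "\<gamma> - 2" 1] by simp
            show "A powr \<gamma> / A = A powr (\<gamma> - 1)" using A0 powr_diff[of A \<gamma> 1] by simp
          qed
          have nP: "norm (W *\<^sub>R P0) \<le> 2 * W * A powr (\<gamma> - 1)"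
          proof -
            have "norm P0 \<le> A powr \<gamma> * norm b + \<gamma> * A powr (\<gamma> - 2) * A"
              unfolding P0_def using norm_triangle_ineq[of "A powr \<gamma> *\<^sub>R b" "(\<gamma> * A powr (\<gamma> - 2)) *\<^sub>R (x - y)"] \<gamma> by (simp add: A_def)
            also have "A powr \<gamma> * norm b \<le> A powr \<gamma> * (1 / A)"
            proof (intro mult_left_mono)
              have "1 / (8 * R) \<le> 1 / A" using AR1 A0 R0 by (intro divide_left_mono mult_pos_pos) auto
              then show "norm b \<le> 1 / A" using nb by linarith
            qed simp
            also have "\<gamma> * A powr (\<gamma> - 2) * A \<le> A powr (\<gamma> - 1)"
              using \<gamma> mult_right_mono[of \<gamma> 1 "A powr (\<gamma> - 1)"] by (simp add: mult.assoc pow1)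
            finally have "norm P0 \<le> 2 * A powr (\<gamma> - 1)" using pow1 by simp
            then show ?thesis using W1 by (simp add: mult_left_mono)
          qed
          have spx: "sweight k (x + z) * norm (x + z - y) powr \<gamma> \<le> sweight k x * (A powr \<gamma> + P0 \<bullet> z + A powr (\<gamma> - 2) * (norm z)\<^sup>2)"
            if z: "norm z \<le> A" for z
          proof -
            have z2: "norm z \<le> 2 * R" using z AR1 R0 by simp
            have xyz: "x + z - y = (x - y) + z" by simp
            have "sweight k (x + z) * norm (x + z - y) powr \<gamma>
                \<le> sweight k x * (1 + b \<bullet> z + (norm z)\<^sup>2 / (8 * R\<^sup>2)) * norm (x - y + z) powr \<gamma>"
              unfolding xyz using sweight_quadratic(2)[OF x1 k(1) R0 Rk z2] unfolding b_def by (rule mult_right_mono) simp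
            also have "\<dots> \<le> sweight k x * (A powr \<gamma> + P0 \<bullet> z + A powr (\<gamma> - 2) * (norm z)\<^sup>2)"
              unfolding mult.assoc P0_def A_def
              using \<gamma> dd(3) AR1 z nb sweight_pos[OF x1, of k]
              by (intro mult_left_mono product_paraboloid) (auto simp: A_def)
            finally show ?thesis .
          qed
          \<comment> \<open>The touching cylinder has to stay in the set where maximality is known,
            so its height is at most \<open>\<sigma>\<close>. This radius depends on the solution,
            the error only on \<open>\<rho>\<close>.\<close>
          define r where "r = min \<rho> (sqrt \<sigma>)"
          have r: "0 < r" "r \<le> \<rho>" "r\<^sup>2 \<le> \<sigma>"
          proof -
            show "0 < r" "r \<le> \<rho>" using \<rho> \<sigma> by (auto simp: r_def)
            have "r\<^sup>2 \<le> (sqrt \<sigma>)\<^sup>2" using \<open>0 < r\<close> by (intro power_mono) (auto simp: r_def)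
            then show "r\<^sup>2 \<le> \<sigma>" using \<sigma> by simp
          qed
          have rR: "r \<le> R" using r \<rho> AR1 by linarith
          have cylK: "x' \<in> K" "t' \<in> I" if "(x', t') \<in> par_cyl r x t" for x' t'
          proof -
            have "norm (x' - x) < r" "t - r\<^sup>2 < t'" "t' \<le> t" using that by (auto simp: par_cyl_def dist_norm norm_minus_commute)
            then show "x' \<in> K" "t' \<in> I" using xK[of "x' - x"] rR R0 r(3) D8 Dt \<sigma> t1 by (auto simp: I_def)
          qed
          have \<tau>8: "7 * \<sigma> \<le> 1 + \<tau>"
          proof -
            have "\<sigma> / real k \<le> \<sigma> / 1" using \<sigma> k by (intro divide_left_mono) auto
            then show ?thesis using small(1) \<iota>(3) D8 Dt by linarith
          qed
          have cylK2: "y' \<in> K" "t' \<in> I" if "(y', t') \<in> par_cyl r y \<tau>" for y' t'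
          proof -
            have "norm (y' - y) < r" "\<tau> - r\<^sup>2 < t'" "t' \<le> \<tau>" using that by (auto simp: par_cyl_def dist_norm norm_minus_commute)
            then show "y' \<in> K" "t' \<in> I" using yK[of "y' - y"] rR r(3) \<tau>8 \<sigma> \<tau>1 by (auto simp: I_def)
          qed
          have KIsub: "x' \<in> K \<Longrightarrow> t' \<in> I \<Longrightarrow> (x', t') \<in> par_cyl 1 0 0" for x' t'
            using K1 \<sigma> T by (auto simp: par_cyl_def I_def)
          \<comment> \<open>Time enters the weighted modulus only through \<open>\<theta>\<close>.
            The paraboloid at \<open>t'\<close> is therefore the one at \<open>t\<close> times this
            ratio; its constant term \<open>wa\<close> goes into \<open>\<alpha>\<close> together
            with the penalty.\<close>
          define \<beta> where "\<beta> = (\<lambda>t'. \<theta> t' / \<theta> t)"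
          define \<beta>' where "\<beta>' = (\<lambda>t'. - real k * (1 + t') powr (- real k - 1) / \<theta> t)"
          define \<alpha> where "\<alpha> = (\<lambda>t'. u (x, t) + wa * (\<beta> t' - 1) + n * ((t' - \<tau>)\<^sup>2 - (t - \<tau>)\<^sup>2))"
          define \<alpha>' where "\<alpha>' = (\<lambda>t'. wa * \<beta>' t' + n * (2 * (t' - \<tau>)))"
          have d\<beta>: "(\<beta> has_real_derivative \<beta>' t') (at t')" if "-1 < t'" for t'
            unfolding \<beta>_def \<beta>'_def \<theta>_def using that \<theta>0 by (auto intro!: derivative_eq_intros simp: \<theta>_def)
          have d\<alpha>: "(\<alpha> has_real_derivative \<alpha>' t') (at t')" if "-1 < t'" for t'
            unfolding \<alpha>_def \<alpha>'_def by (rule derivative_eq_intros d\<beta> that refl | simp)+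
          have tt: "-1 < t'" if "t' \<in> {t - r\<^sup>2<..t}" for t' using that r(3) D8 Dt \<sigma> by auto
          have c\<beta>: "continuous_on {t - r\<^sup>2<..t} \<beta>'"
            unfolding \<beta>'_def using tt \<theta>0 by (intro continuous_intros) force+
          have vx: "\<alpha>' t + (LINT w:{w. \<rho> \<le> norm (x - w)}|lebesgue. frac_kernel p s (\<lambda>w. u (w, t)) x w)
              \<le> C0 * (norm (W *\<^sub>R P0) + Q * \<rho>) powr (p - 2) * Q * \<rho> powr (p - s * p)"
          proof (rule visc_ineqD[OF vsub r(1,2) Q0, where \<beta> = \<beta> and \<beta>' = \<beta>'])
            show "par_cyl r x t \<subseteq> par_cyl 1 0 0" using cylK KIsub by auto
            show "\<psi> (x, t) < u (x, t)" by (rule obst)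
            show "(\<alpha> has_real_derivative \<alpha>' t') (at t')" "(\<beta> has_real_derivative \<beta>' t') (at t')" if "t' \<in> {t - r\<^sup>2<..t}" for t'
              using d\<alpha> d\<beta> tt[OF that] by auto
            show "continuous_on {t - r\<^sup>2<..t} \<beta>'" by (rule c\<beta>)
            show "continuous_on {t - r\<^sup>2<..t} \<alpha>'" unfolding \<alpha>'_def by (intro continuous_intros c\<beta>)
            show "\<beta> t = 1" using \<theta>0 by (simp add: \<beta>_def)
            then show "\<alpha> t = u (x, t)" by (simp add: \<alpha>_def)
            fix x' t' assume cyl: "(x', t') \<in> par_cyl r x t"
            define z where "z = x' - x"
            have x': "x' = x + z" by (simp add: z_def)
            have nz: "norm (x - x') = norm z" "norm z \<le> A" using cyl r \<rho> by (auto simp: z_def par_cyl_def dist_norm norm_minus_commute)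
            have "t' > -1" using cylK(2)[OF cyl] \<sigma> by (simp add: I_def)
            then have \<theta>': "0 < \<theta> t'" by (simp add: \<theta>_def)
            have "u (x', t') - u (y, \<tau>) - \<Phi> x' y t' - n * (t' - \<tau>)\<^sup>2 \<le> u (x, t) - u (y, \<tau>) - \<Phi> x y t - n * (t - \<tau>)\<^sup>2"
              using mx[OF cylK(1)[OF cyl] mem(2) cylK(2)[OF cyl] mem(4)] .
            moreover have "\<Phi> x' y t' \<le> \<beta> t' * (wa + W *\<^sub>R P0 \<bullet> z + Q * (norm z)\<^sup>2)"
            proof -
              have "\<Phi> x' y t' = L * \<theta> t' * (sweight k (x + z) * norm (x + z - y) powr \<gamma>)" by (simp add: \<Phi>_def x')
              also have "\<dots> \<le> L * \<theta> t' * (sweight k x * (A powr \<gamma> + P0 \<bullet> z + A powr (\<gamma> - 2) * (norm z)\<^sup>2))"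
                using L1 \<theta>' by (intro mult_left_mono spx nz(2)) auto
              also have "\<dots> = \<beta> t' * (W * (A powr \<gamma> + P0 \<bullet> z + A powr (\<gamma> - 2) * (norm z)\<^sup>2))"
                using \<theta>0 by (simp add: \<beta>_def W_def)
              also have "W * (A powr \<gamma> + P0 \<bullet> z + A powr (\<gamma> - 2) * (norm z)\<^sup>2) = wa + W *\<^sub>R P0 \<bullet> z + Q * (norm z)\<^sup>2"
                by (simp add: wa_def Q_def algebra_simps)
              finally show ?thesis .
            qed
            ultimately have "u (x', t') \<le> u (x, t) - wa + \<beta> t' * (wa + W *\<^sub>R P0 \<bullet> z + Q * (norm z)\<^sup>2) + n * (t' - \<tau>)\<^sup>2 - n * (t - \<tau>)\<^sup>2"
              unfolding Phi by linarith
            also have "\<dots> = \<alpha> t' + \<beta> t' * (W *\<^sub>R P0 \<bullet> (x' - x) + Q * (norm (x - x'))\<^sup>2)"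
              by (simp add: \<alpha>_def nz(1) z_def[symmetric] algebra_simps)
            finally show "u (x', t') \<le> \<alpha> t' + \<beta> t' * (W *\<^sub>R P0 \<bullet> (x' - x) + Q * (norm (x - x'))\<^sup>2)" .
          next
            fix x' assume x': "norm (x - x') < \<rho>"
            define z where "z = x' - x"
            have nz: "norm (x - x') = norm z" "norm z \<le> A" "norm z \<le> 2 * R" using x' \<rho> AR1 R0 by (auto simp: z_def norm_minus_commute)
            have xz: "x' = x + z" by (simp add: z_def)
            have "\<Phi> x' y t = L * \<theta> t * (sweight k (x + z) * norm (x + z - y) powr \<gamma>)" by (simp add: \<Phi>_def xz)
            also have "\<dots> \<le> L * \<theta> t * (sweight k x * (A powr \<gamma> + P0 \<bullet> z + A powr (\<gamma> - 2) * (norm z)\<^sup>2))"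
              using L1 \<theta>0 by (intro mult_left_mono spx nz(2)) auto
            also have "\<dots> = wa + W *\<^sub>R P0 \<bullet> z + Q * (norm z)\<^sup>2" by (simp add: wa_def W_def Q_def algebra_simps)
            finally show "u (x', t) \<le> u (x, t) + W *\<^sub>R P0 \<bullet> (x' - x) + Q * (norm (x - x'))\<^sup>2"
              using mxS[OF _ mem(2), of x'] xK[OF nz(3)] unfolding nz(1) z_def[symmetric] xz[symmetric] by simp
          qed
          \<comment> \<open>Moving \<open>y\<close> leaves the weight fixed, so this gradient has no
            counterpart of \<open>b\<close>.\<close>
          define P2 where "P2 = (\<gamma> * A powr (\<gamma> - 2)) *\<^sub>R (y - x)"
          have nP2: "norm (W *\<^sub>R P2) \<le> 2 * W * A powr (\<gamma> - 1)"
          proof -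
            have "norm P2 = \<gamma> * (A powr (\<gamma> - 2) * A)" using \<gamma> by (simp add: P2_def A_def norm_minus_commute)
            also have "\<dots> \<le> 1 * A powr (\<gamma> - 1)" unfolding pow1 using \<gamma> by (intro mult_right_mono) auto
            finally have "norm P2 \<le> 2 * A powr (\<gamma> - 1)" by (simp add: order_trans[OF _ mult_right_mono[of 1 2]])
            then show ?thesis using W1 by (simp add: mult_left_mono)
          qed
          have spy: "W * norm (x - (y + z)) powr \<gamma> \<le> wa + W *\<^sub>R P2 \<bullet> z + Q * (norm z)\<^sup>2" if z: "norm z \<le> A" for z
          proof -
            have e: "norm (x - (y + z)) = norm ((y - x) + z)" using norm_minus_cancel[of "(y - x) + z"] by (simp add: algebra_simps)
            have "norm ((y - x) + z) powr \<gamma> \<le> (1 + 0 \<bullet> z + (norm z)\<^sup>2 / (8 * R\<^sup>2)) * norm ((y - x) + z) powr \<gamma>"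
              using mult_right_mono[of 1 "1 + (norm z)\<^sup>2 / (8 * R\<^sup>2)" "norm ((y - x) + z) powr \<gamma>"] by simp
            also have "\<dots> \<le> norm (y - x) powr \<gamma> + (norm (y - x) powr \<gamma> *\<^sub>R 0 + (\<gamma> * norm (y - x) powr (\<gamma> - 2)) *\<^sub>R (y - x)) \<bullet> z + norm (y - x) powr (\<gamma> - 2) * (norm z)\<^sup>2"
              using \<gamma> dd(3) AR1 z R0 by (intro product_paraboloid) (auto simp: A_def norm_minus_commute)
            also have "\<dots> = A powr \<gamma> + P2 \<bullet> z + A powr (\<gamma> - 2) * (norm z)\<^sup>2" by (simp add: P2_def A_def norm_minus_commute)
            finally have "W * norm (x - (y + z)) powr \<gamma> \<le> W * (A powr \<gamma> + P2 \<bullet> z + A powr (\<gamma> - 2) * (norm z)\<^sup>2)"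
              unfolding e using W1 by (intro mult_left_mono) auto
            also have "\<dots> = wa + W *\<^sub>R P2 \<bullet> z + Q * (norm z)\<^sup>2" by (simp add: wa_def Q_def algebra_simps)
            finally show ?thesis .
          qed
          define \<alpha>2 where "\<alpha>2 = (\<lambda>t'. - u (y, \<tau>) + n * ((t - t')\<^sup>2 - (t - \<tau>)\<^sup>2))"
          define \<alpha>2' where "\<alpha>2' = (\<lambda>t'. n * (- 2 * (t - t')))"
          have vy: "\<alpha>2' \<tau> + (LINT w:{w. \<rho> \<le> norm (y - w)}|lebesgue. frac_kernel p s (\<lambda>w. - u (w, \<tau>)) y w)
              \<le> C0 * (norm (W *\<^sub>R P2) + Q * \<rho>) powr (p - 2) * Q * \<rho> powr (p - s * p)"
          proof (rule visc_ineqD[OF vsup r(1,2) Q0, where \<beta> = "\<lambda>t. 1" and \<beta>' = "\<lambda>t. 0"])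
            show "par_cyl r y \<tau> \<subseteq> par_cyl 1 0 0" using cylK2 KIsub by auto
            show "(\<alpha>2 has_real_derivative \<alpha>2' t') (at t')" "((\<lambda>t. 1) has_real_derivative 0) (at t')" if "t' \<in> {\<tau> - r\<^sup>2<..\<tau>}" for t'
              unfolding \<alpha>2_def \<alpha>2'_def by (auto intro!: derivative_eq_intros)
            show "continuous_on {\<tau> - r\<^sup>2<..\<tau>} \<alpha>2'" unfolding \<alpha>2'_def by (intro continuous_intros)
            show "\<alpha>2 \<tau> = - u (y, \<tau>)" by (simp add: \<alpha>2_def)
            have phi_y: "\<Phi> x (y + z) t = W * norm (x - (y + z)) powr \<gamma>" for z by (simp add: \<Phi>_def W_def)
            {
              fix y' t' assume cyl: "(y', t') \<in> par_cyl r y \<tau>"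
              define z where "z = y' - y"
              have y': "y' = y + z" by (simp add: z_def)
              have nz: "norm (y - y') = norm z" "norm z \<le> A" using cyl r \<rho> by (auto simp: z_def par_cyl_def dist_norm norm_minus_commute)
              have "u (x, t) - u (y', t') - \<Phi> x y' t - n * (t - t')\<^sup>2 \<le> u (x, t) - u (y, \<tau>) - \<Phi> x y t - n * (t - \<tau>)\<^sup>2"
                using mx[OF mem(1) cylK2(1)[OF cyl] mem(3) cylK2(2)[OF cyl]] .
              then have "- u (y', t') \<le> - u (y, \<tau>) + (wa + W *\<^sub>R P2 \<bullet> z + Q * (norm z)\<^sup>2) - wa + n * (t - t')\<^sup>2 - n * (t - \<tau>)\<^sup>2"
                using spy[OF nz(2)] unfolding Phi y' phi_y by linarith
              also have "\<dots> = \<alpha>2 t' + 1 * (W *\<^sub>R P2 \<bullet> (y' - y) + Q * (norm (y - y'))\<^sup>2)"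
                by (simp add: \<alpha>2_def nz(1) z_def[symmetric] algebra_simps)
              finally show "- u (y', t') \<le> \<alpha>2 t' + 1 * (W *\<^sub>R P2 \<bullet> (y' - y) + Q * (norm (y - y'))\<^sup>2)" .
            }
            fix y' assume y': "norm (y - y') < \<rho>"
            define z where "z = y' - y"
            have nz: "norm (y - y') = norm z" "norm z \<le> A" "norm z \<le> R" using y' \<rho> AR1 by (auto simp: z_def norm_minus_commute)
            have yz: "y' = y + z" by (simp add: z_def)
            show "- u (y', \<tau>) \<le> - u (y, \<tau>) + W *\<^sub>R P2 \<bullet> (y' - y) + Q * (norm (y - y'))\<^sup>2"
              using mxS[OF mem(1) yK[OF nz(3)]] spy[OF nz(2)] unfolding phi_y nz(1) z_def[symmetric] yz by simp
          qed auto

          \<comment> \<open>Contradiction from the two viscosity inequalities\<close>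
          define X where "X = W powr (p - 1) * A powr (\<gamma> * (p - 1) - s * p)"
          have e1: "C0 * (norm (W *\<^sub>R P0) + Q * \<rho>) powr (p - 2) * Q * \<rho> powr (p - s * p) \<le> C0 * 3 powr (p - 2) * \<delta> powr (p - s * p) * X"
            unfolding Q_def \<rho>_def X_def using \<delta> C0 by (intro test_error_bound \<gamma>(1,2) A0 W1 nP) auto
          have e2: "C0 * (norm (W *\<^sub>R P2) + Q * \<rho>) powr (p - 2) * Q * \<rho> powr (p - s * p) \<le> C0 * 3 powr (p - 2) * \<delta> powr (p - s * p) * X"
            unfolding Q_def \<rho>_def X_def using \<delta> C0 by (intro test_error_bound \<gamma>(1,2) A0 W1 nP2) auto
          have minus: "(LINT w:{w. \<rho> \<le> norm (y - w)}|lebesgue. frac_kernel p s (\<lambda>w. - u (w, \<tau>)) y w)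
              = - (LINT w:{w. \<rho> \<le> norm (y - w)}|lebesgue. frac_kernel p s (\<lambda>w. u (w, \<tau>)) y w)"
            by (simp add: frac_kernel_minus set_lebesgue_integral_def)
          \<comment> \<open>The derivatives of the penalty cancel. What remains is
            \<open>- wa * k / (1 + t)\<close>, and \<open>k / (1 + t) \<le> 1 / R\<close> by the
            choice of \<open>R\<close>.\<close>
          have \<Theta>: "- (1 * W * norm (x - y) powr \<gamma> / R) \<le> \<alpha>' t + \<alpha>2' \<tau>"
          proof -
            have "(1 + t) powr (- real k - 1) = \<theta> t / (1 + t)" using t1 by (simp add: \<theta>_def powr_diff)
            then have "\<beta>' t = - (real k / (1 + t))" using \<theta>0 by (simp add: \<beta>'_def)
            then have "\<alpha>' t + \<alpha>2' \<tau> = - (wa * (real k / (1 + t)))" by (simp add: \<alpha>'_def \<alpha>2'_def algebra_simps)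
            moreover have "real k / (1 + t) \<le> 1 / R"
            proof -
              have "real k / (1 + t) \<le> real k / D" using Dt D0 t1 by (intro divide_left_mono mult_pos_pos) auto
              also have "\<dots> \<le> 1 / R" using D0 N by (simp add: R_def N_def field_simps)
              finally show ?thesis .
            qed
            ultimately show ?thesis using mult_left_mono[of "real k / (1 + t)" "1 / R" wa] wa0 by (simp add: wa_def A_def)
          qed
          have "X \<le> C * R powr (- q - 1) * (W * norm (x - y) powr \<gamma> + \<bar>u (x, t) - u (y, \<tau>)\<bar> + \<zeta> + \<zeta> powr (2 - p) * tail_mass (\<lambda>w. u (w, t) - u (w, \<tau>)))"
            unfolding X_def A_def
          proof (rule core[where \<Theta> = "\<alpha>' t + \<alpha>2' \<tau>"])
            show "\<alpha>' t + \<alpha>2' \<tau> + (LINT w:{w. \<delta> * norm (x - y) \<le> norm (x - w)}|lebesgue. frac_kernel p s (\<lambda>w. u (w, t)) x w)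
              - (LINT w:{w. \<delta> * norm (x - y) \<le> norm (y - w)}|lebesgue. frac_kernel p s (\<lambda>w. u (w, \<tau>)) y w)
              \<le> 2 * C0 * 3 powr (p - 2) * \<delta> powr (p - s * p) * (W powr (p - 1) * norm (x - y) powr (\<gamma> * (p - 1) - s * p))"
              using vx vy e1 e2 minus unfolding \<rho>_def X_def A_def by linarith
          qed (use dd(3) R0 R1 AR W1 wa2 x1 y1 ubd ok mass t1 \<tau>1 H1 H2 H3x H3y \<zeta> \<Theta> in \<open>auto simp: A_def wa_def\<close>)
          \<comment> \<open>The hypothesis with \<open>2 * L\<close> gives
            \<open>M + wa \<le> 2 * wa + \<iota>\<close>, so \<open>M\<close> itself is controlled
            by \<open>wa\<close> and so are all quantities that were chosen small relative to
            \<open>M\<close>.\<close>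
          also have "\<dots> \<le> C * R powr (- q - 1) * (5 * wa)"
          proof (intro mult_left_mono)
            have "u (x, t) - u (y, t) \<le> 2 * wa"
              using sb2 x1 y1 t1 unfolding space_bound_def wa_def W_def \<theta>_def A_def by (simp add: mult.assoc)
            then have g2: "u (x, t) - u (y, \<tau>) \<le> 2 * wa + \<iota>" using small(2) by (simp add: abs_less_iff)
            have g3: "\<zeta> powr (2 - p) * tail_mass (\<lambda>w. u (w, t) - u (w, \<tau>)) \<le> M / 8"
            proof -
              have "\<zeta> powr (2 - p) * tail_mass (\<lambda>w. u (w, t) - u (w, \<tau>)) \<le> \<zeta> powr (2 - p) * \<iota>"
                using small(3) by (intro mult_left_mono) auto
              then show ?thesis using \<iota>(5) by linarith
            qed
            have "\<bar>u (x, t) - u (y, \<tau>)\<bar> = u (x, t) - u (y, \<tau>)" using gap wa0 M unfolding Phi by simp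
            then show "W * norm (x - y) powr \<gamma> + \<bar>u (x, t) - u (y, \<tau>)\<bar> + \<zeta> + \<zeta> powr (2 - p) * tail_mass (\<lambda>w. u (w, t) - u (w, \<tau>)) \<le> 5 * wa"
              using g2 g3 gap \<zeta>(3) \<iota>(2) unfolding Phi A_def[symmetric] wa_def[symmetric] by linarith
          qed (use C in simp)
          finally have X5: "X \<le> C * R powr (- q - 1) * (5 * wa)" .
          \<comment> \<open>After division by \<open>wa\<close> the left side still has the power
            \<open>\<gamma> * (p - 2) - s * p < 0\<close> of \<open>A \<le> 1\<close>, which is at
            least 1. This is where \<open>s p > p - 2\<close> decides the sign.\<close>
          have "W powr (p - 2) \<le> H * D powr (- q - 1)"
          proof -
            have Xe: "X = W powr (p - 2) * A powr (\<gamma> * (p - 2) - s * p) * wa"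
            proof -
              have "W powr (p - 2) * W powr 1 = W powr (p - 1)" "A powr (\<gamma> * (p - 2) - s * p) * A powr \<gamma> = A powr (\<gamma> * (p - 1) - s * p)"
                unfolding powr_add[symmetric] by (simp_all add: algebra_simps)
              then have "X = (W powr (p - 2) * W powr 1) * (A powr (\<gamma> * (p - 2) - s * p) * A powr \<gamma>)" by (simp only: X_def)
              then show ?thesis using W1 by (simp add: wa_def)
            qed
            have wapos: "0 < wa" using W1 A0 by (simp add: wa_def)
            have "1 powr (\<gamma> * (p - 2) - s * p) \<le> A powr (\<gamma> * (p - 2) - s * p)"
              using A0 A1 \<gamma>(3) by (intro powr_mono2') auto
            then have "W powr (p - 2) * 1 \<le> W powr (p - 2) * A powr (\<gamma> * (p - 2) - s * p)" by (intro mult_left_mono) auto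
            moreover have "W powr (p - 2) * A powr (\<gamma> * (p - 2) - s * p) \<le> 5 * C * R powr (- q - 1)"
            proof (rule mult_right_le_imp_le[OF _ wapos])
              show "W powr (p - 2) * A powr (\<gamma> * (p - 2) - s * p) * wa \<le> 5 * C * R powr (- q - 1) * wa"
                using X5 unfolding Xe by (simp only: mult_ac)
            qed
            moreover have "R powr (- q - 1) = N powr (q + 1) * D powr (- q - 1)"
            proof -
              have "R powr (- q - 1) = D powr (- q - 1) / N powr (- q - 1)" using D0 N by (simp add: R_def powr_divide)
              also have "N powr (- q - 1) = 1 / N powr (q + 1)" using powr_minus_divide[of N "q + 1"] by simp
              finally show ?thesis by simp
            qed
            ultimately show ?thesis by (simp add: H_def mult.assoc)
          qed
          moreover have "W powr (p - 2) = L powr (p - 2) * D powr (- (real k * (p - 2)))"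
          proof -
            have "(1 / D) ^ k = D powr (- real k)" using D0 by (simp add: powr_minus powr_realpow power_one_over divide_simps)
            then show ?thesis unfolding WD using L1 D0 by (simp add: powr_mult powr_powr)
          qed
          \<comment> \<open>The choice of \<open>k\<close>: the blow-up of the weight beats that of
            the far field, so \<open>D\<close> drops out and \<open>L\<close> is bounded by a
            universal constant.\<close>
          moreover have "D powr (- q - 1) \<le> D powr (- (real k * (p - 2)))"
            using k(2) D0 Dle by (intro powr_mono') auto
          moreover have "L powr (p - 2) \<ge> 0" by simp
          ultimately have "L powr (p - 2) * D powr (- q - 1) \<le> H * D powr (- q - 1)"
            by (smt (verit) mult_left_mono)
          then have "L powr (p - 2) \<le> H" using D0 by simp
          moreover have "H + 1 \<le> L powr (p - 2)"
          proof -
            have "((H + 1) powr (1 / (p - 2))) powr (p - 2) \<le> L powr (p - 2)"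
              using L1(4) p by (intro powr_mono2) auto
            then show ?thesis using H p by (simp add: powr_powr)
          qed
          ultimately show False by simp
        qed (use bd ok \<Phi>0 M' in auto)
      qed
    qed
  qed (use C0 in auto)
qed

text \<open>Both weights are at least 1 and \<open>a \<le> 2 * a powr \<gamma>\<close> for
  \<open>a \<le> 2\<close>, so the Lipschitz constant of \<open>u\<close> yields the bound with some
  \<open>L0 * 2 ^ n\<close>. The number \<open>n\<close> of halvings depends on \<open>u\<close>,
  the end of the descent does not.\<close>

lemma space_bound_iterate:
  assumes halve: "\<And>u \<psi> T L. sol_data C0 A \<psi> u \<Longrightarrow> -1 < T \<Longrightarrow> T < 0 \<Longrightarrow> L0 \<le> L \<Longrightarrow> space_bound k \<gamma> T (2 * L) u \<Longrightarrow> space_bound k \<gamma> T L u"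
    and L0: "1 \<le> L0" and \<gamma>: "0 < \<gamma>" "\<gamma> < 1"
    and sol: "sol_data C0 A \<psi> u" and T: "-1 < T" "T < 0"
  shows "space_bound k \<gamma> T L0 u"
proof -
  obtain C1 where C1: "\<And>x y t. norm x < 1 \<Longrightarrow> norm y < 1 \<Longrightarrow> -1 < t \<Longrightarrow> t \<le> 0 \<Longrightarrow> \<bar>u (x, t) - u (y, t)\<bar> \<le> C1 * norm (x - y)"
    using sol unfolding sol_data_def by blast
  obtain n :: nat where n: "2 * \<bar>C1\<bar> < 2 ^ n" using real_arch_pow[of 2 "2 * \<bar>C1\<bar>"] by auto
  have "space_bound k \<gamma> T (L0 * 2 ^ n) u"
    unfolding space_bound_def
  proof (intro allI impI)
    fix x y :: "real^'n" and t :: real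
    assume xy: "norm x < 1" "norm y < 1" and t: "-1 < t" "t \<le> T"
    define a where "a = norm (x - y)"
    have a2: "0 \<le> a" "a \<le> 2" unfolding a_def using norm_triangle_ineq4[of x y] xy by auto
    have "(norm x)\<^sup>2 < 1" using xy(1) by (simp add: power_less_one_iff abs_square_less_1)
    then have "1 \<le> 1 / (1 - (norm x)\<^sup>2)" by (simp add: field_simps)
    then have s1: "1 \<le> sweight k x" unfolding sweight_def by (rule one_le_power)
    have t1: "1 \<le> (1 + t) powr (- real k)"
      using powr_mono2'[of "- real k" "1 + t" 1] t T by simp
    have st: "1 \<le> sweight k x * (1 + t) powr (- real k)" using mult_mono[OF s1 t1] s1 by simp
    have a1: "a \<le> 2 * a powr \<gamma>"
    proof (cases "a = 0")
      case False
      then have "a = a powr (1 - \<gamma>) * a powr \<gamma>" using a2 by (simp add: powr_add[symmetric])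
      also have "a powr (1 - \<gamma>) \<le> 2 powr (1 - \<gamma>)" using a2 \<gamma> by (intro powr_mono2) auto
      also have "2 powr (1 - \<gamma>) \<le> 2 powr (1::real)" using \<gamma> by (intro powr_mono) auto
      finally show ?thesis by (simp add: mult_right_mono)
    qed simp
    have "u (x, t) - u (y, t) \<le> C1 * a" using C1[OF xy t(1)] t T by (simp add: a_def abs_le_iff)
    also have "\<dots> \<le> \<bar>C1\<bar> * (2 * a powr \<gamma>)" using a1 a2 by (intro mult_mono) auto
    also have "\<dots> \<le> 2 ^ n * a powr \<gamma>" using n mult_right_mono[of "2 * \<bar>C1\<bar>" "2 ^ n" "a powr \<gamma>"] by simp
    also have "\<dots> \<le> (L0 * 2 ^ n * (sweight k x * (1 + t) powr (- real k))) * a powr \<gamma>"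
    proof (intro mult_right_mono)
      have "1 * 2 ^ n * 1 \<le> L0 * 2 ^ n * (sweight k x * (1 + t) powr (- real k))"
        using L0 st by (intro mult_mono) auto
      then show "2 ^ n \<le> L0 * 2 ^ n * (sweight k x * (1 + t) powr (- real k))" by simp
    qed simp
    finally show "u (x, t) - u (y, t) \<le> L0 * 2 ^ n * sweight k x * (1 + t) powr (- real k) * norm (x - y) powr \<gamma>"
      by (simp add: a_def mult.assoc)
  qed
  then show ?thesis
  proof (induction n)
    case (Suc n)
    have "space_bound k \<gamma> T (2 * (L0 * 2 ^ n)) u" using Suc.prems by (simp add: mult_ac)
    then have "space_bound k \<gamma> T (L0 * 2 ^ n) u"
      by (rule halve[OF sol T, rotated]) (use L0 in auto)
    then show ?case by (rule Suc.IH)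
  qed simp
qed

lemma space_holder:
  assumes \<gamma>: "0 < \<gamma>" "\<gamma> < 1" "\<gamma> * (p - 2) < s * p" and C0: "C0 > 0" and A: "A \<ge> 0"
  obtains K where "64 \<le> K"
    "\<And>u \<psi> x y t. sol_data C0 A \<psi> u \<Longrightarrow> norm x \<le> 7 / 8 \<Longrightarrow> norm y \<le> 7 / 8 \<Longrightarrow> - 1 / 4 \<le> t \<Longrightarrow> t \<le> 0 \<Longrightarrow>
       \<bar>u (x, t) - u (y, t)\<bar> \<le> K * norm (x - y) powr \<gamma>"
proof -
  obtain k L0 where kL: "1 \<le> k" "1 \<le> L0" and halve: "\<And>u \<psi> T L. sol_data C0 A \<psi> u \<Longrightarrow> -1 < T \<Longrightarrow> T < 0 \<Longrightarrow> L0 \<le> L \<Longrightarrow> space_bound k \<gamma> T (2 * L) u \<Longrightarrow> space_bound k \<gamma> T L u"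
    by (rule space_bound_halving[OF \<gamma> C0 A]) blast
  \<comment> \<open>For \<open>|x| \<le> 7/8\<close> and \<open>t \<ge> -1/2\<close> the weights are
    at most \<open>5 ^ k\<close> and \<open>2 ^ k\<close>. The summand 64 makes the barrier of the
    time estimate exceed the oscillation of \<open>u\<close> on the lateral boundary.\<close>
  define K where "K = 64 + L0 * 10 ^ k"
  have K0: "0 \<le> K" using kL by (simp add: K_def)
  show ?thesis
  proof (rule that[of K])
    show "64 \<le> K" using kL by (simp add: K_def)
    fix u \<psi> :: "(real^'n) \<times> real \<Rightarrow> real" and x y :: "real^'n" and t :: real
    assume sol: "sol_data C0 A \<psi> u" and x: "norm x \<le> 7 / 8" and y: "norm y \<le> 7 / 8" and t: "- 1 / 4 \<le> t" "t \<le> 0"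
    have one: "u (x, t) - u (y, t) \<le> K * norm (x - y) powr \<gamma>"
      if x: "norm x \<le> 7 / 8" and y: "norm y \<le> 7 / 8" and t: "- 1 / 2 \<le> t" "t < 0" for x y :: "real^'n" and t :: real
    proof -
      have "space_bound k \<gamma> t L0 u"
        by (rule space_bound_iterate[OF halve kL(2) \<gamma>(1,2) sol]) (use t in auto)
      then have "u (x, t) - u (y, t) \<le> L0 * sweight k x * (1 + t) powr (- real k) * norm (x - y) powr \<gamma>"
        unfolding space_bound_def using x y t by auto
      also have "\<dots> \<le> K * norm (x - y) powr \<gamma>"
      proof (intro mult_right_mono)
        have "(norm x)\<^sup>2 \<le> (7 / 8)\<^sup>2" using x by (intro power_mono) auto
        then have "(norm x)\<^sup>2 \<le> 49 / 64" by (simp add: power2_eq_square)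
        then have "0 \<le> 1 / (1 - (norm x)\<^sup>2)" "1 / (1 - (norm x)\<^sup>2) \<le> 5" by (auto simp: field_simps)
        then have s5: "sweight k x \<le> 5 ^ k" "0 \<le> sweight k x" unfolding sweight_def by (auto intro: power_mono)
        have "(1 + t) powr (- real k) \<le> (1 / 2) powr (- real k)" using t by (intro powr_mono2') auto
        also have "\<dots> = 2 ^ k" by (simp add: powr_minus_divide powr_divide powr_realpow)
        finally have "L0 * sweight k x * (1 + t) powr (- real k) \<le> L0 * 5 ^ k * 2 ^ k"
          using s5 kL by (intro mult_mono) auto
        also have "\<dots> = L0 * 10 ^ k" by (simp add: power_mult_distrib[symmetric])
        finally show "L0 * sweight k x * (1 + t) powr (- real k) \<le> K" by (simp add: K_def)
      qed simp
      finally show ?thesis .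
    qed
    have cont: "continuous_on (ball 0 1 \<times> {-1<..0}) u" using sol unfolding sol_data_def by blast
    have two: "u (x, t) - u (y, t) \<le> K * norm (x - y) powr \<gamma>"
      if x: "norm x \<le> 7 / 8" and y: "norm y \<le> 7 / 8" for x y :: "real^'n"
    proof -
      \<comment> \<open>The estimate is available for negative times only; the final time is a limit
        of these.\<close>
      let ?h = "\<lambda>\<tau>. u (x, \<tau>) - u (y, \<tau>)"
      have ch: "continuous_on {-1/2..0} ?h"
        by (intro continuous_intros continuous_on_compose2[OF cont]) (use x y in auto)
      have cl: "closure {-1/2..<0} = {-1/2..(0::real)}" by (rule closure_atLeastLessThan) simp
      show ?thesis
        by (rule continuous_le_on_closure[of "{-1/2..<0}" ?h]) (use ch cl one[OF x y] t in auto)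
    qed
    show "\<bar>u (x, t) - u (y, t)\<bar> \<le> K * norm (x - y) powr \<gamma>"
      using two[OF x y] two[OF y x] by (simp add: abs_le_iff norm_minus_commute)
  qed
qed

subsection \<open>Time regularity\<close>

text \<open>The predicate \<open>E\<close> lets one statement serve twice: for \<open>u\<close> it
  is the set above the obstacle, off which the growth of the obstacle takes over; for
  \<open>- u\<close> it is everything. The spatial Hoelder bound is used both to start the barrier
  and to bound its gradient at a contact point.\<close>

lemma time_growth:
  assumes \<gamma>: "0 < \<gamma>" "\<gamma> < 1" and \<alpha>: "0 < \<alpha>" "\<alpha> \<le> 1" and C0: "C0 > 0" and K: "64 \<le> K" and b: "0 \<le> b"
    and lam: "s * p < \<gamma> * (p - 1) + \<gamma> * (1 / \<alpha> - 1)"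
  obtains C where "C > 0"
    "\<And>v E t1 t2 x0. visc_ineq C0 E v \<Longrightarrow>
       (\<And>t. -1 < t \<Longrightarrow> t \<le> 0 \<Longrightarrow> tail_ok (\<lambda>x. v (x, t))) \<Longrightarrow> (\<And>t. -1 < t \<Longrightarrow> t \<le> 0 \<Longrightarrow> tail_mass (\<lambda>x. v (x, t)) \<le> 1) \<Longrightarrow>
       continuous_on (ball 0 1 \<times> {-1<..0}) v \<Longrightarrow>
       (\<And>x t. norm x < 1 \<Longrightarrow> -1 < t \<Longrightarrow> t \<le> 0 \<Longrightarrow> \<bar>v (x, t)\<bar> \<le> 1) \<Longrightarrow>
       (\<And>x y t. norm x \<le> 7 / 8 \<Longrightarrow> norm y \<le> 7 / 8 \<Longrightarrow> - 1 / 4 \<le> t \<Longrightarrow> t \<le> 0 \<Longrightarrow> \<bar>v (x, t) - v (y, t)\<bar> \<le> K * norm (x - y) powr \<gamma>) \<Longrightarrow>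
       - 1 / 4 < t1 \<Longrightarrow> t1 < t2 \<Longrightarrow> t2 \<le> 0 \<Longrightarrow> norm x0 < 1 / 2 \<Longrightarrow>
       (\<And>x t. norm x < 1 \<Longrightarrow> t1 \<le> t \<Longrightarrow> t \<le> t2 \<Longrightarrow> \<not> E (x, t) \<Longrightarrow> v (x, t) \<le> v (x, t1) + b * (t2 - t1) powr \<alpha>) \<Longrightarrow>
       v (x0, t2) - v (x0, t1) \<le> C * (t2 - t1) powr \<alpha>"
proof -
  \<comment> \<open>The exponent for which \<open>\<rho> powr (- l) * \<Delta>\<close> is of order
    \<open>\<Delta> powr \<alpha>\<close> when \<open>\<rho> powr \<gamma>\<close> is. The
    hypothesis \<open>lam\<close> says that the operator grows more slowly than
    \<open>\<rho> powr (- l)\<close>.\<close>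
  define l where "l = \<gamma> * (1 / \<alpha> - 1)"
  have l: "0 \<le> l" "s * p < \<gamma> * (p - 1) + l" "l * (\<alpha> / \<gamma>) = 1 - \<alpha>"
    using \<gamma> \<alpha> lam by (auto simp: l_def field_simps)
  define e where "e = \<gamma> * (p - 1) + l - s * p"
  have e: "e > 0" using l by (simp add: e_def)
  obtain Ci where Ci: "Ci > 0" "\<And>(x::real^'n) \<rho>. \<rho> > 0 \<Longrightarrow>
    set_integrable lebesgue {y. norm (x - y) < \<rho>} (\<lambda>y. norm (x - y) powr (e - real CARD('n)))
    \<and> (LINT y:{y. norm (x - y) < \<rho>}|lebesgue. norm (x - y) powr (e - real CARD('n))) \<le> Ci * \<rho> powr e"
    using radial_inner_at[OF e] by blast
  define Kt where "Kt = (1 + 2 powr q) * (1 / 16) powr (- q)"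
  have Kt: "Kt \<ge> 0" by (simp add: Kt_def)
  \<comment> \<open>The three contributions at a contact point: the paraboloid inside
    \<open>\<rho>\<close>, the Hoelder increments up to distance \<open>1/16\<close>, and the
    tail.\<close>
  define C5 where "C5 = C0 * 4 powr (p - 2) * K powr (p - 1) + K powr (p - 1) * Ci + Kt * tail_const"
  have C5: "C5 \<ge> 0" using C0 Ci Kt tail_const_pos by (simp add: C5_def)
  define C where "C = K + b + (C5 + 1) * 16 powr l"
  show ?thesis
  proof (rule that[of C])
    show "C > 0" using K b C5 by (auto simp: C_def intro!: add_pos_nonneg)
    fix v :: "(real^'n) \<times> real \<Rightarrow> real" and E t1 t2 and x0 :: "real^'n"
    assume visc: "visc_ineq C0 E v" and ok: "\<And>t. -1 < t \<Longrightarrow> t \<le> 0 \<Longrightarrow> tail_ok (\<lambda>x. v (x, t))"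
      and mass: "\<And>t. -1 < t \<Longrightarrow> t \<le> 0 \<Longrightarrow> tail_mass (\<lambda>x. v (x, t)) \<le> 1"
      and cont: "continuous_on (ball 0 1 \<times> {-1<..0}) v"
      and bd: "\<And>x t. norm x < 1 \<Longrightarrow> -1 < t \<Longrightarrow> t \<le> 0 \<Longrightarrow> \<bar>v (x, t)\<bar> \<le> 1"
      and hol: "\<And>x y t. norm x \<le> 7 / 8 \<Longrightarrow> norm y \<le> 7 / 8 \<Longrightarrow> - 1 / 4 \<le> t \<Longrightarrow> t \<le> 0 \<Longrightarrow> \<bar>v (x, t) - v (y, t)\<bar> \<le> K * norm (x - y) powr \<gamma>"
      and t: "- 1 / 4 < t1" "t1 < t2" "t2 \<le> 0" and x0: "norm x0 < 1 / 2"
      and obs: "\<And>x t. norm x < 1 \<Longrightarrow> t1 \<le> t \<Longrightarrow> t \<le> t2 \<Longrightarrow> \<not> E (x, t) \<Longrightarrow> v (x, t) \<le> v (x, t1) + b * (t2 - t1) powr \<alpha>"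

    \<comment> \<open>The barrier and the position of its contact points\<close>
    define \<Delta> where "\<Delta> = t2 - t1"
    have \<Delta>: "0 < \<Delta>" "\<Delta> \<le> 1" using t by (auto simp: \<Delta>_def)
    define \<rho> where "\<rho> = \<Delta> powr (\<alpha> / \<gamma>) / 16"
    have "\<Delta> powr (\<alpha> / \<gamma>) \<le> 1" using \<Delta> \<alpha> \<gamma> by (intro powr_le1) auto
    then have \<rho>: "0 < \<rho>" "\<rho> \<le> 1 / 16" using \<Delta> by (auto simp: \<rho>_def)
    define \<eta> where "\<eta> = K * \<rho> powr \<gamma>"
    define \<Lambda> where "\<Lambda> = K * \<rho> powr (\<gamma> - 2)"
    define M where "M = (C5 + 1) * \<rho> powr (- l)"
    have pow1: "1 \<le> \<rho> powr (\<gamma> - 2)" "1 \<le> \<rho> powr (- l)"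
      using powr_mono2'[of "\<gamma> - 2" \<rho> 1] powr_mono2'[of "- l" \<rho> 1] \<rho> \<gamma> l by auto
    have \<Lambda>: "64 \<le> \<Lambda>" "0 \<le> \<eta>" "0 < M"
    proof -
      have "64 * 1 \<le> K * \<rho> powr (\<gamma> - 2)" using K pow1 by (intro mult_mono) auto
      then show "64 \<le> \<Lambda>" by (simp add: \<Lambda>_def)
      show "0 \<le> \<eta>" using K by (simp add: \<eta>_def)
      show "0 < M" using C5 \<rho> by (simp add: M_def)
    qed
    \<comment> \<open>The paraboloid lies above the Hoelder cusp: below \<open>\<rho>\<close> by its
      constant, above \<open>\<rho>\<close> because \<open>r powr (\<gamma> - 2)\<close>
      decreases.\<close>
    have para: "K * r powr \<gamma> \<le> \<eta> + \<Lambda> * r\<^sup>2" if "0 \<le> r" for r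
    proof (cases "r \<le> \<rho>")
      case True
      then have "K * r powr \<gamma> \<le> K * \<rho> powr \<gamma>" using that \<gamma> K by (intro mult_left_mono powr_mono2) auto
      moreover have "0 \<le> \<Lambda> * r\<^sup>2" using \<Lambda> by simp
      ultimately show ?thesis by (simp add: \<eta>_def)
    next
      case False
      then have "r powr (\<gamma> - 2) \<le> \<rho> powr (\<gamma> - 2)" using \<rho> \<gamma> by (intro powr_mono2') auto
      then have "r powr (\<gamma> - 2) * r powr 2 \<le> \<rho> powr (\<gamma> - 2) * r powr 2" by (rule mult_right_mono) simp
      then have "r powr \<gamma> \<le> \<rho> powr (\<gamma> - 2) * r\<^sup>2" unfolding powr_add[symmetric] using False \<rho> by simp
      then have "K * r powr \<gamma> \<le> K * (\<rho> powr (\<gamma> - 2) * r\<^sup>2)" using K by (intro mult_left_mono) auto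
      then show ?thesis using \<Lambda> by (simp add: \<Lambda>_def mult.assoc)
    qed
    define b\<Delta> where "b\<Delta> = b * \<Delta> powr \<alpha>"
    have b\<Delta>: "0 \<le> b\<Delta>" using b by (simp add: b\<Delta>_def)
    define f where "f = (\<lambda>(x, t). v (x, t) - (v (x0, t1) + \<eta> + \<Lambda> * (norm (x - x0))\<^sup>2 + b\<Delta> + M * (t - t1)))"
    let ?S = "cball x0 (1/4) \<times> {t1..t2}"
    have S78: "norm x \<le> 3 / 4" if "norm (x - x0) \<le> 1 / 4" for x
      using norm_triangle_ineq[of x0 "x - x0"] that x0 by simp
    have nx0: "norm (x - x0) = norm (x0 - x)" for x by (rule norm_minus_commute)
    have Ssub: "?S \<subseteq> ball 0 1 \<times> {-1<..0}"
    proof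
      fix z assume "z \<in> ?S"
      then obtain x t where z: "z = (x, t)" "norm (x - x0) \<le> 1/4" "t1 \<le> t" "t \<le> t2"
        by (cases z) (auto simp: dist_norm nx0)
      then show "z \<in> ball 0 1 \<times> {-1<..0}" using S78[OF z(2)] \<open>- 1 / 4 < t1\<close> \<open>t2 \<le> 0\<close> by auto
    qed
    have "continuous_on ?S f"
      unfolding f_def case_prod_unfold
      by (intro continuous_intros continuous_on_compose2[OF continuous_on_subset[OF cont Ssub]]) auto
    moreover have "compact ?S" by (intro compact_Times) auto
    moreover have "?S \<noteq> {}" using t by auto
    ultimately obtain z0 where z0: "z0 \<in> ?S" "\<forall>z\<in>?S. f z \<le> f z0"
      using continuous_attains_sup[of ?S f] by blast
    obtain x1 \<tau> where z0e: "z0 = (x1, \<tau>)" by (cases z0) auto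
    have x1: "norm (x1 - x0) \<le> 1 / 4" and \<tau>: "t1 \<le> \<tau>" "\<tau> \<le> t2" using z0(1) by (auto simp: z0e dist_norm nx0)
    have mx: "f (x, t') \<le> f (x1, \<tau>)" if "norm (x - x0) \<le> 1/4" "t1 \<le> t'" "t' \<le> t2" for x t'
      using z0(2) that by (auto simp: z0e dist_norm nx0)
    have init: "v (x, t1) \<le> v (x0, t1) + \<eta> + \<Lambda> * (norm (x - x0))\<^sup>2" if "norm (x - x0) \<le> 1/4" for x
    proof -
      have "\<bar>v (x, t1) - v (x0, t1)\<bar> \<le> K * norm (x - x0) powr \<gamma>"
        using S78[OF that] x0 t by (intro hol) auto
      then show ?thesis using para[of "norm (x - x0)"] by (simp add: abs_le_iff)
    qed
    \<comment> \<open>At distance \<open>1/4\<close> the quadratic term is at least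
      \<open>64 / 16 = 4\<close>, more than the oscillation 2 of \<open>v\<close>.\<close>
    have far: "f (x, t') < 0" if "norm x < 1" "1 / 4 \<le> norm (x - x0)" "t1 \<le> t'" "t' \<le> t2" for x t'
    proof -
      have "v (x, t') \<le> 1" "- 1 \<le> v (x0, t1)" using bd[of x t'] bd[of x0 t1] that x0 t by (auto simp: abs_le_iff)
      moreover have "(1/4)\<^sup>2 \<le> (norm (x - x0))\<^sup>2" using that by (intro power_mono) auto
      then have "64 * (1/4)\<^sup>2 \<le> \<Lambda> * (norm (x - x0))\<^sup>2" using \<Lambda> by (intro mult_mono) auto
      then have "4 \<le> \<Lambda> * (norm (x - x0))\<^sup>2" by (simp add: power2_eq_square)
      moreover have "0 \<le> M * (t' - t1)" using \<Lambda> that by simp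
      ultimately show ?thesis using \<Lambda> b\<Delta> unfolding f_def by simp
    qed
    have "f (x1, \<tau>) \<le> 0"
    proof (rule ccontr)

      \<comment> \<open>Contradiction at a positive maximum\<close>
      assume "\<not> f (x1, \<tau>) \<le> 0"
      then have fpos: "f (x1, \<tau>) > 0" by simp
      have x11: "norm x1 < 1" using S78[OF x1] by simp
      have x1lt: "norm (x1 - x0) < 1 / 4"
        using far[OF x11 _ \<tau>] fpos by (cases "1 / 4 \<le> norm (x1 - x0)") auto
      have \<tau>1: "t1 < \<tau>"
      proof (rule ccontr)
        assume "\<not> t1 < \<tau>"
        then have "\<tau> = t1" using \<tau> by simp
        then show False using fpos init[OF x1] b\<Delta> by (simp add: f_def)
      qed
      have E: "E (x1, \<tau>)"
      proof (rule ccontr)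
        assume "\<not> E (x1, \<tau>)"
        then have "v (x1, \<tau>) \<le> v (x1, t1) + b\<Delta>" using obs[OF x11 \<tau>] by (simp add: b\<Delta>_def \<Delta>_def)
        moreover have "0 \<le> M * (\<tau> - t1)" using \<Lambda> \<tau> by simp
        ultimately show False using fpos init[OF x1] by (simp add: f_def)
      qed
      have \<tau>0: "-1/4 \<le> \<tau>" "\<tau> \<le> 0" "-1 < \<tau>" using \<tau> t by auto
      define P where "P = (2 * \<Lambda>) *\<^sub>R (x1 - x0)"
      have sq: "(norm (x - x0))\<^sup>2 = (norm (x1 - x0))\<^sup>2 + 2 * ((x1 - x0) \<bullet> (x - x1)) + (norm (x1 - x))\<^sup>2" for x
      proof -
        have "x - x0 = (x1 - x0) + (x - x1)" by simp
        then have "(norm (x - x0))\<^sup>2 = (norm (x1 - x0))\<^sup>2 + 2 * ((x1 - x0) \<bullet> (x - x1)) + (norm (x - x1))\<^sup>2"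
          by (metis (no_types) power2_norm_eq_inner inner_add_left inner_add_right inner_commute add.assoc mult_2)
        then show ?thesis by (simp add: norm_minus_commute)
      qed
      have touch: "v (x, t') \<le> v (x1, \<tau>) + M * (t' - \<tau>) + (P \<bullet> (x - x1) + \<Lambda> * (norm (x1 - x))\<^sup>2)"
        if "f (x, t') \<le> f (x1, \<tau>)" for x t'
      proof -
        have "\<Lambda> * (norm (x - x0))\<^sup>2 = \<Lambda> * (norm (x1 - x0))\<^sup>2 + (P \<bullet> (x - x1) + \<Lambda> * (norm (x1 - x))\<^sup>2)"
          unfolding sq[of x] by (simp add: P_def algebra_simps)
        moreover have "M * (t' - t1) = M * (\<tau> - t1) + M * (t' - \<tau>)" by (simp add: algebra_simps)
        ultimately show ?thesis using that unfolding f_def by simp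
      qed
      \<comment> \<open>The ball of radius \<open>\<rho>\<close> may leave the set of maximisation,
        but there \<open>f\<close> is negative, hence below its positive maximum.\<close>
      have mx1: "f (x, \<tau>) \<le> f (x1, \<tau>)" if "norm (x1 - x) < \<rho>" for x
      proof (cases "norm (x - x0) \<le> 1/4")
        case True
        then show ?thesis using mx \<tau> by simp
      next
        case False
        have "norm x \<le> norm x1 + norm (x1 - x)" using norm_triangle_ineq4[of x1 "x1 - x"] by simp
        then have "norm x < 1" using S78[OF x1] that \<rho> by simp
        then show ?thesis using far[of x \<tau>] False \<tau> fpos by simp
      qed
      define r where "r = min \<rho> (min (sqrt (\<tau> - t1)) (1 / 4 - norm (x1 - x0)))"
      have r: "0 < r" "r \<le> \<rho>" "r\<^sup>2 \<le> \<tau> - t1" "r \<le> 1 / 4 - norm (x1 - x0)"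
      proof -
        show "0 < r" "r \<le> \<rho>" "r \<le> 1 / 4 - norm (x1 - x0)" using \<rho> \<tau>1 x1lt by (auto simp: r_def)
        have "r\<^sup>2 \<le> (sqrt (\<tau> - t1))\<^sup>2" using \<open>0 < r\<close> by (intro power_mono) (auto simp: r_def)
        then show "r\<^sup>2 \<le> \<tau> - t1" using \<tau>1 by simp
      qed
      have cyl: "norm (x - x0) \<le> 1/4" "t1 \<le> t'" "t' \<le> t2" if "(x, t') \<in> par_cyl r x1 \<tau>" for x t'
      proof -
        have c: "norm (x1 - x) < r" "\<tau> - r\<^sup>2 < t'" "t' \<le> \<tau>" using that by (auto simp: par_cyl_def dist_norm)
        have "norm (x - x0) \<le> norm (x1 - x0) + norm (x1 - x)"
          using norm_triangle_ineq4[of "x1 - x0" "x1 - x"] by simp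
        then show "norm (x - x0) \<le> 1/4" "t1 \<le> t'" "t' \<le> t2" using c r \<tau> by auto
      qed
      let ?I = "LINT y:{y. \<rho> \<le> norm (x1 - y)}|lebesgue. frac_kernel p s (\<lambda>y. v (y, \<tau>)) x1 y"
      have main: "M + ?I \<le> C0 * (norm P + \<Lambda> * \<rho>) powr (p - 2) * \<Lambda> * \<rho> powr (p - s * p)"
      proof (rule visc_ineqD[OF visc r(1,2), where \<alpha> = "\<lambda>t'. v (x1, \<tau>) + M * (t' - \<tau>)" and \<alpha>' = "\<lambda>_. M" and \<beta> = "\<lambda>_. 1" and \<beta>' = "\<lambda>_. 0"])
        show "par_cyl r x1 \<tau> \<subseteq> par_cyl 1 0 0"
        proof
          fix z assume z: "z \<in> par_cyl r x1 \<tau>"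
          obtain x t' where zz: "z = (x, t')" by (cases z)
          note c = cyl[OF z[unfolded zz]]
          show "z \<in> par_cyl 1 0 0" unfolding zz using Ssub c by (auto simp: par_cyl_def dist_norm nx0 subset_eq)
        qed
        show "v (x, t') \<le> v (x1, \<tau>) + M * (t' - \<tau>) + 1 * (P \<bullet> (x - x1) + \<Lambda> * (norm (x1 - x))\<^sup>2)"
          if "(x, t') \<in> par_cyl r x1 \<tau>" for x t'
          using touch[OF mx[OF cyl[OF that]]] by simp
        show "v (x, \<tau>) \<le> v (x1, \<tau>) + P \<bullet> (x - x1) + \<Lambda> * (norm (x1 - x))\<^sup>2" if "norm (x1 - x) < \<rho>" for x
          using touch[OF mx1[OF that]] by simp
      qed (use \<Lambda> E in \<open>auto intro!: derivative_eq_intros\<close>)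
      have near78: "norm y \<le> 7 / 8" if "norm (x1 - y) < 1 / 16" for y
      proof -
        have "norm y \<le> norm x1 + norm (x1 - y)" using norm_triangle_ineq4[of x1 "x1 - y"] by simp
        then show ?thesis using S78[OF x1] that by simp
      qed
      have pA: "\<rho> powr (\<gamma> - 2) * \<rho> = \<rho> powr (\<gamma> - 1)" "\<rho> powr (\<gamma> - 1) * \<rho> = \<rho> powr \<gamma>"
        using \<rho> powr_add[of \<rho> "\<gamma> - 2" 1] powr_add[of \<rho> "\<gamma> - 1" 1] by auto
      \<comment> \<open>The formula for \<open>P\<close> alone gives only the order
        \<open>\<Lambda>\<close>. Since the paraboloid touches \<open>v\<close> from above, moving
        by \<open>\<rho> / 2\<close> against \<open>P\<close> cannot lower it by more than
        \<open>v\<close> can vary, and the Hoelder bound improves this to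
        \<open>\<rho> powr (\<gamma> - 1)\<close>.\<close>
      have P3: "norm P \<le> 3 * (K * \<rho> powr (\<gamma> - 1))"
      proof (cases "P = 0")
        case False
        define x where "x = x1 - (\<rho> / (2 * norm P)) *\<^sub>R P"
        have nx: "norm (x1 - x) = \<rho> / 2" using False \<rho> by (simp add: x_def)
        then have nr: "norm (x1 - x) < \<rho>" "norm (x1 - x) < 1 / 16" using \<rho> by auto
        have "\<bar>v (x1, \<tau>) - v (x, \<tau>)\<bar> \<le> K * norm (x1 - x) powr \<gamma>"
          using near78[OF nr(2)] S78[OF x1] \<tau>0 by (intro hol) auto
        then have "v (x1, \<tau>) - v (x, \<tau>) \<le> K * norm (x1 - x) powr \<gamma>" by (rule abs_le_D1)
        moreover have "K * norm (x1 - x) powr \<gamma> \<le> K * \<rho> powr \<gamma>" using K \<rho> \<gamma> nx by (intro mult_left_mono powr_mono2) auto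
        moreover have "v (x, \<tau>) \<le> v (x1, \<tau>) + (P \<bullet> (x - x1) + \<Lambda> * (norm (x1 - x))\<^sup>2)" using touch[OF mx1[OF nr(1)]] by simp
        moreover have "P \<bullet> (x - x1) = - (norm P * (\<rho> / 2))"
          using False by (simp add: x_def power2_norm_eq_inner[symmetric] power2_eq_square)
        moreover have "\<Lambda> * (norm (x1 - x))\<^sup>2 = K * \<rho> powr \<gamma> / 4"
          unfolding nx \<Lambda>_def by (simp add: power2_eq_square pA[symmetric] mult_ac)
        ultimately have "norm P * (\<rho> / 2) \<le> 5 / 4 * (K * \<rho> powr \<gamma>)" by argo
        also have "\<dots> = (5 / 2 * (K * \<rho> powr (\<gamma> - 1))) * (\<rho> / 2)" by (simp add: pA(2)[symmetric])
        finally have "norm P \<le> 5 / 2 * (K * \<rho> powr (\<gamma> - 1))" using \<rho> by (subst (asm) mult_le_cancel_right_pos) auto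
        also have "\<dots> \<le> 3 * (K * \<rho> powr (\<gamma> - 1))" using K by (intro mult_right_mono) auto
        finally show ?thesis .
      qed (use K in simp)
      have rhs: "C0 * (norm P + \<Lambda> * \<rho>) powr (p - 2) * \<Lambda> * \<rho> powr (p - s * p) \<le> C0 * 4 powr (p - 2) * K powr (p - 1) * \<rho> powr (- l)"
      proof -
        have "norm P + \<Lambda> * \<rho> \<le> 4 * (K * \<rho> powr (\<gamma> - 1))" using P3 by (simp add: \<Lambda>_def mult.assoc pA)
        moreover have "0 \<le> norm P + \<Lambda> * \<rho>" using \<Lambda> \<rho> by simp
        ultimately have "(norm P + \<Lambda> * \<rho>) powr (p - 2) \<le> (4 * (K * \<rho> powr (\<gamma> - 1))) powr (p - 2)"
          using p by (intro powr_mono2) auto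
        also have "\<dots> = 4 powr (p - 2) * K powr (p - 2) * \<rho> powr ((\<gamma> - 1) * (p - 2))"
          using K by (simp add: powr_mult powr_powr)
        finally have "C0 * (norm P + \<Lambda> * \<rho>) powr (p - 2) * \<Lambda> * \<rho> powr (p - s * p)
          \<le> C0 * (4 powr (p - 2) * K powr (p - 2) * \<rho> powr ((\<gamma> - 1) * (p - 2))) * \<Lambda> * \<rho> powr (p - s * p)"
          using C0 \<Lambda> by (intro mult_right_mono mult_left_mono) auto
        also have "\<dots> = C0 * 4 powr (p - 2) * (K powr (p - 2) * K powr 1) * (\<rho> powr ((\<gamma> - 1) * (p - 2)) * \<rho> powr (\<gamma> - 2) * \<rho> powr (p - s * p))"
          using K by (simp add: \<Lambda>_def mult_ac)
        also have "K powr (p - 2) * K powr 1 = K powr (p - 1)" unfolding powr_add[symmetric] by simp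
        also have "\<rho> powr ((\<gamma> - 1) * (p - 2)) * \<rho> powr (\<gamma> - 2) * \<rho> powr (p - s * p) = \<rho> powr (\<gamma> * (p - 1) - s * p)"
          unfolding powr_add[symmetric] by (simp add: algebra_simps)
        also have "\<rho> powr (\<gamma> * (p - 1) - s * p) \<le> \<rho> powr (- l)" using l(2) \<rho> by (intro powr_mono') auto
        finally show ?thesis using C0 by (simp add: mult_left_mono)
      qed
      \<comment> \<open>Near \<open>x1\<close> the integrand is a power \<open>e - d\<close> of the
        distance times its power \<open>- l\<close>; the latter is at most
        \<open>\<rho> powr (- l)\<close> on the domain, and the former is integrable since
        \<open>e > 0\<close>.\<close>
      have int: "- (K powr (p - 1) * Ci * \<rho> powr (- l) + Kt * tail_const) \<le> ?I"
      proof -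
        define U where "U = (\<lambda>y. v (y, \<tau>))"
        have U: "tail_ok U" "tail_mass U \<le> 1" using ok mass \<tau>0 by (auto simp: U_def)
        define g1 where "g1 = (\<lambda>y. indicator {y. norm (x1 - y) < 1/16} y * norm (x1 - y) powr (e - real CARD('n)))"
        define g2 where "g2 = (\<lambda>y. (2 + \<bar>U y\<bar> + \<bar>U y\<bar>) powr (p - 1) * tailw y)"
        define G where "G = (\<lambda>y. K powr (p - 1) * \<rho> powr (- l) * g1 y + Kt * g2 y)"
        have i1: "integrable lebesgue g1" "integral\<^sup>L lebesgue g1 \<le> Ci"
        proof -
          have "(1 / 16) powr e \<le> (1::real)" using e by (intro powr_le1) auto
          then have "Ci * (1 / 16) powr e \<le> Ci * 1" using Ci by (intro mult_left_mono) auto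
          then show "integrable lebesgue g1" "integral\<^sup>L lebesgue g1 \<le> Ci"
            using Ci(2)[of "1/16" x1] by (auto simp: g1_def set_integrable_def set_lebesgue_integral_def)
        qed
        have i2: "integrable lebesgue g2" "integral\<^sup>L lebesgue g2 \<le> tail_const"
          unfolding g2_def using tail_sum_integral[OF U U] by auto
        have iG: "integrable lebesgue G" unfolding G_def using i1 i2 by simp
        have G0: "0 \<le> G y" for y
          unfolding G_def g1_def g2_def using Kt tailw_pos[of y] by (intro add_nonneg_nonneg mult_nonneg_nonneg) auto
        have GU: "set_integrable lebesgue UNIV G" using iG by (simp add: set_integrable_def)
        have bound: "\<bar>frac_kernel p s U x1 y\<bar> \<le> G y" if y: "y \<in> {y. \<rho> \<le> norm (x1 - y)}" for y
        proof (cases "norm (x1 - y) < 1/16")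
          case True
          let ?z = "norm (x1 - y)"
          have z: "?z > 0" "\<rho> \<le> ?z" using y \<rho> by auto
          have "\<bar>U x1 - U y\<bar> \<le> K * ?z powr \<gamma>" unfolding U_def
            using near78[OF True] S78[OF x1] \<tau>0 by (intro hol) auto
          then have "\<bar>U x1 - U y\<bar> powr (p - 1) \<le> (K * ?z powr \<gamma>) powr (p - 1)" using p by (intro powr_mono2) auto
          then have "\<bar>frac_kernel p s U x1 y\<bar> \<le> (K * ?z powr \<gamma>) powr (p - 1) * ?z powr (- q)"
            by (simp add: frac_kernel_eq abs_mult abs_spow mult_right_mono)
          also have "\<dots> = K powr (p - 1) * (?z powr (\<gamma> * (p - 1)) * ?z powr (- q))" using K by (simp add: powr_mult powr_powr)
          also have "?z powr (\<gamma> * (p - 1)) * ?z powr (- q) = ?z powr (- l) * ?z powr (e - real CARD('n))"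
            unfolding powr_add[symmetric] by (simp add: e_def q algebra_simps)
          also have "\<dots> \<le> \<rho> powr (- l) * ?z powr (e - real CARD('n))"
            using z \<rho> l by (intro mult_right_mono powr_mono2') auto
          finally have "\<bar>frac_kernel p s U x1 y\<bar> \<le> K powr (p - 1) * (\<rho> powr (- l) * ?z powr (e - real CARD('n)))"
            by (simp add: mult_left_mono)
          also have "\<dots> = K powr (p - 1) * \<rho> powr (- l) * g1 y" using True by (simp add: g1_def)
          also have "\<dots> \<le> G y" unfolding G_def g2_def using Kt tailw_pos[of y] by simp
          finally show ?thesis .
        next
          case False
          have "\<bar>U x1 - U y\<bar> \<le> 2 + \<bar>U y\<bar> + \<bar>U y\<bar>" using bd[OF x11 \<tau>0(3,2)] by (simp add: U_def)
          then have "\<bar>U x1 - U y\<bar> powr (p - 1) \<le> (2 + \<bar>U y\<bar> + \<bar>U y\<bar>) powr (p - 1)" using p by (intro powr_mono2) auto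
          moreover have "norm (x1 - y) powr (- q) \<le> Kt * tailw y"
            using farw_le[of x1 "1/16" y] x11 False by (simp add: farw_def Kt_def)
          ultimately have "\<bar>frac_kernel p s U x1 y\<bar> \<le> (2 + \<bar>U y\<bar> + \<bar>U y\<bar>) powr (p - 1) * (Kt * tailw y)"
            by (simp add: frac_kernel_eq abs_mult abs_spow mult_mono)
          also have "\<dots> = Kt * g2 y" by (simp add: g2_def)
          also have "\<dots> \<le> G y" unfolding G_def g1_def by simp
          finally show ?thesis .
        qed
        have "\<bar>LINT y:{y. \<rho> \<le> norm (x1 - y)}|lebesgue. frac_kernel p s U x1 y\<bar> \<le> (LINT y:{y. \<rho> \<le> norm (x1 - y)}|lebesgue. G y)"
          by (rule set_integrable_bounded_by(2)[OF GU frac_kernel_measurable[OF tail_ok_measurable[OF U(1)]] lebesgue_norm_sets(1) _ bound]) auto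
        also have "\<dots> \<le> (LINT y:UNIV|lebesgue. G y)"
          by (rule LINT_nonneg_mono_sets[OF GU lebesgue_norm_sets(1)]) (use G0 in auto)
        also have "\<dots> = K powr (p - 1) * \<rho> powr (- l) * integral\<^sup>L lebesgue g1 + Kt * integral\<^sup>L lebesgue g2"
          using i1 i2 by (simp add: set_lebesgue_integral_def G_def)
        also have "\<dots> \<le> K powr (p - 1) * \<rho> powr (- l) * Ci + Kt * tail_const"
          using i1 i2 Kt by (intro add_mono mult_left_mono) auto
        finally show ?thesis unfolding U_def by (simp add: abs_le_iff mult_ac)
      qed
      \<comment> \<open>The slope \<open>M\<close> was set to
        \<open>(C5 + 1) * \<rho> powr (- l)\<close> in order to violate this.\<close>
      have "M \<le> C5 * \<rho> powr (- l)"
      proof -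
        have "M \<le> C0 * 4 powr (p - 2) * K powr (p - 1) * \<rho> powr (- l) + (K powr (p - 1) * Ci * \<rho> powr (- l) + Kt * tail_const)"
          using main rhs int by linarith
        also have "Kt * tail_const \<le> Kt * tail_const * \<rho> powr (- l)"
          using mult_left_mono[OF pow1(2), of "Kt * tail_const"] Kt tail_const_pos by simp
        finally show ?thesis by (simp add: C5_def distrib_right)
      qed
      then show False using \<rho> by (simp add: M_def distrib_right)
    qed
    then have "f (x0, t2) \<le> 0" using mx[of x0 t2] t by simp
    then have fin: "v (x0, t2) - v (x0, t1) \<le> \<eta> + b\<Delta> + M * \<Delta>" by (simp add: f_def \<Delta>_def)
    have "\<rho> powr \<gamma> = \<Delta> powr \<alpha> / 16 powr \<gamma>" using \<gamma> \<Delta> by (simp add: \<rho>_def powr_divide powr_powr)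
    also have "\<dots> \<le> \<Delta> powr \<alpha> / 1" using \<gamma> ge_one_powr_ge_zero[of 16 \<gamma>] by (intro divide_left_mono) auto
    finally have 1: "\<eta> \<le> K * \<Delta> powr \<alpha>" using K by (simp add: \<eta>_def mult_left_mono)
    have "\<rho> powr (- l) = \<Delta> powr (- (l * (\<alpha> / \<gamma>))) * 16 powr l"
      using \<Delta> powr_minus_divide[of 16 l] by (simp add: \<rho>_def powr_divide powr_powr mult.commute)
    also have "\<dots> = \<Delta> powr (\<alpha> - 1) * 16 powr l" unfolding l(3) by simp
    finally have "\<rho> powr (- l) * \<Delta> = 16 powr l * (\<Delta> powr (\<alpha> - 1) * \<Delta> powr 1)" using \<Delta> by simp
    also have "\<Delta> powr (\<alpha> - 1) * \<Delta> powr 1 = \<Delta> powr \<alpha>" unfolding powr_add[symmetric] by simp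
    finally have "M * \<Delta> = (C5 + 1) * 16 powr l * \<Delta> powr \<alpha>" by (simp add: M_def mult.assoc)
    then have "\<eta> + b\<Delta> + M * \<Delta> \<le> C * \<Delta> powr \<alpha>" using 1 by (simp add: C_def b\<Delta>_def distrib_right)
    then show "v (x0, t2) - v (x0, t1) \<le> C * (t2 - t1) powr \<alpha>" using fin by (simp add: \<Delta>_def)
  qed
qed

end

subsection \<open>Consequences of the hypotheses\<close>

lemma usc_lsc_continuous_on:
  fixes f :: "'a::topological_space \<Rightarrow> real"
  assumes "usc_on S f" "lsc_on S f"
  shows "continuous_on S f"
  unfolding continuous_on_def using assms unfolding usc_on_def lsc_on_def
  by (auto intro!: order_tendstoI)

text \<open>By continuity a value above the essential supremum would persist on a nonempty open set,
  which is not negligible.\<close>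

lemma Linf_norm_ge:
  fixes u :: "(real^'n) \<times> real \<Rightarrow> real"
  assumes cont: "continuous_on (ball 0 1 \<times> {-1<..0}) u" and z: "norm x < 1" "-1 < t" "t \<le> 0"
  shows "ereal \<bar>u (x, t)\<bar> \<le> Linf_norm (par_cyl 1 0 0) u"
proof (rule ccontr)
  let ?Q = "par_cyl 1 0 0 :: ((real^'n) \<times> real) set"
  have Q: "?Q = ball 0 1 \<times> {-1<..0}" by (simp add: par_cyl_def)
  assume "\<not> ?thesis"
  then have "esssup (lebesgue_on ?Q) (\<lambda>z. ereal \<bar>u z\<bar>) < ereal \<bar>u (x, t)\<bar>" by (simp add: Linf_norm_def not_le)
  then obtain c :: ereal where c: "esssup (lebesgue_on ?Q) (\<lambda>z. ereal \<bar>u z\<bar>) < c" "c < ereal \<bar>u (x, t)\<bar>"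
    using dense by blast
  obtain c' where c': "c < ereal c'" "c' < \<bar>u (x, t)\<bar>" using ereal_dense2[OF c(2)] by auto
  have zQ: "(x, t) \<in> ?Q" using z by (simp add: Q)
  have "continuous_on ?Q (\<lambda>z. \<bar>u z\<bar>)" unfolding Q by (intro continuous_intros cont)
  then obtain d where d: "d > 0" "\<And>w. w \<in> ?Q \<Longrightarrow> dist w (x, t) < d \<Longrightarrow> dist \<bar>u w\<bar> \<bar>u (x, t)\<bar> < \<bar>u (x, t)\<bar> - c'"
    using zQ c'(2) unfolding continuous_on_iff by (metis diff_gt_0_iff_gt)
  define e where "e = min (d / 4) (min ((1 - norm x) / 2) ((1 + t) / 4))"
  have e0: "0 < e" using d z by (simp add: e_def)
  have e: "0 < e" "e \<le> d / 4" "e \<le> (1 - norm x) / 2" "e \<le> (1 + t) / 4"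
    by (rule e0) (simp_all only: e_def min_le_iff_disj order_refl simp_thms)
  \<comment> \<open>The box is moved into the past because the cylinder is not open at its top
    time.\<close>
  let ?B = "ball x e \<times> {t - 2 * e<..<t - e}"
  have sub: "?B \<subseteq> ?Q"
  proof (clarsimp simp: Q)
    fix y \<tau> assume y: "dist x y < e" and \<tau>: "t - 2 * e < \<tau>" "\<tau> < t - e"
    have "norm y \<le> norm x + dist x y" using norm_triangle_ineq4[of x "x - y"] by (simp add: dist_norm)
    then show "norm y < 1 \<and> - 1 < \<tau> \<and> \<tau> \<le> 0" using y \<tau> e z by auto
  qed
  have big: "c' < \<bar>u w\<bar>" if "w \<in> ?B" for w
  proof -
    obtain y \<tau> where w: "w = (y, \<tau>)" by (cases w)
    have "dist w (x, t) \<le> dist y x + dist \<tau> t" unfolding w dist_Pair_Pair by (rule sqrt_sum_squares_le_sum) auto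
    also have "\<dots> < d" using that e by (auto simp: w dist_real_def dist_commute)
    finally show ?thesis using d(2)[of w] sub that by (auto simp: dist_real_def)
  qed
  have "AE w in lebesgue_on ?Q. ereal \<bar>u w\<bar> \<le> esssup (lebesgue_on ?Q) (\<lambda>z. ereal \<bar>u z\<bar>)" by (rule esssup_AE)
  then have "AE w in lebesgue_on ?Q. w \<notin> ?B"
  proof (rule AE_mp, intro AE_I2 impI notI)
    fix w assume "ereal \<bar>u w\<bar> \<le> esssup (lebesgue_on ?Q) (\<lambda>z. ereal \<bar>u z\<bar>)" "w \<in> ?B"
    then have "ereal \<bar>u w\<bar> < ereal c'" using c c' by (meson le_less_trans less_trans)
    then show False using big[OF \<open>w \<in> ?B\<close>] by simp
  qed
  moreover have "?Q \<in> sets lebesgue" unfolding Q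
    by (intro sets_completionI_sets) (auto intro!: borel_Times)
  ultimately have ae: "AE w in lebesgue. w \<in> ?Q \<longrightarrow> w \<notin> ?B" by (simp add: AE_restrict_space_iff)
  have op: "open ?B" by (intro open_Times) auto
  have "AE w in lebesgue. w \<notin> ?B" using ae by (rule AE_mp) (use sub in auto)
  then have "?B \<in> null_sets lebesgue" using op by (subst (asm) AE_iff_null_sets[symmetric]) auto
  then have "negligible ?B" by (simp add: negligible_iff_null_sets)
  then have "?B = {}" using open_not_negligible[OF op] by auto
  moreover have "(x, t - 3 / 2 * e) \<in> ?B" using e by auto
  ultimately show False by auto
qed

lemma lip_x_seminormD:
  assumes "lip_x_seminorm \<psi> = ereal A" "norm x < 1" "norm y < 1" "-1 < t" "t \<le> 0"
  shows "\<bar>\<psi> (x, t) - \<psi> (y, t)\<bar> \<le> max A 0 * norm (x - y)"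
proof (cases "x = y")
  case False
  have "ereal (\<bar>\<psi> (x, t) - \<psi> (y, t)\<bar> / norm (x - y)) \<le> ereal A"
    unfolding assms(1)[symmetric] lip_x_seminorm_def
    using assms False by (intro Sup_upper) (auto simp: par_cyl_def)
  then have "\<bar>\<psi> (x, t) - \<psi> (y, t)\<bar> \<le> A * norm (x - y)" using False by (simp add: field_simps)
  also have "\<dots> \<le> max A 0 * norm (x - y)" by (intro mult_right_mono) auto
  finally show ?thesis .
qed simp

lemma holder_t_seminormD:
  assumes "holder_t_seminorm a \<psi> = ereal B" "norm x < 1" "-1 < t" "t \<le> 0" "-1 < \<tau>" "\<tau> \<le> 0"
  shows "\<bar>\<psi> (x, t) - \<psi> (x, \<tau>)\<bar> \<le> max B 0 * \<bar>t - \<tau>\<bar> powr a"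
proof (cases "t = \<tau>")
  case False
  have "ereal (\<bar>\<psi> (x, t) - \<psi> (x, \<tau>)\<bar> / \<bar>t - \<tau>\<bar> powr a) \<le> ereal B"
    unfolding assms(1)[symmetric] holder_t_seminorm_def
    using assms False by (intro Sup_upper) (auto simp: par_cyl_def)
  moreover have "\<bar>t - \<tau>\<bar> powr a > 0" using False by simp
  ultimately have "\<bar>\<psi> (x, t) - \<psi> (x, \<tau>)\<bar> \<le> B * \<bar>t - \<tau>\<bar> powr a" by (simp add: pos_divide_le_eq)
  also have "\<dots> \<le> max B 0 * \<bar>t - \<tau>\<bar> powr a" by (intro mult_right_mono) auto
  finally show ?thesis .
qed simp

text \<open>The definition says \<open>u \<ge> \<psi>\<close> only at points that can be touched
  from below by a test function. If the inequality failed, it would fail on a small backward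
  cylinder, and a steep enough paraboloid touches \<open>u\<close> at some point of that
  cylinder.\<close>

lemma supersol_above_obstacle:
  fixes u \<psi> :: "(real^'n) \<times> real \<Rightarrow> real"
  assumes super: "visc_supersol p s (ball 0 1) (-1) 0 \<psi> u"
    and cu: "continuous_on (ball 0 1 \<times> {-1<..0}) u" and c\<psi>: "continuous_on (ball 0 1 \<times> {-1<..0}) \<psi>"
    and bd: "\<And>x t. norm x < 1 \<Longrightarrow> -1 < t \<Longrightarrow> t \<le> 0 \<Longrightarrow> \<bar>u (x, t)\<bar> \<le> 1"
    and z: "norm x0 < 1" "-1 < t0" "t0 \<le> 0"
  shows "\<psi> (x0, t0) \<le> u (x0, t0)"
proof (rule ccontr)
  assume "\<not> ?thesis"
  then have neg: "u (x0, t0) - \<psi> (x0, t0) < 0" by simp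
  let ?Q = "ball (0::real^'n) 1 \<times> {-1<..0::real}"
  have zQ: "(x0, t0) \<in> ?Q" using z by simp
  have "continuous_on ?Q (\<lambda>z. u z - \<psi> z)" by (intro continuous_intros cu c\<psi>)
  then obtain d where d: "d > 0" "\<And>w. w \<in> ?Q \<Longrightarrow> dist w (x0, t0) < d \<Longrightarrow> dist (u w - \<psi> w) (u (x0, t0) - \<psi> (x0, t0)) < - (u (x0, t0) - \<psi> (x0, t0))"
    using zQ neg unfolding continuous_on_iff by (metis neg_0_less_iff_less)
  define e where "e = min (d / 4) (min ((1 - norm x0) / 2) ((1 + t0) / 2))"
  have e0: "0 < e" using d z by (simp add: e_def)
  have e: "0 < e" "e \<le> d / 4" "e \<le> (1 - norm x0) / 2" "e \<le> (1 + t0) / 2"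
    by (rule e0) (simp_all only: e_def min_le_iff_disj order_refl simp_thms)
  let ?S = "cball x0 e \<times> {t0 - e..t0}"
  have SQ: "?S \<subseteq> ?Q"
  proof (clarsimp)
    fix y \<tau> assume y: "dist x0 y \<le> e" and \<tau>: "t0 - e \<le> \<tau>" "\<tau> \<le> t0"
    have "norm y \<le> norm x0 + dist x0 y" using norm_triangle_ineq4[of x0 "x0 - y"] by (simp add: dist_norm)
    then show "norm y < 1 \<and> - 1 < \<tau> \<and> \<tau> \<le> 0" using y \<tau> e z by auto
  qed
  have below: "u w < \<psi> w" if "w \<in> ?S" for w
  proof -
    obtain y \<tau> where w: "w = (y, \<tau>)" by (cases w)
    have "dist w (x0, t0) \<le> dist y x0 + dist \<tau> t0" unfolding w dist_Pair_Pair by (rule sqrt_sum_squares_le_sum) auto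
    also have "\<dots> < d" using that e d by (auto simp: w dist_real_def dist_commute)
    finally have "dist (u w - \<psi> w) (u (x0, t0) - \<psi> (x0, t0)) < - (u (x0, t0) - \<psi> (x0, t0))" using d(2)[of w] SQ that by blast
    then show ?thesis by (simp add: dist_real_def)
  qed
  \<comment> \<open>Steepness beyond the oscillation 2 of \<open>u\<close>, in space and in time,
    keeps the minimum off the lateral and the bottom boundary; the top time is admissible for a
    backward cylinder.\<close>
  define N where "N = 3 / e + 3 / e\<^sup>2"
  have N: "N > 0" "2 < N * e" "2 < N * e\<^sup>2" using e by (auto simp: N_def field_simps power2_eq_square add_pos_pos)
  define f where "f = (\<lambda>(x, t). u (x, t) + N * (norm (x - x0))\<^sup>2 + N * (t0 - t))"
  have cf: "continuous_on ?S f"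
    unfolding f_def case_prod_unfold
    by (intro continuous_intros continuous_on_compose2[OF continuous_on_subset[OF cu SQ]]) auto
  have "compact ?S" "?S \<noteq> {}" using e by (auto intro: compact_Times)
  then obtain z1 where z1: "z1 \<in> ?S" "\<forall>w\<in>?S. f z1 \<le> f w" using continuous_attains_inf[OF _ _ cf] by blast
  obtain x1 t1 where z1e: "z1 = (x1, t1)" by (cases z1)
  have x1: "norm (x1 - x0) \<le> e" and t1: "t0 - e \<le> t1" "t1 \<le> t0"
    using z1(1) by (auto simp: z1e dist_norm norm_minus_commute)
  have Q1: "(x1, t1) \<in> ?Q" using z1(1) SQ z1e by blast
  have mn: "f (x1, t1) \<le> f (x, t)" if "norm (x - x0) \<le> e" "t0 - e \<le> t" "t \<le> t0" for x t
    using z1(2) that by (auto simp: z1e dist_norm norm_minus_commute)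
  have "f (x1, t1) \<le> f (x0, t0)" using mn[of x0 t0] e by simp
  also have "f (x0, t0) \<le> 1" using bd[OF z] by (simp add: f_def abs_le_iff)
  finally have "N * (norm (x1 - x0))\<^sup>2 + N * (t0 - t1) \<le> 2"
    using bd[of x1 t1] Q1 by (simp add: f_def abs_le_iff)
  moreover have "0 \<le> N * (norm (x1 - x0))\<^sup>2" "0 \<le> N * (t0 - t1)" using N t1 by auto
  ultimately have "N * (norm (x1 - x0))\<^sup>2 \<le> 2" "N * (t0 - t1) \<le> 2" by linarith+
  then have "N * (norm (x1 - x0))\<^sup>2 < N * e\<^sup>2" "N * (t0 - t1) < N * e" using N by linarith+
  then have x1lt: "norm (x1 - x0) < e" and t1lt: "t0 - e < t1" using N e by (auto intro: power2_less_imp_less)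
  define r where "r = min (e - norm (x1 - x0)) (sqrt (t1 - (t0 - e)))"
  have r: "0 < r" "r \<le> e - norm (x1 - x0)" "r\<^sup>2 \<le> t1 - (t0 - e)"
  proof -
    show "0 < r" "r \<le> e - norm (x1 - x0)" using x1lt t1lt by (auto simp: r_def)
    have "r\<^sup>2 \<le> (sqrt (t1 - (t0 - e)))\<^sup>2" using \<open>0 < r\<close> by (intro power_mono) (auto simp: r_def)
    then show "r\<^sup>2 \<le> t1 - (t0 - e)" using t1lt by simp
  qed
  have cyl: "norm (x - x0) \<le> e" "t0 - e \<le> t" "t \<le> t0" if "(x, t) \<in> par_cyl r x1 t1" for x t
  proof -
    have c: "norm (x1 - x) < r" "t1 - r\<^sup>2 < t" "t \<le> t1" using that by (auto simp: par_cyl_def dist_norm)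
    have "norm (x - x0) \<le> norm (x1 - x0) + norm (x1 - x)" using norm_triangle_ineq4[of "x1 - x0" "x1 - x"] by simp
    then show "norm (x - x0) \<le> e" "t0 - e \<le> t" "t \<le> t0" using c r t1 by auto
  qed
  have cylS: "par_cyl r x1 t1 \<subseteq> ?S" using cyl by (auto simp: dist_norm norm_minus_commute)
  define P where "P = (- 2 * N) *\<^sub>R (x1 - x0)"
  define \<phi> where "\<phi> = (\<lambda>z. (u (x1, t1) + N * (snd z - t1)) + (\<lambda>t. 1) (snd z) * (P \<bullet> (fst z - x1) + (- N) * (norm (x1 - fst z))\<^sup>2))"
  have sq: "(norm (x - x0))\<^sup>2 = (norm (x1 - x0))\<^sup>2 + 2 * ((x1 - x0) \<bullet> (x - x1)) + (norm (x1 - x))\<^sup>2" for x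
  proof -
    have "x - x0 = (x1 - x0) + (x - x1)" by simp
    then have "(norm (x - x0))\<^sup>2 = (norm (x1 - x0))\<^sup>2 + 2 * ((x1 - x0) \<bullet> (x - x1)) + (norm (x - x1))\<^sup>2"
      by (metis (no_types) power2_norm_eq_inner inner_add_left inner_add_right inner_commute add.assoc mult_2)
    then show ?thesis by (simp add: norm_minus_commute)
  qed
  have "C21_on (par_cyl r x1 t1) \<phi>"
    unfolding \<phi>_def
    by (rule C21_on_paraboloid[where I = UNIV and \<alpha>' = "\<lambda>_. N" and \<beta>' = "\<lambda>_. 0" and \<alpha> = "\<lambda>t. u (x1, t1) + N * (t - t1)"])
      (auto intro!: derivative_eq_intros)
  moreover have "\<forall>z\<in>par_cyl r x1 t1. \<phi> z \<le> u z"
  proof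
    fix z assume z: "z \<in> par_cyl r x1 t1"
    obtain x t where zz: "z = (x, t)" by (cases z)
    have "f (x1, t1) \<le> f (x, t)" using mn[OF cyl[OF z[unfolded zz]]] .
    moreover have "N * (norm (x - x0))\<^sup>2 = N * (norm (x1 - x0))\<^sup>2 - (P \<bullet> (x - x1) + (- N) * (norm (x1 - x))\<^sup>2)"
      unfolding sq[of x] by (simp add: P_def algebra_simps)
    ultimately show "\<phi> z \<le> u z" by (simp add: \<phi>_def f_def zz algebra_simps)
  qed
  moreover have "\<phi> (x1, t1) = u (x1, t1)" by (simp add: \<phi>_def)
  moreover have "par_cyl r x1 t1 \<subseteq> ball 0 1 \<times> {-1<..0}" using cylS SQ by blast
  ultimately have "0 \<le> obstacle_op p s \<psi> u \<phi> r x1 t1" using super r(1) unfolding visc_supersol_def by blast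
  then have "0 \<le> u (x1, t1) - \<psi> (x1, t1)" by (simp add: obstacle_op_def zero_ereal_def)
  moreover have "(x1, t1) \<in> ?S" using z1 z1e by simp
  ultimately show False using below by fastforce
qed

context frac_params
begin

text \<open>The normalization bounds a sum of two extended reals. Each is shown to be nonnegative by
  evaluating it at one point or time, and therefore each is at most 1.\<close>

lemma data_bounds:
  fixes u :: "(real^'n) \<times> real \<Rightarrow> real"
  assumes sol: "visc_sol p s (ball 0 1) (-1) 0 \<psi> u" and norm: "normalized p s u"
  shows "continuous_on (ball 0 1 \<times> {-1<..0}) u"
    and "norm x < 1 \<Longrightarrow> -1 < t \<Longrightarrow> t \<le> 0 \<Longrightarrow> \<bar>u (x, t)\<bar> \<le> 1"
    and "-1 < t \<Longrightarrow> t \<le> 0 \<Longrightarrow> tail_ok (\<lambda>x. u (x, t))"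
    and "-1 < t \<Longrightarrow> t \<le> 0 \<Longrightarrow> tail_mass (\<lambda>x. u (x, t)) \<le> 1"
proof -
  show cont: "continuous_on (ball 0 1 \<times> {-1<..0}) u"
    using sol unfolding visc_sol_def visc_subsol_def visc_supersol_def by (intro usc_lsc_continuous_on) auto
  let ?S = "SUP t \<in> {-1<..0}. ereal (tail_norm p s (\<lambda>x. u (x, t)))"
  let ?L = "Linf_norm (par_cyl 1 0 0) u"
  have sum: "?L + ?S \<le> 1" using norm unfolding normalized_def by blast
  have L: "ereal \<bar>u (x, t)\<bar> \<le> ?L" if "norm x < 1" "-1 < t" "t \<le> 0" for x t by (rule Linf_norm_ge[OF cont that])
  have S: "ereal (tail_norm p s (\<lambda>x. u (x, t))) \<le> ?S" if "-1 < t" "t \<le> 0" for t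
    using that by (intro SUP_upper) auto
  have tn: "0 \<le> tail_norm p s (\<lambda>x. u (x, t))" for t by (simp add: tail_norm_def)
  have "ereal 0 \<le> ereal (tail_norm p s (\<lambda>x. u (x, 0)))" using tn by simp
  also have "\<dots> \<le> ?S" by (rule S) auto
  finally have S0: "0 \<le> ?S" by (simp add: zero_ereal_def)
  have "ereal 0 \<le> ereal \<bar>u (0, 0)\<bar>" by simp
  also have "\<dots> \<le> ?L" by (rule L) auto
  finally have L0: "0 \<le> ?L" by (simp add: zero_ereal_def)
  have L1: "?L \<le> 1" using sum add_left_mono[OF S0, of ?L] by (simp add: order_trans)
  have S1: "?S \<le> 1" using sum add_right_mono[OF L0, of ?S] by (simp add: order_trans)
  show "norm x < 1 \<Longrightarrow> -1 < t \<Longrightarrow> t \<le> 0 \<Longrightarrow> \<bar>u (x, t)\<bar> \<le> 1"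
    using order_trans[OF L L1] by (simp add: one_ereal_def)
  show ok: "-1 < t \<Longrightarrow> t \<le> 0 \<Longrightarrow> tail_ok (\<lambda>x. u (x, t))"
    using norm by (auto simp: normalized_def tail_space_def tail_ok_def tail_integrand_eq)
  show "-1 < t \<Longrightarrow> t \<le> 0 \<Longrightarrow> tail_mass (\<lambda>x. u (x, t)) \<le> 1"
  proof -
    assume "-1 < t" "t \<le> 0"
    then have "tail_norm p s (\<lambda>x. u (x, t)) \<le> 1" using order_trans[OF S S1] by (simp add: one_ereal_def)
    then show "tail_mass (\<lambda>x. u (x, t)) \<le> 1" unfolding tail_mass_eq_norm using tn p by (intro powr_le1) auto
  qed
qed

text \<open>The hypothesis on \<open>\<alpha>\<close> says \<open>s p < j\<close> with
  \<open>j = 1 / \<alpha> + p - 2\<close>, while the barrier argument needs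
  \<open>s p < \<gamma> j\<close>. Any \<open>\<gamma>\<close> strictly between
  \<open>s p / j\<close> and 1 works; the midpoint is taken.\<close>

lemma time_regularity:
  assumes \<alpha>: "0 < \<alpha>" "\<alpha> \<le> 1" "\<alpha> * (s * p - p + 2) < 1" and qc: "p - 2 < s * p"
  shows "\<exists>C>0. \<forall>a (\<psi> :: (real^'n) \<times> real \<Rightarrow> real) u. \<alpha> \<le> a \<longrightarrow> lip_x_seminorm \<psi> = ereal A \<longrightarrow> holder_t_seminorm a \<psi> = ereal B \<longrightarrow>
      visc_sol p s (ball 0 1) (-1) 0 \<psi> u \<longrightarrow> normalized p s u \<longrightarrow>
      (\<exists>C1. \<forall>x \<in> ball 0 1. \<forall>y \<in> ball 0 1. \<forall>t \<in> {-1 <.. 0}. \<bar>u (x, t) - u (y, t)\<bar> \<le> C1 * norm (x - y)) \<longrightarrow>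
      (\<forall>t1 \<in> {-1/4 <.. 0}. \<forall>t2 \<in> {-1/4 <.. 0}.
         (SUP x \<in> ball 0 (1/2). ereal \<bar>u (x, t1) - u (x, t2)\<bar>) \<le> ereal (C * \<bar>t1 - t2\<bar> powr \<alpha>))"
proof -
  obtain C0 where C0: "C0 > 0" and vi0: "\<forall>\<psi> u. (\<forall>t\<in>{-1<..0}. tail_ok (\<lambda>x. u (x, t))) \<longrightarrow>
     (visc_subsol p s (ball 0 1) (-1) 0 \<psi> u \<longrightarrow> visc_ineq C0 (\<lambda>z. \<psi> z < u z) u) \<and>
     (visc_supersol p s (ball 0 1) (-1) 0 \<psi> u \<longrightarrow> visc_ineq C0 (\<lambda>z. True) (\<lambda>z. - u z))"
    using visc_ineq_exists by (elim exE conjE, intro that) assumption+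
  define j where "j = 1 / \<alpha> + (p - 2)"
  have j: "s * p < j" "0 < j"
  proof -
    have "s * p - p + 2 < 1 / \<alpha>" using \<alpha> by (simp add: field_simps)
    then show "s * p < j" by (simp add: j_def)
    then show "0 < j" using sp by simp
  qed
  define w where "w = s * p / j"
  define \<gamma> where "\<gamma> = (1 + w) / 2"
  have "0 < w" "w < 1" using j sp by (auto simp: w_def)
  then have \<gamma>: "0 < \<gamma>" "\<gamma> < 1" "w < \<gamma>" by (auto simp: \<gamma>_def)
  have "s * p < \<gamma> * j" using \<gamma>(3) j(2) by (simp add: w_def pos_divide_less_eq)
  then have lam: "s * p < \<gamma> * (p - 1) + \<gamma> * (1 / \<alpha> - 1)" by (simp add: j_def algebra_simps)
  have "\<gamma> * (p - 2) \<le> 1 * (p - 2)" using \<gamma> p by (intro mult_right_mono) auto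
  then have \<gamma>sp: "\<gamma> * (p - 2) < s * p" using qc by simp
  define A' where "A' = max A 0"
  define B' where "B' = max B 0"
  obtain K where K: "64 \<le> K" and hol: "\<And>u \<psi> x y t. sol_data C0 A' \<psi> u \<Longrightarrow> norm x \<le> 7 / 8 \<Longrightarrow> norm y \<le> 7 / 8 \<Longrightarrow> - 1 / 4 \<le> t \<Longrightarrow> t \<le> 0 \<Longrightarrow>
       \<bar>u (x, t) - u (y, t)\<bar> \<le> K * norm (x - y) powr \<gamma>"
    by (rule space_holder[OF \<gamma>(1,2) \<gamma>sp C0, of A']) (auto simp: A'_def)
  have B0: "0 \<le> B'" by (simp add: B'_def)
  show ?thesis
  proof (rule time_growth[OF \<gamma>(1,2) \<alpha>(1,2) C0 K B0 lam], goal_cases)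
    case (1 C)
    note C = 1(1) and grow = 1(2)
    show ?case
    proof (rule exI[of _ C], intro conjI allI impI ballI SUP_least C)
      fix a t1 t2 :: real and \<psi> u :: "(real^'n) \<times> real \<Rightarrow> real" and x0 :: "real^'n"
      assume a: "\<alpha> \<le> a" and lip: "lip_x_seminorm \<psi> = ereal A" and hld: "holder_t_seminorm a \<psi> = ereal B"
        and sol: "visc_sol p s (ball 0 1) (-1) 0 \<psi> u" and nrm: "normalized p s u"
        and C1: "\<exists>C1. \<forall>x \<in> ball 0 1. \<forall>y \<in> ball 0 1. \<forall>t \<in> {-1 <.. 0}. \<bar>u (x, t) - u (y, t)\<bar> \<le> C1 * norm (x - y)"
        and t: "t1 \<in> {-1/4 <.. 0}" "t2 \<in> {-1/4 <.. 0}" and x0: "x0 \<in> ball 0 (1/2)"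
      note db = data_bounds[OF sol nrm]
      have a0: "0 < a" using a \<alpha> by simp
      have \<psi>x: "\<bar>\<psi> (x, t) - \<psi> (y, t)\<bar> \<le> A' * norm (x - y)" if "norm x < 1" "norm y < 1" "-1 < t" "t \<le> 0" for x y t
        unfolding A'_def by (rule lip_x_seminormD[OF lip that])
      have \<psi>t: "\<bar>\<psi> (x, t) - \<psi> (x, \<tau>)\<bar> \<le> B' * \<bar>t - \<tau>\<bar> powr a" if "norm x < 1" "-1 < t" "t \<le> 0" "-1 < \<tau>" "\<tau> \<le> 0" for x t \<tau>
        unfolding B'_def by (rule holder_t_seminormD[OF hld that])
      \<comment> \<open>Separate moduli in space and time add up to joint continuity, through the
        point with mixed coordinates.\<close>
      have c\<psi>: "continuous_on (ball 0 1 \<times> {-1<..0}) \<psi>"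
        unfolding continuous_on_def
      proof
        fix z :: "(real^'n) \<times> real" assume z: "z \<in> ball 0 1 \<times> {-1<..0}"
        obtain x t where zz: "z = (x, t)" by (cases z)
        let ?F = "at z within ball 0 1 \<times> {-1<..0}"
        have "((\<lambda>w. A' * norm (fst w - x) + B' * \<bar>snd w - t\<bar> powr a) \<longlongrightarrow> A' * norm (fst z - x) + B' * \<bar>snd z - t\<bar> powr a) ?F"
          using a0 by (intro tendsto_intros tendsto_powr') auto
        then have lim: "((\<lambda>w. A' * norm (fst w - x) + B' * \<bar>snd w - t\<bar> powr a) \<longlongrightarrow> 0) ?F" using a0 by (simp add: zz)
        have "((\<lambda>w. \<psi> w - \<psi> z) \<longlongrightarrow> 0) ?F"
        proof (rule Lim_null_comparison[OF _ lim])
          show "\<forall>\<^sub>F w in ?F. norm (\<psi> w - \<psi> z) \<le> A' * norm (fst w - x) + B' * \<bar>snd w - t\<bar> powr a"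
            unfolding eventually_at_filter
          proof (intro always_eventually allI impI)
            fix w assume w: "w \<noteq> z" "w \<in> ball 0 1 \<times> {-1<..(0::real)}"
            obtain y \<tau> where ww: "w = (y, \<tau>)" by (cases w)
            show "norm (\<psi> w - \<psi> z) \<le> A' * norm (fst w - x) + B' * \<bar>snd w - t\<bar> powr a"
              using \<psi>x[of y x \<tau>] \<psi>t[of x \<tau> t] w z by (simp add: ww zz)
          qed
        qed
        then show "(\<psi> \<longlongrightarrow> \<psi> z) ?F" by (simp add: LIM_zero_iff)
      qed
      have sub: "visc_subsol p s (ball 0 1) (-1) 0 \<psi> u" and super: "visc_supersol p s (ball 0 1) (-1) 0 \<psi> u"
        using sol by (auto simp: visc_sol_def)
      have obs: "\<psi> (x, t) \<le> u (x, t)" if "norm x < 1" "-1 < t" "t \<le> 0" for x t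
        by (rule supersol_above_obstacle[OF super db(1) c\<psi> db(2) that])
      have tok: "\<forall>t\<in>{-1<..0}. tail_ok (\<lambda>x. u (x, t))" using db(3) by auto
      have v1: "visc_ineq C0 (\<lambda>z. \<psi> z < u z) u" using vi0 tok sub by simp
      have v2: "visc_ineq C0 (\<lambda>z. True) (\<lambda>z. - u z)" using vi0 tok super by simp
      have sd: "sol_data C0 A' \<psi> u"
        unfolding sol_data_def
      proof (intro conjI v1 v2)
        show "cont_loc_tail p s (-1) 0 u" using sub by (simp add: visc_subsol_def)
        show "\<exists>B a. 0 < a \<and> (\<forall>x t \<tau>. norm x < 1 \<longrightarrow> -1 < t \<longrightarrow> t \<le> 0 \<longrightarrow> -1 < \<tau> \<longrightarrow> \<tau> \<le> 0 \<longrightarrow>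
          \<bar>\<psi> (x, t) - \<psi> (x, \<tau>)\<bar> \<le> B * \<bar>t - \<tau>\<bar> powr a)"
          by (rule exI[of _ B'], rule exI[of _ a]) (use a0 \<psi>t in blast)
        show "\<exists>C1. \<forall>x y t. norm x < 1 \<longrightarrow> norm y < 1 \<longrightarrow> -1 < t \<longrightarrow> t \<le> 0 \<longrightarrow> \<bar>u (x, t) - u (y, t)\<bar> \<le> C1 * norm (x - y)"
          using C1 by (auto simp: Ball_def)
      qed (use db obs \<psi>x in auto)
      have one: "\<bar>u (x0, t2) - u (x0, t1)\<bar> \<le> C * (t2 - t1) powr \<alpha>" if t: "- 1 / 4 < t1" "t1 < t2" "t2 \<le> 0" for t1 t2 :: real
      proof -
        have nx0: "norm x0 < 1 / 2" using x0 by simp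
        have "u (x0, t2) - u (x0, t1) \<le> C * (t2 - t1) powr \<alpha>"
        proof (rule grow[OF v1])
          show "u (x, t) \<le> u (x, t1) + B' * (t2 - t1) powr \<alpha>"
            \<comment> \<open>On the contact set \<open>u\<close> grows no faster than the obstacle,
              which lies below \<open>u\<close> at time \<open>t1\<close>. Time differences are
              below 1, so the larger exponent \<open>a\<close> may be lowered to
              \<open>\<alpha>\<close>.\<close>
            if x: "norm x < 1" and tt: "t1 \<le> t" "t \<le> t2" and n: "\<not> \<psi> (x, t) < u (x, t)" for x t
          proof -
            have "u (x, t) \<le> \<psi> (x, t)" using n by simp
            also have "\<dots> \<le> \<psi> (x, t1) + B' * \<bar>t - t1\<bar> powr a" using \<psi>t[of x t t1] x tt t by (simp add: abs_le_iff)
            also have "\<psi> (x, t1) \<le> u (x, t1)" using obs x t by simp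
            also have "\<bar>t - t1\<bar> powr a \<le> \<bar>t - t1\<bar> powr \<alpha>" using a tt t by (intro powr_mono') auto
            also have "\<bar>t - t1\<bar> powr \<alpha> \<le> (t2 - t1) powr \<alpha>" using tt \<alpha> by (intro powr_mono2) auto
            finally show ?thesis using B0 by (simp add: mult_left_mono)
          qed
        qed (use db hol[OF sd] t nx0 in auto)
        \<comment> \<open>For the lower bound the supersolution inequality holds everywhere, and the
          obstacle condition is vacuous.\<close>
        moreover have "- u (x0, t2) - - u (x0, t1) \<le> C * (t2 - t1) powr \<alpha>"
        proof (rule grow[OF v2])
          show "tail_ok (\<lambda>x. - u (x, t))" if "-1 < t" "t \<le> 0" for t using db(3)[OF that] by (rule tail_ok_minus)
          show "tail_mass (\<lambda>x. - u (x, t)) \<le> 1" if "-1 < t" "t \<le> 0" for t using db(4)[OF that] by (simp add: tail_mass_def)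
          show "continuous_on (ball 0 1 \<times> {-1<..0}) (\<lambda>z. - u z)" by (intro continuous_intros db(1))
          show "\<bar>- u (x, t) - - u (y, t)\<bar> \<le> K * norm (x - y) powr \<gamma>" if "norm x \<le> 7 / 8" "norm y \<le> 7 / 8" "- 1 / 4 \<le> t" "t \<le> 0" for x y t
            using hol[OF sd that] by simp
        qed (use db t nx0 in auto)
        ultimately show ?thesis by (simp add: abs_le_iff)
      qed
      consider "t1 = t2" | "t1 < t2" | "t2 < t1" by linarith
      then have "\<bar>u (x0, t1) - u (x0, t2)\<bar> \<le> C * \<bar>t1 - t2\<bar> powr \<alpha>"
        using one[of t1 t2] one[of t2 t1] t by cases (auto simp: abs_minus_commute)
      then show "ereal \<bar>u (x0, t1) - u (x0, t2)\<bar> \<le> ereal (C * \<bar>t1 - t2\<bar> powr \<alpha>)" by simp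
    qed
  qed
qed

end

text \<open>The order of quantifiers carries the dependence of the constant: \<open>C\<close> comes
  after \<open>p\<close>, \<open>s\<close>, \<open>A\<close>, \<open>B\<close> and
  \<open>\<alpha>\<close> but before the obstacle, its exponent, \<open>\<beta>\<close> and
  \<open>u\<close>. Equating the seminorms with \<open>ereal A\<close> and \<open>ereal B\<close>
  expresses their finiteness and names the values on which \<open>C\<close> depends.
  \<open>\<beta>\<close> is the number strictly below \<open>1 / (1 - q_c)\<close>.\<close>

theorem proposition4p1:
  fixes p s A B :: real
  assumes "p > 2" and "0 < s" and "s < 1" and "crit_exp p s < 1"
  shows
    "(\<forall>\<alpha>. \<exists>C>0. \<forall>\<alpha>\<^sub>\<phi> \<beta> (\<psi> :: (real ^ 'n) \<times> real \<Rightarrow> real) u.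
        0 < \<alpha>\<^sub>\<phi> \<longrightarrow> \<alpha>\<^sub>\<phi> \<le> 1 \<longrightarrow> \<beta> < 1 / (1 - crit_exp p s) \<longrightarrow> \<alpha> = min \<beta> \<alpha>\<^sub>\<phi> \<longrightarrow>
        lip_x_seminorm \<psi> = ereal A \<longrightarrow> holder_t_seminorm \<alpha>\<^sub>\<phi> \<psi> = ereal B \<longrightarrow>
        visc_sol p s (ball 0 1) (-1) 0 \<psi> u \<longrightarrow> normalized p s u \<longrightarrow>
        (\<exists>C\<^sub>1. \<forall>x \<in> ball 0 1. \<forall>y \<in> ball 0 1. \<forall>t \<in> {-1 <.. 0}.
            \<bar>u (x, t) - u (y, t)\<bar> \<le> C\<^sub>1 * norm (x - y)) \<longrightarrow>
        (\<forall>t\<^sub>1 \<in> {-1/4 <.. 0}. \<forall>t\<^sub>2 \<in> {-1/4 <.. 0}.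
            (SUP x \<in> ball 0 (1/2). ereal \<bar>u (x, t\<^sub>1) - u (x, t\<^sub>2)\<bar>) \<le> ereal (C * \<bar>t\<^sub>1 - t\<^sub>2\<bar> powr \<alpha>)))
     \<and>
     (crit_exp p s > 0 \<longrightarrow>
      (\<exists>C>0. \<forall>(\<psi> :: (real ^ 'n) \<times> real \<Rightarrow> real) u.
        lip_x_seminorm \<psi> = ereal A \<longrightarrow> holder_t_seminorm 1 \<psi> = ereal B \<longrightarrow>
        visc_sol p s (ball 0 1) (-1) 0 \<psi> u \<longrightarrow> normalized p s u \<longrightarrow>
        (\<exists>C\<^sub>1. \<forall>x \<in> ball 0 1. \<forall>y \<in> ball 0 1. \<forall>t \<in> {-1 <.. 0}.
            \<bar>u (x, t) - u (y, t)\<bar> \<le> C\<^sub>1 * norm (x - y)) \<longrightarrow>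
        (\<forall>t\<^sub>1 \<in> {-1/4 <.. 0}. \<forall>t\<^sub>2 \<in> {-1/4 <.. 0}.
            (SUP x \<in> ball 0 (1/2). ereal \<bar>u (x, t\<^sub>1) - u (x, t\<^sub>2)\<bar>) \<le> ereal (C * \<bar>t\<^sub>1 - t\<^sub>2\<bar>))))"
proof -
  interpret frac_params p s "real CARD('n) + s * p" "TYPE('n)"
    using assms by unfold_locales auto
  have cr: "1 - crit_exp p s = s * p - p + 2" by (simp add: crit_exp_def algebra_simps)
  have pos: "0 < s * p - p + 2" using assms(4) cr by linarith
  then have qc: "p - 2 < s * p" by simp
  show ?thesis
  proof (intro conjI allI impI)
    fix \<alpha> :: real
    \<comment> \<open>\<open>\<alpha>\<close> is arbitrary when \<open>C\<close> is chosen. A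
      nonpositive value can occur through \<open>\<beta>\<close>, and a value excluded by
      \<open>min \<beta> \<alpha>\<^sub>\<phi>\<close> admits any constant.\<close>
    consider (nonpos) "\<alpha> \<le> 0" | (main) "0 < \<alpha>" "\<alpha> \<le> 1" "\<alpha> < 1 / (1 - crit_exp p s)"
      | (vacuous) "\<alpha> > 1 \<or> \<alpha> \<ge> 1 / (1 - crit_exp p s)" by linarith
    then show "\<exists>C>0. \<forall>\<alpha>\<^sub>\<phi> \<beta> (\<psi> :: (real ^ 'n) \<times> real \<Rightarrow> real) u.
        0 < \<alpha>\<^sub>\<phi> \<longrightarrow> \<alpha>\<^sub>\<phi> \<le> 1 \<longrightarrow> \<beta> < 1 / (1 - crit_exp p s) \<longrightarrow> \<alpha> = min \<beta> \<alpha>\<^sub>\<phi> \<longrightarrow>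
        lip_x_seminorm \<psi> = ereal A \<longrightarrow> holder_t_seminorm \<alpha>\<^sub>\<phi> \<psi> = ereal B \<longrightarrow>
        visc_sol p s (ball 0 1) (-1) 0 \<psi> u \<longrightarrow> normalized p s u \<longrightarrow>
        (\<exists>C\<^sub>1. \<forall>x \<in> ball 0 1. \<forall>y \<in> ball 0 1. \<forall>t \<in> {-1 <.. 0}.
            \<bar>u (x, t) - u (y, t)\<bar> \<le> C\<^sub>1 * norm (x - y)) \<longrightarrow>
        (\<forall>t\<^sub>1 \<in> {-1/4 <.. 0}. \<forall>t\<^sub>2 \<in> {-1/4 <.. 0}.
            (SUP x \<in> ball 0 (1/2). ereal \<bar>u (x, t\<^sub>1) - u (x, t\<^sub>2)\<bar>) \<le> ereal (C * \<bar>t\<^sub>1 - t\<^sub>2\<bar> powr \<alpha>))"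
    proof cases
      case nonpos
      show ?thesis
      proof (rule exI[of _ 2], intro conjI allI impI ballI SUP_least)
        fix t1 t2 :: real and \<psi> u :: "(real^'n) \<times> real \<Rightarrow> real" and x0 :: "real^'n"
        assume sol: "visc_sol p s (ball 0 1) (-1) 0 \<psi> u" and nrm: "normalized p s u"
          and t: "t1 \<in> {-1/4 <.. 0}" "t2 \<in> {-1/4 <.. (0::real)}" and x0: "x0 \<in> ball 0 (1/2)"
        have "\<bar>u (x0, t1) - u (x0, t2)\<bar> \<le> 2 * \<bar>t1 - t2\<bar> powr \<alpha>"
        \<comment> \<open>Distinct times are less than 1 apart, so a nonpositive power of their
          distance is at least 1 and \<open>|u| \<le> 1\<close> suffices. Equal times are separate
          because \<open>0 powr \<alpha> = 0\<close>.\<close>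
        proof (cases "t1 = t2")
          case False
          have "\<bar>u (x0, t1)\<bar> \<le> 1" "\<bar>u (x0, t2)\<bar> \<le> 1"
            using data_bounds(2)[OF sol nrm] x0 t by auto
          moreover have "1 powr \<alpha> \<le> \<bar>t1 - t2\<bar> powr \<alpha>" using False t nonpos by (intro powr_mono2') auto
          ultimately show ?thesis by auto
        qed simp
        then show "ereal \<bar>u (x0, t1) - u (x0, t2)\<bar> \<le> ereal (2 * \<bar>t1 - t2\<bar> powr \<alpha>)" by simp
      qed simp
    next
      case main
      have "\<alpha> * (s * p - p + 2) < 1" using main(3) pos unfolding cr by (simp add: pos_less_divide_eq)
      from time_regularity[OF main(1,2) this qc, of A B] obtain C where C: "C > 0"
        "\<forall>a (\<psi> :: (real^'n) \<times> real \<Rightarrow> real) u. \<alpha> \<le> a \<longrightarrow> lip_x_seminorm \<psi> = ereal A \<longrightarrow> holder_t_seminorm a \<psi> = ereal B \<longrightarrow>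
      visc_sol p s (ball 0 1) (-1) 0 \<psi> u \<longrightarrow> normalized p s u \<longrightarrow>
      (\<exists>C1. \<forall>x \<in> ball 0 1. \<forall>y \<in> ball 0 1. \<forall>t \<in> {-1 <.. 0}. \<bar>u (x, t) - u (y, t)\<bar> \<le> C1 * norm (x - y)) \<longrightarrow>
      (\<forall>t1 \<in> {-1/4 <.. 0}. \<forall>t2 \<in> {-1/4 <.. 0}.
         (SUP x \<in> ball 0 (1/2). ereal \<bar>u (x, t1) - u (x, t2)\<bar>) \<le> ereal (C * \<bar>t1 - t2\<bar> powr \<alpha>))"
        by (elim exE conjE, intro that) assumption+
      show ?thesis
      proof (rule exI[of _ C], intro conjI C(1), intro allI impI)
        fix \<alpha>\<^sub>\<phi> \<beta> and \<psi> u :: "(real ^ 'n) \<times> real \<Rightarrow> real"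
        assume "\<alpha> = min \<beta> \<alpha>\<^sub>\<phi>" and H: "lip_x_seminorm \<psi> = ereal A" "holder_t_seminorm \<alpha>\<^sub>\<phi> \<psi> = ereal B"
          "visc_sol p s (ball 0 1) (-1) 0 \<psi> u" "normalized p s u"
          "\<exists>C1. \<forall>x \<in> ball 0 1. \<forall>y \<in> ball 0 1. \<forall>t \<in> {-1 <.. 0}. \<bar>u (x, t) - u (y, t)\<bar> \<le> C1 * norm (x - y)"
        then have "\<alpha> \<le> \<alpha>\<^sub>\<phi>" by simp
        from C(2)[rule_format, OF this H(1-4)] H(5)
        show "\<forall>t\<^sub>1 \<in> {-1/4 <.. 0}. \<forall>t\<^sub>2 \<in> {-1/4 <.. 0}.
            (SUP x \<in> ball 0 (1/2). ereal \<bar>u (x, t\<^sub>1) - u (x, t\<^sub>2)\<bar>) \<le> ereal (C * \<bar>t\<^sub>1 - t\<^sub>2\<bar> powr \<alpha>)" by auto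
      qed
    next
      case vacuous
      show ?thesis by (rule exI[of _ 1]) (use vacuous in \<open>auto simp: min_def split: if_splits\<close>)
    qed
  next
    assume "crit_exp p s > 0"
    \<comment> \<open>For \<open>q_c > 0\<close> the exponent 1 lies strictly below
      \<open>1 / (1 - q_c)\<close>, so no loss in the exponent occurs.\<close>
    then have "1 * (s * p - p + 2) < 1" unfolding mult_1 cr[symmetric] by simp
    from time_regularity[OF _ _ this qc, of A B] obtain C where C: "C > 0"
      "\<forall>a (\<psi> :: (real^'n) \<times> real \<Rightarrow> real) u. 1 \<le> a \<longrightarrow> lip_x_seminorm \<psi> = ereal A \<longrightarrow> holder_t_seminorm a \<psi> = ereal B \<longrightarrow>
      visc_sol p s (ball 0 1) (-1) 0 \<psi> u \<longrightarrow> normalized p s u \<longrightarrow>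
      (\<exists>C1. \<forall>x \<in> ball 0 1. \<forall>y \<in> ball 0 1. \<forall>t \<in> {-1 <.. 0}. \<bar>u (x, t) - u (y, t)\<bar> \<le> C1 * norm (x - y)) \<longrightarrow>
      (\<forall>t1 \<in> {-1/4 <.. 0}. \<forall>t2 \<in> {-1/4 <.. 0}.
         (SUP x \<in> ball 0 (1/2). ereal \<bar>u (x, t1) - u (x, t2)\<bar>) \<le> ereal (C * \<bar>t1 - t2\<bar> powr 1))"
      by (simp, elim exE conjE, intro that) (assumption, simp)
    show "\<exists>C>0. \<forall>(\<psi> :: (real ^ 'n) \<times> real \<Rightarrow> real) u.
        lip_x_seminorm \<psi> = ereal A \<longrightarrow> holder_t_seminorm 1 \<psi> = ereal B \<longrightarrow>
        visc_sol p s (ball 0 1) (-1) 0 \<psi> u \<longrightarrow> normalized p s u \<longrightarrow>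
        (\<exists>C\<^sub>1. \<forall>x \<in> ball 0 1. \<forall>y \<in> ball 0 1. \<forall>t \<in> {-1 <.. 0}.
            \<bar>u (x, t) - u (y, t)\<bar> \<le> C\<^sub>1 * norm (x - y)) \<longrightarrow>
        (\<forall>t\<^sub>1 \<in> {-1/4 <.. 0}. \<forall>t\<^sub>2 \<in> {-1/4 <.. 0}.
            (SUP x \<in> ball 0 (1/2). ereal \<bar>u (x, t\<^sub>1) - u (x, t\<^sub>2)\<bar>) \<le> ereal (C * \<bar>t\<^sub>1 - t\<^sub>2\<bar>))"
    proof (rule exI[of _ C], intro conjI C(1), intro allI impI)
      fix \<psi> u :: "(real ^ 'n) \<times> real \<Rightarrow> real"
      assume H: "lip_x_seminorm \<psi> = ereal A" "holder_t_seminorm 1 \<psi> = ereal B"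
          "visc_sol p s (ball 0 1) (-1) 0 \<psi> u" "normalized p s u"
          "\<exists>C1. \<forall>x \<in> ball 0 1. \<forall>y \<in> ball 0 1. \<forall>t \<in> {-1 <.. 0}. \<bar>u (x, t) - u (y, t)\<bar> \<le> C1 * norm (x - y)"
      from C(2)[rule_format, OF order_refl H(1-4)] H(5)
      show "\<forall>t\<^sub>1 \<in> {-1/4 <.. 0}. \<forall>t\<^sub>2 \<in> {-1/4 <.. 0}.
            (SUP x \<in> ball 0 (1/2). ereal \<bar>u (x, t\<^sub>1) - u (x, t\<^sub>2)\<bar>) \<le> ereal (C * \<bar>t\<^sub>1 - t\<^sub>2\<bar>)" by auto
    qed
  qed
qed

end
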